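(* Let $\lambda\in I_1\cup I_3$ (notation of the context) and let $L=L_\theta^+\in\mathcal L_\lambda^+$. Then either $N_{L/Z}\simeq O(1)^{\oplus2}$ or $N_{L/Z}\simeq O\oplus O(2)$, and the latter holds if and only if $\lambda$ is a critical point of $$h_1(\lambda)=2B(\lambda)\,\left|\frac{x_1}{\ell_1}\right|.$$ The same claims hold for $L=L_\theta^-\in\mathcal L_\lambda^-$ if $h_1$ is replaced by $$h_3(\lambda)=\frac{-f(\lambda)}{2B(\lambda)}\left|\frac{x_1^3}{\ell_1\ell_2\ell_3}\right|.$$ Here $B(\lambda)=\left(\frac{\sqrt{Q(\lambda,1)^2-f(\lambda)}-Q(\lambda,1)}{2}\right)^{1/2}$, and $x_1/\ell_1$, $x_1^3/(\ell_1\ell_2\ell_3)$ are evaluated at $x_0=\lambda x_1$, so that they depend only on $\lambda$.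
   Context: Fix real numbers $a,b>0$ and a real quadratic form $Q(y_0,y_1)$; put $f(\lambda)=\lambda(\lambda+1)(a\lambda-b)$. Assume: there is $\lambda_0\in\mathbf R$ such that $Q(\lambda,1)^2-f(\lambda)\ge0$ for all $\lambda\in\mathbf R$ with equality iff $\lambda=\lambda_0$, and $\lambda_0$ is a root of multiplicity two; and $Q(\lambda,1)>\sqrt{f(\lambda)}$ whenever $\lambda\in\mathbf R$, $f(\lambda)\ge0$, $\lambda\ne\lambda_0$; moreover $\lambda_0>b/a$ (as may be arranged by a projective transformation in $y_0,y_1$). Put $I_1=(-\infty,-1)$, $I_3=(0,b/a)$ (where $f<0$). $B\subset\mathbf{CP}^3$ is the quartic $(y_2y_3+Q(y_0,y_1))^2-y_0y_1(y_0+y_1)(ay_0-by_1)=0$; the real structure on $\mathbf{CP}^3$ is $\sigma(y_0:y_1:y_2:y_3)=(\overline y_0:\overline y_1:\overline y_3:\overline y_2)$; the singular points of $B$ are $P_\infty=(0:0:0:1)$, $\overline P_\infty=(0:0:1:0)$, $P_0=(\lambda_0:1:0:0)$. $\Phi_0:Z_0\to\mathbf{CP}^3$ is the double covering branched along $B$, $Z_0=\{z^2+(y_2y_3+Q)^2-y_0y_1(y_0+y_1)(ay_0-by_1)=0\}\subset O(2)$, with real structure $(y,z)\mapsto(\sigma(y),\overline z)$. Small resolutions: near $p_\infty=\Phi_0^{-1}(P_\infty)$ put $x_i=y_i/y_3$, $\xi=z+i(x_2+Q(x_0,x_1))$, $\eta=z-i(x_2+Q(x_0,x_1))$, so $Z_0:\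 \xi\eta=x_0x_1(x_0+x_1)(ax_0-bx_1)$. Choose an ordered triple of distinct linear forms $\ell_1,\ell_2,\ell_3\in\{x_0,x_1,x_0+x_1,ax_0-bx_1\}$. Blow up successively along $\{\xi=\ell_1=0\}$ (with $\xi=u\ell_1$), $\{u=\ell_2=0\}$ (with $u=v\ell_2$), $\{v=\ell_3=0\}$ (with $v=w\ell_3$). This gives a small resolution of $p_\infty$ with exceptional curve a chain $\Gamma_1+\Gamma_2+\Gamma_3$ ($\Gamma_i$ from the $i$-th blow-up). The conjugate point $\overline p_\infty$ is resolved correspondingly by reality, and the ordinary double point over $P_0$ by any small resolution; this gives $\mu:Z\to Z_0$ with $Z$ smooth; put $\Phi=\Phi_0\circ\mu$. For $\lambda\in I_1\cup I_3$, $\theta\in\mathbf R$, let $C_\theta\subset H_\lambda=\{y_0=\lambda y_1\}$ be the conic $\sqrt{Q^2-f}\,y_1^2+B(\lambda)e^{i\theta}y_1y_2+B(\lambda)e^{-i\theta}y_1y_3+y_2y_3=0$ ($Q=Q(\lambda,1)$, $f=f(\lambda)$). $\Phi^{-1}(C_\theta)$ consists of the exceptional curves over $P_\infty,\overline P_\infty$ and two real smooth rational curves $L_\theta^+,L_\theta^-$ mapped biholomorphically onto $C_\theta$: $L_\theta^+$ is the proper transform of the component of $\Phi_0^{-1}(C_\theta)$ given near $p_\infty$ by $\xi=-2iB(\lambda)e^{-i\theta}x_1+O(x_1^2)$, $\eta=\frac{ie^{i\theta}f}{2B(\lambda)}x_1^3+O(x_1^4)$, $x_0=\lambda x_1$ (it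 meets $\Gamma_1$ but not $\Gamma_2,\Gamma_3$), and $L_\theta^-$ that of the component given by $\xi=-\frac{ie^{i\theta}f}{2B(\lambda)}x_1^3+O(x_1^4)$, $\eta=2iB(\lambda)e^{-i\theta}x_1+O(x_1^2)$, $x_0=\lambda x_1$ (it meets $\Gamma_3$ but not $\Gamma_1,\Gamma_2$). $\mathcal L_\lambda^\pm=\{L_\theta^\pm:\theta\in\mathbf R\}$. $N_{L/Z}$ is the normal bundle. *)

theory Defs
  imports "HOL-Analysis.Analysis" "HOL-Computational_Algebra.Polynomial"
begin

section \<open>Reduced complex spaces\<close>

text \<open>
  A reduced complex space is a topological space with its sheaf of holomorphic functions:
  \<open>chol X U\<close> is the set of functions that are holomorphic on the open set \<open>U\<close>. Functions are total
  on the carrier type; only their values on \<open>U\<close> are meaningful.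
\<close>

record 'a cspace =
  ctop :: "'a topology"
  chol :: "'a set \<Rightarrow> ('a \<Rightarrow> complex) set"

abbreviation pts :: "'a cspace \<Rightarrow> 'a set" where
  "pts X \<equiv> topspace (ctop X)"

definition hol_on :: "(complex^'n) set \<Rightarrow> (complex^'n \<Rightarrow> complex) \<Rightarrow> bool" where
  "hol_on W F \<longleftrightarrow>
     (\<forall>x\<in>W. \<exists>D. (F has_derivative D) (at x) \<and> (\<forall>c v. D (c *s v) = c * D v))"

text \<open>A subset of \<open>\<complex>\<^sup>n\<close> with the functions that locally extend holomorphically to the ambient space.\<close>

definition model :: "(complex^'n) set \<Rightarrow> (complex^'n) cspace" where
  "model S = \<lparr>ctop = top_of_set S,
     chol = (\<lambda>U. {f. openin (top_of_set S) U \<and>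
       (\<forall>x\<in>U. \<exists>W F. open W \<and> x \<in> W \<and> hol_on W F \<and> (\<forall>w\<in>W \<inter> U. f w = F w))})\<rparr>"

definition subspace_of :: "'a cspace \<Rightarrow> 'a set \<Rightarrow> 'a cspace" where
  "subspace_of X S = \<lparr>ctop = subtopology (ctop X) S,
     chol = (\<lambda>U. {f. openin (subtopology (ctop X) S) U \<and>
       (\<forall>p\<in>U. \<exists>V F. openin (ctop X) V \<and> p \<in> V \<and> F \<in> chol X V \<and> (\<forall>q\<in>V \<inter> U. f q = F q))})\<rparr>"

text \<open>
  The quotient of a set \<open>C\<close> of homogeneous coordinate vectors, \<open>\<pi>\<close> being the quotient map. The generating
  family of the topology is the quotient topology itself. Below the fibres of \<open>\<pi>\<close> are orbits of a free
  torus action with local holomorphic slices, so a function on the quotient is holomorphic iff its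
  pull-back to \<open>C\<close> is.
\<close>

definition quotient_space :: "(complex^'n) set \<Rightarrow> (complex^'n \<Rightarrow> 'a) \<Rightarrow> 'a cspace" where
  "quotient_space C \<pi> =
     \<lparr>ctop = topology_generated_by {U. U \<subseteq> \<pi> ` C \<and> openin (top_of_set C) (C \<inter> \<pi> -` U)},
      chol = (\<lambda>U. {f. U \<subseteq> \<pi> ` C \<and> f \<circ> \<pi> \<in> chol (model C) (C \<inter> \<pi> -` U)})\<rparr>"

text \<open>The complex conjugate space: its holomorphic functions are the antiholomorphic ones of \<open>X\<close>.\<close>

definition conj_space :: "'a cspace \<Rightarrow> 'a cspace" where
  "conj_space X = \<lparr>ctop = ctop X, chol = (\<lambda>U. {f. cnj \<circ> f \<in> chol X U})\<rparr>"

definition holomorphic_map :: "'a cspace \<Rightarrow> 'b cspace \<Rightarrow> ('a \<Rightarrow> 'b) \<Rightarrow> bool" where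
  "holomorphic_map X Y g \<longleftrightarrow> continuous_map (ctop X) (ctop Y) g \<and>
     (\<forall>V f. openin (ctop Y) V \<and> f \<in> chol Y V \<longrightarrow> f \<circ> g \<in> chol X {p \<in> pts X. g p \<in> V})"

definition biholomorphic_map :: "'a cspace \<Rightarrow> 'b cspace \<Rightarrow> ('a \<Rightarrow> 'b) \<Rightarrow> bool" where
  "biholomorphic_map X Y g \<longleftrightarrow> holomorphic_map X Y g \<and>
     (\<exists>h. holomorphic_map Y X h \<and> (\<forall>p\<in>pts X. h (g p) = p) \<and> (\<forall>q\<in>pts Y. g (h q) = q))"

type_synonym ('a, 'n) chart = "'a set \<times> ('a \<Rightarrow> complex^'n)"

definition charts :: "'a cspace \<Rightarrow> ('a, 'n::finite) chart set" where
  "charts X = {(U, \<phi>). openin (ctop X) U \<and> open (\<phi> ` U) \<and>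
                biholomorphic_map (subspace_of X U) (model (\<phi> ` U)) \<phi>}"

text \<open>The condition \<open>subspace_of X (pts X) = X\<close> is the sheaf property of \<open>chol X\<close>.\<close>

definition complex_manifold :: "'n::finite itself \<Rightarrow> 'a cspace \<Rightarrow> bool" where
  "complex_manifold _ X \<longleftrightarrow>
     subspace_of X (pts X) = X \<and> Hausdorff_space (ctop X) \<and> second_countable (ctop X) \<and>
     (\<forall>p\<in>pts X. \<exists>(U, \<phi>)\<in>(charts X :: ('a, 'n) chart set). p \<in> U)"

definition analytic_subset :: "'a cspace \<Rightarrow> 'a set \<Rightarrow> bool" where
  "analytic_subset X A \<longleftrightarrow> A \<subseteq> pts X \<and>
     (\<forall>p\<in>pts X. \<exists>U F. openin (ctop X) U \<and> p \<in> U \<and> F \<subseteq> chol X U \<and>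
        A \<inter> U = {q \<in> U. \<forall>f\<in>F. f q = 0})"

definition irreducible_analytic :: "'a cspace \<Rightarrow> 'a set \<Rightarrow> bool" where
  "irreducible_analytic X A \<longleftrightarrow> analytic_subset X A \<and> A \<noteq> {} \<and>
     (\<forall>A1 A2. analytic_subset X A1 \<and> analytic_subset X A2 \<and> A = A1 \<union> A2 \<longrightarrow> A = A1 \<or> A = A2)"

definition irreducible_components :: "'a cspace \<Rightarrow> 'a set \<Rightarrow> 'a set set" where
  "irreducible_components X A = {K. irreducible_analytic X K \<and> K \<subseteq> A \<and>
     (\<forall>K'. irreducible_analytic X K' \<and> K \<subseteq> K' \<and> K' \<subseteq> A \<longrightarrow> K' = K)}"


section \<open>Holomorphic vector bundles and normal bundles\<close>

text \<open>
  Bundles are given by transition matrices: local sections satisfy \<open>s\<^sub>i = g\<^sub>i\<^sub>j s\<^sub>j\<close>.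
\<close>

record ('i, 'a, 'r) cocycle =
  idx :: "'i set"
  patch :: "'i \<Rightarrow> 'a set"
  trans :: "'i \<Rightarrow> 'i \<Rightarrow> 'a \<Rightarrow> complex^'r^'r"

definition holomorphic_matrix ::
    "'a cspace \<Rightarrow> 'a set \<Rightarrow> ('a \<Rightarrow> complex^'c^'r) \<Rightarrow> bool" where
  "holomorphic_matrix X U g \<longleftrightarrow> (\<forall>i j. (\<lambda>p. g p $ i $ j) \<in> chol X U)"

definition holomorphic_bundle :: "'a cspace \<Rightarrow> ('i, 'a, 'r::finite) cocycle \<Rightarrow> bool" where
  "holomorphic_bundle X E \<longleftrightarrow>
     (\<forall>i\<in>idx E. openin (ctop X) (patch E i)) \<and> (\<Union>i\<in>idx E. patch E i) = pts X \<and>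
     (\<forall>i\<in>idx E. \<forall>j\<in>idx E. holomorphic_matrix X (patch E i \<inter> patch E j) (trans E i j)) \<and>
     (\<forall>i\<in>idx E. \<forall>p\<in>patch E i. trans E i i p = mat 1) \<and>
     (\<forall>i\<in>idx E. \<forall>j\<in>idx E. \<forall>k\<in>idx E. \<forall>p\<in>patch E i \<inter> patch E j \<inter> patch E k.
        trans E i j p ** trans E j k p = trans E i k p)"

definition bundle_iso ::
    "'a cspace \<Rightarrow> ('i, 'a, 'r::finite) cocycle \<Rightarrow> ('j, 'a, 'r::finite) cocycle \<Rightarrow> bool" where
  "bundle_iso X E F \<longleftrightarrow> holomorphic_bundle X E \<and> holomorphic_bundle X F \<and>
     (\<exists>h. (\<forall>i\<in>idx E. \<forall>\<alpha>\<in>idx F. holomorphic_matrix X (patch E i \<inter> patch F \<alpha>) (h i \<alpha>) \<and>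
            (\<forall>p\<in>patch E i \<inter> patch F \<alpha>. invertible (h i \<alpha> p))) \<and>
          (\<forall>i\<in>idx E. \<forall>j\<in>idx E. \<forall>\<alpha>\<in>idx F. \<forall>\<beta>\<in>idx F.
            \<forall>p\<in>patch E i \<inter> patch E j \<inter> patch F \<alpha> \<inter> patch F \<beta>.
              trans E i j p ** h j \<beta> p = h i \<alpha> p ** trans F \<alpha> \<beta> p))"

definition pullback_bundle ::
    "'b cspace \<Rightarrow> ('b \<Rightarrow> 'a) \<Rightarrow> ('i, 'a, 'r::finite) cocycle \<Rightarrow> ('i, 'b, 'r::finite) cocycle" where
  "pullback_bundle Y g E = \<lparr>idx = idx E, patch = (\<lambda>i. {q \<in> pts Y. g q \<in> patch E i}),
                             trans = (\<lambda>i j q. trans E i j (g q))\<rparr>"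

text \<open>
  Charts in which \<open>L\<close> is the coordinate subspace where the coordinates indexed by \<open>'m\<close> vanish; the
  transition matrices of the normal bundle are the Jacobians of the transverse coordinates.
\<close>

definition adapted_charts :: "'a cspace \<Rightarrow> 'a set \<Rightarrow> ('a, 'k::finite + 'm::finite) chart set" where
  "adapted_charts Z L = {(U, \<phi>). (U, \<phi>) \<in> charts Z \<and>
      \<phi> ` (U \<inter> L) = {v \<in> \<phi> ` U. \<forall>j. v $ Inr j = 0}}"

definition normal_bundle ::
    "'a cspace \<Rightarrow> 'a set \<Rightarrow> (('a, 'k::finite + 'm::finite) chart, 'a, 'm) cocycle" where
  "normal_bundle Z L =
     \<lparr>idx = adapted_charts Z L,
      patch = (\<lambda>(U, \<phi>). U \<inter> L),
      trans = (\<lambda>(U, \<phi>) (V, \<psi>) p. \<chi> i j.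
        frechet_derivative (\<phi> \<circ> inv_into V \<psi>) (at (\<psi> p)) (axis (Inr j) 1) $ Inr i)\<rparr>"

definition line_through :: "complex^'n \<Rightarrow> (complex^'n) set" where
  "line_through v = {c *s v | c. c \<noteq> 0}"

definition projective_space :: "(complex^'n) set cspace" where
  "projective_space = quotient_space (- {0}) line_through"

text \<open>
  \<open>\<Oplus>\<^sub>r O(k r)\<close> on \<open>\<complex>P\<^sup>1\<close>: a homogeneous function \<open>s\<close> of degree \<open>k\<close> has the local expressions
  \<open>s / y\<^sub>i\<^sup>k\<close> where \<open>y\<^sub>i \<noteq> 0\<close>, whence the transition functions \<open>(y\<^sub>j / y\<^sub>i)\<^sup>k\<close>.
\<close>

definition O_sum :: "('r \<Rightarrow> int) \<Rightarrow> (2, (complex^2) set, 'r::finite) cocycle" where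
  "O_sum k =
     \<lparr>idx = UNIV,
      patch = (\<lambda>i. {P \<in> pts projective_space. \<forall>y\<in>P. y $ i \<noteq> 0}),
      trans = (\<lambda>i j P. \<chi> r s.
        if r = s then (let y = (SOME y. y \<in> P) in (y $ j / y $ i) powi k r) else 0)\<rparr>"

text \<open>
  For a smooth rational curve \<open>L\<close> in a threefold \<open>Z\<close>: the normal bundle is isomorphic to
  \<open>O(m) \<oplus> O(n)\<close>. This includes that \<open>L\<close> is a submanifold, since the adapted charts must cover it.
\<close>

definition normal_bundle_splits_as :: "'a cspace \<Rightarrow> 'a set \<Rightarrow> int \<Rightarrow> int \<Rightarrow> bool" where
  "normal_bundle_splits_as Z L m n \<longleftrightarrow>
     (\<exists>\<gamma>. biholomorphic_map projective_space (subspace_of Z L) \<gamma> \<and>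
        bundle_iso projective_space
          (pullback_bundle projective_space \<gamma>
             (normal_bundle Z L :: (('a, 1 + 2) chart, 'a, 2) cocycle))
          (O_sum (\<lambda>r. if r = 0 then m else n)))"


section \<open>Blow-ups\<close>

abbreviation lft :: "complex^('n::finite + 'm::finite) \<Rightarrow> complex^'n" where
  "lft v \<equiv> (\<chi> i. v $ Inl i)"

abbreviation rgt :: "complex^('n::finite + 'm::finite) \<Rightarrow> complex^'m" where
  "rgt v \<equiv> (\<chi> i. v $ Inr i)"

text \<open>
  The blow-up of a space along the ideal \<open>(g, h)\<close> is the closure, in its product with \<open>\<complex>P\<^sup>1\<close>, of the
  graph of \<open>(g : h)\<close>. Here the space is \<open>\<pi> ` C\<close>, \<open>C\<close> being a set of coordinate vectors; the coordinates
  of \<open>\<complex>P\<^sup>1\<close> are appended to those of \<open>C\<close>. If \<open>C\<close> is itself multihomogeneous, \<open>g\<close> and \<open>h\<close> must have the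
  same multidegree. The point \<open>(g : h)\<close> corresponds to the quotient \<open>g/h\<close>.
\<close>

definition blowup_coords ::
    "(complex^'n) set \<Rightarrow> (complex^'n \<Rightarrow> complex) \<Rightarrow> (complex^'n \<Rightarrow> complex) \<Rightarrow> (complex^('n::finite + 2)) set" where
  "blowup_coords C g h =
     {w. lft w \<in> C \<and> rgt w \<noteq> 0} \<inter>
     closure {w. lft w \<in> C \<and> rgt w \<noteq> 0 \<and> (g (lft w) \<noteq> 0 \<or> h (lft w) \<noteq> 0) \<and>
                 rgt w $ 0 * h (lft w) = rgt w $ 1 * g (lft w)}"

definition blowup_proj ::
    "(complex^'n \<Rightarrow> 'a) \<Rightarrow> complex^('n::finite + 2) \<Rightarrow> 'a \<times> (complex^2) set" where
  "blowup_proj \<pi> w = (\<pi> (lft w), line_through (rgt w))"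

text \<open>
  The iterated blow-up of \<open>\<xi>\<eta> = x\<^sub>0 x\<^sub>1 (x\<^sub>0 + x\<^sub>1)(a x\<^sub>0 - b x\<^sub>1)\<close>, with coordinates
  \<open>(x\<^sub>0, x\<^sub>1, \<xi>, \<eta>)\<close> indexed by \<open>0, 1, 2, 3\<close>. The centres are \<open>\<xi> = l\<^sub>1 = 0\<close>, then \<open>u = l\<^sub>2 = 0\<close>
  for \<open>u = \<xi>/l\<^sub>1 = s\<^sub>1/t\<^sub>1\<close>, which is the ideal \<open>(s\<^sub>1, t\<^sub>1l\<^sub>2)\<close>, then \<open>v = l\<^sub>3 = 0\<close> for \<open>v = u/l\<^sub>2\<close>.
\<close>

type_synonym form = "complex \<Rightarrow> complex \<Rightarrow> complex"

definition linear_forms :: "real \<Rightarrow> real \<Rightarrow> form set" where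
  "linear_forms a b = {\<lambda>x0 x1. x0, \<lambda>x0 x1. x1, \<lambda>x0 x1. x0 + x1,
                       \<lambda>x0 x1. of_real a * x0 - of_real b * x1}"

definition germ_coords :: "real \<Rightarrow> real \<Rightarrow> (complex^4) set" where
  "germ_coords a b =
     {v. v $ 2 * v $ 3 = v $ 0 * v $ 1 * (v $ 0 + v $ 1) * (of_real a * v $ 0 - of_real b * v $ 1)}"

definition res_coords1 :: "real \<Rightarrow> real \<Rightarrow> form \<Rightarrow> (complex^(4 + 2)) set" where
  "res_coords1 a b l1 = blowup_coords (germ_coords a b) (\<lambda>v. v $ 2) (\<lambda>v. l1 (v $ 0) (v $ 1))"

definition res_coords2 :: "real \<Rightarrow> real \<Rightarrow> form \<Rightarrow> form \<Rightarrow> (complex^((4 + 2) + 2)) set" where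
  "res_coords2 a b l1 l2 = blowup_coords (res_coords1 a b l1)
     (\<lambda>w. rgt w $ 0) (\<lambda>w. rgt w $ 1 * l2 (lft w $ 0) (lft w $ 1))"

definition res_coords3 :: "real \<Rightarrow> real \<Rightarrow> form \<Rightarrow> form \<Rightarrow> form \<Rightarrow> (complex^(((4 + 2) + 2) + 2)) set" where
  "res_coords3 a b l1 l2 l3 = blowup_coords (res_coords2 a b l1 l2)
     (\<lambda>w. rgt w $ 0) (\<lambda>w. rgt w $ 1 * l3 (lft (lft w) $ 0) (lft (lft w) $ 1))"

type_synonym res_point =
  "(((complex^4) \<times> (complex^2) set) \<times> (complex^2) set) \<times> (complex^2) set"

definition local_resolution ::
    "real \<Rightarrow> real \<Rightarrow> form \<Rightarrow> form \<Rightarrow> form \<Rightarrow> res_point cspace" where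
  "local_resolution a b l1 l2 l3 =
     quotient_space (res_coords3 a b l1 l2 l3) (blowup_proj (blowup_proj (blowup_proj (\<lambda>v. v))))"

definition blow_down :: "res_point \<Rightarrow> complex^4" where
  "blow_down r = fst (fst (fst r))"


section \<open>The double solid and its small resolutions\<close>

fun quad_form :: "real \<times> real \<times> real \<Rightarrow> 'a::real_field \<Rightarrow> 'a \<Rightarrow> 'a" where
  "quad_form (p, q, r) y0 y1 = of_real p * y0^2 + of_real q * y0 * y1 + of_real r * y1^2"

definition f_cubic :: "real \<Rightarrow> real \<Rightarrow> real \<Rightarrow> real" where
  "f_cubic a b t = t * (t + 1) * (a * t - b)"

text \<open>The polynomial \<open>Q(\<lambda>,1)\<^sup>2 - f(\<lambda>)\<close>.\<close>

fun Q2f_poly :: "real \<Rightarrow> real \<Rightarrow> real \<times> real \<times> real \<Rightarrow> real poly" where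
  "Q2f_poly a b (p, q, r) = [:r, q, p:]^2 - [:0, 1:] * [:1, 1:] * [:-b, a:]"

text \<open>
  A point of the total space of \<open>O(2)\<close> over \<open>\<complex>P\<^sup>3\<close> has homogeneous coordinates
  \<open>(y\<^sub>0, y\<^sub>1, y\<^sub>2, y\<^sub>3; z)\<close> of weights \<open>(1, 1, 1, 1; 2)\<close> with \<open>y \<noteq> 0\<close>. The coordinate \<open>y\<^sub>i\<close> is \<open>v $ Inl i\<close>
  and \<open>z\<close> is \<open>v $ Inr 1\<close>.
\<close>

definition O2_class :: "complex^(4 + 1) \<Rightarrow> (complex^(4 + 1)) set" where
  "O2_class v = {(\<chi> i. case i of Inl k \<Rightarrow> c * v $ Inl k | Inr k \<Rightarrow> c^2 * v $ Inr k) | c. c \<noteq> 0}"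

definition Z0_coords :: "real \<Rightarrow> real \<Rightarrow> real \<times> real \<times> real \<Rightarrow> (complex^(4 + 1)) set" where
  "Z0_coords a b Q = {v. lft v \<noteq> 0 \<and>
     (let y = lft v; z = v $ Inr 1 in
       z^2 + (y $ 2 * y $ 3 + quad_form Q (y $ 0) (y $ 1))^2
         - y $ 0 * y $ 1 * (y $ 0 + y $ 1) * (of_real a * y $ 0 - of_real b * y $ 1) = 0)}"

definition Z0 :: "real \<Rightarrow> real \<Rightarrow> real \<times> real \<times> real \<Rightarrow> (complex^(4 + 1)) set cspace" where
  "Z0 a b Q = quotient_space (Z0_coords a b Q) O2_class"

definition Phi0 :: "(complex^(4 + 1)) set \<Rightarrow> (complex^4) set" where
  "Phi0 q = (\<lambda>v. lft v) ` q"

definition Z0_conj :: "(complex^(4 + 1)) set \<Rightarrow> (complex^(4 + 1)) set" where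
  "Z0_conj q = (\<lambda>v. \<chi> i. case i of
       Inl k \<Rightarrow> cnj (v $ Inl (if k = 2 then 3 else if k = 3 then 2 else k))
     | Inr k \<Rightarrow> cnj (v $ Inr k)) ` q"

text \<open>The points of \<open>Z\<^sub>0\<close> over \<open>P\<^sub>\<infinity>\<close>, its conjugate, and \<open>P\<^sub>0\<close>; at all of them \<open>z = 0\<close>.\<close>

definition p_inf :: "(complex^(4 + 1)) set" where
  "p_inf = O2_class (axis (Inl 3) 1)"

definition p_inf_bar :: "(complex^(4 + 1)) set" where
  "p_inf_bar = O2_class (axis (Inl 2) 1)"

definition p_zero :: "real \<Rightarrow> (complex^(4 + 1)) set" where
  "p_zero lam0 = O2_class (axis (Inl 0) (of_real lam0) + axis (Inl 1) 1)"

text \<open>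
  \<open>(x\<^sub>0, x\<^sub>1, \<xi>, \<eta>)\<close> as functions of the homogeneous coordinates, where \<open>y\<^sub>3 \<noteq> 0\<close>. These identify the
  whole affine part \<open>y\<^sub>3 \<noteq> 0\<close> of \<open>Z\<^sub>0\<close> with \<open>germ_coords a b\<close>.
\<close>

definition affine_coords :: "real \<times> real \<times> real \<Rightarrow> complex^(4 + 1) \<Rightarrow> complex^4" where
  "affine_coords Q v =
     (let x0 = v $ Inl 0 / v $ Inl 3; x1 = v $ Inl 1 / v $ Inl 3; x2 = v $ Inl 2 / v $ Inl 3;
          z = v $ Inr 1 / (v $ Inl 3)^2
      in \<chi> i. if i = 0 then x0 else if i = 1 then x1
              else if i = 2 then z + \<i> * (x2 + quad_form Q x0 x1)
              else z - \<i> * (x2 + quad_form Q x0 x1))"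

text \<open>
  Over the affine part \<open>y\<^sub>3 \<noteq> 0\<close>, whose only singular point is \<open>p\<^sub>\<infinity>\<close>, the map \<open>\<nu>\<close> is the iterated
  blow-up determined by the linear forms. (The blown-up ideals are locally principal away from
  the fibre over \<open>p\<^sub>\<infinity>\<close>, so there is no difference between blowing up near \<open>p\<^sub>\<infinity>\<close> and over the whole affine part.)
\<close>

definition resolves_p_inf_by ::
    "real \<Rightarrow> real \<Rightarrow> real \<times> real \<times> real \<Rightarrow> form \<Rightarrow> form \<Rightarrow> form \<Rightarrow>
     'z cspace \<Rightarrow> ('z \<Rightarrow> (complex^(4 + 1)) set) \<Rightarrow> bool" where
  "resolves_p_inf_by a b Q l1 l2 l3 Z \<nu> \<longleftrightarrow>
     (let U = {p \<in> pts Z. \<forall>v\<in>\<nu> p. v $ Inl 3 \<noteq> 0} in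
      \<exists>F. biholomorphic_map (subspace_of Z U) (local_resolution a b l1 l2 l3) F \<and>
          (\<forall>p\<in>U. \<forall>v\<in>\<nu> p. blow_down (F p) = affine_coords Q v))"

text \<open>
  Small resolution of a three-dimensional space with isolated singular points \<open>S\<close>: the exceptional
  set is at most one-dimensional, that is, no open subset of \<open>\<complex>\<^sup>2\<close> maps injectively and holomorphically into it.
\<close>

definition small_resolution :: "'z cspace \<Rightarrow> ('z \<Rightarrow> 'a) \<Rightarrow> 'a cspace \<Rightarrow> 'a set \<Rightarrow> bool" where
  "small_resolution Z \<mu> X S \<longleftrightarrow>
     complex_manifold TYPE(3) Z \<and> holomorphic_map Z X \<mu> \<and> proper_map (ctop Z) (ctop X) \<mu> \<and>
     biholomorphic_map (subspace_of Z {p \<in> pts Z. \<mu> p \<notin> S}) (subspace_of X (pts X - S)) \<mu> \<and>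
     \<not> (\<exists>(W :: (complex^2) set) g. open W \<and> W \<noteq> {} \<and> holomorphic_map (model W) Z g \<and>
          inj_on g W \<and> \<mu> ` g ` W \<subseteq> S)"

text \<open>
  The conjugate point is resolved by reality: the real structure of \<open>Z\<^sub>0\<close> intertwines the
  resolution over \<open>y\<^sub>2 \<noteq> 0\<close>, with the conjugate complex structure, with the one over \<open>y\<^sub>3 \<noteq> 0\<close>.
  The resolution of the double point over \<open>P\<^sub>0\<close> is arbitrary.
\<close>

definition twistor_resolution ::
    "real \<Rightarrow> real \<Rightarrow> real \<times> real \<times> real \<Rightarrow> real \<Rightarrow> form \<Rightarrow> form \<Rightarrow> form \<Rightarrow>
     'z cspace \<Rightarrow> ('z \<Rightarrow> (complex^(4 + 1)) set) \<Rightarrow> bool" where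
  "twistor_resolution a b Q lam0 l1 l2 l3 Z \<mu> \<longleftrightarrow>
     small_resolution Z \<mu> (Z0 a b Q) {p_inf, p_inf_bar, p_zero lam0} \<and>
     resolves_p_inf_by a b Q l1 l2 l3 Z \<mu> \<and>
     resolves_p_inf_by a b Q l1 l2 l3 (conj_space Z) (\<lambda>p. Z0_conj (\<mu> p))"


section \<open>The curves over the conics\<close>

definition B_fun :: "real \<Rightarrow> real \<Rightarrow> real \<times> real \<times> real \<Rightarrow> real \<Rightarrow> real" where
  "B_fun a b Q t = sqrt ((sqrt ((quad_form Q t 1)^2 - f_cubic a b t) - quad_form Q t 1) / 2)"

definition conic ::
    "real \<Rightarrow> real \<Rightarrow> real \<times> real \<times> real \<Rightarrow> real \<Rightarrow> real \<Rightarrow> (complex^4) set set" where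
  "conic a b Q lam \<theta> = {P \<in> pts projective_space. \<forall>y\<in>P.
     y $ 0 = of_real lam * y $ 1 \<and>
     of_real (sqrt ((quad_form Q lam 1)^2 - f_cubic a b lam)) * (y $ 1)^2
       + of_real (B_fun a b Q lam) * cis \<theta> * y $ 1 * y $ 2
       + of_real (B_fun a b Q lam) * cis (- \<theta>) * y $ 1 * y $ 3 + y $ 2 * y $ 3 = 0}"

text \<open>
  Near \<open>p\<^sub>\<infinity>\<close> the set \<open>K\<close> is given by \<open>x\<^sub>0 = \<lambda>x\<^sub>1\<close>, \<open>\<xi> = c x\<^sub>1\<^sup>m + O(x\<^sub>1\<^sup>m\<^sup>+\<^sup>1)\<close>,
  \<open>\<eta> = d x\<^sub>1\<^sup>n + O(x\<^sub>1\<^sup>n\<^sup>+\<^sup>1)\<close>.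
\<close>

definition has_germ ::
    "real \<Rightarrow> real \<Rightarrow> real \<times> real \<times> real \<Rightarrow> real \<Rightarrow> complex \<Rightarrow> nat \<Rightarrow> complex \<Rightarrow> nat \<Rightarrow>
     (complex^(4 + 1)) set set \<Rightarrow> bool" where
  "has_germ a b Q lam c m d n K \<longleftrightarrow> p_inf \<in> K \<and>
     (\<exists>W M. openin (ctop (Z0 a b Q)) W \<and> p_inf \<in> W \<and>
       (\<forall>q\<in>K \<inter> W. \<forall>v\<in>q. v $ Inl 3 \<noteq> 0 \<and>
          (let x = affine_coords Q v in
             x $ 0 = of_real lam * x $ 1 \<and>
             norm (x $ 2 - c * (x $ 1)^m) \<le> M * norm (x $ 1)^(m + 1) \<and>
             norm (x $ 3 - d * (x $ 1)^n) \<le> M * norm (x $ 1)^(n + 1))))"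

definition conic_component ::
    "real \<Rightarrow> real \<Rightarrow> real \<times> real \<times> real \<Rightarrow> real \<Rightarrow> real \<Rightarrow>
     complex \<Rightarrow> nat \<Rightarrow> complex \<Rightarrow> nat \<Rightarrow> (complex^(4 + 1)) set set" where
  "conic_component a b Q lam \<theta> c m d n =
     (THE K. K \<in> irreducible_components (Z0 a b Q) {q \<in> pts (Z0 a b Q). Phi0 q \<in> conic a b Q lam \<theta>} \<and>
             has_germ a b Q lam c m d n K)"

definition proper_transform ::
    "'z cspace \<Rightarrow> ('z \<Rightarrow> 'a) \<Rightarrow> 'a set \<Rightarrow> 'a set \<Rightarrow> 'z set" where
  "proper_transform Z \<mu> S K = ctop Z closure_of {p \<in> pts Z. \<mu> p \<in> K - S}"

definition L_plus ::
    "real \<Rightarrow> real \<Rightarrow> real \<times> real \<times> real \<Rightarrow> real \<Rightarrow> 'z cspace \<Rightarrow>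
     ('z \<Rightarrow> (complex^(4 + 1)) set) \<Rightarrow> real \<Rightarrow> real \<Rightarrow> 'z set" where
  "L_plus a b Q lam0 Z \<mu> lam \<theta> = proper_transform Z \<mu> {p_inf, p_inf_bar, p_zero lam0}
     (conic_component a b Q lam \<theta>
        (- 2 * \<i> * of_real (B_fun a b Q lam) * cis (- \<theta>)) 1
        (\<i> * cis \<theta> * of_real (f_cubic a b lam) / (2 * of_real (B_fun a b Q lam))) 3)"

definition L_minus ::
    "real \<Rightarrow> real \<Rightarrow> real \<times> real \<times> real \<Rightarrow> real \<Rightarrow> 'z cspace \<Rightarrow>
     ('z \<Rightarrow> (complex^(4 + 1)) set) \<Rightarrow> real \<Rightarrow> real \<Rightarrow> 'z set" where
  "L_minus a b Q lam0 Z \<mu> lam \<theta> = proper_transform Z \<mu> {p_inf, p_inf_bar, p_zero lam0}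
     (conic_component a b Q lam \<theta>
        (- \<i> * cis \<theta> * of_real (f_cubic a b lam) / (2 * of_real (B_fun a b Q lam))) 3
        (2 * \<i> * of_real (B_fun a b Q lam) * cis (- \<theta>)) 1)"

text \<open>By homogeneity \<open>x\<^sub>1/l\<^sub>1\<close> and \<open>x\<^sub>1\<^sup>3/(l\<^sub>1l\<^sub>2l\<^sub>3)\<close> may be evaluated at \<open>(x\<^sub>0, x\<^sub>1) = (\<lambda>, 1)\<close>.\<close>

definition h1 :: "real \<Rightarrow> real \<Rightarrow> real \<times> real \<times> real \<Rightarrow> form \<Rightarrow> real \<Rightarrow> real" where
  "h1 a b Q l1 t = 2 * B_fun a b Q t * norm (1 / l1 (of_real t) 1)"

definition h3 :: "real \<Rightarrow> real \<Rightarrow> real \<times> real \<times> real \<Rightarrow> form \<Rightarrow> form \<Rightarrow> form \<Rightarrow> real \<Rightarrow> real" where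
  "h3 a b Q l1 l2 l3 t = (- f_cubic a b t) / (2 * B_fun a b Q t) *
     norm (1 / (l1 (of_real t) 1 * l2 (of_real t) 1 * l3 (of_real t) 1))"

definition critical_point :: "(real \<Rightarrow> real) \<Rightarrow> real \<Rightarrow> bool" where
  "critical_point h t \<longleftrightarrow> (h has_real_derivative 0) (at t)"

end

theory Submission
  imports Defs "HOL-Complex_Analysis.Conformal_Mappings"
begin

text \<open>
  Both curves are treated at once, with \<open>j = \<i>\<close>, \<open>l = l\<^sub>1\<close> for the first one and \<open>j = - \<i>\<close>, \<open>l = l\<^sub>4\<close> (the
  linear form that is not blown up) for the second one. The curve is covered by two charts of the
  threefold: \<open>(x\<^sub>0, x\<^sub>1, \<omega>)\<close> over \<open>y\<^sub>3 \<noteq> 0\<close>, where \<open>z + j(x\<^sub>2 + Q) = \<omega> l\<close>, and its image under the real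
  structure over \<open>y\<^sub>2 \<noteq> 0\<close>. In suitable transverse coordinates the transition matrix of the normal bundle
  is triangular and exhibits it as an extension of \<open>O(2)\<close> by \<open>O\<close>, the class of which is a multiple of
  \<open>\<delta> = Q' - A f'/f + 2 s l'/l\<close> with \<open>s = sqrt (Q\<^sup>2 - f)\<close>, \<open>A = (s + Q)/2\<close>. The extension splits iff \<open>\<delta> = 0\<close>;
  otherwise it is \<open>O(1) \<oplus> O(1)\<close>. Finally \<open>\<delta> = - 2 s h'/h\<close> for \<open>h = 2 B/|l|\<close>, which is \<open>h\<^sub>1\<close> for \<open>l = l\<^sub>1\<close> and
  \<open>1/h\<^sub>3\<close> for \<open>l = l\<^sub>4\<close>, because \<open>- f = |l\<^sub>1 l\<^sub>2 l\<^sub>3 l\<^sub>4|\<close>.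
\<close>

section \<open>Holomorphic functions of several variables\<close>

text \<open>With \<beta> = B exp(i \<theta>) the conic is (y2 + cnj \<beta> y1) (y3 + \<beta> y1) =
  - A y1^2, because s = A + B^2; as also Q = A - B^2 and f = - 4 A B^2, all computations are
  rational in \<beta>, cnj \<beta>, A and s. Over y3 \<noteq> 0 the function \<omega> has no zero on
  the curve, and where \<omega> is nonzero the other blow-up coordinates are functions of \<omega>,
  x0 and x1; so one chart and its conjugate suffice although there are three blow-ups. The
  transverse coordinates are m = x0 - \<lambda> x1 and a combination n of \<omega>, x1 and m; its
  multiple of m is chosen so that a coboundary disappears from the off-diagonal entry. Extensions of
  O(2) by O are classified by the one-dimensional space H^1(O(-2)), which is why all nonzero classes
  give the same bundle; explicit frames realise this. Two points shape the formal side. The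
  splitting predicate quantifies over all parametrisations of the curve, so the two types must be
  told apart for different parametrisations. And the normal bundle is indexed by all adapted charts,
  so frames given in two charts must be transported to the others.\<close>

lemma hol_on_subset: "hol_on W F \<Longrightarrow> V \<subseteq> W \<Longrightarrow> hol_on V F"
  unfolding hol_on_def by blast

lemma hol_on_const [intro, simp]: "hol_on W (\<lambda>x. c)"
  unfolding hol_on_def by (intro ballI exI[of _ "\<lambda>_. 0"]) auto

lemma hol_on_coord [intro, simp]: "hol_on W (\<lambda>x. x $ i)"
  unfolding hol_on_def
  by (intro ballI exI[of _ "\<lambda>v. v $ i"])
     (auto intro: bounded_linear_imp_has_derivative bounded_linear_vec_nth)

lemma hol_on_add [intro]:
  assumes "hol_on W F" "hol_on W G" shows "hol_on W (\<lambda>x. F x + G x)"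
  unfolding hol_on_def
proof
  fix x assume "x \<in> W"
  obtain D E where "(F has_derivative D) (at x)" "\<And>c v. D (c *s v) = c * D v"
    "(G has_derivative E) (at x)" "\<And>c v. E (c *s v) = c * E v"
    using assms \<open>x \<in> W\<close> unfolding hol_on_def by meson
  then show "\<exists>D. ((\<lambda>x. F x + G x) has_derivative D) (at x) \<and> (\<forall>c v. D (c *s v) = c * D v)"
    by (intro exI[of _ "\<lambda>v. D v + E v"]) (auto intro: has_derivative_add simp: distrib_left)
qed

lemma hol_on_mult [intro]:
  assumes "hol_on W F" "hol_on W G" shows "hol_on W (\<lambda>x. F x * G x)"
  unfolding hol_on_def
proof
  fix x assume "x \<in> W"
  obtain D E where "(F has_derivative D) (at x)" "\<And>c v. D (c *s v) = c * D v"
    "(G has_derivative E) (at x)" "\<And>c v. E (c *s v) = c * E v"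
    using assms \<open>x \<in> W\<close> unfolding hol_on_def by meson
  then show "\<exists>D. ((\<lambda>x. F x * G x) has_derivative D) (at x) \<and> (\<forall>c v. D (c *s v) = c * D v)"
    using has_derivative_mult[of F D x UNIV G E]
    by (intro exI[of _ "\<lambda>v. F x * E v + D v * G x"]) (auto simp: algebra_simps)
qed

lemma hol_on_field_compose:
  assumes "hol_on W F" "f holomorphic_on T" "open T" "F ` W \<subseteq> T"
  shows "hol_on W (\<lambda>x. f (F x))"
  unfolding hol_on_def
proof
  fix x assume "x \<in> W"
  obtain D where D: "(F has_derivative D) (at x)" "\<And>c v. D (c *s v) = c * D v"
    using assms \<open>x \<in> W\<close> unfolding hol_on_def by meson
  have "F x \<in> T" using \<open>x \<in> W\<close> assms by auto
  then obtain f' where "(f has_field_derivative f') (at (F x))"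
    using assms(2,3) by (metis holomorphic_derivI)
  then have "(f has_derivative (\<lambda>h. f' * h)) (at (F x))"
    by (simp add: has_field_derivative_def)
  from has_derivative_compose[OF D(1) this]
  show "\<exists>D. ((\<lambda>x. f (F x)) has_derivative D) (at x) \<and> (\<forall>c v. D (c *s v) = c * D v)"
    using D(2) by (intro exI[of _ "\<lambda>v. f' * D v"]) auto
qed

lemma hol_on_uminus [intro]: "hol_on W F \<Longrightarrow> hol_on W (\<lambda>x. - F x)"
  using hol_on_mult[of W "\<lambda>_. -1" F] by simp

lemma hol_on_diff [intro]: "hol_on W F \<Longrightarrow> hol_on W G \<Longrightarrow> hol_on W (\<lambda>x. F x - G x)"
  using hol_on_add[of W F "\<lambda>x. - G x"] by auto

lemma hol_on_power [intro]: "hol_on W F \<Longrightarrow> hol_on W (\<lambda>x. F x ^ n)"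
  by (rule hol_on_field_compose[where f = "\<lambda>z. z ^ n" and T = UNIV]) (auto intro: holomorphic_intros)

lemma hol_on_inverse [intro]:
  assumes "hol_on W F" "\<And>x. x \<in> W \<Longrightarrow> F x \<noteq> 0"
  shows "hol_on W (\<lambda>x. inverse (F x))"
  by (rule hol_on_field_compose[where T = "- {0}"]) (use assms in \<open>auto intro!: holomorphic_intros\<close>)

lemma hol_on_divide [intro]:
  assumes "hol_on W F" "hol_on W G" "\<And>x. x \<in> W \<Longrightarrow> G x \<noteq> 0"
  shows "hol_on W (\<lambda>x. F x / G x)"
  unfolding divide_inverse by (intro hol_on_mult hol_on_inverse) (use assms in auto)

lemma hol_on_powi [intro]:
  assumes "hol_on W F" "\<And>x. x \<in> W \<Longrightarrow> F x \<noteq> 0"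
  shows "hol_on W (\<lambda>x. F x powi k)"
  by (cases "k \<ge> 0") (use assms(1) hol_on_power[OF hol_on_inverse[OF assms]] in \<open>auto simp: power_int_def\<close>)

lemma hol_on_sum [intro]:
  "(\<And>i. i \<in> I \<Longrightarrow> hol_on W (F i)) \<Longrightarrow> hol_on W (\<lambda>x. \<Sum>i\<in>I. F i x)"
  by (induction I rule: infinite_finite_induct) auto

lemma has_derivative_vec_componentwise:
  fixes g :: "'a::real_normed_vector \<Rightarrow> complex^'n"
  assumes "\<And>i. ((\<lambda>v. g v $ i) has_derivative (\<lambda>v. D v $ i)) (at x)"
  shows "(g has_derivative D) (at x)"
  unfolding has_derivative_componentwise_within[of g]
proof
  fix b :: "complex^'n" assume "b \<in> Basis"
  then obtain i u where b: "b = axis i u" by (auto simp: Basis_vec_def)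
  show "((\<lambda>x. g x \<bullet> b) has_derivative (\<lambda>x. D x \<bullet> b)) (at x)"
    unfolding b inner_axis by (rule has_derivative_inner_left[OF assms])
qed

lemma hol_on_compose:
  assumes "hol_on T G" "\<And>i. hol_on W (\<lambda>v. g v $ i)" "\<And>x. x \<in> W \<Longrightarrow> g x \<in> T"
  shows "hol_on W (\<lambda>v. G (g v))"
  unfolding hol_on_def
proof
  fix x assume x: "x \<in> W"
  obtain D where D: "(G has_derivative D) (at (g x))" "\<And>c v. D (c *s v) = c * D v"
    using assms x unfolding hol_on_def by meson
  have "\<forall>i. \<exists>E. ((\<lambda>v. g v $ i) has_derivative E) (at x) \<and> (\<forall>c v. E (c *s v) = c * E v)"
    using assms(2) x unfolding hol_on_def by blast
  then obtain E where E: "\<And>i. ((\<lambda>v. g v $ i) has_derivative E i) (at x)"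
    "\<And>i c v. E i (c *s v) = c * E i v" by metis
  have "(g has_derivative (\<lambda>v. \<chi> i. E i v)) (at x)"
    by (rule has_derivative_vec_componentwise) (simp add: E)
  from has_derivative_compose[OF this D(1)]
  have "((\<lambda>v. G (g v)) has_derivative (\<lambda>v. D (\<chi> i. E i v))) (at x)" .
  moreover have "D (\<chi> i. E i (c *s v)) = c * D (\<chi> i. E i v)" for c v
  proof -
    have "(\<chi> i. E i (c *s v)) = c *s (\<chi> i. E i v)" by (simp add: vec_eq_iff E)
    then show ?thesis by (simp add: D)
  qed
  ultimately show "\<exists>D. ((\<lambda>x. G (g x)) has_derivative D) (at x) \<and> (\<forall>c v. D (c *s v) = c * D v)"
    by (intro exI[of _ "\<lambda>v. D (\<chi> i. E i v)"]) auto
qed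

lemma hol_on_compose_curve:
  assumes "hol_on W F" "\<And>i. (\<lambda>t. c t $ i) holomorphic_on T" "open T" "\<And>t. t \<in> T \<Longrightarrow> c t \<in> W"
  shows "(\<lambda>t. F (c t)) holomorphic_on T"
proof -
  have "(\<lambda>t. F (c t)) field_differentiable (at t)" if t: "t \<in> T" for t
  proof -
    obtain D where D: "(F has_derivative D) (at (c t))" "\<And>a v. D (a *s v) = a * D v"
      using assms t unfolding hol_on_def by meson
    have "\<forall>i. \<exists>c'. ((\<lambda>t. c t $ i) has_field_derivative c') (at t)"
      using assms(2,3) t by (meson holomorphic_derivI)
    then obtain c' where c': "\<And>i. ((\<lambda>t. c t $ i) has_field_derivative c' i) (at t)" by metis
    have "(c has_derivative (\<lambda>h. h *s (\<chi> i. c' i))) (at t)"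
      by (rule has_derivative_vec_componentwise)
         (use c' in \<open>simp add: has_field_derivative_def mult_commute_abs\<close>)
    from has_derivative_compose[OF this D(1)]
    have "((\<lambda>t. F (c t)) has_derivative (\<lambda>h. D (\<chi> i. c' i) * h)) (at t)"
      by (simp add: D mult.commute)
    then show ?thesis unfolding field_differentiable_def has_field_derivative_def by blast
  qed
  then show ?thesis by (simp add: holomorphic_on_open assms(3) field_differentiable_def)
qed

lemma hol_on_cong:
  assumes "open W" "\<And>x. x \<in> W \<Longrightarrow> F x = G x"
  shows "hol_on W F \<longleftrightarrow> hol_on W G"
proof -
  have "hol_on W G" if "hol_on W F" "\<And>x. x \<in> W \<Longrightarrow> F x = G x" for F G :: "complex^'a \<Rightarrow> complex"
    unfolding hol_on_def
  proof
    fix x assume x: "x \<in> W"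
    from that(1) x obtain D where D: "(F has_derivative D) (at x)" "\<And>a v. D (a *s v) = a * D v"
      unfolding hol_on_def by meson
    have "(G has_derivative D) (at x)"
      using has_derivative_transform_within_open[OF D(1) assms(1) x] that(2) by auto
    with D(2) show "\<exists>D. (G has_derivative D) (at x) \<and> (\<forall>c v. D (c *s v) = c * D v)" by blast
  qed
  from this[of F G] this[of G F] assms(2) show ?thesis by auto
qed

lemma hol_on_continuous: "hol_on W F \<Longrightarrow> continuous_on W F"
  unfolding hol_on_def
  by (meson continuous_at_imp_continuous_on has_derivative_continuous)

lemma hol_on_local:
  assumes "\<And>x. x \<in> W \<Longrightarrow> \<exists>V. x \<in> V \<and> hol_on V F"
  shows "hol_on W F"
  using assms unfolding hol_on_def by blast

text \<open>Composed with a chart of \<open>conj_space Z\<close> it yields a chart of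
  \<open>Z\<close>; this is how the chart over y2 \<noteq> 0 is obtained from the real
  structure.\<close>

definition vcnj :: "complex^'n \<Rightarrow> complex^'n" where "vcnj v = (\<chi> i. cnj (v $ i))"

lemma vcnj_nth [simp]: "vcnj v $ i = cnj (v $ i)"
  by (simp add: vcnj_def)

lemma vcnj_vcnj [simp]: "vcnj (vcnj v) = v"
  by (simp add: vec_eq_iff)

lemma vcnj_image_iff: "v \<in> vcnj ` S \<longleftrightarrow> vcnj v \<in> S"
  by (metis image_iff vcnj_vcnj)

lemma continuous_on_vcnj: "continuous_on S vcnj"
  unfolding vcnj_def by (intro continuous_intros)

lemma open_vcnj: "open W \<Longrightarrow> open (vcnj ` W)"
proof -
  assume "open W"
  have "vcnj ` W = vcnj -` W" by (auto simp: vcnj_image_iff)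
  then show ?thesis using \<open>open W\<close> continuous_on_vcnj[of UNIV]
    by (metis open_vimage)
qed

text \<open>Conjugating both argument and value turns the derivative \<open>D\<close> into
  \<open>cnj \<circ> D \<circ> vcnj\<close>, which is complex linear again.\<close>

lemma hol_on_vcnj:
  assumes "hol_on W F"
  shows "hol_on (vcnj ` W) (\<lambda>v. cnj (F (vcnj v)))"
  unfolding hol_on_def
proof
  fix x assume "x \<in> vcnj ` W"
  then have x: "vcnj x \<in> W" by (simp add: vcnj_image_iff)
  obtain D where D: "(F has_derivative D) (at (vcnj x))" "\<And>a v. D (a *s v) = a * D v"
    using assms x unfolding hol_on_def by meson
  have "((\<lambda>v. v $ i) has_derivative (\<lambda>v. v $ i)) (at x)" for i
    by (intro bounded_linear_imp_has_derivative bounded_linear_vec_nth)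
  then have 1: "(vcnj has_derivative vcnj) (at x)"
    by (intro has_derivative_vec_componentwise) (auto simp: has_derivative_cnj)
  have 2: "((\<lambda>v. cnj (F (vcnj v))) has_derivative (\<lambda>v. cnj (D (vcnj v)))) (at x)"
    using has_derivative_compose[OF 1 D(1)] by (rule has_derivative_cnj)
  moreover have "cnj (D (vcnj (c *s v))) = c * cnj (D (vcnj v))" for c v
  proof -
    have "vcnj (c *s v) = cnj c *s vcnj v" by (simp add: vec_eq_iff)
    then show ?thesis by (simp add: D)
  qed
  ultimately show "\<exists>D. ((\<lambda>v. cnj (F (vcnj v))) has_derivative D) (at x) \<and> (\<forall>c v. D (c *s v) = c * D v)"
    by blast
qed

section \<open>Complex spaces and holomorphic maps\<close>

lemma ctop_subspace [simp]: "ctop (subspace_of X S) = subtopology (ctop X) S"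
  by (simp add: subspace_of_def)

lemma chol_subspace: "f \<in> chol (subspace_of X S) U \<longleftrightarrow> openin (subtopology (ctop X) S) U \<and>
       (\<forall>p\<in>U. \<exists>V F. openin (ctop X) V \<and> p \<in> V \<and> F \<in> chol X V \<and> (\<forall>q\<in>V \<inter> U. f q = F q))"
  by (simp add: subspace_of_def)

text \<open>The first clause of \<open>complex_manifold\<close>, isolated because models, quotients
  and subspaces of such spaces satisfy it too; it is what allows restricting and gluing holomorphic
  functions.\<close>

definition csheaf :: "'a cspace \<Rightarrow> bool" where
  "csheaf X \<longleftrightarrow> subspace_of X (pts X) = X"

lemma csheaf_iff:
  "csheaf X \<longleftrightarrow> (\<forall>U f. f \<in> chol X U \<longleftrightarrow> openin (ctop X) U \<and>
     (\<forall>p\<in>U. \<exists>V F. openin (ctop X) V \<and> p \<in> V \<and> F \<in> chol X V \<and> (\<forall>q\<in>V \<inter> U. f q = F q)))"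
  (is "_ \<longleftrightarrow> (\<forall>U f. f \<in> chol X U \<longleftrightarrow> ?P U f)")
proof -
  have "csheaf X \<longleftrightarrow> chol (subspace_of X (pts X)) = chol X"
  proof
    assume "csheaf X"
    then show "chol (subspace_of X (pts X)) = chol X" unfolding csheaf_def by metis
  next
    assume "chol (subspace_of X (pts X)) = chol X"
    then show "csheaf X" unfolding csheaf_def by (intro cspace.equality) auto
  qed
  also have "\<dots> \<longleftrightarrow> (\<forall>U f. f \<in> chol X U \<longleftrightarrow> f \<in> chol (subspace_of X (pts X)) U)"
    by (auto simp: fun_eq_iff set_eq_iff)
  finally show ?thesis by (simp add: chol_subspace)
qed

lemma csheaf_open: "csheaf X \<Longrightarrow> f \<in> chol X U \<Longrightarrow> openin (ctop X) U"
  unfolding csheaf_iff by blast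

lemma csheaf_restrict:
  assumes "csheaf X" "f \<in> chol X U" "openin (ctop X) V" "V \<subseteq> U"
  shows "f \<in> chol X V"
proof -
  have "\<exists>W F. openin (ctop X) W \<and> p \<in> W \<and> F \<in> chol X W \<and> (\<forall>q\<in>W \<inter> V. f q = F q)" if "p \<in> V" for p
    using assms(2,4) csheaf_open[OF assms(1,2)] that by blast
  then show ?thesis using assms(1,3) unfolding csheaf_iff by blast
qed

lemma csheaf_local:
  assumes "csheaf X" "openin (ctop X) U"
    and "\<And>p. p \<in> U \<Longrightarrow> \<exists>V F. openin (ctop X) V \<and> p \<in> V \<and> F \<in> chol X V \<and> (\<forall>q\<in>V \<inter> U. f q = F q)"
  shows "f \<in> chol X U"
  using assms unfolding csheaf_iff by blast

lemma csheaf_cong: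
  assumes "csheaf X" "f \<in> chol X U" "\<And>q. q \<in> U \<Longrightarrow> g q = f q"
  shows "g \<in> chol X U"
  by (rule csheaf_local[OF assms(1) csheaf_open[OF assms(1,2)]]) (use assms csheaf_open in blast)

lemma csheafI:
  assumes "\<And>U f. f \<in> chol X U \<Longrightarrow> openin (ctop X) U"
    and "\<And>U f. openin (ctop X) U \<Longrightarrow>
      (\<And>p. p \<in> U \<Longrightarrow> \<exists>V F. openin (ctop X) V \<and> p \<in> V \<and> F \<in> chol X V \<and> (\<forall>q\<in>V \<inter> U. f q = F q)) \<Longrightarrow>
      f \<in> chol X U"
  shows "csheaf X"
proof -
  have "f \<in> chol X U \<longleftrightarrow> openin (ctop X) U \<and>
     (\<forall>p\<in>U. \<exists>V F. openin (ctop X) V \<and> p \<in> V \<and> F \<in> chol X V \<and> (\<forall>q\<in>V \<inter> U. f q = F q))" for U f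
  proof (intro iffI conjI ballI)
    fix p assume "f \<in> chol X U" "p \<in> U"
    then show "\<exists>V F. openin (ctop X) V \<and> p \<in> V \<and> F \<in> chol X V \<and> (\<forall>q\<in>V \<inter> U. f q = F q)"
      using assms(1)[of f U] by (intro exI[of _ U] exI[of _ f]) auto
  qed (use assms in auto)
  then show ?thesis unfolding csheaf_iff by blast
qed

lemma csheaf_subspace:
  assumes "csheaf X" shows "csheaf (subspace_of X S)"
proof (rule csheafI)
  fix U f assume U: "openin (ctop (subspace_of X S)) U"
    and loc: "\<And>p. p \<in> U \<Longrightarrow> \<exists>V F. openin (ctop (subspace_of X S)) V \<and> p \<in> V \<and>
        F \<in> chol (subspace_of X S) V \<and> (\<forall>q\<in>V \<inter> U. f q = F q)"
  show "f \<in> chol (subspace_of X S) U"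
    unfolding chol_subspace
  proof (intro conjI ballI)
    show "openin (subtopology (ctop X) S) U" using U by simp
    fix p assume p: "p \<in> U"
    obtain V F where V: "openin (subtopology (ctop X) S) V" "p \<in> V" "F \<in> chol (subspace_of X S) V"
      "\<forall>q\<in>V \<inter> U. f q = F q" using loc[OF p] by auto
    obtain V' where V': "openin (ctop X) V'" "V = V' \<inter> S" using V(1) by (auto simp: openin_subtopology)
    obtain W G where W: "openin (ctop X) W" "p \<in> W" "G \<in> chol X W" "\<forall>q\<in>W \<inter> V. F q = G q"
      using V(2,3) unfolding chol_subspace by meson
    have "U \<subseteq> S" using U by (auto simp: openin_subtopology)
    show "\<exists>V F. openin (ctop X) V \<and> p \<in> V \<and> F \<in> chol X V \<and> (\<forall>q\<in>V \<inter> U. f q = F q)"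
    proof (intro exI conjI)
      show o: "openin (ctop X) (V' \<inter> W)" using V' W by auto
      show "G \<in> chol X (V' \<inter> W)" using csheaf_restrict[OF assms W(3) o] by auto
      show "p \<in> V' \<inter> W" using V' V W by auto
      show "\<forall>q\<in>V' \<inter> W \<inter> U. f q = G q" using V V' W \<open>U \<subseteq> S\<close> by auto
    qed
  qed
qed (simp add: chol_subspace)

text \<open>A local extension from the inner subspace to \<open>S\<close> is followed by one from
  \<open>S\<close> to \<open>X\<close>; the latter lives on an open set of its own, and the sheaf
  property allows shrinking both to a common domain.\<close>

lemma subspace_subspace:
  assumes "csheaf X" shows "subspace_of (subspace_of X S) T = subspace_of X (S \<inter> T)"
proof -
  have "f \<in> chol (subspace_of (subspace_of X S) T) U \<longleftrightarrow> f \<in> chol (subspace_of X (S \<inter> T)) U" for f U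
  proof
    assume A: "f \<in> chol (subspace_of (subspace_of X S) T) U"
    then have oU: "openin (subtopology (ctop X) (S \<inter> T)) U"
      by (simp add: chol_subspace[of f "subspace_of X S"] subtopology_subtopology)
    then have "U \<subseteq> S \<inter> T" by (auto simp: openin_subtopology)
    show "f \<in> chol (subspace_of X (S \<inter> T)) U"
    proof (subst chol_subspace, intro conjI ballI)
      show "openin (subtopology (ctop X) (S \<inter> T)) U" by fact
      fix p assume p: "p \<in> U"
      obtain V F where V: "openin (subtopology (ctop X) S) V" "p \<in> V" "F \<in> chol (subspace_of X S) V"
        "\<forall>q\<in>V \<inter> U. f q = F q"
        using A p by (subst (asm) chol_subspace) (metis ctop_subspace)
      obtain V' where V': "openin (ctop X) V'" "V = V' \<inter> S" using V(1) by (auto simp: openin_subtopology)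
      obtain W G where W: "openin (ctop X) W" "p \<in> W" "G \<in> chol X W" "\<forall>q\<in>W \<inter> V. F q = G q"
        using V(2,3) unfolding chol_subspace by meson
      show "\<exists>V F. openin (ctop X) V \<and> p \<in> V \<and> F \<in> chol X V \<and> (\<forall>q\<in>V \<inter> U. f q = F q)"
      proof (intro exI conjI)
        show o: "openin (ctop X) (V' \<inter> W)" using V' W by auto
        show "G \<in> chol X (V' \<inter> W)" using csheaf_restrict[OF assms W(3) o] by auto
        show "p \<in> V' \<inter> W" using V' V W by auto
        show "\<forall>q\<in>V' \<inter> W \<inter> U. f q = G q" using V V' W \<open>U \<subseteq> S \<inter> T\<close> by auto
      qed
    qed
  next
    assume A: "f \<in> chol (subspace_of X (S \<inter> T)) U"
    then have oU: "openin (subtopology (ctop X) (S \<inter> T)) U" by (simp add: chol_subspace)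
    then have "U \<subseteq> S \<inter> T" by (auto simp: openin_subtopology)
    show "f \<in> chol (subspace_of (subspace_of X S) T) U"
    proof (subst chol_subspace, intro conjI ballI)
      show "openin (subtopology (ctop (subspace_of X S)) T) U"
        using oU by (simp add: subtopology_subtopology)
      fix p assume p: "p \<in> U"
      obtain V F where V: "openin (ctop X) V" "p \<in> V" "F \<in> chol X V" "\<forall>q\<in>V \<inter> U. f q = F q"
        using A p unfolding chol_subspace by meson
      show "\<exists>V F. openin (ctop (subspace_of X S)) V \<and> p \<in> V \<and> F \<in> chol (subspace_of X S) V \<and>
          (\<forall>q\<in>V \<inter> U. f q = F q)"
      proof (intro exI conjI)
        show "openin (ctop (subspace_of X S)) (V \<inter> S)" using V by (auto simp: openin_subtopology)
        then show "F \<in> chol (subspace_of X S) (V \<inter> S)" using V by (auto simp: chol_subspace)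
      qed (use V p \<open>U \<subseteq> S \<inter> T\<close> in auto)
    qed
  qed
  then have "chol (subspace_of (subspace_of X S) T) = chol (subspace_of X (S \<inter> T))"
    by (auto simp: fun_eq_iff set_eq_iff)
  then show ?thesis by (intro cspace.equality) (auto simp: subtopology_subtopology)
qed

lemma chol_subspace_open:
  assumes "csheaf X" "openin (ctop X) S"
  shows "f \<in> chol (subspace_of X S) U \<longleftrightarrow> f \<in> chol X U \<and> U \<subseteq> S"
proof
  assume A: "f \<in> chol (subspace_of X S) U"
  then have "openin (ctop X) U \<and> U \<subseteq> S"
    using assms by (simp add: chol_subspace openin_open_subtopology)
  moreover have "f \<in> chol X U"
    by (rule csheaf_local[OF assms(1)]) (use A calculation in \<open>auto simp: chol_subspace\<close>)
  ultimately show "f \<in> chol X U \<and> U \<subseteq> S" by blast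
next
  assume "f \<in> chol X U \<and> U \<subseteq> S"
  then show "f \<in> chol (subspace_of X S) U"
    using csheaf_open[OF assms(1)] assms by (auto simp: chol_subspace openin_open_subtopology)
qed

lemma chol_subspace_restrict:
  assumes "csheaf X" "f \<in> chol X U" shows "f \<in> chol (subspace_of X S) (U \<inter> S)"
  using assms csheaf_open[OF assms] unfolding chol_subspace by (auto simp: openin_subtopology)

subsection \<open>Subsets of affine space\<close>

lemma ctop_model [simp]: "ctop (model S) = top_of_set S"
  by (simp add: model_def)

lemma chol_model: "f \<in> chol (model S) U \<longleftrightarrow> openin (top_of_set S) U \<and>
       (\<forall>x\<in>U. \<exists>W F. open W \<and> x \<in> W \<and> hol_on W F \<and> (\<forall>w\<in>W \<inter> U. f w = F w))"
  by (simp add: model_def)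

lemma csheaf_model [simp]: "csheaf (model S)"
proof (rule csheafI)
  fix U f assume U: "openin (ctop (model S)) U"
    and loc: "\<And>p. p \<in> U \<Longrightarrow> \<exists>V F. openin (ctop (model S)) V \<and> p \<in> V \<and>
        F \<in> chol (model S) V \<and> (\<forall>q\<in>V \<inter> U. f q = F q)"
  show "f \<in> chol (model S) U"
    unfolding chol_model
  proof (intro conjI ballI)
    show "openin (top_of_set S) U" using U by simp
    fix p assume p: "p \<in> U"
    obtain V F where V: "openin (top_of_set S) V" "p \<in> V" "F \<in> chol (model S) V"
      "\<forall>q\<in>V \<inter> U. f q = F q" using loc[OF p] by auto
    obtain V' where V': "open V'" "V = V' \<inter> S" using V(1) by (metis openin_open Int_commute)
    obtain W G where W: "open W" "p \<in> W" "hol_on W G" "\<forall>q\<in>W \<inter> V. F q = G q"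
      using V(2,3) unfolding chol_model by meson
    have "U \<subseteq> S" using U by (auto simp: openin_subtopology)
    show "\<exists>W F. open W \<and> p \<in> W \<and> hol_on W F \<and> (\<forall>w\<in>W \<inter> U. f w = F w)"
      by (rule exI[of _ "V' \<inter> W"], rule exI[of _ G])
         (use V V' W \<open>U \<subseteq> S\<close> in \<open>auto intro: hol_on_subset\<close>)
  qed
qed (simp add: chol_model)

lemma chol_model_open:
  assumes "open S" shows "f \<in> chol (model S) U \<longleftrightarrow> open U \<and> U \<subseteq> S \<and> hol_on U f"
proof
  assume A: "f \<in> chol (model S) U"
  then have U: "open U" "U \<subseteq> S" using assms by (auto simp: chol_model openin_open_eq)
  have "hol_on U f"
  proof (rule hol_on_local)
    fix x assume x: "x \<in> U"
    then obtain W F where W: "open W" "x \<in> W" "hol_on W F" "\<forall>w\<in>W \<inter> U. f w = F w"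
      using A unfolding chol_model by meson
    have "hol_on (W \<inter> U) f" using hol_on_cong[of "W \<inter> U" f F] W U hol_on_subset[OF W(3)] by auto
    then show "\<exists>V. x \<in> V \<and> hol_on V f" using x W by blast
  qed
  with U show "open U \<and> U \<subseteq> S \<and> hol_on U f" by blast
next
  assume "open U \<and> U \<subseteq> S \<and> hol_on U f"
  then show "f \<in> chol (model S) U" using assms by (auto simp: chol_model openin_open_eq)
qed

lemma subspace_model: "T \<subseteq> S \<Longrightarrow> subspace_of (model S) T = model T"
proof -
  assume T: "T \<subseteq> S"
  have "f \<in> chol (subspace_of (model S) T) U \<longleftrightarrow> f \<in> chol (model T) U" for f U
  proof -
    have o: "openin (subtopology (top_of_set S) T) U \<longleftrightarrow> openin (top_of_set T) U"
      using T by (simp add: subtopology_subtopology Int_absorb1)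
    show ?thesis
    proof
      assume A: "f \<in> chol (subspace_of (model S) T) U"
      then have U: "openin (top_of_set T) U" using o by (simp add: chol_subspace)
      then have "U \<subseteq> T" by (auto simp: openin_subtopology)
      show "f \<in> chol (model T) U" unfolding chol_model
      proof (intro conjI ballI U)
        fix p assume p: "p \<in> U"
        obtain V F where V: "openin (top_of_set S) V" "p \<in> V" "F \<in> chol (model S) V" "\<forall>q\<in>V \<inter> U. f q = F q"
          using A p by (subst (asm) chol_subspace) auto
        obtain V' where V': "open V'" "V = V' \<inter> S" using V(1) by (metis openin_open Int_commute)
        obtain W G where W: "open W" "p \<in> W" "hol_on W G" "\<forall>q\<in>W \<inter> V. F q = G q"
          using V(2,3) unfolding chol_model by meson
        show "\<exists>W F. open W \<and> p \<in> W \<and> hol_on W F \<and> (\<forall>w\<in>W \<inter> U. f w = F w)"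
          by (rule exI[of _ "V' \<inter> W"], rule exI[of _ G])
             (use V V' W \<open>U \<subseteq> T\<close> T in \<open>auto intro: hol_on_subset\<close>)
      qed
    next
      assume A: "f \<in> chol (model T) U"
      then have U: "openin (top_of_set T) U" by (simp add: chol_model)
      then have "U \<subseteq> T" by (auto simp: openin_subtopology)
      show "f \<in> chol (subspace_of (model S) T) U"
        unfolding chol_subspace ctop_model o
      proof (intro conjI ballI U)
        fix p assume p: "p \<in> U"
        obtain W F where W: "open W" "p \<in> W" "hol_on W F" "\<forall>w\<in>W \<inter> U. f w = F w"
          using A p unfolding chol_model by meson
        show "\<exists>V F. openin (top_of_set S) V \<and> p \<in> V \<and> F \<in> chol (model S) V \<and> (\<forall>q\<in>V \<inter> U. f q = F q)"
          by (rule exI[of _ "S \<inter> W"], rule exI[of _ F])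
             (use W p \<open>U \<subseteq> T\<close> T in \<open>auto simp: chol_model openin_open\<close>)
      qed
    qed
  qed
  then have "chol (subspace_of (model S) T) = chol (model T)"
    by (auto simp: fun_eq_iff set_eq_iff)
  then show ?thesis using T by (intro cspace.equality) (auto simp: subtopology_subtopology Int_absorb1)
qed

subsection \<open>Quotients\<close>

text \<open>Preimages commute with intersections and unions, so the generating family is already a
  topology and generates nothing new.\<close>

lemma openin_quotient_space:
  "openin (ctop (quotient_space C \<pi>)) U \<longleftrightarrow> U \<subseteq> \<pi> ` C \<and> openin (top_of_set C) (C \<inter> \<pi> -` U)"
proof -
  let ?F = "{U. U \<subseteq> \<pi> ` C \<and> openin (top_of_set C) (C \<inter> \<pi> -` U)}"
  have "generate_topology_on ?F U \<Longrightarrow> U \<in> ?F"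
  proof (induction rule: generate_topology_on.induct)
    case (Int a b)
    then have "openin (top_of_set C) ((C \<inter> \<pi> -` a) \<inter> (C \<inter> \<pi> -` b))" by blast
    moreover have "(C \<inter> \<pi> -` a) \<inter> (C \<inter> \<pi> -` b) = C \<inter> \<pi> -` (a \<inter> b)" by blast
    ultimately show ?case using Int by auto
  next
    case (UN K)
    have "C \<inter> \<pi> -` \<Union>K = \<Union> ((\<lambda>k. C \<inter> \<pi> -` k) ` K)" by blast
    moreover have "openin (top_of_set C) (\<Union> ((\<lambda>k. C \<inter> \<pi> -` k) ` K))"
      by (rule openin_Union) (use UN.IH in auto)
    moreover have "\<Union>K \<subseteq> \<pi> ` C" using UN.IH by blast
    ultimately show ?case by auto
  qed auto
  then show ?thesis
    by (auto simp: quotient_space_def openin_topology_generated_by_iff intro: generate_topology_on.Basis)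
qed

lemma pts_quotient_space [simp]: "pts (quotient_space C \<pi>) = \<pi> ` C"
proof -
  have "openin (ctop (quotient_space C \<pi>)) (\<pi> ` C)"
  proof -
    have "C \<inter> \<pi> -` (\<pi> ` C) = C" by blast
    then show ?thesis by (simp add: openin_quotient_space)
  qed
  then show ?thesis
    by (metis openin_quotient_space openin_subset openin_topspace subset_antisym)
qed

lemma chol_quotient_space:
  "f \<in> chol (quotient_space C \<pi>) U \<longleftrightarrow> U \<subseteq> \<pi> ` C \<and> f \<circ> \<pi> \<in> chol (model C) (C \<inter> \<pi> -` U)"
  by (simp add: quotient_space_def)

lemma csheaf_quotient_space [simp]: "csheaf (quotient_space C \<pi>)"
proof (rule csheafI)
  fix U f assume U: "openin (ctop (quotient_space C \<pi>)) U"
    and loc: "\<And>p. p \<in> U \<Longrightarrow> \<exists>V F. openin (ctop (quotient_space C \<pi>)) V \<and> p \<in> V \<and>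
        F \<in> chol (quotient_space C \<pi>) V \<and> (\<forall>q\<in>V \<inter> U. f q = F q)"
  have "f \<circ> \<pi> \<in> chol (model C) (C \<inter> \<pi> -` U)"
  proof (rule csheaf_local[OF csheaf_model])
    show "openin (ctop (model C)) (C \<inter> \<pi> -` U)" using U by (simp add: openin_quotient_space)
    fix p assume p: "p \<in> C \<inter> \<pi> -` U"
    obtain V F where V: "openin (ctop (quotient_space C \<pi>)) V" "\<pi> p \<in> V"
        "F \<in> chol (quotient_space C \<pi>) V" "\<forall>q\<in>V \<inter> U. f q = F q" using loc[of "\<pi> p"] p by auto
    show "\<exists>V F. openin (ctop (model C)) V \<and> p \<in> V \<and> F \<in> chol (model C) V \<and>
        (\<forall>q\<in>V \<inter> (C \<inter> \<pi> -` U). (f \<circ> \<pi>) q = F q)"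
      by (rule exI[of _ "C \<inter> \<pi> -` V"], rule exI[of _ "F \<circ> \<pi>"])
         (use V p in \<open>auto simp: openin_quotient_space chol_quotient_space\<close>)
  qed
  then show "f \<in> chol (quotient_space C \<pi>) U"
    using U by (simp add: chol_quotient_space openin_quotient_space)
qed (simp add: chol_quotient_space openin_quotient_space chol_model)

subsection \<open>Holomorphic maps\<close>

lemma holomorphic_map_continuous: "holomorphic_map X Y g \<Longrightarrow> continuous_map (ctop X) (ctop Y) g"
  by (simp add: holomorphic_map_def)

lemma holomorphic_map_pts: "holomorphic_map X Y g \<Longrightarrow> p \<in> pts X \<Longrightarrow> g p \<in> pts Y"
  unfolding holomorphic_map_def by (simp add: continuous_map_def Pi_iff)

lemma holomorphic_map_chol:
  "holomorphic_map X Y g \<Longrightarrow> csheaf Y \<Longrightarrow> f \<in> chol Y V \<Longrightarrow> f \<circ> g \<in> chol X {p \<in> pts X. g p \<in> V}"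
  unfolding holomorphic_map_def using csheaf_open by blast

lemma holomorphic_map_compose:
  assumes "holomorphic_map X Y g" "holomorphic_map Y W h"
  shows "holomorphic_map X W (h \<circ> g)"
  unfolding holomorphic_map_def
proof (intro conjI allI impI)
  show "continuous_map (ctop X) (ctop W) (h \<circ> g)"
    using assms by (meson continuous_map_compose holomorphic_map_def)
  fix V f assume A: "openin (ctop W) V \<and> f \<in> chol W V"
  have 1: "openin (ctop Y) {p \<in> pts Y. h p \<in> V}"
    using A assms(2) openin_continuous_map_preimage holomorphic_map_continuous by blast
  have 2: "f \<circ> h \<in> chol Y {p \<in> pts Y. h p \<in> V}" using A assms(2) unfolding holomorphic_map_def by blast
  have "(f \<circ> h) \<circ> g \<in> chol X {p \<in> pts X. g p \<in> {p \<in> pts Y. h p \<in> V}}"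
    using 1 2 assms(1) unfolding holomorphic_map_def by blast
  moreover have "{p \<in> pts X. g p \<in> {p \<in> pts Y. h p \<in> V}} = {p \<in> pts X. (h \<circ> g) p \<in> V}"
    using holomorphic_map_pts[OF assms(1)] by auto
  ultimately show "f \<circ> (h \<circ> g) \<in> chol X {p \<in> pts X. (h \<circ> g) p \<in> V}" by (simp add: comp_assoc)
qed

lemma holomorphic_map_from_subspace:
  assumes "csheaf X" "csheaf Y" "holomorphic_map X Y g"
  shows "holomorphic_map (subspace_of X S) Y g"
  unfolding holomorphic_map_def
proof (intro conjI allI impI)
  show "continuous_map (ctop (subspace_of X S)) (ctop Y) g"
    using assms by (simp add: continuous_map_from_subtopology holomorphic_map_def)
  fix V f assume A: "openin (ctop Y) V \<and> f \<in> chol Y V"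
  have "{p \<in> pts (subspace_of X S). g p \<in> V} = {p \<in> pts X. g p \<in> V} \<inter> S" by auto
  then show "f \<circ> g \<in> chol (subspace_of X S) {p \<in> pts (subspace_of X S). g p \<in> V}"
    using chol_subspace_restrict[OF assms(1) holomorphic_map_chol[OF assms(3,2)]] A by metis
qed

lemma holomorphic_map_into_subspace:
  assumes "csheaf X" "csheaf Y"
  shows "holomorphic_map X (subspace_of Y T) g \<longleftrightarrow> holomorphic_map X Y g \<and> (\<forall>p\<in>pts X. g p \<in> T)"
proof
  assume A: "holomorphic_map X (subspace_of Y T) g"
  then have g: "g p \<in> T" if "p \<in> pts X" for p using holomorphic_map_pts[OF A] that by auto
  have "holomorphic_map X Y g" unfolding holomorphic_map_def
  proof (intro conjI allI impI)
    show "continuous_map (ctop X) (ctop Y) g"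
      using holomorphic_map_continuous[OF A] continuous_map_into_fulltopology by auto
    fix V f assume V: "openin (ctop Y) V \<and> f \<in> chol Y V"
    then have "f \<in> chol (subspace_of Y T) (V \<inter> T)" using chol_subspace_restrict[OF assms(2)] by blast
    from holomorphic_map_chol[OF A csheaf_subspace[OF assms(2)] this]
    have "f \<circ> g \<in> chol X {p \<in> pts X. g p \<in> V \<inter> T}" .
    moreover have "{p \<in> pts X. g p \<in> V \<inter> T} = {p \<in> pts X. g p \<in> V}" using g by auto
    ultimately show "f \<circ> g \<in> chol X {p \<in> pts X. g p \<in> V}" by simp
  qed
  with g show "holomorphic_map X Y g \<and> (\<forall>p\<in>pts X. g p \<in> T)" by blast
next
  assume A: "holomorphic_map X Y g \<and> (\<forall>p\<in>pts X. g p \<in> T)"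
  show "holomorphic_map X (subspace_of Y T) g" unfolding holomorphic_map_def
  proof (intro conjI allI impI)
    show c: "continuous_map (ctop X) (ctop (subspace_of Y T)) g"
      using A by (auto simp: continuous_map_in_subtopology holomorphic_map_continuous)
    fix V f assume V: "openin (ctop (subspace_of Y T)) V \<and> f \<in> chol (subspace_of Y T) V"
    show "f \<circ> g \<in> chol X {p \<in> pts X. g p \<in> V}"
    proof (rule csheaf_local[OF assms(1)])
      show "openin (ctop X) {p \<in> pts X. g p \<in> V}" using c V openin_continuous_map_preimage by blast
      fix p assume p: "p \<in> {p \<in> pts X. g p \<in> V}"
      then obtain W F where W: "openin (ctop Y) W" "g p \<in> W" "F \<in> chol Y W" "\<forall>q\<in>W \<inter> V. f q = F q"
        using V unfolding chol_subspace by blast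
      show "\<exists>Va F. openin (ctop X) Va \<and> p \<in> Va \<and> F \<in> chol X Va \<and>
          (\<forall>q\<in>Va \<inter> {p \<in> pts X. g p \<in> V}. (f \<circ> g) q = F q)"
        by (rule exI[of _ "{p \<in> pts X. g p \<in> W}"], rule exI[of _ "F \<circ> g"])
           (use A W p holomorphic_map_chol[OF _ assms(2) W(3), of X g] openin_continuous_map_preimage[OF _ W(1), of "ctop X" g]
             in \<open>auto simp: holomorphic_map_continuous\<close>)
    qed
  qed
qed

text \<open>Continuity is local on the source, and so is the pull-back condition, by the sheaf
  property of \<open>X\<close>.\<close>

lemma holomorphic_map_local:
  assumes "csheaf X" "csheaf Y"
    and "\<And>p. p \<in> pts X \<Longrightarrow> \<exists>U. openin (ctop X) U \<and> p \<in> U \<and> holomorphic_map (subspace_of X U) Y g"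
  shows "holomorphic_map X Y g"
proof -
  have loc: "\<exists>U. openin (ctop X) U \<and> p \<in> U \<and> openin (ctop X) {q \<in> U. g q \<in> V}" if "p \<in> pts X" "openin (ctop Y) V" for p V
  proof -
    obtain U where U: "openin (ctop X) U" "p \<in> U" "holomorphic_map (subspace_of X U) Y g"
      using assms(3)[OF \<open>p \<in> pts X\<close>] by blast
    have "openin (subtopology (ctop X) U) {q \<in> pts (subspace_of X U). g q \<in> V}"
      using openin_continuous_map_preimage[OF holomorphic_map_continuous[OF U(3)] that(2)] by simp
    moreover have "{q \<in> pts (subspace_of X U). g q \<in> V} = {q \<in> U. g q \<in> V}"
      using openin_subset[OF U(1)] by auto
    ultimately show ?thesis using U openin_open_subtopology by metis
  qed
  have co: "openin (ctop X) {q \<in> pts X. g q \<in> V}" if V: "openin (ctop Y) V" for V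
  proof (subst openin_subopen, intro ballI)
    fix p assume p: "p \<in> {q \<in> pts X. g q \<in> V}"
    then obtain U where U: "openin (ctop X) U" "p \<in> U" "openin (ctop X) {q \<in> U. g q \<in> V}"
      using loc[OF _ V, of p] by blast
    then show "\<exists>T. openin (ctop X) T \<and> p \<in> T \<and> T \<subseteq> {q \<in> pts X. g q \<in> V}"
      by (intro exI[of _ "{q \<in> U. g q \<in> V}"]) (use p openin_subset[OF U(1)] in auto)
  qed
  have gp: "g p \<in> pts Y" if p: "p \<in> pts X" for p
  proof -
    obtain U where U: "openin (ctop X) U" "p \<in> U" "holomorphic_map (subspace_of X U) Y g"
      using assms(3)[OF p] by blast
    then show ?thesis using holomorphic_map_pts[OF U(3), of p] p by auto
  qed
  show ?thesis unfolding holomorphic_map_def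
  proof (intro conjI allI impI)
    show "continuous_map (ctop X) (ctop Y) g" using co gp by (simp add: continuous_map_def Pi_iff)
    fix V f assume V: "openin (ctop Y) V \<and> f \<in> chol Y V"
    show "f \<circ> g \<in> chol X {p \<in> pts X. g p \<in> V}"
    proof (rule csheaf_local[OF assms(1)])
      show "openin (ctop X) {p \<in> pts X. g p \<in> V}" using co V by blast
      fix p assume p: "p \<in> {p \<in> pts X. g p \<in> V}"
      then obtain U where U: "openin (ctop X) U" "p \<in> U" "holomorphic_map (subspace_of X U) Y g"
        using assms(3)[of p] by blast
      have "f \<circ> g \<in> chol (subspace_of X U) {q \<in> pts (subspace_of X U). g q \<in> V}"
        using holomorphic_map_chol[OF U(3) assms(2)] V by blast
      then have 1: "f \<circ> g \<in> chol X {q \<in> pts (subspace_of X U). g q \<in> V}"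
        using chol_subspace_open[OF assms(1) U(1)] by blast
      show "\<exists>Va F. openin (ctop X) Va \<and> p \<in> Va \<and> F \<in> chol X Va \<and>
          (\<forall>q\<in>Va \<inter> {p \<in> pts X. g p \<in> V}. (f \<circ> g) q = F q)"
        by (rule exI[of _ "{q \<in> pts (subspace_of X U). g q \<in> V}"], rule exI[of _ "f \<circ> g"])
           (use 1 p U csheaf_open[OF assms(1) 1] in auto)
    qed
  qed
qed

lemma holomorphic_map_cong:
  assumes "csheaf X" "csheaf Y" "holomorphic_map X Y g" "\<And>p. p \<in> pts X \<Longrightarrow> h p = g p"
  shows "holomorphic_map X Y h"
  unfolding holomorphic_map_def
proof (intro conjI allI impI)
  show "continuous_map (ctop X) (ctop Y) h"
    using assms(3,4) continuous_map_eq[of "ctop X" "ctop Y" g h] holomorphic_map_continuous by metis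
  fix V f assume V: "openin (ctop Y) V \<and> f \<in> chol Y V"
  have e: "{p \<in> pts X. h p \<in> V} = {p \<in> pts X. g p \<in> V}" using assms(4) by auto
  show "f \<circ> h \<in> chol X {p \<in> pts X. h p \<in> V}"
    unfolding e by (rule csheaf_cong[OF assms(1) holomorphic_map_chol[OF assms(3,2)], of f])
      (use V assms(4) in auto)
qed

text \<open>Topology and functions of a quotient are both defined by pulling back along
  \<open>\<pi>\<close>, so each condition on \<open>g\<close> translates into the one on
  \<open>g \<circ> \<pi>\<close>.\<close>

lemma holomorphic_map_quotient_iff:
  assumes "csheaf Y"
  shows "holomorphic_map (quotient_space C \<pi>) Y g \<longleftrightarrow> holomorphic_map (model C) Y (g \<circ> \<pi>)"
proof -
  have 1: "C \<inter> \<pi> -` {p \<in> \<pi> ` C. g p \<in> V} = {p \<in> C. (g \<circ> \<pi>) p \<in> V}" for V by auto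
  have 2: "C \<inter> {y. \<pi> y \<in> \<pi> ` C \<and> g (\<pi> y) \<in> V} = {p \<in> C. g (\<pi> p) \<in> V}" for V by auto
  have "continuous_map (ctop (quotient_space C \<pi>)) (ctop Y) g \<longleftrightarrow> continuous_map (top_of_set C) (ctop Y) (g \<circ> \<pi>)"
    by (auto simp: continuous_map_def openin_quotient_space 1 2 Pi_iff)
  then show ?thesis by (auto simp: holomorphic_map_def chol_quotient_space 1 2 comp_assoc)
qed

lemma holomorphic_map_id [simp]: "csheaf X \<Longrightarrow> holomorphic_map X X id"
  unfolding holomorphic_map_def
proof (intro conjI allI impI)
  fix V f assume X: "csheaf X" and V: "openin (ctop X) V \<and> f \<in> chol X V"
  then have "{p \<in> pts X. id p \<in> V} = V" using openin_subset by fastforce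
  with V show "f \<circ> id \<in> chol X {p \<in> pts X. id p \<in> V}" by simp
qed (auto simp: id_def)

lemma holomorphic_map_quotient_proj: "holomorphic_map (model C) (quotient_space C \<pi>) \<pi>"
  using holomorphic_map_quotient_iff[of "quotient_space C \<pi>" C \<pi> id] holomorphic_map_id by simp

text \<open>\<open>S\<close> may be any subset, so holomorphy at a point is witnessed by a map
  \<open>G\<close> on an ambient neighbourhood that agrees with \<open>g\<close> on
  \<open>S\<close>; both continuity and pull-back of functions are read off from
  \<open>G\<close>.\<close>

lemma holomorphic_map_model:
  assumes "\<And>x. x \<in> S \<Longrightarrow> g x \<in> T"
    and "\<And>x. x \<in> S \<Longrightarrow> \<exists>W G. open W \<and> x \<in> W \<and> (\<forall>i. hol_on W (\<lambda>v. G v $ i)) \<and> (\<forall>w\<in>W \<inter> S. g w = G w)"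
  shows "holomorphic_map (model S) (model T) g"
proof -
  have cont: "continuous_on S g"
    unfolding continuous_on_eq_continuous_within
  proof
    fix x assume x: "x \<in> S"
    then obtain W G where W: "open W" "x \<in> W" "\<And>i. hol_on W (\<lambda>v. G v $ i)" "\<forall>w\<in>W \<inter> S. g w = G w"
      using assms(2)[OF x] by blast
    have "continuous_on W (\<lambda>v. \<chi> i. G v $ i)"
      by (intro continuous_on_vec_lambda hol_on_continuous W)
    then have "continuous_on W G" by simp
    then have "continuous (at x within S) G"
      using W(1,2) continuous_on_eq_continuous_at continuous_at_imp_continuous_at_within by blast
    then show "continuous (at x within S) g"
      by (rule continuous_transform_within_openin[of _ _ _ "S \<inter> W"]) (use W x in \<open>auto simp: openin_open\<close>)
  qed
  show ?thesis unfolding holomorphic_map_def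
  proof (intro conjI allI impI)
    show c: "continuous_map (ctop (model S)) (ctop (model T)) g"
      using cont assms(1) by (auto simp: continuous_map_in_subtopology)
    fix V f assume V: "openin (ctop (model T)) V \<and> f \<in> chol (model T) V"
    show "f \<circ> g \<in> chol (model S) {p \<in> pts (model S). g p \<in> V}"
      unfolding chol_model
    proof (intro conjI ballI)
      show "openin (top_of_set S) {p \<in> pts (model S). g p \<in> V}"
        using openin_continuous_map_preimage[OF c] V by simp
      fix x assume x: "x \<in> {p \<in> pts (model S). g p \<in> V}"
      obtain W G where W: "open W" "x \<in> W" "\<And>i. hol_on W (\<lambda>v. G v $ i)" "\<forall>w\<in>W \<inter> S. g w = G w"
        using assms(2)[of x] x by auto
      obtain W' F where W': "open W'" "g x \<in> W'" "hol_on W' F" "\<forall>w\<in>W' \<inter> V. f w = F w"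
        using V x unfolding chol_model by blast
      have "continuous_on W (\<lambda>v. \<chi> i. G v $ i)"
        by (intro continuous_on_vec_lambda hol_on_continuous W)
      then have cG: "continuous_on W G" by simp
      have "open (W \<inter> G -` W')" using cG W(1) W'(1) continuous_on_open_vimage[of W G] by (metis Int_commute)
      moreover have "hol_on (W \<inter> G -` W') (\<lambda>v. F (G v))"
        by (rule hol_on_compose[OF W'(3)]) (auto intro: hol_on_subset[OF W(3)])
      ultimately show "\<exists>W F. open W \<and> x \<in> W \<and> hol_on W F \<and> (\<forall>w\<in>W \<inter> {p \<in> pts (model S). g p \<in> V}. (f \<circ> g) w = F w)"
        by (intro exI[of _ "W \<inter> G -` W'"] exI[of _ "\<lambda>v. F (G v)"]) (use W W' x in auto)
    qed
  qed
qed

lemma holomorphic_map_model_open: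
  assumes "open S" "\<And>x. x \<in> S \<Longrightarrow> g x \<in> T" "\<And>i. hol_on S (\<lambda>v. g v $ i)"
  shows "holomorphic_map (model S) (model T) g"
  by (rule holomorphic_map_model) (use assms in blast)+

subsection \<open>Biholomorphic maps\<close>

lemma biholomorphic_mapI:
  assumes "holomorphic_map X Y g" "holomorphic_map Y X h"
    "\<And>p. p \<in> pts X \<Longrightarrow> h (g p) = p" "\<And>q. q \<in> pts Y \<Longrightarrow> g (h q) = q"
  shows "biholomorphic_map X Y g"
  using assms unfolding biholomorphic_map_def by blast

lemma biholomorphic_map_bij: "biholomorphic_map X Y g \<Longrightarrow> bij_betw g (pts X) (pts Y)"
proof -
  assume "biholomorphic_map X Y g"
  then obtain h where h: "holomorphic_map X Y g" "holomorphic_map Y X h" "\<forall>p\<in>pts X. h (g p) = p" "\<forall>q\<in>pts Y. g (h q) = q"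
    unfolding biholomorphic_map_def by blast
  show ?thesis
    by (rule bij_betw_byWitness[where f' = h])
      (use h(3,4) holomorphic_map_pts[OF h(1)] holomorphic_map_pts[OF h(2)] in auto)
qed

lemma biholomorphic_map_inv_into:
  assumes "csheaf X" "csheaf Y" "biholomorphic_map X Y g"
  shows "holomorphic_map Y X (inv_into (pts X) g)"
proof -
  obtain h where h: "holomorphic_map Y X h" "\<forall>p\<in>pts X. h (g p) = p" "\<forall>q\<in>pts Y. g (h q) = q"
    using assms(3) unfolding biholomorphic_map_def by blast
  show ?thesis
  proof (rule holomorphic_map_cong[OF assms(2,1) h(1)])
    fix q assume q: "q \<in> pts Y"
    then have "h q \<in> pts X" using holomorphic_map_pts[OF h(1)] by blast
    then show "inv_into (pts X) g q = h q"
      by (metis biholomorphic_map_bij[OF assms(3)] bij_betw_inv_into_left h(3) q)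
  qed
qed

lemma biholomorphic_map_compose:
  assumes "biholomorphic_map X Y g" "biholomorphic_map Y W h"
  shows "biholomorphic_map X W (h \<circ> g)"
proof -
  obtain g' h' where "holomorphic_map X Y g" "holomorphic_map Y X g'" "\<forall>p\<in>pts X. g' (g p) = p" "\<forall>q\<in>pts Y. g (g' q) = q"
    "holomorphic_map Y W h" "holomorphic_map W Y h'" "\<forall>p\<in>pts Y. h' (h p) = p" "\<forall>q\<in>pts W. h (h' q) = q"
    using assms unfolding biholomorphic_map_def by blast
  then show ?thesis
    by (intro biholomorphic_mapI[where h = "g' \<circ> h'"]) (auto intro: holomorphic_map_compose simp: holomorphic_map_pts)
qed

lemma biholomorphic_map_restrict:
  assumes "csheaf X" "csheaf Y" "biholomorphic_map X Y g" "T \<subseteq> pts Y"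
  shows "biholomorphic_map (subspace_of X {p \<in> pts X. g p \<in> T}) (subspace_of Y T) g"
proof -
  obtain h where h: "holomorphic_map X Y g" "holomorphic_map Y X h" "\<forall>p\<in>pts X. h (g p) = p" "\<forall>q\<in>pts Y. g (h q) = q"
    using assms unfolding biholomorphic_map_def by blast
  show ?thesis
  proof (rule biholomorphic_mapI[where h = h])
    show "holomorphic_map (subspace_of X {p \<in> pts X. g p \<in> T}) (subspace_of Y T) g"
      using holomorphic_map_into_subspace[OF csheaf_subspace[OF assms(1)] assms(2)]
        holomorphic_map_from_subspace[OF assms(1,2) h(1)] by auto
    show "holomorphic_map (subspace_of Y T) (subspace_of X {p \<in> pts X. g p \<in> T}) h"
      using holomorphic_map_into_subspace[OF csheaf_subspace[OF assms(2)] assms(1)]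
        holomorphic_map_from_subspace[OF assms(2,1) h(2)] holomorphic_map_pts[OF h(2)] h(4) by auto
  qed (use h in auto)
qed

subsection \<open>The conjugate space\<close>

lemma ctop_conj_space [simp]: "ctop (conj_space X) = ctop X"
  by (simp add: conj_space_def)

lemma chol_conj_space: "f \<in> chol (conj_space X) U \<longleftrightarrow> cnj \<circ> f \<in> chol X U"
  by (simp add: conj_space_def)

lemma cnj_comp_cnj [simp]: "cnj \<circ> (cnj \<circ> f) = f"
  by (simp add: fun_eq_iff)

lemma conj_space_subspace: "subspace_of (conj_space X) S = conj_space (subspace_of X S)"
proof -
  have "f \<in> chol (subspace_of (conj_space X) S) U \<longleftrightarrow> f \<in> chol (conj_space (subspace_of X S)) U" for f U
  proof -
    have "(\<exists>V F. openin (ctop X) V \<and> p \<in> V \<and> cnj \<circ> F \<in> chol X V \<and> (\<forall>q\<in>V \<inter> U. f q = F q)) \<longleftrightarrow>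
        (\<exists>V F. openin (ctop X) V \<and> p \<in> V \<and> F \<in> chol X V \<and> (\<forall>q\<in>V \<inter> U. cnj (f q) = F q))" for p
      by (metis cnj_comp_cnj comp_apply complex_cnj_cnj)
    then show ?thesis by (simp add: chol_conj_space chol_subspace)
  qed
  then have "chol (subspace_of (conj_space X) S) = chol (conj_space (subspace_of X S))"
    by (auto simp: fun_eq_iff set_eq_iff)
  then show ?thesis by (intro cspace.equality) auto
qed

lemma conj_conj_space [simp]: "conj_space (conj_space X) = X"
  by (intro cspace.equality) (auto simp: conj_space_def comp_def)

lemma csheaf_conj_space: "csheaf X \<Longrightarrow> csheaf (conj_space X)"
  by (simp add: csheaf_def conj_space_subspace)

lemma holomorphic_map_conj_space: "holomorphic_map X Y g \<Longrightarrow> holomorphic_map (conj_space X) (conj_space Y) g"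
  unfolding holomorphic_map_def by (simp add: chol_conj_space comp_assoc[symmetric])

lemma biholomorphic_map_conj_space: "biholomorphic_map X Y g \<Longrightarrow> biholomorphic_map (conj_space X) (conj_space Y) g"
  unfolding biholomorphic_map_def by (simp add: holomorphic_map_conj_space) (metis holomorphic_map_conj_space)

text \<open>The functions of \<open>conj_space (model W)\<close> are antiholomorphic, and
  \<open>hol_on_vcnj\<close> makes them holomorphic on the mirrored set. Together with
  \<open>conj_conj_space\<close> this converts charts of the conjugate space.\<close>

lemma biholomorphic_map_conj_model:
  assumes "open W" shows "biholomorphic_map (conj_space (model W)) (model (vcnj ` W)) vcnj"
proof -
  have oW: "open (vcnj ` W)" using assms by (rule open_vcnj)
  have 1: "holomorphic_map (conj_space (model W)) (model (vcnj ` W)) vcnj"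
    unfolding holomorphic_map_def
  proof (intro conjI allI impI)
    show c: "continuous_map (ctop (conj_space (model W))) (ctop (model (vcnj ` W))) vcnj"
      by (auto simp: continuous_map_in_subtopology continuous_on_vcnj)
    fix V f assume "openin (ctop (model (vcnj ` W))) V \<and> f \<in> chol (model (vcnj ` W)) V"
    then have V: "open V" "V \<subseteq> vcnj ` W" "hol_on V f" using oW by (auto simp: chol_model_open)
    have "{p \<in> pts (conj_space (model W)). vcnj p \<in> V} = vcnj ` V"
      using V(2) by (auto simp: vcnj_image_iff)
    moreover have "cnj \<circ> (f \<circ> vcnj) \<in> chol (model W) (vcnj ` V)"
      unfolding chol_model_open[OF assms]
      using V hol_on_vcnj[OF V(3)] open_vcnj[OF V(1)] by (auto simp: comp_def vcnj_image_iff)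
    ultimately show "f \<circ> vcnj \<in> chol (conj_space (model W)) {p \<in> pts (conj_space (model W)). vcnj p \<in> V}"
      by (simp add: chol_conj_space)
  qed
  have 2: "holomorphic_map (model (vcnj ` W)) (conj_space (model W)) vcnj"
    unfolding holomorphic_map_def
  proof (intro conjI allI impI)
    show c: "continuous_map (ctop (model (vcnj ` W))) (ctop (conj_space (model W))) vcnj"
      by (auto simp: continuous_map_in_subtopology continuous_on_vcnj)
    fix V f assume "openin (ctop (conj_space (model W))) V \<and> f \<in> chol (conj_space (model W)) V"
    then have V: "open V" "V \<subseteq> W" "hol_on V (cnj \<circ> f)" using assms by (auto simp: chol_model_open chol_conj_space)
    have "{p \<in> pts (model (vcnj ` W)). vcnj p \<in> V} = vcnj ` V"
      using V(2) by (auto simp: vcnj_image_iff)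
    moreover have "f \<circ> vcnj \<in> chol (model (vcnj ` W)) (vcnj ` V)"
      unfolding chol_model_open[OF oW]
      using V hol_on_vcnj[OF V(3)] open_vcnj[OF V(1)] by (auto simp: comp_def)
    ultimately show "f \<circ> vcnj \<in> chol (model (vcnj ` W)) {p \<in> pts (model (vcnj ` W)). vcnj p \<in> V}"
      by simp
  qed
  show ?thesis by (rule biholomorphic_mapI[OF 1 2]) auto
qed

section \<open>Bundles on the projective line\<close>

text \<open>The library lemmas on the type \<open>2\<close> use the indices \<open>1\<close> and
  \<open>2\<close>, the definitions here \<open>0\<close> and \<open>1\<close>; this identification
  links the two conventions.\<close>

lemma two_eq_zero [simp]: "(2::2) = 0"
  by simp

lemma forall_2': "(\<forall>i::2. P i) \<longleftrightarrow> P 0 \<and> P 1"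
  using forall_2[of P] by auto

lemma sum_2': "sum f (UNIV::2 set) = f 0 + f 1"
  using sum_2[of f] by (simp add: add.commute)

lemma sum_mult_if_eq:
  fixes f g :: "'r::finite \<Rightarrow> complex"
  shows "(\<Sum>k\<in>UNIV. f k * (if k = r then g k else 0)) = f r * g r"
proof -
  have "(\<Sum>k\<in>UNIV. f k * (if k = r then g k else 0)) = (\<Sum>k\<in>UNIV. if k = r then f k * g k else 0)"
    by (rule sum.cong) auto
  then show ?thesis by simp
qed

lemma det_2': "det (A::'a::comm_ring_1^2^2) = A $ 0 $ 0 * A $ 1 $ 1 - A $ 0 $ 1 * A $ 1 $ 0"
  by (simp add: det_2 mult.commute)

section \<open>Points and functions on the projective line, and the bundles
  \<open>O_sum\<close>\<close>

lemma line_through_scale [simp]: "c \<noteq> 0 \<Longrightarrow> line_through (c *s v) = line_through v"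
proof -
  assume c: "c \<noteq> 0"
  have "\<exists>d. a *s v = d *s (c *s v) \<and> d \<noteq> 0" if "a \<noteq> 0" for a
    by (rule exI[of _ "a / c"]) (use c that in simp)
  moreover have "\<exists>d. a *s (c *s v) = d *s v \<and> d \<noteq> 0" if "a \<noteq> 0" for a
    by (rule exI[of _ "a * c"]) (use c that in simp)
  ultimately show ?thesis unfolding line_through_def by blast
qed

lemma in_line_through: "w \<in> line_through v \<longleftrightarrow> (\<exists>c. c \<noteq> 0 \<and> w = c *s v)"
  by (auto simp: line_through_def)

lemma self_in_line_through [simp]: "v \<in> line_through v"
  unfolding in_line_through by (rule exI[of _ 1]) simp

lemma line_through_eq_iff: "line_through v = line_through w \<longleftrightarrow> (\<exists>c. c \<noteq> 0 \<and> w = c *s v)"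
  by (metis in_line_through line_through_scale self_in_line_through)

lemma pts_projective_space [simp]: "pts projective_space = line_through ` (- {0})"
  by (simp add: projective_space_def)

lemma csheaf_projective_space [simp]: "csheaf projective_space"
  by (simp add: projective_space_def)

lemma open_nonzero: "open (- {0 :: complex^'n})"
  by (intro open_Compl closed_singleton)

lemma openin_projective_space:
  "openin (ctop projective_space) U \<longleftrightarrow> U \<subseteq> line_through ` (- {0}) \<and> open {y. y \<noteq> 0 \<and> line_through y \<in> U}"
proof -
  have "- {0} \<inter> line_through -` U = {y. y \<noteq> 0 \<and> line_through y \<in> U}" by auto
  then show ?thesis by (auto simp: projective_space_def openin_quotient_space openin_open_eq[OF open_nonzero])
qed

lemma chol_projective_space:
  "f \<in> chol projective_space U \<longleftrightarrow> U \<subseteq> line_through ` (- {0}) \<and> open {y. y \<noteq> 0 \<and> line_through y \<in> U} \<and>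
     hol_on {y. y \<noteq> 0 \<and> line_through y \<in> U} (\<lambda>y. f (line_through y))"
proof -
  have "- {0} \<inter> line_through -` U = {y. y \<noteq> 0 \<and> line_through y \<in> U}" by auto
  then show ?thesis by (auto simp: projective_space_def chol_quotient_space chol_model_open[OF open_nonzero] comp_def)
qed

lemma continuous_on_vec_nth_imp_open:
  "open {y :: complex^'n. y \<noteq> 0 \<and> y $ i \<noteq> 0}"
proof -
  have "{y :: complex^'n. y \<noteq> 0 \<and> y $ i \<noteq> 0} = (\<lambda>y. y $ i) -` (- {0})" by auto
  moreover have "open ((\<lambda>y :: complex^'n. y $ i) -` (- {0}))"
    by (intro open_vimage_vec_nth open_Compl closed_singleton)
  ultimately show ?thesis by simp
qed

lemma O_sum_patch: "y \<noteq> 0 \<Longrightarrow> line_through y \<in> patch (O_sum k) i \<longleftrightarrow> y $ i \<noteq> 0"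
  by (auto simp: O_sum_def in_line_through)

lemma O_sum_patch_subset: "patch (O_sum k) i \<subseteq> line_through ` (- {0})"
  by (auto simp: O_sum_def)

lemma O_sum_patchE:
  assumes "p \<in> patch (O_sum k) i"
  obtains y where "y \<noteq> 0" "p = line_through y" "y $ i \<noteq> 0"
  using assms by (auto simp: O_sum_def)

lemma idx_O_sum [simp]: "idx (O_sum k) = UNIV"
  by (simp add: O_sum_def)

lemma O_sum_trans:
  "trans (O_sum k) i j (line_through y) $ r $ s = (if r = s then (y $ j / y $ i) powi k r else 0)"
proof -
  have "(SOME x. x \<in> line_through y) \<in> line_through y" by (rule someI) (rule self_in_line_through)
  then obtain c where "c \<noteq> 0" "(SOME x. x \<in> line_through y) = c *s y" by (auto simp: in_line_through)
  then show ?thesis by (simp add: O_sum_def)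
qed

lemma holomorphic_bundle_O_sum: "holomorphic_bundle projective_space (O_sum k)"
  unfolding holomorphic_bundle_def
proof (intro conjI ballI)
  have op: "open {y. y \<noteq> 0 \<and> line_through y \<in> patch (O_sum k) i}" for i
  proof -
    have "{y. y \<noteq> 0 \<and> line_through y \<in> patch (O_sum k) i} = {y. y \<noteq> 0 \<and> y $ i \<noteq> 0}"
      by (auto simp: O_sum_patch)
    then show ?thesis by (simp add: continuous_on_vec_nth_imp_open)
  qed
  show o: "openin (ctop projective_space) (patch (O_sum k) i)" for i
    unfolding openin_projective_space using op O_sum_patch_subset by blast
  show "(\<Union>i\<in>idx (O_sum k). patch (O_sum k) i) = pts projective_space"
  proof
    show "pts projective_space \<subseteq> (\<Union>i\<in>idx (O_sum k). patch (O_sum k) i)"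
    proof
      fix P assume "P \<in> pts (projective_space :: (complex^2) set cspace)"
      then obtain y :: "complex^2" where y: "y \<noteq> 0" "P = line_through y" by auto
      then obtain i where "y $ i \<noteq> 0" by (auto simp: vec_eq_iff)
      then show "P \<in> (\<Union>i\<in>idx (O_sum k). patch (O_sum k) i)" using y O_sum_patch by auto
    qed
  qed (use O_sum_patch_subset in fastforce)
  show "holomorphic_matrix projective_space (patch (O_sum k) i \<inter> patch (O_sum k) j) (trans (O_sum k) i j)" for i j
    unfolding holomorphic_matrix_def
  proof (intro allI)
    fix r s
    have "{y. y \<noteq> 0 \<and> line_through y \<in> patch (O_sum k) i \<inter> patch (O_sum k) j} =
        {y. y \<noteq> 0 \<and> y $ i \<noteq> 0} \<inter> {y. y \<noteq> 0 \<and> y $ j \<noteq> 0}"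
      by (auto simp: O_sum_patch)
    moreover have "hol_on ({y. y \<noteq> 0 \<and> y $ i \<noteq> 0} \<inter> {y. y \<noteq> 0 \<and> y $ j \<noteq> 0})
      (\<lambda>y. trans (O_sum k) i j (line_through y) $ r $ s)"
      unfolding O_sum_trans by (cases "r = s") (auto intro!: hol_on_powi hol_on_divide)
    ultimately show "(\<lambda>p. trans (O_sum k) i j p $ r $ s) \<in> chol projective_space (patch (O_sum k) i \<inter> patch (O_sum k) j)"
      using O_sum_patch_subset[of k i] by (auto simp: chol_projective_space continuous_on_vec_nth_imp_open open_Int)
  qed
  fix i p assume "p \<in> patch (O_sum k) i"
  then obtain y where y: "y \<noteq> 0" "p = line_through y" "y $ i \<noteq> 0"
    by (rule O_sum_patchE)
  then show "trans (O_sum k) i i p = mat 1" by (simp add: vec_eq_iff O_sum_trans mat_def)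
next
  fix i j l p assume p: "p \<in> patch (O_sum k) i \<inter> patch (O_sum k) j \<inter> patch (O_sum k) l"
  then obtain y where y: "y \<noteq> 0" "p = line_through y" "y $ i \<noteq> 0"
    by (blast elim: O_sum_patchE)
  then have y': "y $ j \<noteq> 0" "y $ l \<noteq> 0" using p by (auto simp: O_sum_patch)
  have "(y $ j / y $ i) powi k r * (y $ l / y $ j) powi k r = (y $ l / y $ i) powi k r" for r
    using y y' by (simp add: power_int_mult_distrib[symmetric])
  then show "trans (O_sum k) i j p ** trans (O_sum k) j l p = trans (O_sum k) i l p"
    by (auto simp: vec_eq_iff matrix_matrix_mult_def y O_sum_trans sum_mult_if_eq)
qed

text \<open>
  A frame of a bundle on the projective line, written as a matrix function of the homogeneous
  coordinates: the \<open>r\<close>-th column is a section with values in \<open>O(- k r)\<close>.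
\<close>

definition homogeneous_frame ::
    "('i, (complex^2) set, 'r::finite) cocycle \<Rightarrow> 'i set \<Rightarrow> ('r \<Rightarrow> int) \<Rightarrow> ('i \<Rightarrow> complex^2 \<Rightarrow> complex^'r^'r) \<Rightarrow> bool" where
  "homogeneous_frame E J k H \<longleftrightarrow>
     (\<forall>i\<in>J. \<forall>a r. hol_on {y. y \<noteq> 0 \<and> line_through y \<in> patch E i} (\<lambda>y. H i y $ a $ r)) \<and>
     (\<forall>i\<in>J. \<forall>y. y \<noteq> 0 \<and> line_through y \<in> patch E i \<longrightarrow> invertible (H i y) \<and>
        (\<forall>a r c. c \<noteq> 0 \<longrightarrow> H i (c *s y) $ a $ r = c powi (- k r) * H i y $ a $ r)) \<and>
     (\<forall>i\<in>J. \<forall>j\<in>J. \<forall>y. y \<noteq> 0 \<and> line_through y \<in> patch E i \<inter> patch E j \<longrightarrow>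
        trans E i j (line_through y) ** H j y = H i y)"

lemma homogeneous_frame_trans:
  "homogeneous_frame E J k H \<Longrightarrow> i \<in> J \<Longrightarrow> j \<in> J \<Longrightarrow> y \<noteq> 0 \<Longrightarrow> line_through y \<in> patch E i \<Longrightarrow>
     line_through y \<in> patch E j \<Longrightarrow> trans E i j (line_through y) ** H j y = H i y"
  unfolding homogeneous_frame_def by blast

lemma invertible_diagonal:
  fixes d :: "'r::finite \<Rightarrow> complex"
  assumes "\<And>r. d r \<noteq> 0"
  shows "invertible (\<chi> a r. if a = r then d r else 0 :: complex^'r^'r)"
proof -
  have "(\<Sum>k\<in>UNIV. (if a = k then f k else 0) * (if k = r then inverse (f r) else 0)) = (if a = r then 1 else 0)"
    if "\<And>k. f k \<noteq> 0" for a r and f :: "'r \<Rightarrow> complex"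
  proof -
    have "(\<Sum>k\<in>UNIV. (if a = k then f k else 0) * (if k = r then inverse (f r) else 0)) =
        (\<Sum>k\<in>UNIV. if a = k then (if a = r then 1 else 0) else 0)"
      by (rule sum.cong) (use that in auto)
    then show ?thesis by simp
  qed
  from this[of d] this[of "\<lambda>k. inverse (d k)", unfolded inverse_inverse_eq] show ?thesis
    unfolding invertible_def using assms
    by (intro exI[of _ "\<chi> a r. if a = r then inverse (d r) else 0"])
       (simp add: vec_eq_iff matrix_matrix_mult_def mat_def)
qed

text \<open>The normal bundle has one index for every adapted chart, but frames can be written down
  in two charts only. Since these cover the curve, the transition matrices carry the frame to every
  other chart.\<close>

lemma homogeneous_frame_extend:
  assumes E: "holomorphic_bundle projective_space E" and J: "J \<subseteq> idx E"
    and cover: "\<And>y. y \<noteq> 0 \<Longrightarrow> \<exists>j\<in>J. line_through y \<in> patch E j"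
    and H: "homogeneous_frame E J k H"
  shows "\<exists>K. homogeneous_frame E (idx E) k K"
proof -
  define jj where "jj y = (SOME j. j \<in> J \<and> line_through y \<in> patch E j)" for y
  have jj: "jj y \<in> J \<and> line_through y \<in> patch E (jj y)" if "y \<noteq> 0" for y
    unfolding jj_def using cover[OF that] by (metis (mono_tags, lifting) someI_ex)
  \<comment> \<open>The value in chart \<open>i\<close> is transported from an arbitrarily chosen
    chart of \<open>J\<close>; \<open>key\<close> shows that the choice does not matter.\<close>
  define K where "K i y = trans E i (jj y) (line_through y) ** H (jj y) y" for i y
  have tr: "trans E i j p ** trans E j l p = trans E i l p"
    if "i \<in> idx E" "j \<in> idx E" "l \<in> idx E" "p \<in> patch E i \<inter> patch E j \<inter> patch E l" for i j l p
    using E that unfolding holomorphic_bundle_def by blast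
  have key: "K i y = trans E i j (line_through y) ** H j y"
    if "i \<in> idx E" "line_through y \<in> patch E i" "j \<in> J" "line_through y \<in> patch E j" "y \<noteq> 0" for i j y
  proof -
    have "H (jj y) y = trans E (jj y) j (line_through y) ** H j y"
      using homogeneous_frame_trans[OF H, of "jj y" j y] jj[of y] that by simp
    then show ?thesis
      using tr[of i "jj y" j "line_through y"] subsetD[OF J, of j] subsetD[OF J, of "jj y"] jj[of y] that
      by (simp add: K_def matrix_mul_assoc)
  qed
  have "homogeneous_frame E (idx E) k K"
    unfolding homogeneous_frame_def
  proof (intro conjI ballI allI impI)
    fix i a r assume i: "i \<in> idx E"
    show "hol_on {y. y \<noteq> 0 \<and> line_through y \<in> patch E i} (\<lambda>y. K i y $ a $ r)"
    proof (rule hol_on_local)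
      fix y assume y: "y \<in> {y. y \<noteq> 0 \<and> line_through y \<in> patch E i}"
      then obtain j where j: "j \<in> J" "line_through y \<in> patch E j" using cover by blast
      let ?W = "{y. y \<noteq> 0 \<and> line_through y \<in> patch E i \<inter> patch E j}"
      have ij: "i \<in> idx E" "j \<in> idx E" using i j J by auto
      have t: "open ?W \<and> hol_on ?W (\<lambda>y. trans E i j (line_through y) $ a $ b)" for b
      proof -
        have "(\<lambda>p. trans E i j p $ a $ b) \<in> chol projective_space (patch E i \<inter> patch E j)"
          using E ij unfolding holomorphic_bundle_def holomorphic_matrix_def by blast
        then show ?thesis by (simp add: chol_projective_space)
      qed
      have h: "hol_on ?W (\<lambda>y. H j y $ b $ r)" for b
        using H j unfolding homogeneous_frame_def by (auto intro: hol_on_subset)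
      have S: "hol_on ?W (\<lambda>y. \<Sum>b\<in>UNIV. trans E i j (line_through y) $ a $ b * H j y $ b $ r)"
        by (intro hol_on_sum hol_on_mult) (use t h in blast)+
      have oW: "open ?W" using t by blast
      have "K i y $ a $ r = (\<Sum>b\<in>UNIV. trans E i j (line_through y) $ a $ b * H j y $ b $ r)"
        if "y \<in> ?W" for y
        using key[OF i _ j(1), of y] that by (simp add: matrix_matrix_mult_def)
      from iffD2[OF hol_on_cong[OF oW this] S]
      have "hol_on ?W (\<lambda>y. K i y $ a $ r)" .
      moreover have "y \<in> ?W" using y j by simp
      ultimately show "\<exists>V. y \<in> V \<and> hol_on V (\<lambda>y. K i y $ a $ r)" by (intro exI[of _ ?W]) simp
    qed
  next
    fix i y assume i: "i \<in> idx E" and y: "y \<noteq> 0 \<and> line_through y \<in> patch E i"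
    obtain j where j: "j \<in> J" "line_through y \<in> patch E j" using cover y by blast
    have ij: "i \<in> idx E" "j \<in> idx E" using i j J by auto
    have id: "trans E l l (line_through y) = mat 1" if "l \<in> idx E" "line_through y \<in> patch E l" for l
      using E that unfolding holomorphic_bundle_def by blast
    have "trans E i j (line_through y) ** trans E j i (line_through y) = mat 1"
      "trans E j i (line_through y) ** trans E i j (line_through y) = mat 1"
      using tr[of i j i "line_through y"] tr[of j i j "line_through y"] ij y j id by auto
    then have "invertible (trans E i j (line_through y))" unfolding invertible_def by blast
    moreover have "invertible (H j y)" using H j y unfolding homogeneous_frame_def by blast
    ultimately show "invertible (K i y)" using key[OF i _ j] y by (simp add: invertible_mult)
    fix a r and c :: complex assume c: "c \<noteq> 0"
    have "H j (c *s y) $ b $ r = c powi (- k r) * H j y $ b $ r" for b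
      using H j y c unfolding homogeneous_frame_def by blast
    moreover have "c *s y \<noteq> 0" using c y by auto
    ultimately show "K i (c *s y) $ a $ r = c powi (- k r) * K i y $ a $ r"
      using key[OF i _ j(1), of y] key[OF i _ j(1), of "c *s y"] y j c
      by (simp add: matrix_matrix_mult_def sum_distrib_left mult.left_commute)
  next
    fix i l y assume i: "i \<in> idx E" "l \<in> idx E" and y: "y \<noteq> 0 \<and> line_through y \<in> patch E i \<inter> patch E l"
    obtain j where j: "j \<in> J" "line_through y \<in> patch E j" using cover y by blast
    then have "j \<in> idx E" using J by blast
    then have "trans E i l (line_through y) ** trans E l j (line_through y) = trans E i j (line_through y)"
      using tr[of i l j "line_through y"] i j y by auto
    then show "trans E i l (line_through y) ** K l y = K i y"
      using key[OF i(1) _ j] key[OF i(2) _ j] y by (auto simp: matrix_mul_assoc)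
  qed
  then show ?thesis by blast
qed

text \<open>Multiplying the \<open>r\<close>-th column of the frame by the \<open>k r\<close>-th
  power of a nonvanishing coordinate makes it homogeneous of degree 0, so that it descends to a
  matrix of functions on the projective line. These matrices are the isomorphism.\<close>

lemma bundle_iso_O_sumI:
  assumes E: "holomorphic_bundle projective_space E" and J: "J \<subseteq> idx E"
    and cover: "\<And>y. y \<noteq> 0 \<Longrightarrow> \<exists>j\<in>J. line_through y \<in> patch E j"
    and H: "homogeneous_frame E J k H"
  shows "bundle_iso projective_space E (O_sum k)"
proof -
  obtain K where K: "homogeneous_frame E (idx E) k K"
    using homogeneous_frame_extend[OF assms] by blast
  define h where "h i \<alpha> P = (let y = (SOME y. y \<in> P) in \<chi> a r. K i y $ a $ r * (y $ \<alpha>) powi k r)" for i \<alpha> P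
  have h: "h i \<alpha> (line_through y) = (\<chi> a r. K i y $ a $ r * (y $ \<alpha>) powi k r)"
    if "i \<in> idx E" "y \<noteq> 0" "line_through y \<in> patch E i" for i \<alpha> y
  proof -
    have "(SOME x. x \<in> line_through y) \<in> line_through y" by (rule someI) (rule self_in_line_through)
    then obtain c where c: "c \<noteq> 0" "(SOME x. x \<in> line_through y) = c *s y" by (auto simp: in_line_through)
    have "K i (c *s y) $ a $ r = c powi (- k r) * K i y $ a $ r" for a r
      using K that c unfolding homogeneous_frame_def by blast
    then show ?thesis using c(1)
      by (simp add: h_def c(2) vec_eq_iff power_int_mult_distrib power_int_minus del: vector_smult_component)
        (simp add: power_int_mult_distrib)
  qed
  have op: "open {y. y \<noteq> 0 \<and> line_through y \<in> patch E i}" if "i \<in> idx E" for i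
    using E that unfolding holomorphic_bundle_def openin_projective_space by blast
  have sub: "patch E i \<subseteq> line_through ` (- {0})" if "i \<in> idx E" for i
    using E that unfolding holomorphic_bundle_def openin_projective_space by blast
  show ?thesis unfolding bundle_iso_def
  proof (intro conjI exI[of _ h] ballI)
    fix i \<alpha> assume i: "i \<in> idx E"
    have e: "{y. y \<noteq> 0 \<and> line_through y \<in> patch E i \<inter> patch (O_sum k) \<alpha>} =
      {y. y \<noteq> 0 \<and> line_through y \<in> patch E i} \<inter> {y. y \<noteq> 0 \<and> y $ \<alpha> \<noteq> 0}" (is "?W = _")
      by (auto simp: O_sum_patch)
    have oW: "open ?W" unfolding e using op[OF i] continuous_on_vec_nth_imp_open by blast
    show "holomorphic_matrix projective_space (patch E i \<inter> patch (O_sum k) \<alpha>) (h i \<alpha>)"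
      unfolding holomorphic_matrix_def
    proof (intro allI)
      fix a r
      have "hol_on {y. y \<noteq> 0 \<and> line_through y \<in> patch E i} (\<lambda>y. K i y $ a $ r)"
        using K i unfolding homogeneous_frame_def by blast
      then have "hol_on ?W (\<lambda>y. K i y $ a $ r * (y $ \<alpha>) powi k r)"
        unfolding e by (auto intro!: hol_on_mult hol_on_powi intro: hol_on_subset)
      then have "hol_on ?W (\<lambda>y. h i \<alpha> (line_through y) $ a $ r)"
        by (subst hol_on_cong[OF oW, of _ "\<lambda>y. K i y $ a $ r * (y $ \<alpha>) powi k r"]) (auto simp: h[OF i])
      then show "(\<lambda>p. h i \<alpha> p $ a $ r) \<in> chol projective_space (patch E i \<inter> patch (O_sum k) \<alpha>)"
        using oW sub[OF i] by (auto simp: chol_projective_space)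
    qed
    fix p assume p: "p \<in> patch E i \<inter> patch (O_sum k) \<alpha>"
    then obtain y where y: "y \<noteq> 0" "p = line_through y" "y $ \<alpha> \<noteq> 0" "line_through y \<in> patch E i"
      by (blast elim: O_sum_patchE)
    have "invertible (K i y)" using K i y unfolding homogeneous_frame_def by blast
    moreover have "invertible (\<chi> a r. if a = r then (y $ \<alpha>) powi k r else 0 :: complex^'b^'b)" (is "invertible ?D")
      using y by (intro invertible_diagonal) simp
    ultimately have "invertible (K i y ** ?D)" by (rule invertible_mult)
    moreover have "h i \<alpha> p = K i y ** ?D"
      using h[OF i y(1,4)] by (simp add: y(2) vec_eq_iff matrix_matrix_mult_def sum_mult_if_eq)
    ultimately show "invertible (h i \<alpha> p)" by simp
  next
    fix i j \<alpha> \<beta> p assume i: "i \<in> idx E" "j \<in> idx E"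
      and p: "p \<in> patch E i \<inter> patch E j \<inter> patch (O_sum k) \<alpha> \<inter> patch (O_sum k) \<beta>"
    then obtain y where y: "y \<noteq> 0" "p = line_through y" "y $ \<alpha> \<noteq> 0"
      by (blast elim: O_sum_patchE)
    then have y': "y $ \<beta> \<noteq> 0" "line_through y \<in> patch E i" "line_through y \<in> patch E j"
      using p by (auto simp: O_sum_patch)
    note y = y y'
    have t: "trans E i j p ** K j y = K i y" using K i y unfolding homogeneous_frame_def by blast
    have "(trans E i j p ** h j \<beta> p) $ a $ r = (h i \<alpha> p ** trans (O_sum k) \<alpha> \<beta> p) $ a $ r" for a r
    proof -
      have "(trans E i j p ** h j \<beta> p) $ a $ r = (trans E i j p ** K j y) $ a $ r * (y $ \<beta>) powi k r"
        using y h[OF i(2)] by (simp add: matrix_matrix_mult_def sum_distrib_right mult.assoc)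
      also have "\<dots> = K i y $ a $ r * (y $ \<alpha>) powi k r * (y $ \<beta> / y $ \<alpha>) powi k r"
        using y by (simp add: t[unfolded y(2)] power_int_mult_distrib[symmetric] mult.assoc)
      also have "\<dots> = (h i \<alpha> p ** trans (O_sum k) \<alpha> \<beta> p) $ a $ r"
        using y h[OF i(1)] by (simp add: matrix_matrix_mult_def O_sum_trans sum_mult_if_eq)
      finally show ?thesis .
    qed
    then show "trans E i j p ** h j \<beta> p = h i \<alpha> p ** trans (O_sum k) \<alpha> \<beta> p" by (simp add: vec_eq_iff)
  qed (use E holomorphic_bundle_O_sum in auto)
qed

text \<open>Inverse of the construction in \<open>bundle_iso_O_sumI\<close>: the columns of the
  isomorphism are divided by powers of a nonvanishing coordinate. The transition functions of
  \<open>O_sum\<close> are the quotients of such powers, so the result does not depend on the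
  coordinate.\<close>

lemma bundle_iso_O_sumD:
  fixes E :: "('i, (complex^2) set, 'r::finite) cocycle"
  assumes iso: "bundle_iso projective_space E (O_sum k)"
  shows "\<exists>H. homogeneous_frame E (idx E) k H"
proof -
  obtain h where E: "holomorphic_bundle projective_space E"
    and h1: "\<And>i \<alpha>. i \<in> idx E \<Longrightarrow> holomorphic_matrix projective_space (patch E i \<inter> patch (O_sum k) \<alpha>) (h i \<alpha>)"
    and h2: "\<And>i \<alpha> p. i \<in> idx E \<Longrightarrow> p \<in> patch E i \<inter> patch (O_sum k) \<alpha> \<Longrightarrow> invertible (h i \<alpha> p)"
    and h3: "\<And>i j \<alpha> \<beta> p. i \<in> idx E \<Longrightarrow> j \<in> idx E \<Longrightarrow>
        p \<in> patch E i \<inter> patch E j \<inter> patch (O_sum k) \<alpha> \<inter> patch (O_sum k) \<beta> \<Longrightarrow>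
        trans E i j p ** h j \<beta> p = h i \<alpha> p ** trans (O_sum k) \<alpha> \<beta> p"
    using iso unfolding bundle_iso_def idx_O_sum by blast
  \<comment> \<open>The chosen coordinate may jump with \<open>y\<close>; \<open>key\<close> allows
    replacing it by a fixed one near each point, where holomorphy is visible.\<close>
  define al where "al y = (SOME \<alpha>. y $ \<alpha> \<noteq> 0)" for y :: "complex^2"
  have al: "y $ al y \<noteq> 0" if "y \<noteq> 0" for y
  proof -
    have "\<exists>\<alpha>. y $ \<alpha> \<noteq> 0" using that by (auto simp: vec_eq_iff)
    then show ?thesis unfolding al_def by (rule someI_ex)
  qed
  define H where "H i y = (\<chi> a r. h i (al y) (line_through y) $ a $ r * (y $ al y) powi (- k r))" for i y
  have id: "trans E l l p = mat 1" if "l \<in> idx E" "p \<in> patch E l" for l p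
    using E that unfolding holomorphic_bundle_def by blast
  have key: "H i y $ a $ r = h i \<beta> (line_through y) $ a $ r * (y $ \<beta>) powi (- k r)"
    if "i \<in> idx E" "line_through y \<in> patch E i" "y \<noteq> 0" "y $ \<beta> \<noteq> 0" for i y \<beta> a r
  proof -
    have "h i \<beta> (line_through y) = h i (al y) (line_through y) ** trans (O_sum k) (al y) \<beta> (line_through y)"
      using h3[OF that(1,1), of "line_through y" "al y" \<beta>] that al id by (simp add: O_sum_patch)
    then have "h i \<beta> (line_through y) $ a $ r = h i (al y) (line_through y) $ a $ r * (y $ \<beta> / y $ al y) powi k r"
      by (simp add: matrix_matrix_mult_def O_sum_trans sum_mult_if_eq)
    moreover have "(y $ \<beta> / y $ al y) powi k r * (y $ \<beta>) powi (- k r) = (y $ al y) powi (- k r)"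
      using that al[of y] by (simp add: power_int_minus power_int_divide_distrib field_simps)
    ultimately show ?thesis by (simp add: H_def mult.assoc)
  qed
  have "homogeneous_frame E (idx E) k H"
    unfolding homogeneous_frame_def
  proof (intro conjI ballI allI impI)
    fix i a r assume i: "i \<in> idx E"
    show "hol_on {y. y \<noteq> 0 \<and> line_through y \<in> patch E i} (\<lambda>y. H i y $ a $ r)"
    proof (rule hol_on_local)
      fix y assume y: "y \<in> {y. y \<noteq> 0 \<and> line_through y \<in> patch E i}"
      define \<beta> where "\<beta> = al y"
      let ?W = "{y. y \<noteq> 0 \<and> line_through y \<in> patch E i \<inter> patch (O_sum k) \<beta>}"
      have "(\<lambda>p. h i \<beta> p $ a $ r) \<in> chol projective_space (patch E i \<inter> patch (O_sum k) \<beta>)"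
        using h1[OF i] unfolding holomorphic_matrix_def by blast
      then have W: "open ?W" "hol_on ?W (\<lambda>y. h i \<beta> (line_through y) $ a $ r)"
        by (auto simp: chol_projective_space)
      have "hol_on ?W (\<lambda>y. h i \<beta> (line_through y) $ a $ r * (y $ \<beta>) powi (- k r))"
        using W by (auto intro!: hol_on_mult hol_on_powi simp: O_sum_patch)
      then have "hol_on ?W (\<lambda>y. H i y $ a $ r)"
        by (subst hol_on_cong[OF W(1), of _ "\<lambda>y. h i \<beta> (line_through y) $ a $ r * (y $ \<beta>) powi (- k r)"])
          (auto simp: O_sum_patch intro: key[OF i])
      then show "\<exists>V. y \<in> V \<and> hol_on V (\<lambda>y. H i y $ a $ r)"
        using y al[of y] by (intro exI[of _ ?W]) (auto simp: O_sum_patch \<beta>_def)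
    qed
  next
    fix i y assume i: "i \<in> idx E" and y: "y \<noteq> 0 \<and> line_through y \<in> patch E i"
    let ?D = "\<chi> a r. if a = r then (y $ al y) powi (- k r) else 0 :: complex^'r^'r"
    have "invertible ?D" using y al[of y] by (intro invertible_diagonal) simp
    moreover have "invertible (h i (al y) (line_through y))"
      using h2[OF i, of "line_through y" "al y"] y al[of y] by (simp add: O_sum_patch)
    ultimately have "invertible (h i (al y) (line_through y) ** ?D)" by (simp add: invertible_mult)
    moreover have "H i y = h i (al y) (line_through y) ** ?D"
      by (simp add: H_def vec_eq_iff matrix_matrix_mult_def sum_mult_if_eq)
    ultimately show "invertible (H i y)" by simp
    fix a r and c :: complex assume c: "c \<noteq> 0"
    then show "H i (c *s y) $ a $ r = c powi (- k r) * H i y $ a $ r"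
      using key[OF i, of y "al y" a r] key[OF i, of "c *s y" "al y" a r] y al[of y]
      by (simp add: power_int_mult_distrib)
  next
    fix i l y assume i: "i \<in> idx E" "l \<in> idx E" and y: "y \<noteq> 0 \<and> line_through y \<in> patch E i \<inter> patch E l"
    have "trans E i l (line_through y) ** h l (al y) (line_through y) =
        h i (al y) (line_through y) ** trans (O_sum k) (al y) (al y) (line_through y)"
      using h3[OF i, of "line_through y" "al y" "al y"] y al[of y] by (simp add: O_sum_patch)
    also have "trans (O_sum k) (al y) (al y) (line_through y) = mat 1"
      using y al[of y] by (simp add: vec_eq_iff O_sum_trans mat_def)
    finally have t: "trans E i l (line_through y) ** h l (al y) (line_through y) = h i (al y) (line_through y)"
      by simp
    have "(trans E i l (line_through y) ** H l y) $ a $ r = H i y $ a $ r" for a r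
    proof -
      have "(trans E i l (line_through y) ** H l y) $ a $ r =
        (trans E i l (line_through y) ** h l (al y) (line_through y)) $ a $ r * (y $ al y) powi (- k r)"
        by (simp add: H_def matrix_matrix_mult_def sum_distrib_right mult.assoc)
      then show ?thesis by (simp add: t H_def)
    qed
    then show "trans E i l (line_through y) ** H l y = H i y" by (simp add: vec_eq_iff)
  qed
  then show ?thesis by blast
qed

section \<open>The two splitting types exclude each other\<close>

lemma invertible_column_nonzero:
  fixes A :: "complex^2^2" assumes "invertible A" shows "A $ 0 $ r \<noteq> 0 \<or> A $ 1 $ r \<noteq> 0"
proof (rule ccontr)
  assume "\<not> ?thesis"
  then have "det A = 0" using exhaust_2[of r] by (auto simp: det_2')
  then show False using assms by (simp add: invertible_det_nz)
qed

lemma matrix_vector_mult_2: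
  fixes A :: "complex^2^2" shows "(A *v x) $ a = A $ a $ 0 * x $ 0 + A $ a $ 1 * x $ 1"
  by (simp add: matrix_vector_mult_def sum_2')

text \<open>Coordinates of a section in a frame as explicit quotients, which makes their holomorphy
  visible.\<close>

lemma cramer_2:
  fixes A :: "complex^2^2" assumes "A *v x = b" "det A \<noteq> 0"
  shows "x $ 0 = (A $ 1 $ 1 * b $ 0 - A $ 0 $ 1 * b $ 1) / det A"
    and "x $ 1 = (A $ 0 $ 0 * b $ 1 - A $ 1 $ 0 * b $ 0) / det A"
proof -
  have "b $ 0 = A $ 0 $ 0 * x $ 0 + A $ 0 $ 1 * x $ 1" "b $ 1 = A $ 1 $ 0 * x $ 0 + A $ 1 $ 1 * x $ 1"
    using assms(1) by (auto simp: matrix_vector_mult_2[symmetric])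
  then show "x $ 0 = (A $ 1 $ 1 * b $ 0 - A $ 0 $ 1 * b $ 1) / det A"
    "x $ 1 = (A $ 0 $ 0 * b $ 1 - A $ 1 $ 0 * b $ 0) / det A"
    using assms(2) by (simp_all add: field_simps) (simp_all add: det_2' algebra_simps)
qed

definition vec2 :: "complex \<Rightarrow> complex \<Rightarrow> complex^2" where
  "vec2 s t = (\<chi> i. if i = 0 then s else t)"

lemma vec2_nth [simp]: "vec2 s t $ 0 = s" "vec2 s t $ 1 = t"
  by (simp_all add: vec2_def)

lemma vec2_holomorphic:
  "f holomorphic_on S \<Longrightarrow> g holomorphic_on S \<Longrightarrow> (\<lambda>t. vec2 (f t) (g t) $ i) holomorphic_on S"
  by (cases "i = 0") (simp_all add: vec2_def)

lemma vec2_eq_iff: "(v :: complex^2) = w \<longleftrightarrow> v $ 0 = w $ 0 \<and> v $ 1 = w $ 1"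
  by (simp add: vec_eq_iff forall_2')

text \<open>This is the vanishing of a section of O(1) with two zeros, seen in affine coordinates.
  Because of the zero at 0 the quotient g(t)/t is entire; it equals k(1/t), which tends to 0 at
  infinity, so Liouville's theorem applies.\<close>

lemma entire_linear_growth_zero:
  assumes g: "g holomorphic_on UNIV" and g0: "g 0 = 0"
    and k: "isCont k 0" "k 0 = 0" and gk: "\<And>t. t \<noteq> 0 \<Longrightarrow> g t = t * k (1 / t)"
  shows "g t = 0"
proof -
  define G where "G = (\<lambda>z. if z = 0 then deriv g 0 else (g z - g 0) / (z - 0))"
  have "G holomorphic_on UNIV" unfolding G_def by (rule pole_lemma_open[OF g]) auto
  moreover have "(G \<longlongrightarrow> 0) at_infinity"
    unfolding lim_at_infinity_0
  proof (rule Lim_transform_eventually)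
    show "(k \<longlongrightarrow> 0) (at 0)" using k by (simp add: isCont_def)
    show "\<forall>\<^sub>F x in at 0. k x = (G \<circ> inverse) x"
      unfolding eventually_at by (rule exI[of _ 1]) (auto simp: G_def g0 gk divide_inverse)
  qed
  ultimately have "G t = 0" by (rule Liouville_weak_0)
  then show ?thesis using g0 by (cases "t = 0") (auto simp: G_def)
qed

lemma chol_pullback_patch:
  "patch (pullback_bundle Y g E) i = {q \<in> pts Y. g q \<in> patch E i}"
  "idx (pullback_bundle Y g E) = idx E"
  "trans (pullback_bundle Y g E) i j q = trans E i j (g q)"
  by (simp_all add: pullback_bundle_def)

text \<open>
  A section of the summand \<open>O(2)\<close> can be chosen to vanish at two given points, while a nonzero section
  of \<open>O(1) \<oplus> O(1)\<close> has at most one zero.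
\<close>

lemma splitting_types_distinct:
  fixes E :: "('i, 'a, 2) cocycle"
  assumes X: "csheaf X"
    and g1: "biholomorphic_map projective_space X \<gamma>" and g2: "biholomorphic_map projective_space X \<gamma>'"
    and iso1: "bundle_iso projective_space (pullback_bundle projective_space \<gamma> E) (O_sum (\<lambda>r. 1))"
    and iso2: "bundle_iso projective_space (pullback_bundle projective_space \<gamma>' E) (O_sum (\<lambda>r. if r = 0 then 0 else 2))"
  shows False
proof -
  let ?P = "projective_space :: (complex^2) set cspace"
  let ?E1 = "pullback_bundle ?P \<gamma> E" and ?E2 = "pullback_bundle ?P \<gamma>' E"
  let ?k2 = "\<lambda>r::2. if r = 0 then 0 else 2 :: int"
  obtain H where H: "homogeneous_frame ?E1 (idx E) (\<lambda>r. 1) H"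
    using bundle_iso_O_sumD[OF iso1] by (auto simp: chol_pullback_patch)
  obtain H' where H': "homogeneous_frame ?E2 (idx E) ?k2 H'"
    using bundle_iso_O_sumD[OF iso2] by (auto simp: chol_pullback_patch)
  obtain \<delta> where d: "holomorphic_map X ?P \<delta>" "\<forall>p\<in>pts ?P. \<delta> (\<gamma>' p) = p" "\<forall>q\<in>pts X. \<gamma>' (\<delta> q) = q"
    using g2 unfolding biholomorphic_map_def by blast
  have hg: "holomorphic_map ?P X \<gamma>" using g1 unfolding biholomorphic_map_def by blast
  \<comment> \<open>The change between the two parametrisations; it enters through its holomorphy
    and injectivity.\<close>
  define al where "al = \<delta> \<circ> \<gamma>"
  have al: "holomorphic_map ?P ?P al" unfolding al_def by (rule holomorphic_map_compose[OF hg d(1)])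
  have al_pt: "al P \<in> pts ?P" if "P \<in> pts ?P" for P using holomorphic_map_pts[OF al that] .
  have gal: "\<gamma>' (al P) = \<gamma> P" if "P \<in> pts ?P" for P
    using d(3) holomorphic_map_pts[OF hg that] by (simp add: al_def)
  have al_inj: "P = P'" if "P \<in> pts ?P" "P' \<in> pts ?P" "al P = al P'" for P P'
    using gal[OF that(1)] gal[OF that(2)] that biholomorphic_map_bij[OF g1]
    by (metis bij_betw_def inj_onD)
  have line_pt: "line_through y \<in> pts ?P" if "y \<noteq> 0" for y using that by simp
  define e0 e1 where "e0 = vec2 0 1" and "e1 = vec2 1 0"
  have e: "e0 \<noteq> 0" "e1 \<noteq> 0" by (auto simp: e0_def e1_def vec2_eq_iff)
  obtain u where u: "u \<noteq> 0" "al (line_through e0) = line_through u"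
    using al_pt[OF line_pt[OF e(1)]] by auto
  obtain w where w: "w \<noteq> 0" "al (line_through e1) = line_through w"
    using al_pt[OF line_pt[OF e(2)]] by auto
  \<comment> \<open>The quadratic form whose zeros are the images \<open>u\<close> and
    \<open>w\<close> of the two chosen points \<open>e0\<close> and \<open>e1\<close>.\<close>
  define q where "q y = (u $ 0 * y $ 1 - u $ 1 * y $ 0) * (w $ 0 * y $ 1 - w $ 1 * y $ 0)" for y :: "complex^2"
  have cross: "line_through y = line_through v" if "v \<noteq> 0" "y \<noteq> 0" "v $ 0 * y $ 1 - v $ 1 * y $ 0 = 0" for v y :: "complex^2"
  proof -
    have "\<exists>c. c \<noteq> 0 \<and> v = c *s y"
    proof (cases "y $ 0 = 0")
      case True
      then have "y $ 1 \<noteq> 0" using that(2) by (auto simp: vec2_eq_iff)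
      then have "v $ 0 = 0" using that(3) True by auto
      then have "v $ 1 \<noteq> 0" using that(1) by (auto simp: vec2_eq_iff)
      then show ?thesis using \<open>y $ 1 \<noteq> 0\<close> \<open>v $ 0 = 0\<close> True by (intro exI[of _ "v $ 1 / y $ 1"]) (auto simp: vec2_eq_iff)
    next
      case False
      have v1: "v $ 1 = v $ 0 / y $ 0 * y $ 1" using that(3) False by (simp add: field_simps)
      then have "v $ 0 \<noteq> 0" using that(1) by (auto simp: vec2_eq_iff)
      then show ?thesis using False v1 by (intro exI[of _ "v $ 0 / y $ 0"]) (auto simp: vec2_eq_iff)
    qed
    then show ?thesis by (simp add: line_through_eq_iff)
  qed
  have q_scale: "q (c *s y) = c\<^sup>2 * q y" for c y
    by (simp add: q_def power2_eq_square algebra_simps)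
  \<comment> \<open>Column \<open>1\<close> of \<open>H'\<close> has weight -2, so its product with
    the quadratic form \<open>q\<close> has weight 0: a global section of the bundle lying in the
    summand O(2).\<close>
  define V where "V i P = (let y = (SOME y. y \<in> P) in \<chi> a. H' i y $ a $ 1 * q y)" for i P
  have V: "V i (line_through y) $ a = H' i y $ a $ 1 * q y"
    if "i \<in> idx E" "y \<noteq> 0" "line_through y \<in> patch ?E2 i" for i y a
  proof -
    have "(SOME x. x \<in> line_through y) \<in> line_through y" by (rule someI) (rule self_in_line_through)
    then obtain c where c: "c \<noteq> 0" "(SOME x. x \<in> line_through y) = c *s y" by (auto simp: in_line_through)
    have "H' i (c *s y) $ a $ 1 = c powi (- 2) * H' i y $ a $ 1"
      using H' that c(1) unfolding homogeneous_frame_def by simp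
    then show ?thesis using c(1) unfolding V_def Let_def c(2)
      by (simp add: q_scale power_int_minus power_int_def field_simps del: vector_smult_component)
  qed
  have V_hol: "(\<lambda>P. V i P $ a) \<in> chol ?P (patch ?E2 i)" if "i \<in> idx E" for i a
  proof -
    let ?W = "{y. y \<noteq> 0 \<and> line_through y \<in> patch ?E2 i}"
    have "openin (ctop ?P) (patch ?E2 i)"
      using iso2 that unfolding bundle_iso_def holomorphic_bundle_def by (simp add: chol_pullback_patch)
    then have o: "patch ?E2 i \<subseteq> line_through ` (- {0})" "open ?W" by (auto simp: openin_projective_space)
    have "hol_on ?W (\<lambda>y. H' i y $ a $ 1 * q y)"
      unfolding q_def using H' that unfolding homogeneous_frame_def by (intro hol_on_mult hol_on_diff) auto
    from iffD2[OF hol_on_cong[OF o(2)] this]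
    have "hol_on ?W (\<lambda>y. V i (line_through y) $ a)" using V[OF that] by auto
    with o show ?thesis by (simp add: chol_projective_space)
  qed
  define W where "W i P = V i (al P)" for i P
  have patch12: "{P \<in> pts ?P. al P \<in> patch ?E2 i} = patch ?E1 i" for i
    using gal al_pt by (auto simp: chol_pullback_patch simp del: pts_projective_space)
  have W_hol: "(\<lambda>P. W i P $ a) \<in> chol ?P (patch ?E1 i)" if "i \<in> idx E" for i a
    using holomorphic_map_chol[OF al csheaf_projective_space V_hol[OF that]] unfolding patch12
    by (simp add: comp_def W_def)
  have W_tr: "trans E i j (\<gamma> P) *v W j P = W i P"
    if "i \<in> idx E" "j \<in> idx E" "P \<in> patch ?E1 i" "P \<in> patch ?E1 j" for i j P
  proof -
    have P: "P \<in> pts ?P" "al P \<in> patch ?E2 i" "al P \<in> patch ?E2 j" using that patch12 by blast+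
    then obtain y where y: "y \<noteq> 0" "al P = line_through y" using al_pt by auto
    have "trans ?E2 i j (line_through y) ** H' j y = H' i y"
      using homogeneous_frame_trans[OF H' that(1,2) y(1)] P y by simp
    then have t: "trans E i j (\<gamma> P) ** H' j y = H' i y" using gal[OF P(1)] y by (simp add: chol_pullback_patch)
    have "(trans E i j (\<gamma> P) *v W j P) $ a = W i P $ a" for a
    proof -
      have "(trans E i j (\<gamma> P) *v W j P) $ a = (trans E i j (\<gamma> P) ** H' j y) $ a $ 1 * q y"
        using V[OF that(2) y(1)] P y
        by (simp add: W_def matrix_vector_mult_2 matrix_matrix_mult_def sum_2' algebra_simps)
      also have "\<dots> = W i P $ a" using V[OF that(1) y(1)] P y by (simp add: t W_def)
      finally show ?thesis .
    qed
    then show ?thesis by (simp add: vec_eq_iff)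
  qed
  have cover: "\<exists>i\<in>idx E. line_through y \<in> patch ?E1 i" if "y \<noteq> 0" for y
  proof -
    have "(\<Union>i\<in>idx E. patch ?E1 i) = pts ?P"
      using iso1 unfolding bundle_iso_def holomorphic_bundle_def by (simp add: chol_pullback_patch)
    then show ?thesis using line_pt[OF that] by blast
  qed
  have Hinv: "invertible (H i y)" if "i \<in> idx E" "y \<noteq> 0" "line_through y \<in> patch ?E1 i" for i y
    using H that unfolding homogeneous_frame_def by blast
  have ex: "\<exists>s. \<forall>i\<in>idx E. line_through y \<in> patch ?E1 i \<longrightarrow> H i y *v s = W i (line_through y)" if "y \<noteq> 0" for y
  proof -
    note yn = that(1)
    obtain j where j: "j \<in> idx E" "line_through y \<in> patch ?E1 j" using cover[OF yn] by blast
    obtain B where B: "H j y ** B = mat 1" using Hinv[OF j(1) yn j(2)] unfolding invertible_def by blast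
    define s where "s = B *v W j (line_through y)"
    have s: "H j y *v s = W j (line_through y)" by (simp add: s_def matrix_vector_mul_assoc B)
    have "H i y *v s = W i (line_through y)" if i: "i \<in> idx E" "line_through y \<in> patch ?E1 i" for i
    proof -
      have "H i y *v s = (trans E i j (\<gamma> (line_through y)) ** H j y) *v s"
        using homogeneous_frame_trans[OF H i(1) j(1) \<open>y \<noteq> 0\<close> i(2) j(2)] by (simp add: chol_pullback_patch)
      also have "\<dots> = trans E i j (\<gamma> (line_through y)) *v W j (line_through y)"
        by (simp add: matrix_vector_mul_assoc[symmetric] s)
      also have "\<dots> = W i (line_through y)" by (rule W_tr[OF i(1) j(1) i(2) j(2)])
      finally show ?thesis .
    qed
    then show ?thesis by blast
  qed
  \<comment> \<open>The coordinates of that section in the first frame. The frame has weight -1, so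
    \<open>S\<close> is homogeneous of degree 1, and it vanishes at the points whose image is a zero
    of \<open>q\<close>.\<close>
  define S where "S y = (SOME s. \<forall>i\<in>idx E. line_through y \<in> patch ?E1 i \<longrightarrow> H i y *v s = W i (line_through y))" for y
  have S: "H i y *v S y = W i (line_through y)" if "y \<noteq> 0" "i \<in> idx E" "line_through y \<in> patch ?E1 i" for i y
    using someI_ex[OF ex[OF that(1)]] that unfolding S_def by blast
  have S_unique: "S y = s" if "y \<noteq> 0" "i \<in> idx E" "line_through y \<in> patch ?E1 i" "H i y *v s = W i (line_through y)" for i y s
    using cramer_2[OF S[OF that(1-3)]] cramer_2[OF that(4)] Hinv[OF that(2,1,3)]
    by (simp add: invertible_det_nz vec2_eq_iff)
  have S_hol: "hol_on (- {0}) (\<lambda>y. S y $ a)" for a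
  proof (rule hol_on_local)
    fix y :: "complex^2" assume y: "y \<in> - {0}"
    then obtain i where i: "i \<in> idx E" "line_through y \<in> patch ?E1 i" using cover[of y] by blast
    let ?W = "{y. y \<noteq> 0 \<and> line_through y \<in> patch ?E1 i}"
    have o: "open ?W" and Wh: "hol_on ?W (\<lambda>y. W i (line_through y) $ b)" for b
      using W_hol[OF i(1)] by (auto simp: chol_projective_space)
    have Hh: "hol_on ?W (\<lambda>y. H i y $ b $ r)" for b r
      using H i unfolding homogeneous_frame_def by blast
    have dn: "det (H i y) \<noteq> 0" if "y \<in> ?W" for y
      using Hinv[OF i(1)] that invertible_det_nz[of "H i y"] by auto
    have dh: "hol_on ?W (\<lambda>y. det (H i y))"
      unfolding det_2' by (intro hol_on_mult hol_on_diff Hh)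
    have "hol_on ?W (\<lambda>y. S y $ 0)"
      by (rule iffD2[OF hol_on_cong[OF o cramer_2(1)[OF S]]])
         (use i dn in \<open>auto intro!: hol_on_divide hol_on_mult hol_on_diff Hh Wh dh\<close>)
    moreover have "hol_on ?W (\<lambda>y. S y $ 1)"
      by (rule iffD2[OF hol_on_cong[OF o cramer_2(2)[OF S]]])
         (use i dn in \<open>auto intro!: hol_on_divide hol_on_mult hol_on_diff Hh Wh dh\<close>)
    ultimately have "hol_on ?W (\<lambda>y. S y $ a)" using exhaust_2[of a] by auto
    moreover have "y \<in> ?W" using y i by simp
    ultimately show "\<exists>V. y \<in> V \<and> hol_on V (\<lambda>y. S y $ a)" by (intro exI[of _ ?W]) simp
  qed
  have S_scale: "S (c *s y) = c *s S y" if "y \<noteq> 0" "c \<noteq> 0" for c y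
  proof -
    note yn = that(1)
    obtain i where i: "i \<in> idx E" "line_through y \<in> patch ?E1 i" using cover[OF yn] by blast
    have cy: "c *s y \<noteq> 0" using that by auto
    have h: "H i (c *s y) $ a $ r = inverse c * H i y $ a $ r" for a r
      using H i that unfolding homogeneous_frame_def by (simp add: power_int_minus)
    have "H i (c *s y) *v (c *s S y) = H i y *v S y"
      using that(2) by (simp add: vec_eq_iff matrix_vector_mult_2 h) (simp add: field_simps)
    also have "\<dots> = W i (line_through (c *s y))" using S[OF that(1) i] that by simp
    finally show ?thesis using S_unique[OF cy i(1)] i(2) that by simp
  qed
  have S_zero: "S y = 0" if "y \<noteq> 0" "al (line_through y) = line_through v" "v \<noteq> 0" "q v = 0" for y v
  proof -
    note yn = that(1)
    obtain i where i: "i \<in> idx E" "line_through y \<in> patch ?E1 i" using cover[OF yn] by blast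
    have "al (line_through y) \<in> patch ?E2 i" using i patch12[of i] by blast
    then have "line_through v \<in> patch ?E2 i" using that by simp
    then have "W i (line_through y) = 0" using V[OF i(1) that(3)] that by (simp add: W_def vec_eq_iff)
    then show ?thesis using S_unique[OF that(1) i, of 0] by simp
  qed
  have S0: "S (vec2 0 1) = 0" using S_zero[OF e(1) u(2,1)] by (simp add: e0_def q_def)
  have S1: "S (vec2 1 0) = 0" using S_zero[OF e(2) w(2,1)] by (simp add: e1_def q_def)
  have S_eq: "S (vec2 t 1) $ a = 0" for t a
  proof (rule entire_linear_growth_zero[where g = "\<lambda>t. S (vec2 t 1) $ a" and k = "\<lambda>t. S (vec2 1 t) $ a"])
    show "(\<lambda>t. S (vec2 t 1) $ a) holomorphic_on UNIV"
      by (rule hol_on_compose_curve[OF S_hol]) (auto simp: vec2_eq_iff intro!: vec2_holomorphic holomorphic_intros)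
    have "(\<lambda>t. S (vec2 1 t) $ a) holomorphic_on UNIV"
      by (rule hol_on_compose_curve[OF S_hol]) (auto simp: vec2_eq_iff intro!: vec2_holomorphic holomorphic_intros)
    from holomorphic_on_imp_continuous_on[OF this] show "isCont (\<lambda>t. S (vec2 1 t) $ a) 0"
      by (simp only: continuous_on_eq_continuous_at[OF open_UNIV] UNIV_I ball_simps)
    show "S (vec2 t 1) $ a = t * S (vec2 1 (1 / t)) $ a" if "t \<noteq> 0" for t
    proof -
      have e: "vec2 t 1 = t *s vec2 1 (1 / t)" using that by (simp add: vec2_eq_iff)
      have "S (vec2 t 1) = t *s S (vec2 1 (1 / t))"
        unfolding e by (rule S_scale) (use that in \<open>auto simp: vec2_eq_iff\<close>)
      then show ?thesis by simp
    qed
  qed (auto simp: S0 S1)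
  \<comment> \<open>A third point. Since \<open>S\<close> vanishes there as well, \<open>q\<close>
    vanishes at its image, which then coincides with one of the two chosen images, against
    injectivity.\<close>
  define y where "y = vec2 1 1"
  have y: "y \<noteq> 0" by (simp add: y_def vec2_eq_iff)
  have Sy: "S y = 0" using S_eq[of 1] by (simp add: y_def vec2_eq_iff)
  obtain i where i: "i \<in> idx E" "line_through y \<in> patch ?E1 i" using cover[OF y] by blast
  have "W i (line_through y) = 0" using S[OF y i] Sy by simp
  obtain v where v: "v \<noteq> 0" "al (line_through y) = line_through v" using al_pt[OF line_pt[OF y]] by auto
  have "al (line_through y) \<in> patch ?E2 i" using i patch12[of i] by blast
  then have pv: "line_through v \<in> patch ?E2 i" using v by simp
  have "invertible (H' i v)" using H' i v pv unfolding homogeneous_frame_def by blast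
  moreover have "H' i v $ a $ 1 * q v = 0" for a
    using V[OF i(1) v(1) pv] \<open>W i (line_through y) = 0\<close> v by (simp add: W_def)
  ultimately have "q v = 0" using invertible_column_nonzero[of "H' i v" 1] by (metis mult_eq_0_iff)
  then consider "line_through v = line_through u" | "line_through v = line_through w"
    using cross[OF u(1) v(1)] cross[OF w(1) v(1)] by (auto simp: q_def)
  then have "line_through y = line_through e0 \<or> line_through y = line_through e1"
    using al_inj[OF line_pt[OF y] line_pt[OF e(1)]] al_inj[OF line_pt[OF y] line_pt[OF e(2)]] u v w by cases auto
  then show False by (auto simp: line_through_eq_iff y_def e0_def e1_def vec2_eq_iff)
qed

section \<open>Normal bundles are holomorphic\<close>

text \<open>Taylor's formula with second-order remainder: Cauchy's inequality on discs of radius r/2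
  inside \<open>cball 0 r\<close> bounds the second derivative by 2 M / (r/2)^2. The bound depends
  on \<open>f\<close> through \<open>M\<close> only, hence is uniform in families.\<close>

lemma difference_quotient_bound:
  fixes f :: "complex \<Rightarrow> complex"
  assumes f: "f holomorphic_on ball 0 R" and "r < R" "0 < r" and M: "\<And>x. x \<in> cball 0 r \<Longrightarrow> norm (f x) \<le> M"
    and h: "norm h \<le> r / 2" "h \<noteq> 0"
  shows "norm ((f h - f 0) / h - deriv f 0) \<le> 8 * M / r\<^sup>2 * norm h"
proof -
  let ?f = "\<lambda>i. (deriv ^^ i) f"
  have "norm (?f 0 h - (\<Sum>i\<le>1. ?f i 0 * (h - 0) ^ i / fact i)) \<le> 8 * M / r\<^sup>2 * norm (h - 0) ^ Suc 1 / fact 1"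
  proof (rule complex_Taylor[where S = "cball 0 (r / 2)"])
    fix i and x :: complex assume x: "x \<in> cball 0 (r / 2)"
    have "x \<in> ball 0 R" using x assms(2,3) by (simp add: dist_norm)
    moreover have "?f i holomorphic_on ball 0 R" by (rule holomorphic_higher_deriv[OF f]) auto
    ultimately show "(?f i has_field_derivative ?f (Suc i) x) (at x within cball 0 (r / 2))"
      using holomorphic_derivI[of "?f i" "ball 0 R" x] by (simp add: has_field_derivative_at_within)
  next
    fix x :: complex assume x: "x \<in> cball 0 (r / 2)"
    have sub: "cball x (r / 2) \<subseteq> cball 0 r"
    proof
      fix y assume y: "y \<in> cball x (r / 2)"
      have "norm y \<le> norm x + norm (y - x)" by (metis add.commute diff_add_cancel norm_triangle_ineq)
      then show "y \<in> cball 0 r" using x y by (simp add: dist_norm norm_minus_commute)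
    qed
    then have subR: "cball x (r / 2) \<subseteq> ball 0 R" using assms(2) by (meson cball_subset_ball_iff order_trans subset_iff less_imp_le cball_eq_ball_iff mem_ball mem_cball order_le_less_trans)
    have "norm ((deriv ^^ 2) f x) \<le> fact 2 * M / (r / 2)\<^sup>2"
    proof (rule Cauchy_inequality)
      show "f holomorphic_on ball x (r / 2)" using f subR by (meson ball_subset_cball holomorphic_on_subset order_trans)
      show "continuous_on (cball x (r / 2)) f" using f subR by (meson holomorphic_on_imp_continuous_on holomorphic_on_subset)
      show "0 < r / 2" using assms(3) by simp
      fix y assume "norm (x - y) = r / 2"
      then have "y \<in> cball x (r / 2)" by (simp add: dist_norm)
      then show "norm (f y) \<le> M" using M sub by blast
    qed
    then show "norm (?f (Suc 1) x) \<le> 8 * M / r\<^sup>2"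
      using assms(3) by (simp add: numeral_2_eq_2[symmetric] power_divide field_simps)
  qed (use h assms(3) in auto)
  then have "norm (f h - f 0 - deriv f 0 * h) \<le> 8 * M / r\<^sup>2 * norm h * norm h"
    by (simp add: algebra_simps power2_eq_square)
  moreover have "(f h - f 0) / h - deriv f 0 = (f h - f 0 - deriv f 0 * h) / h"
    using h by (simp add: field_simps)
  ultimately show ?thesis using h by (simp add: norm_divide field_simps)
qed

text \<open>\<open>hol_on\<close> asks for a complex linear derivative at each point and says
  nothing about how it varies. The difference quotients in the direction \<open>b\<close> are
  holomorphic in \<open>t\<close> and converge locally uniformly by
  \<open>difference_quotient_bound\<close>, so the limit is holomorphic.\<close>

lemma partial_derivative_holomorphic:
  fixes g :: "complex^'n \<Rightarrow> complex" and a b :: "complex^'n"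
  assumes W: "open W" and g: "hol_on W g"
  shows "(\<lambda>t. deriv (\<lambda>z. g (t *s a + z *s b)) 0) holomorphic_on {t. t *s a \<in> W}"
proof -
  let ?T = "{t. t *s a \<in> W}" and ?F = "\<lambda>p :: complex \<times> complex. fst p *s a + snd p *s b"
  have cF: "continuous_on S ?F" for S
  proof -
    have "?F = (\<lambda>p. \<chi> i. fst p * a $ i + snd p * b $ i)" by (simp add: fun_eq_iff vec_eq_iff)
    then show ?thesis by (simp only:) (intro continuous_intros)
  qed
  have oF: "open (?F -` W)" using W cF by (rule open_vimage)
  have oT: "open ?T"
  proof -
    have "?T = (\<lambda>t. (t, 0)) -` (?F -` W)" by auto
    then show ?thesis by (simp only:) (intro open_vimage oF continuous_intros)
  qed
  have gF: "continuous_on (?F -` W) (\<lambda>p. g (?F p))"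
    by (rule continuous_on_compose2[OF hol_on_continuous[OF g] cF]) auto
  have hs: "(\<lambda>z. g (t *s a + z *s b)) holomorphic_on S" if "open S" "\<And>z. z \<in> S \<Longrightarrow> (t, z) \<in> ?F -` W" for t S
    by (rule hol_on_compose_curve[OF g _ that(1)]) (use that(2) in \<open>auto intro!: holomorphic_intros\<close>)
  have ht: "(\<lambda>t. g (t *s a + z *s b)) holomorphic_on S" if "open S" "\<And>t. t \<in> S \<Longrightarrow> (t, z) \<in> ?F -` W" for z S
    by (rule hol_on_compose_curve[OF g _ that(1)]) (use that(2) in \<open>auto intro!: holomorphic_intros\<close>)
  have "\<exists>d>0. (\<lambda>t. deriv (\<lambda>z. g (t *s a + z *s b)) 0) holomorphic_on ball t0 d" if t0: "t0 \<in> ?T" for t0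
  proof -
    have "(t0, 0) \<in> ?F -` W" using t0 by simp
    then obtain A B where AB: "open A" "open B" "(t0, 0) \<in> A \<times> B" "A \<times> B \<subseteq> ?F -` W"
      using open_prod_elim[OF oF] by blast
    obtain d where d: "d > 0" "cball t0 d \<subseteq> A" using AB by (auto simp: open_contains_cball)
    obtain R where R: "R > 0" "ball 0 R \<subseteq> B" using AB by (auto simp: open_contains_ball)
    define r where "r = R / 2"
    have r: "0 < r" "r < R" using R by (auto simp: r_def)
    have rB: "cball 0 r \<subseteq> B" using R r by force
    have in_F: "(t, z) \<in> ?F -` W" if "t \<in> cball t0 d" "z \<in> ball 0 R" for t z
      using AB(4) d(2) R(2) that by blast
    have "compact (cball t0 d \<times> cball (0::complex) r)" by (intro compact_Times) auto
    moreover have "continuous_on (cball t0 d \<times> cball (0::complex) r) (\<lambda>p. g (?F p))"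
      by (rule continuous_on_subset[OF gF]) (use AB(4) d(2) rB in blast)
    ultimately have "bounded ((\<lambda>p. g (?F p)) ` (cball t0 d \<times> cball (0::complex) r))"
      by (intro compact_imp_bounded compact_continuous_image)
    then obtain M where M: "\<And>t z. t \<in> cball t0 d \<Longrightarrow> z \<in> cball 0 r \<Longrightarrow> norm (g (t *s a + z *s b)) \<le> M"
      unfolding bounded_iff by (metis (mono_tags, lifting) SigmaI fst_conv imageI snd_conv)
    define h where "h n = complex_of_real (r / 2 * inverse (of_nat (Suc n)))" for n
    have nh: "norm (h n) = r / 2 * inverse (of_nat (Suc n))" for n
      unfolding h_def norm_of_real by (rule abs_of_nonneg) (use r in simp)
    have h: "norm (h n) \<le> r / 2" "h n \<noteq> 0" for n
    proof -
      have "inverse (real (Suc n)) \<le> 1" by (simp add: divide_simps)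
      then show "norm (h n) \<le> r / 2" using r unfolding nh by (intro mult_left_le) auto
      have "norm (h n) > 0" unfolding nh by (intro mult_pos_pos) (use r in auto)
      then show "h n \<noteq> 0" by auto
    qed
    have hlim: "(\<lambda>n. norm (h n)) \<longlonglongrightarrow> 0"
    proof -
      have "(\<lambda>n. r / 2 * inverse (of_nat (Suc n))) \<longlonglongrightarrow> r / 2 * 0"
        by (intro tendsto_intros LIMSEQ_inverse_real_of_nat)
      then show ?thesis by (simp add: nh)
    qed
    have bound: "norm ((g (t *s a + h n *s b) - g (t *s a)) / h n - deriv (\<lambda>z. g (t *s a + z *s b)) 0) \<le> 8 * M / r\<^sup>2 * norm (h n)"
      if "t \<in> cball t0 d" for t n
    proof -
      have "(\<lambda>z. g (t *s a + z *s b)) holomorphic_on ball 0 R"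
        by (rule hs) (use in_F[OF that] in auto)
      from difference_quotient_bound[OF this r(2,1) M[OF that] h] show ?thesis by simp
    qed
    have "(\<lambda>t. deriv (\<lambda>z. g (t *s a + z *s b)) 0) holomorphic_on ball t0 d"
    proof (rule holomorphic_uniform_sequence)
      fix n
      have "h n \<in> ball 0 R" using h(1)[of n] r by auto
      then have "(\<lambda>t. g (t *s a + h n *s b)) holomorphic_on ball t0 d"
        by (intro ht) (use in_F in auto)
      moreover have "(\<lambda>t. g (t *s a + 0 *s b)) holomorphic_on ball t0 d"
        by (intro ht) (use in_F[of _ 0] R in auto)
      ultimately show "(\<lambda>t. (g (t *s a + h n *s b) - g (t *s a)) / h n) holomorphic_on ball t0 d"
        using h(2)[of n] by (auto intro!: holomorphic_intros)
    next
      fix x assume x: "x \<in> ball t0 d"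
      then obtain e where e: "e > 0" "cball x e \<subseteq> ball t0 d" by (meson open_ball open_contains_cball)
      have "uniform_limit (cball x e) (\<lambda>n t. (g (t *s a + h n *s b) - g (t *s a)) / h n) (\<lambda>t. deriv (\<lambda>z. g (t *s a + z *s b)) 0) sequentially"
      proof (rule uniform_limitI)
        fix ee :: real assume "ee > 0"
        have "(\<lambda>n. 8 * M / r\<^sup>2 * norm (h n)) \<longlonglongrightarrow> 8 * M / r\<^sup>2 * 0" by (intro tendsto_intros hlim)
        then have "\<forall>\<^sub>F n in sequentially. 8 * M / r\<^sup>2 * norm (h n) < ee"
          using \<open>ee > 0\<close> by (auto dest: order_tendstoD(2))
        then show "\<forall>\<^sub>F n in sequentially. \<forall>t\<in>cball x e.
            dist ((g (t *s a + h n *s b) - g (t *s a)) / h n) (deriv (\<lambda>z. g (t *s a + z *s b)) 0) < ee"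
        proof eventually_elim
          case (elim n)
          have "t \<in> cball t0 d" if "t \<in> cball x e" for t using e(2) that by force
          then show ?case using bound[of _ n] elim by (force simp: dist_norm)
        qed
      qed
      then show "\<exists>e>0. cball x e \<subseteq> ball t0 d \<and> uniform_limit (cball x e)
          (\<lambda>n t. (g (t *s a + h n *s b) - g (t *s a)) / h n) (\<lambda>t. deriv (\<lambda>z. g (t *s a + z *s b)) 0) sequentially"
        using e by blast
    qed auto
    with d(1) show ?thesis by blast
  qed
  then have "(\<lambda>t. deriv (\<lambda>z. g (t *s a + z *s b)) 0) field_differentiable (at t0)" if "t0 \<in> ?T" for t0
    using that by (meson centre_in_ball holomorphic_on_imp_differentiable_at open_ball)
  then show ?thesis using oT
    by (simp add: holomorphic_on_def field_differentiable_at_within)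
qed

section \<open>Jacobians of holomorphic maps and of chart transitions\<close>

lemma hol_on_frechet:
  fixes T :: "complex^'n \<Rightarrow> complex^'m"
  assumes "\<And>i. hol_on W (\<lambda>v. T v $ i)" "x \<in> W"
  obtains D where "(T has_derivative D) (at x)" "\<And>c v. D (c *s v) = c *s D v" "frechet_derivative T (at x) = D"
proof -
  have "\<forall>i. \<exists>E. ((\<lambda>v. T v $ i) has_derivative E) (at x) \<and> (\<forall>c v. E (c *s v) = c * E v)"
    using assms unfolding hol_on_def by blast
  then obtain E where E: "\<And>i. ((\<lambda>v. T v $ i) has_derivative E i) (at x)"
    "\<And>i c v. E i (c *s v) = c * E i v" by metis
  have 1: "(T has_derivative (\<lambda>v. \<chi> i. E i v)) (at x)"
    by (rule has_derivative_vec_componentwise) (simp add: E)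
  have "(\<chi> i. E i (c *s v)) = c *s (\<chi> i. E i v)" for c v by (simp add: vec_eq_iff E)
  from that[OF 1 this frechet_derivative_at[OF 1, symmetric]] show ?thesis .
qed

text \<open>Reduces the entries of a Jacobian to complex derivatives in one variable, for which
  uniqueness and the differentiation rules can be used.\<close>

lemma frechet_derivative_direction:
  fixes T :: "complex^'n \<Rightarrow> complex^'m"
  assumes "\<And>i. hol_on W (\<lambda>v. T v $ i)" "x \<in> W"
  shows "((\<lambda>z. T (x + z *s b) $ i) has_field_derivative frechet_derivative T (at x) b $ i) (at 0)"
proof -
  obtain D where D: "(T has_derivative D) (at x)" "\<And>c v. D (c *s v) = c *s D v" "frechet_derivative T (at x) = D"
    using hol_on_frechet[OF assms] by blast
  have "((\<lambda>z. x + z *s b) has_derivative (\<lambda>z. z *s b)) (at 0)"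
    by (rule has_derivative_vec_componentwise) (auto intro!: derivative_eq_intros)
  moreover have "(T has_derivative D) (at (x + 0 *s b))" using D(1) by simp
  ultimately have "((\<lambda>z. T (x + z *s b)) has_derivative (\<lambda>z. D (z *s b))) (at 0)"
    by (rule has_derivative_compose)
  then have "((\<lambda>z. T (x + z *s b) $ i) has_derivative (\<lambda>z. D (z *s b) $ i)) (at 0)"
    by (rule bounded_linear.has_derivative[OF bounded_linear_vec_nth])
  then show ?thesis
    by (simp add: has_field_derivative_def D mult_commute_abs)
qed

lemma charts_iff: "(U, \<phi>) \<in> charts Z \<longleftrightarrow> openin (ctop Z) U \<and> open (\<phi> ` U) \<and>
    biholomorphic_map (subspace_of Z U) (model (\<phi> ` U)) \<phi>"
  by (simp add: charts_def)

lemma pts_subspace: "openin (ctop Z) U \<Longrightarrow> pts (subspace_of Z U) = U"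
  using openin_subset by fastforce

lemma chart_inj: "(U, \<phi>) \<in> charts Z \<Longrightarrow> inj_on \<phi> U"
  using biholomorphic_map_bij[of "subspace_of Z U"] unfolding charts_iff
  by (metis bij_betw_def pts_subspace)

lemma chart_inv_into: "(U, \<phi>) \<in> charts Z \<Longrightarrow> p \<in> U \<Longrightarrow> inv_into U \<phi> (\<phi> p) = p"
  using chart_inj by (metis inv_into_f_f)

lemma chart_inv_holomorphic:
  assumes "csheaf Z" "(U, \<phi>) \<in> charts Z"
  shows "holomorphic_map (model (\<phi> ` U)) (subspace_of Z U) (inv_into U \<phi>)"
  using biholomorphic_map_inv_into[OF csheaf_subspace[OF assms(1)] csheaf_model] assms(2)
  unfolding charts_iff by (metis pts_subspace)

lemma chart_pullback_chol:
  assumes Z: "csheaf Z" and c: "(U, \<phi>) \<in> charts Z" and F: "hol_on W F" and W: "open W"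
  shows "(\<lambda>p. F (\<phi> p)) \<in> chol Z {p \<in> U. \<phi> p \<in> W}"
proof -
  have o: "openin (ctop Z) U" "open (\<phi> ` U)" and h: "holomorphic_map (subspace_of Z U) (model (\<phi> ` U)) \<phi>"
    using c unfolding charts_iff biholomorphic_map_def by auto
  have "F \<in> chol (model (\<phi> ` U)) (\<phi> ` U \<inter> W)"
    unfolding chol_model_open[OF o(2)] using W o(2) F by (auto intro: hol_on_subset)
  from holomorphic_map_chol[OF h csheaf_model this]
  have "F \<circ> \<phi> \<in> chol (subspace_of Z U) {p \<in> U. \<phi> p \<in> \<phi> ` U \<inter> W}" by (simp only: pts_subspace[OF o(1)])
  moreover have "{p \<in> U. \<phi> p \<in> \<phi> ` U \<inter> W} = {p \<in> U. \<phi> p \<in> W}" by auto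
  ultimately show ?thesis using chol_subspace_open[OF Z o(1)] by (simp add: comp_def)
qed

lemma chart_transition:
  fixes \<phi> :: "'a \<Rightarrow> complex^'n" and \<psi> :: "'a \<Rightarrow> complex^'m"
  assumes Z: "csheaf Z" and c: "(U, \<phi>) \<in> charts Z" "(V, \<psi>) \<in> charts Z"
  shows "open (\<psi> ` (U \<inter> V))" and "hol_on (\<psi> ` (U \<inter> V)) (\<lambda>v. (\<phi> \<circ> inv_into V \<psi>) v $ i)"
proof -
  let ?W = "\<psi> ` (U \<inter> V)"
  have oU: "openin (ctop Z) U" and oV: "openin (ctop Z) V" "open (\<psi> ` V)" using c unfolding charts_iff by auto
  have inv: "holomorphic_map (model (\<psi> ` V)) (subspace_of Z V) (inv_into V \<psi>)"
    by (rule chart_inv_holomorphic[OF Z c(2)])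
  have UV: "openin (ctop Z) (U \<inter> V)" using oU oV by blast
  have "(\<lambda>p. \<phi> p $ i) \<in> chol Z {p \<in> U. \<phi> p \<in> UNIV}"
    by (rule chart_pullback_chol[OF Z c(1) hol_on_coord]) simp
  then have "(\<lambda>p. \<phi> p $ i) \<in> chol Z (U \<inter> V)"
    using csheaf_restrict[OF Z _ UV] by auto
  then have "(\<lambda>p. \<phi> p $ i) \<in> chol (subspace_of Z V) (U \<inter> V)"
    by (simp add: chol_subspace_open[OF Z oV(1)])
  from holomorphic_map_chol[OF inv csheaf_subspace[OF Z] this]
  have "(\<lambda>p. \<phi> p $ i) \<circ> inv_into V \<psi> \<in> chol (model (\<psi> ` V)) {v \<in> \<psi> ` V. inv_into V \<psi> v \<in> U \<inter> V}" by simp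
  moreover have "{v \<in> \<psi> ` V. inv_into V \<psi> v \<in> U \<inter> V} = ?W"
    using chart_inv_into[OF c(2)] by force
  ultimately show "open ?W" "hol_on ?W (\<lambda>v. (\<phi> \<circ> inv_into V \<psi>) v $ i)"
    by (auto simp: chol_model_open[OF oV(2)] comp_def)
qed

lemma sum_UNIV_Plus:
  fixes f :: "'k::finite + 'm::finite \<Rightarrow> 'b::comm_monoid_add"
  shows "(\<Sum>i\<in>UNIV. f i) = (\<Sum>i\<in>UNIV. f (Inl i)) + (\<Sum>i\<in>UNIV. f (Inr i))"
  by (simp add: UNIV_Plus_UNIV[symmetric] sum.Plus del: UNIV_Plus_UNIV)

lemma linear_expand:
  fixes D :: "complex^'n \<Rightarrow> complex^'m"
  assumes "(T has_derivative D) F" "\<And>c v. D (c *s v) = c *s D v"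
  shows "D v = (\<Sum>k\<in>UNIV. v $ k *s D (axis k 1))"
proof -
  have l: "linear D" using assms(1) by (rule has_derivative_linear)
  have "v = (\<Sum>k\<in>UNIV. v $ k *s axis k 1)"
    by (simp add: vec_eq_iff axis_def if_distrib sum.delta' cong: if_cong)
  then have "D v = D (\<Sum>k\<in>UNIV. v $ k *s axis k 1)" by simp
  also have "\<dots> = (\<Sum>k\<in>UNIV. v $ k *s D (axis k 1))" by (simp add: linear_sum[OF l] assms(2))
  finally show ?thesis .
qed

section \<open>The transition matrices of the normal bundle\<close>

lemma normal_bundle_simps:
  "idx (normal_bundle Z L) = adapted_charts Z L"
  "patch (normal_bundle Z L) (U, \<phi>) = U \<inter> L"
  "trans (normal_bundle Z L) (U, \<phi>) (V, \<psi>) p $ i $ j =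
     frechet_derivative (\<phi> \<circ> inv_into V \<psi>) (at (\<psi> p)) (axis (Inr j) 1) $ Inr i"
  by (simp_all add: normal_bundle_def)

context
  fixes Z :: "'a cspace" and L :: "'a set"
  assumes Z: "csheaf Z"
begin

lemma adapted_zero:
  assumes "(V, \<psi>) \<in> (adapted_charts Z L :: ('a, 'k::finite + 'm::finite) chart set)" "q \<in> V"
  shows "q \<in> L \<longleftrightarrow> (\<forall>j. \<psi> q $ Inr j = 0)"
proof -
  have e: "\<psi> ` (V \<inter> L) = {v \<in> \<psi> ` V. \<forall>j. v $ Inr j = 0}" and c: "(V, \<psi>) \<in> charts Z"
    using assms by (auto simp: adapted_charts_def)
  show ?thesis
  proof
    assume "q \<in> L"
    then have "\<psi> q \<in> \<psi> ` (V \<inter> L)" using assms by blast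
    then show "\<forall>j. \<psi> q $ Inr j = 0" unfolding e by blast
  next
    assume "\<forall>j. \<psi> q $ Inr j = 0"
    then have "\<psi> q \<in> \<psi> ` (V \<inter> L)" unfolding e using assms by blast
    then obtain r where "r \<in> V \<inter> L" "\<psi> r = \<psi> q" by auto
    then show "q \<in> L" using chart_inj[OF c] assms(2) by (metis IntD1 IntD2 inj_onD)
  qed
qed

text \<open>Moving along a tangential coordinate line stays in \<open>L\<close> as long as the point
  remains in both charts, so the transverse coordinates of the other chart are constantly 0 there.
  Hence the Jacobian is block triangular.\<close>

lemma adapted_block:
  fixes \<phi> \<psi> :: "'a \<Rightarrow> complex^('k::finite + 'm::finite)"
  assumes U: "(U, \<phi>) \<in> adapted_charts Z L" and V: "(V, \<psi>) \<in> adapted_charts Z L" and p: "p \<in> U \<inter> V \<inter> L"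
  shows "frechet_derivative (\<phi> \<circ> inv_into V \<psi>) (at (\<psi> p)) (axis (Inl k) 1) $ Inr i = 0"
proof -
  have cU: "(U, \<phi>) \<in> charts Z" and cV: "(V, \<psi>) \<in> charts Z" using U V by (auto simp: adapted_charts_def)
  let ?T = "\<phi> \<circ> inv_into V \<psi>" and ?W = "\<psi> ` (U \<inter> V)" and ?b = "axis (Inl k) 1 :: complex^('k + 'm)"
  note tr = chart_transition[OF Z cU cV]
  have pW: "\<psi> p \<in> ?W" using p by auto
  have "((\<lambda>z. ?T (\<psi> p + z *s ?b) $ Inr i) has_field_derivative frechet_derivative ?T (at (\<psi> p)) ?b $ Inr i) (at 0)"
    by (rule frechet_derivative_direction[OF tr(2) pW])
  moreover have "((\<lambda>z. ?T (\<psi> p + z *s ?b) $ Inr i) has_field_derivative 0) (at 0)"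
  proof (rule has_field_derivative_transform_within_open[of "\<lambda>_. 0"])
    have "continuous_on UNIV (\<lambda>z. \<psi> p + z *s ?b)"
      unfolding vector_scalar_mult_def by (intro continuous_intros)
    then show "open ((\<lambda>z. \<psi> p + z *s ?b) -` ?W)" using tr(1) by (intro open_vimage)
    show "0 \<in> (\<lambda>z. \<psi> p + z *s ?b) -` ?W" using pW by simp
    fix z assume "z \<in> (\<lambda>z. \<psi> p + z *s ?b) -` ?W"
    then obtain q where q: "q \<in> U" "q \<in> V" "\<psi> p + z *s ?b = \<psi> q" by auto
    have "\<psi> q $ Inr j = 0" for j
      using adapted_zero[OF V, of p] p q(3)[symmetric] by (simp add: axis_def)
    then have "q \<in> L" using adapted_zero[OF V q(2)] by blast
    then have "\<phi> q $ Inr i = 0" using adapted_zero[OF U q(1)] by blast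
    then show "0 = ?T (\<psi> p + z *s ?b) $ Inr i" using q chart_inv_into[OF cV q(2)] by simp
  qed auto
  ultimately show ?thesis by (rule DERIV_unique)
qed

text \<open>Holomorphy of the transition matrices rests on
  \<open>partial_derivative_holomorphic\<close>, the cocycle rule on the chain rule together with
  \<open>adapted_block\<close>.\<close>

lemma holomorphic_bundle_normal_bundle:
  assumes L: "L \<subseteq> pts Z"
    and cover: "\<And>p. p \<in> L \<Longrightarrow> \<exists>(U, \<phi>)\<in>(adapted_charts Z L :: ('a, 1 + 'm::finite) chart set). p \<in> U"
  shows "holomorphic_bundle (subspace_of Z L) (normal_bundle Z L :: (('a, 1 + 'm) chart, 'a, 'm) cocycle)"
  unfolding holomorphic_bundle_def
proof (intro conjI ballI)
  let ?E = "normal_bundle Z L :: (('a, 1 + 'm) chart, 'a, 'm) cocycle"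
  have ch: "(U, \<phi>) \<in> charts Z" if "(U, \<phi>) \<in> adapted_charts Z L" for U and \<phi> :: "'a \<Rightarrow> complex^(1 + 'm)"
    using that by (auto simp: adapted_charts_def)
  show op: "openin (ctop (subspace_of Z L)) (patch ?E c)" if "c \<in> idx ?E" for c
    using that ch by (cases c) (auto simp: normal_bundle_simps charts_iff openin_subtopology)
  show "(\<Union>c\<in>idx ?E. patch ?E c) = pts (subspace_of Z L)"
  proof
    show "(\<Union>c\<in>idx ?E. patch ?E c) \<subseteq> pts (subspace_of Z L)" using op openin_subset by blast
    show "pts (subspace_of Z L) \<subseteq> (\<Union>c\<in>idx ?E. patch ?E c)"
    proof
      fix p assume "p \<in> pts (subspace_of Z L)"
      then have "p \<in> L" by simp
      with cover[OF this] show "p \<in> (\<Union>c\<in>idx ?E. patch ?E c)"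
        by (auto simp: normal_bundle_simps intro!: bexI)
    qed
  qed
  fix c d assume cd: "c \<in> idx ?E" "d \<in> idx ?E"
  obtain U \<phi> V \<psi> where c: "c = (U, \<phi>)" and d: "d = (V, \<psi>)" by (metis surj_pair)
  have A: "(U, \<phi>) \<in> adapted_charts Z L" "(V, \<psi>) \<in> adapted_charts Z L"
    using cd by (auto simp: normal_bundle_simps c d)
  note cU = ch[OF A(1)] and cV = ch[OF A(2)]
  let ?T = "\<phi> \<circ> inv_into V \<psi>" and ?W = "\<psi> ` (U \<inter> V)"
  note tr = chart_transition[OF Z cU cV]
  show "holomorphic_matrix (subspace_of Z L) (patch ?E c \<inter> patch ?E d) (trans ?E c d)"
    unfolding holomorphic_matrix_def
  proof (intro allI)
    fix i j
    let ?a = "axis (Inl 1) 1 :: complex^(1 + 'm)" and ?b = "axis (Inr j) 1 :: complex^(1 + 'm)"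
    \<comment> \<open>A point of \<open>L\<close> is \<open>t *s ?a\<close> in the chart, so an
      entry of the transition matrix depends on the single variable \<open>t\<close>. Evaluated at
      the coordinate \<open>Inl 1\<close> it extends to an open set of \<open>Z\<close>, as
      functions on a subspace must.\<close>
    define e where "e t = deriv (\<lambda>z. ?T (t *s ?a + z *s ?b) $ Inr i) 0" for t
    let ?S = "{t. t *s ?a \<in> ?W}"
    have eh: "e holomorphic_on ?S" unfolding e_def by (rule partial_derivative_holomorphic[OF tr])
    have "continuous_on UNIV (\<lambda>t. t *s ?a)" unfolding vector_scalar_mult_def by (intro continuous_intros)
    then have oS: "open ?S" using tr(1) open_vimage[of ?W "\<lambda>t. t *s ?a"] by (simp add: vimage_def)
    let ?X = "(\<lambda>v :: complex^(1 + 'm). v $ Inl 1) -` ?S"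
    have oX: "open ?X" by (intro open_vimage_vec_nth oS)
    have "hol_on ?X (\<lambda>v. e (v $ Inl 1))" by (rule hol_on_field_compose[OF hol_on_coord eh oS]) auto
    note F = chart_pullback_chol[OF Z cV this oX]
    have on_L: "\<psi> p = (\<psi> p $ Inl 1) *s ?a" if "p \<in> V" "p \<in> L" for p
      unfolding vec_eq_iff
    proof
      fix s show "\<psi> p $ s = ((\<psi> p $ Inl 1) *s ?a) $ s"
        using adapted_zero[OF A(2) that(1)] that(2) by (cases s) (auto simp: axis_def intro: arg_cong[where f = "\<lambda>k. \<psi> p $ Inl k"])
    qed
    have val: "trans ?E c d p $ i $ j = e (\<psi> p $ Inl 1)" and mem: "\<psi> p \<in> ?X" if "p \<in> U" "p \<in> V" "p \<in> L" for p
    proof -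
      have pW: "\<psi> p \<in> ?W" using that by auto
      then show "\<psi> p \<in> ?X" using on_L[OF that(2,3)] by auto
      show "trans ?E c d p $ i $ j = e (\<psi> p $ Inl 1)"
        using DERIV_imp_deriv[OF frechet_derivative_direction[OF tr(2) pW, of ?b "Inr i"]]
        unfolding e_def on_L[OF that(2,3), symmetric] by (simp add: c d normal_bundle_simps comp_def)
    qed
    show "(\<lambda>p. trans ?E c d p $ i $ j) \<in> chol (subspace_of Z L) (patch ?E c \<inter> patch ?E d)"
      unfolding chol_subspace
    proof (intro conjI ballI)
      show "openin (subtopology (ctop Z) L) (patch ?E c \<inter> patch ?E d)"
        using op[OF cd(1)] op[OF cd(2)] by auto
      fix p assume "p \<in> patch ?E c \<inter> patch ?E d"
      then have "p \<in> U" "p \<in> V" "p \<in> L" by (auto simp: c d normal_bundle_simps)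
      then show "\<exists>V F. openin (ctop Z) V \<and> p \<in> V \<and> F \<in> chol Z V \<and>
            (\<forall>q\<in>V \<inter> (patch ?E c \<inter> patch ?E d). trans ?E c d q $ i $ j = F q)"
        by (intro exI[of _ "{p \<in> V. \<psi> p \<in> ?X}"] exI[of _ "\<lambda>p. e (\<psi> p $ Inl 1)"])
          (use F mem csheaf_open[OF Z F] val in \<open>auto simp: c d normal_bundle_simps\<close>)
    qed
  qed
next
  let ?E = "normal_bundle Z L :: (('a, 1 + 'm) chart, 'a, 'm) cocycle"
  fix c p assume c: "c \<in> idx ?E" and p: "p \<in> patch ?E c"
  obtain U \<phi> where cU: "c = (U, \<phi>)" by (metis surj_pair)
  then have pU: "p \<in> U" and ch: "(U, \<phi>) \<in> charts Z"
    using c p by (auto simp: normal_bundle_simps adapted_charts_def)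
  have "open (\<phi> ` U)" using ch by (simp add: charts_iff)
  then have "(\<phi> \<circ> inv_into U \<phi> has_derivative (\<lambda>v. v)) (at (\<phi> p))"
    by (rule has_derivative_transform_within_open[OF has_derivative_ident])
       (use pU chart_inv_into[OF ch] in auto)
  then have "frechet_derivative (\<phi> \<circ> inv_into U \<phi>) (at (\<phi> p)) = (\<lambda>v. v)"
    using frechet_derivative_at by metis
  then show "trans ?E c c p = mat 1"
    by (simp add: vec_eq_iff cU normal_bundle_simps mat_def axis_def)
next
  let ?E = "normal_bundle Z L :: (('a, 1 + 'm) chart, 'a, 'm) cocycle"
  fix c d e p assume cde: "c \<in> idx ?E" "d \<in> idx ?E" "e \<in> idx ?E"
    and p: "p \<in> patch ?E c \<inter> patch ?E d \<inter> patch ?E e"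
  obtain U \<phi> V \<psi> X \<rho> where c: "c = (U, \<phi>)" and d: "d = (V, \<psi>)" and e: "e = (X, \<rho>)" by (metis surj_pair)
  have A: "(U, \<phi>) \<in> adapted_charts Z L" "(V, \<psi>) \<in> adapted_charts Z L" "(X, \<rho>) \<in> adapted_charts Z L"
    using cde by (auto simp: normal_bundle_simps c d e)
  then have ch: "(U, \<phi>) \<in> charts Z" "(V, \<psi>) \<in> charts Z" "(X, \<rho>) \<in> charts Z" by (auto simp: adapted_charts_def)
  have pp: "p \<in> U" "p \<in> V" "p \<in> X" "p \<in> L" using p by (auto simp: c d e normal_bundle_simps)
  let ?R = "\<phi> \<circ> inv_into V \<psi>" and ?S = "\<psi> \<circ> inv_into X \<rho>" and ?T = "\<phi> \<circ> inv_into X \<rho>"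
  have Sp: "?S (\<rho> p) = \<psi> p" using chart_inv_into[OF ch(3) pp(3)] by simp
  obtain DR where DR: "(?R has_derivative DR) (at (\<psi> p))" "\<And>c v. DR (c *s v) = c *s DR v"
      "frechet_derivative ?R (at (\<psi> p)) = DR"
    using hol_on_frechet[OF chart_transition(2)[OF Z ch(1,2)], of "\<psi> p"] pp by blast
  obtain DS where DS: "(?S has_derivative DS) (at (\<rho> p))" "\<And>c v. DS (c *s v) = c *s DS v"
      "frechet_derivative ?S (at (\<rho> p)) = DS"
    using hol_on_frechet[OF chart_transition(2)[OF Z ch(2,3)], of "\<rho> p"] pp by blast
  have "(?R \<circ> ?S has_derivative DR \<circ> DS) (at (\<rho> p))"
    by (rule diff_chain_at[OF DS(1)]) (use DR(1) Sp in simp)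
  then have "(?T has_derivative DR \<circ> DS) (at (\<rho> p))"
  proof (rule has_derivative_transform_within_open)
    show "open (\<rho> ` (V \<inter> X))" by (rule chart_transition(1)[OF Z ch(2,3)])
    show "\<rho> p \<in> \<rho> ` (V \<inter> X)" using pp by auto
    fix v assume "v \<in> \<rho> ` (V \<inter> X)"
    then show "(?R \<circ> ?S) v = ?T v" using chart_inv_into[OF ch(2)] chart_inv_into[OF ch(3)] by auto
  qed
  then have DT: "frechet_derivative ?T (at (\<rho> p)) = DR \<circ> DS" by (metis frechet_derivative_at)
  \<comment> \<open>Tangential components of the inner derivative thus do not reach the transverse
    components of the composite, and the sum in the chain rule reduces to a product of transverse
    blocks.\<close>
  have block: "DR (axis (Inl k) 1) $ Inr i = 0" for k i
    using adapted_block[OF A(1,2), of p] pp by (simp add: DR(3))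
  have "(DR \<circ> DS) (axis (Inr j) 1) $ Inr i =
      (\<Sum>k\<in>UNIV. DR (axis (Inr k) 1) $ Inr i * DS (axis (Inr j) 1) $ Inr k)" for i j
  proof -
    have "DR (DS (axis (Inr j) 1)) $ Inr i = (\<Sum>k\<in>UNIV. DS (axis (Inr j) 1) $ k * DR (axis k 1) $ Inr i)"
      by (subst linear_expand[OF DR(1,2)]) simp
    then show ?thesis by (simp add: sum_UNIV_Plus block mult.commute)
  qed
  then show "trans ?E c d p ** trans ?E d e p = trans ?E c e p"
    by (simp add: vec_eq_iff c d e normal_bundle_simps matrix_matrix_mult_def DR(3) DS(3) DT)
qed

end

lemma holomorphic_bundle_pullback:
  assumes "csheaf X" "csheaf Y" "holomorphic_map Y X g" "holomorphic_bundle X E"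
  shows "holomorphic_bundle Y (pullback_bundle Y g E)"
proof -
  have pu: "patch (pullback_bundle Y g E) i = {q \<in> pts Y. g q \<in> patch E i}" "idx (pullback_bundle Y g E) = idx E"
    "trans (pullback_bundle Y g E) i j q = trans E i j (g q)" for i j q
    by (simp_all add: pullback_bundle_def)
  have op: "openin (ctop X) (patch E i)" if "i \<in> idx E" for i
    using assms(4) that unfolding holomorphic_bundle_def by blast
  have cov: "(\<Union>i\<in>idx E. patch E i) = pts X" using assms(4) unfolding holomorphic_bundle_def by blast
  have 1: "openin (ctop Y) {q \<in> pts Y. g q \<in> patch E i}" if "i \<in> idx E" for i
    by (rule openin_continuous_map_preimage[OF holomorphic_map_continuous[OF assms(3)] op[OF that]])
  have 2: "(\<Union>i\<in>idx E. {q \<in> pts Y. g q \<in> patch E i}) = pts Y"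
    using cov holomorphic_map_pts[OF assms(3)] by blast
  have 3: "holomorphic_matrix Y ({q \<in> pts Y. g q \<in> patch E i} \<inter> {q \<in> pts Y. g q \<in> patch E j}) (trans (pullback_bundle Y g E) i j)"
    if ij: "i \<in> idx E" "j \<in> idx E" for i j
    unfolding holomorphic_matrix_def
  proof (intro allI)
    fix a b
    have "(\<lambda>p. trans E i j p $ a $ b) \<in> chol X (patch E i \<inter> patch E j)"
      using assms(4) ij unfolding holomorphic_bundle_def holomorphic_matrix_def by blast
    from holomorphic_map_chol[OF assms(3,1) this]
    have "(\<lambda>q. trans E i j (g q) $ a $ b) \<in> chol Y {q \<in> pts Y. g q \<in> patch E i \<inter> patch E j}" by (simp add: comp_def)
    moreover have "{q \<in> pts Y. g q \<in> patch E i \<inter> patch E j} = {q \<in> pts Y. g q \<in> patch E i} \<inter> {q \<in> pts Y. g q \<in> patch E j}" by auto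
    ultimately show "(\<lambda>q. trans (pullback_bundle Y g E) i j q $ a $ b) \<in> chol Y ({q \<in> pts Y. g q \<in> patch E i} \<inter> {q \<in> pts Y. g q \<in> patch E j})"
      by (simp add: pu)
  qed
  show ?thesis unfolding holomorphic_bundle_def pu(1,2)
    using 1 2 3 assms(4) by (simp add: pu(3) holomorphic_bundle_def)
qed

section \<open>A rational curve covered by two adapted charts\<close>

text \<open>Chart coordinates: \<open>x\<close> along the curve, \<open>m\<close> and
  \<open>n\<close> transverse to it.\<close>

definition vec12 :: "complex \<Rightarrow> complex \<Rightarrow> complex \<Rightarrow> complex^(1 + 2)" where
  "vec12 x m n = (\<chi> i. case i of Inl k \<Rightarrow> x | Inr k \<Rightarrow> if k = 0 then m else n)"

lemma vec12_nth [simp]: "vec12 x m n $ Inl k = x" "vec12 x m n $ Inr 0 = m" "vec12 x m n $ Inr 1 = n"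
  by (simp_all add: vec12_def)

lemma vec12_eq_iff: "(v :: complex^(1 + 2)) = w \<longleftrightarrow> v $ Inl 1 = w $ Inl 1 \<and> v $ Inr 0 = w $ Inr 0 \<and> v $ Inr 1 = w $ Inr 1"
proof
  assume A: "v $ Inl 1 = w $ Inl 1 \<and> v $ Inr 0 = w $ Inr 0 \<and> v $ Inr 1 = w $ Inr 1"
  have "v $ i = w $ i" for i
  proof (cases i)
    case (Inl k)
    have "k = 1" by (rule num1_eqI)
    then show ?thesis using A Inl \<open>k = 1\<close> by simp
  next
    case (Inr k)
    then show ?thesis using A exhaust_2[of k] by auto
  qed
  then show "v = w" by (simp add: vec_eq_iff)
qed simp

lemma hol_on_vec12 [intro]:
  "hol_on W f \<Longrightarrow> hol_on W g \<Longrightarrow> hol_on W h \<Longrightarrow> hol_on W (\<lambda>v. vec12 (f v) (g v) (h v) $ i)"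
  by (cases i; cases "i = Inr 0") (auto simp: vec12_def)

lemma hol_on_vec2 [intro]:
  "hol_on W f \<Longrightarrow> hol_on W g \<Longrightarrow> hol_on W (\<lambda>v. vec2 (f v) (g v) $ i)"
  by (cases "i = 0") (auto simp: vec2_def)

definition mat22 :: "complex \<Rightarrow> complex \<Rightarrow> complex \<Rightarrow> complex \<Rightarrow> complex^2^2" where
  "mat22 p q r s = (\<chi> i. vec2 (if i = 0 then p else r) (if i = 0 then q else s))"

lemma mat22_nth [simp]: "mat22 p q r s $ 0 $ 0 = p" "mat22 p q r s $ 0 $ 1 = q"
  "mat22 p q r s $ 1 $ 0 = r" "mat22 p q r s $ 1 $ 1 = s"
  by (simp_all add: mat22_def)

lemma mat22_eq_iff: "(A :: complex^2^2) = C \<longleftrightarrow> A $ 0 $ 0 = C $ 0 $ 0 \<and> A $ 0 $ 1 = C $ 0 $ 1 \<and> A $ 1 $ 0 = C $ 1 $ 0 \<and> A $ 1 $ 1 = C $ 1 $ 1"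
  by (auto simp: vec_eq_iff forall_2')

lemma invertible_mat22: "p * s - q * r \<noteq> 0 \<Longrightarrow> invertible (mat22 p q r s)"
  by (simp add: invertible_det_nz det_2')

text \<open>
  The curve is parametrised by \<open>(y\<^sub>0 : y\<^sub>1)\<close> via \<open>x = - y\<^sub>0 / (A y\<^sub>1 + \<beta> y\<^sub>0)\<close> in the first chart and
  \<open>X = y\<^sub>1 / (y\<^sub>0 - cnj \<beta> y\<^sub>1)\<close> in the second one. The normal bundle is an extension of \<open>O(2)\<close> by \<open>O\<close>, with
  class proportional to \<open>\<kappa>\<close>.
\<close>

locale glued_line =
  fixes Z :: "'a cspace" and L U V :: "'a set" and \<phi> \<psi> :: "'a \<Rightarrow> complex^(1 + 2)"
    and \<beta> A s \<kappa> :: complex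
  assumes Z: "csheaf Z" and LZ: "L \<subseteq> pts Z"
    and cU: "(U, \<phi>) \<in> adapted_charts Z L" and cV: "(V, \<psi>) \<in> adapted_charts Z L"
    and cover: "L \<subseteq> U \<union> V"
    and nz: "\<beta> \<noteq> 0" "A \<noteq> 0" "s \<noteq> 0" and s: "s = A + \<beta> * cnj \<beta>"
    and imU: "\<phi> ` (U \<inter> L) = {v. v $ Inr 0 = 0 \<and> v $ Inr 1 = 0 \<and> 1 + \<beta> * v $ Inl 1 \<noteq> 0}"
    and imV: "\<psi> ` (V \<inter> L) = {v. v $ Inr 0 = 0 \<and> v $ Inr 1 = 0 \<and> 1 + cnj \<beta> * v $ Inl 1 \<noteq> 0}"
    and overlap: "\<And>p. p \<in> U \<inter> L \<Longrightarrow> p \<in> V \<longleftrightarrow> \<phi> p $ Inl 1 \<noteq> 0 \<and> cnj \<beta> + s * \<phi> p $ Inl 1 \<noteq> 0"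
    and X: "\<And>p. p \<in> U \<inter> V \<inter> L \<Longrightarrow> \<psi> p $ Inl 1 = - (1 + \<beta> * \<phi> p $ Inl 1) / (cnj \<beta> + s * \<phi> p $ Inl 1)"
    and jac: "\<And>p. p \<in> U \<inter> V \<inter> L \<Longrightarrow> trans (normal_bundle Z L) (V, \<psi>) (U, \<phi>) p =
        mat22 (- (1 + \<beta> * \<phi> p $ Inl 1) / (\<phi> p $ Inl 1 * (cnj \<beta> + s * \<phi> p $ Inl 1))) 0
              (- \<kappa> * \<beta> * (1 + \<beta> * \<phi> p $ Inl 1) / (cnj \<beta> + s * \<phi> p $ Inl 1)) (\<beta> / cnj \<beta>)"
begin

section \<open>The parametrisation of the curve and its inverse\<close>

lemma chU: "(U, \<phi>) \<in> charts Z" and chV: "(V, \<psi>) \<in> charts Z"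
  using cU cV by (auto simp: adapted_charts_def)

lemma oU: "openin (ctop Z) U" and oV: "openin (ctop Z) V"
  using chU chV by (auto simp: charts_iff)

text \<open>On the conic the homogeneous coordinates are y3 = - y1 L3 and y2 = y0 L2 in terms of the
  parameters y0, y1 (see \<open>par\<close> below). Hence \<open>WU\<close> and \<open>WV\<close>
  are the parameters with y3 \<noteq> 0 and y2 \<noteq> 0, and \<open>vU\<close>, \<open>vV\<close>
  divide by y3 and y2.\<close>

definition L3 :: "complex^2 \<Rightarrow> complex" where "L3 y = A * y $ 1 + \<beta> * y $ 0"
definition L2 :: "complex^2 \<Rightarrow> complex" where "L2 y = y $ 0 - cnj \<beta> * y $ 1"

lemma L23_scale [simp]: "L3 (c *s y) = c * L3 y" "L2 (c *s y) = c * L2 y"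
  by (simp_all add: L2_def L3_def algebra_simps)

lemma hol_on_L23 [intro]: "hol_on W L3" "hol_on W L2"
  unfolding L2_def[abs_def] L3_def[abs_def] by (intro hol_on_add hol_on_diff hol_on_mult hol_on_const hol_on_coord)+

definition vU :: "complex^2 \<Rightarrow> complex^(1 + 2)" where "vU y = vec12 (- y $ 0 / L3 y) 0 0"
definition vV :: "complex^2 \<Rightarrow> complex^(1 + 2)" where "vV y = vec12 (y $ 1 / L2 y) 0 0"

definition WU :: "(complex^2) set" where "WU = {y. y $ 1 \<noteq> 0 \<and> L3 y \<noteq> 0}"
definition WV :: "(complex^2) set" where "WV = {y. y $ 0 \<noteq> 0 \<and> L2 y \<noteq> 0}"

lemma open_WUV: "open WU" "open WV"
proof -
  have "open {y. f y \<noteq> 0}" if "continuous_on UNIV f" for f :: "complex^2 \<Rightarrow> complex"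
    using open_Collect_neq[OF that continuous_on_const] .
  then have 1: "open {y. f y \<noteq> 0}" if "hol_on UNIV f" for f :: "complex^2 \<Rightarrow> complex"
    using hol_on_continuous[OF that] by blast
  have "WU = {y. y $ 1 \<noteq> 0} \<inter> {y. L3 y \<noteq> 0}" "WV = {y. y $ 0 \<noteq> 0} \<inter> {y. L2 y \<noteq> 0}"
    by (auto simp: WU_def WV_def)
  then show "open WU" "open WV" by (simp_all add: 1 open_Int hol_on_L23)
qed

text \<open>A zero of one parameter makes the linear form of the other chart nonzero, and
  \<open>L2\<close>, \<open>L3\<close> have no common zero because their determinant is A + \<beta>
  cnj \<beta> = s.\<close>

lemma WUV_cover: assumes "y \<noteq> 0" shows "y \<in> WU \<union> WV"
proof (rule ccontr)
  assume n: "y \<notin> WU \<union> WV"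
  show False
  proof (cases "y $ 1 = 0")
    case True
    then have "y $ 0 \<noteq> 0" using assms by (auto simp: vec2_eq_iff)
    then show False using n True by (auto simp: WV_def L2_def)
  next
    case False
    then have 3: "\<beta> * y $ 0 = - A * y $ 1" using n by (auto simp: WU_def L3_def) (metis add.commute add_eq_0_iff)
    then have y0: "y $ 0 \<noteq> 0" using False nz by auto
    then have "L2 y = 0" using n by (auto simp: WV_def)
    then have "y $ 0 = cnj \<beta> * y $ 1" by (simp add: L2_def)
    then have "s * y $ 1 = 0" using 3 by (simp add: s algebra_simps)
    then show False using False nz by simp
  qed
qed

lemma WUV_nonzero: "y \<in> WU \<Longrightarrow> y \<noteq> 0" "y \<in> WV \<Longrightarrow> y \<noteq> 0"
  by (auto simp: WU_def WV_def)

lemma vU_mem: "y \<in> WU \<Longrightarrow> vU y \<in> \<phi> ` (U \<inter> L)"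
proof -
  assume y: "y \<in> WU"
  then have "1 + \<beta> * (- y $ 0 / L3 y) = A * y $ 1 / L3 y" by (simp add: WU_def field_simps) (simp add: L3_def algebra_simps)
  then show ?thesis unfolding imU using y nz by (simp add: vU_def WU_def)
qed

lemma vV_mem: "y \<in> WV \<Longrightarrow> vV y \<in> \<psi> ` (V \<inter> L)"
proof -
  assume y: "y \<in> WV"
  then have "1 + cnj \<beta> * (y $ 1 / L2 y) = y $ 0 / L2 y" by (simp add: WV_def field_simps) (simp add: L2_def algebra_simps)
  then show ?thesis unfolding imV using y by (simp add: vV_def WV_def)
qed

definition gU :: "complex^2 \<Rightarrow> 'a" where "gU y = inv_into U \<phi> (vU y)"
definition gV :: "complex^2 \<Rightarrow> 'a" where "gV y = inv_into V \<psi> (vV y)"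

lemma gU: "y \<in> WU \<Longrightarrow> gU y \<in> U \<inter> L \<and> \<phi> (gU y) = vU y"
  using vU_mem[of y] chart_inv_into[OF chU] by (auto simp: gU_def)

lemma gV: "y \<in> WV \<Longrightarrow> gV y \<in> V \<inter> L \<and> \<psi> (gV y) = vV y"
  using vV_mem[of y] chart_inv_into[OF chV] by (auto simp: gV_def)

lemma gU_eq_gV:
  assumes "y \<in> WU" "y \<in> WV" shows "gU y = gV y"
proof -
  let ?p = "gU y"
  have p: "?p \<in> U \<inter> L" "\<phi> ?p $ Inl 1 = - y $ 0 / L3 y" using gU[OF assms(1)] by (auto simp: vU_def)
  have e: "cnj \<beta> + s * (- y $ 0 / L3 y) = - A * L2 y / L3 y"
    using assms by (simp add: WU_def field_simps) (simp add: L3_def L2_def s algebra_simps)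
  have e2: "1 + \<beta> * (- y $ 0 / L3 y) = A * y $ 1 / L3 y"
    using assms by (simp add: WU_def field_simps) (simp add: L3_def algebra_simps)
  have V: "?p \<in> V" using overlap[OF p(1)] assms nz unfolding p(2) e by (simp add: WU_def WV_def)
  then have "\<psi> ?p $ Inl 1 = y $ 1 / L2 y"
    using X[of ?p] p assms nz unfolding p(2) e e2 by (simp add: WU_def WV_def field_simps)
  moreover have "\<psi> ?p $ Inr j = 0" for j using adapted_zero[OF Z cV V] p by blast
  ultimately have "\<psi> ?p = vV y" by (simp add: vec12_eq_iff vV_def)
  then show ?thesis using chart_inv_into[OF chV V] by (simp add: gV_def)
qed

definition \<gamma> :: "(complex^2) set \<Rightarrow> 'a" where
  "\<gamma> P = (let y = (SOME y. y \<in> P) in if y \<in> WU then gU y else gV y)"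

lemma gamma_line:
  assumes "y \<noteq> 0" shows "\<gamma> (line_through y) = (if y \<in> WU then gU y else gV y)"
proof -
  have "(SOME x. x \<in> line_through y) \<in> line_through y" by (rule someI) (rule self_in_line_through)
  then obtain c where c: "c \<noteq> 0" "(SOME x. x \<in> line_through y) = c *s y" by (auto simp: in_line_through)
  have "vU (c *s y) = vU y" "vV (c *s y) = vV y" "c *s y \<in> WU \<longleftrightarrow> y \<in> WU"
    using c(1) by (auto simp: vU_def vV_def WU_def)
  then show ?thesis unfolding \<gamma>_def c(2) by (simp add: Let_def gU_def gV_def)
qed

lemma gamma_U: "y \<in> WU \<Longrightarrow> \<gamma> (line_through y) = gU y"
  using gamma_line[of y] WUV_nonzero by auto

lemma gamma_V: "y \<in> WV \<Longrightarrow> \<gamma> (line_through y) = gV y"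
  using gamma_line[of y] gU_eq_gV[of y] WUV_nonzero by auto

lemma gamma_in_L: assumes "y \<noteq> 0" shows "\<gamma> (line_through y) \<in> L"
proof (cases "y \<in> WU")
  case True
  then show ?thesis using gamma_U gU by simp
next
  case False
  then have "y \<in> WV" using WUV_cover[OF assms] by blast
  then show ?thesis using gamma_V gV by simp
qed

text \<open>The equations x = - y0 / (A y1 + \<beta> y0) and X = y1 / (y0 - cnj \<beta> y1) solved
  for the ratio of y0 and y1.\<close>

definition \<eta> :: "'a \<Rightarrow> (complex^2) set" where
  "\<eta> p = (if p \<in> U then line_through (vec2 (- A * \<phi> p $ Inl 1) (1 + \<beta> * \<phi> p $ Inl 1))
          else line_through (vec2 (1 + cnj \<beta> * \<psi> p $ Inl 1) (\<psi> p $ Inl 1)))"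

lemma eta_U: "p \<in> U \<Longrightarrow> \<eta> p = line_through (vec2 (- A * \<phi> p $ Inl 1) (1 + \<beta> * \<phi> p $ Inl 1))"
  by (simp add: \<eta>_def)

lemma eta_V:
  assumes "p \<in> V" "p \<in> L" shows "\<eta> p = line_through (vec2 (1 + cnj \<beta> * \<psi> p $ Inl 1) (\<psi> p $ Inl 1))"
proof (cases "p \<in> U")
  case True
  let ?x = "\<phi> p $ Inl 1"
  define d where "d = cnj \<beta> + s * ?x"
  have d: "d \<noteq> 0" using overlap[of p] assms True by (simp add: d_def)
  have x: "\<psi> p $ Inl 1 = (- 1 / d) * (1 + \<beta> * ?x)"
    using X[of p] assms True unfolding d_def by (simp add: divide_inverse algebra_simps)
  have "1 + cnj \<beta> * \<psi> p $ Inl 1 = (d - cnj \<beta> * (1 + \<beta> * ?x)) / d" using d by (simp add: x field_simps)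
  also have "\<dots> = (- 1 / d) * (- A * ?x)" by (simp add: d_def s algebra_simps)
  finally have "vec2 (1 + cnj \<beta> * \<psi> p $ Inl 1) (\<psi> p $ Inl 1) = (- 1 / d) *s vec2 (- A * ?x) (1 + \<beta> * ?x)"
    by (simp add: vec2_eq_iff x)
  then have "line_through (vec2 (1 + cnj \<beta> * \<psi> p $ Inl 1) (\<psi> p $ Inl 1)) =
      line_through ((- 1 / d) *s vec2 (- A * ?x) (1 + \<beta> * ?x))" by (rule arg_cong)
  also have "\<dots> = line_through (vec2 (- A * ?x) (1 + \<beta> * ?x))"
    by (rule line_through_scale) (use d in simp)
  finally show ?thesis using eta_U[OF True] by simp
qed (simp add: \<eta>_def)

lemma eta_gamma:
  assumes "y \<noteq> 0" shows "\<eta> (\<gamma> (line_through y)) = line_through y"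
proof (cases "y \<in> WU")
  case True
  have "1 + \<beta> * (- y $ 0 / L3 y) = A * y $ 1 / L3 y" using True by (simp add: WU_def field_simps) (simp add: L3_def algebra_simps)
  then have "vec2 (- A * (- y $ 0 / L3 y)) (1 + \<beta> * (- y $ 0 / L3 y)) = (A / L3 y) *s y" by (simp add: vec2_eq_iff)
  then show ?thesis using True gU[OF True] nz by (simp add: gamma_U eta_U vU_def WU_def)
next
  case False
  then have y: "y \<in> WV" using WUV_cover[OF assms] by blast
  have "1 + cnj \<beta> * (y $ 1 / L2 y) = y $ 0 / L2 y" using y by (simp add: WV_def field_simps) (simp add: L2_def algebra_simps)
  then have "vec2 (1 + cnj \<beta> * (y $ 1 / L2 y)) (y $ 1 / L2 y) = (1 / L2 y) *s y" by (simp add: vec2_eq_iff)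
  then show ?thesis using y gV[OF y] by (simp add: gamma_V eta_V vV_def WV_def)
qed

lemma gamma_eta_U:
  assumes "p \<in> U" "p \<in> L"
  shows "vec2 (- A * \<phi> p $ Inl 1) (1 + \<beta> * \<phi> p $ Inl 1) \<in> WU" (is "?y \<in> _") and "\<gamma> (\<eta> p) = p"
proof -
  have "1 + \<beta> * \<phi> p $ Inl 1 \<noteq> 0" using assms imU by blast
  moreover have L: "L3 ?y = A" by (simp add: L3_def algebra_simps)
  ultimately show W: "?y \<in> WU" using nz by (simp add: WU_def)
  have "vU ?y = \<phi> p" unfolding vU_def L vec12_eq_iff using adapted_zero[OF Z cU assms(1)] assms(2) nz by simp
  then have "gU ?y = p" using chart_inv_into[OF chU assms(1)] by (simp add: gU_def)
  then show "\<gamma> (\<eta> p) = p" using gamma_U[OF W] assms by (simp add: eta_U)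
qed

lemma gamma_eta_V:
  assumes "p \<in> V" "p \<in> L"
  shows "vec2 (1 + cnj \<beta> * \<psi> p $ Inl 1) (\<psi> p $ Inl 1) \<in> WV" (is "?y \<in> _") and "\<gamma> (\<eta> p) = p"
proof -
  have "1 + cnj \<beta> * \<psi> p $ Inl 1 \<noteq> 0" using assms imV by blast
  moreover have L: "L2 ?y = 1" by (simp add: L2_def algebra_simps)
  ultimately show W: "?y \<in> WV" by (simp add: WV_def)
  have "vV ?y = \<psi> p" unfolding vV_def L vec12_eq_iff using adapted_zero[OF Z cV assms(1)] assms(2) by simp
  then have "gV ?y = p" using chart_inv_into[OF chV assms(1)] by (simp add: gV_def)
  then show "\<gamma> (\<eta> p) = p" using gamma_V[OF W] assms by (simp add: eta_V)
qed

lemma WU_iff: assumes "y \<noteq> 0" shows "\<gamma> (line_through y) \<in> U \<longleftrightarrow> y \<in> WU"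
proof
  assume A: "\<gamma> (line_through y) \<in> U"
  let ?p = "\<gamma> (line_through y)"
  have "line_through y = line_through (vec2 (- A * \<phi> ?p $ Inl 1) (1 + \<beta> * \<phi> ?p $ Inl 1))" (is "_ = line_through ?z")
    using eta_gamma[OF assms] eta_U[OF A] by simp
  then obtain c where "c \<noteq> 0" "?z = c *s y" by (auto simp: line_through_eq_iff)
  then show "y \<in> WU" using gamma_eta_U(1)[OF A gamma_in_L[OF assms]] by (auto simp: WU_def)
qed (use gamma_U gU in auto)

lemma WV_iff: assumes "y \<noteq> 0" shows "\<gamma> (line_through y) \<in> V \<longleftrightarrow> y \<in> WV"
proof
  assume A: "\<gamma> (line_through y) \<in> V"
  let ?p = "\<gamma> (line_through y)"
  have "line_through y = line_through (vec2 (1 + cnj \<beta> * \<psi> ?p $ Inl 1) (\<psi> ?p $ Inl 1))" (is "_ = line_through ?z")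
    using eta_gamma[OF assms] eta_V[OF A gamma_in_L[OF assms]] by simp
  then obtain c where "c \<noteq> 0" "?z = c *s y" by (auto simp: line_through_eq_iff)
  then show "y \<in> WV" using gamma_eta_V(1)[OF A gamma_in_L[OF assms]] by (auto simp: WV_def)
qed (use gamma_V gV in auto)

lemma gamma_holomorphic: "holomorphic_map projective_space (subspace_of Z L) \<gamma>"
  unfolding holomorphic_map_into_subspace[OF csheaf_projective_space Z]
proof (intro conjI ballI)
  have hU: "holomorphic_map (model WU) Z (inv_into U \<phi> \<circ> vU)"
  proof (rule holomorphic_map_compose)
    show "holomorphic_map (model WU) (model (\<phi> ` U)) vU"
      by (rule holomorphic_map_model_open[OF open_WUV(1)])
        (use vU_mem in \<open>auto simp: vU_def WU_def intro!: hol_on_vec12 hol_on_divide hol_on_uminus hol_on_L23\<close>)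
    show "holomorphic_map (model (\<phi> ` U)) Z (inv_into U \<phi>)"
      using chart_inv_holomorphic[OF Z chU] holomorphic_map_into_subspace[OF csheaf_model Z] by blast
  qed
  have hV: "holomorphic_map (model WV) Z (inv_into V \<psi> \<circ> vV)"
  proof (rule holomorphic_map_compose)
    show "holomorphic_map (model WV) (model (\<psi> ` V)) vV"
      by (rule holomorphic_map_model_open[OF open_WUV(2)])
        (use vV_mem in \<open>auto simp: vV_def WV_def intro!: hol_on_vec12 hol_on_divide hol_on_uminus hol_on_L23\<close>)
    show "holomorphic_map (model (\<psi> ` V)) Z (inv_into V \<psi>)"
      using chart_inv_holomorphic[OF Z chV] holomorphic_map_into_subspace[OF csheaf_model Z] by blast
  qed
  have sub: "WU \<subseteq> - {0}" "WV \<subseteq> - {0}" by (auto simp: WU_def WV_def)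
  have "holomorphic_map (model (- {0})) Z (\<gamma> \<circ> line_through)"
  proof (rule holomorphic_map_local[OF csheaf_model Z])
    fix y assume "y \<in> pts (model (- {0 :: complex^2}))"
    then have "y \<in> WU \<union> WV" using WUV_cover[of y] by simp
    then show "\<exists>U. openin (ctop (model (- {0}))) U \<and> y \<in> U \<and> holomorphic_map (subspace_of (model (- {0})) U) Z (\<gamma> \<circ> line_through)"
    proof
      assume "y \<in> WU"
      then show ?thesis
        by (intro exI[of _ WU])
          (use open_WUV sub in \<open>auto simp: openin_open_eq[OF open_nonzero] subspace_model gamma_U gU_def
            intro: holomorphic_map_cong[OF csheaf_model Z hU]\<close>)
    next
      assume "y \<in> WV"
      then show ?thesis
        by (intro exI[of _ WV])
          (use open_WUV sub in \<open>auto simp: openin_open_eq[OF open_nonzero] subspace_model gamma_V gV_def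
            intro: holomorphic_map_cong[OF csheaf_model Z hV]\<close>)
    qed
  qed
  then show "holomorphic_map projective_space Z \<gamma>"
    unfolding projective_space_def by (simp add: holomorphic_map_quotient_iff[OF Z])
  fix P assume "P \<in> pts (projective_space :: (complex^2) set cspace)"
  then show "\<gamma> P \<in> L" using gamma_in_L by auto
qed

lemma eta_holomorphic: "holomorphic_map (subspace_of Z L) projective_space \<eta>"
proof (rule holomorphic_map_local[OF csheaf_subspace[OF Z] csheaf_projective_space])
  fix p assume "p \<in> pts (subspace_of Z L)"
  then have p: "p \<in> L" by simp
  have pr: "holomorphic_map (model (- {0})) projective_space (line_through :: complex^2 \<Rightarrow> _)"
    unfolding projective_space_def by (rule holomorphic_map_quotient_proj)
  have *: "holomorphic_map (subspace_of (subspace_of Z L) (D \<inter> L)) projective_space \<eta>"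
    if ch: "(D, f) \<in> charts Z" and g: "\<And>i. hol_on (f ` D) (\<lambda>v. g v $ i)" "\<And>v. v \<in> f ` D \<Longrightarrow> g v \<noteq> 0"
      and e: "\<And>p. p \<in> D \<Longrightarrow> p \<in> L \<Longrightarrow> \<eta> p = line_through (g (f p))" for D and f :: "'a \<Rightarrow> complex^(1 + 2)" and g
  proof -
    have o: "openin (ctop Z) D" "open (f ` D)" and h: "holomorphic_map (subspace_of Z D) (model (f ` D)) f"
      using ch unfolding charts_iff biholomorphic_map_def by auto
    have "holomorphic_map (model (f ` D)) (model (- {0})) g"
      by (rule holomorphic_map_model_open[OF o(2)]) (use g in auto)
    from holomorphic_map_compose[OF h holomorphic_map_compose[OF this pr]]
    have "holomorphic_map (subspace_of Z D) projective_space (line_through \<circ> g \<circ> f)" .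
    from holomorphic_map_from_subspace[OF csheaf_subspace[OF Z] csheaf_projective_space this, of "D \<inter> L"]
    have 1: "holomorphic_map (subspace_of Z (D \<inter> L)) projective_space (line_through \<circ> g \<circ> f)"
      by (simp add: subspace_subspace[OF Z] Int_absorb1)
    have "holomorphic_map (subspace_of Z (D \<inter> L)) projective_space \<eta>"
      by (rule holomorphic_map_cong[OF csheaf_subspace[OF Z] csheaf_projective_space 1]) (use e in auto)
    moreover have "L \<inter> (D \<inter> L) = D \<inter> L" by blast
    ultimately show ?thesis by (simp add: subspace_subspace[OF Z])
  qed
  have op: "openin (ctop (subspace_of Z L)) (U \<inter> L)" "openin (ctop (subspace_of Z L)) (V \<inter> L)"
    using oU oV by (auto simp: openin_subtopology)
  have hU: "holomorphic_map (subspace_of (subspace_of Z L) (U \<inter> L)) projective_space \<eta>"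
    by (rule *[OF chU, of "\<lambda>v. vec2 (- A * v $ Inl 1) (1 + \<beta> * v $ Inl 1)"])
      (use nz in \<open>auto simp: eta_U vec2_eq_iff intro!: hol_on_vec2 hol_on_mult hol_on_uminus hol_on_add\<close>)
  have hV: "holomorphic_map (subspace_of (subspace_of Z L) (V \<inter> L)) projective_space \<eta>"
    by (rule *[OF chV, of "\<lambda>v. vec2 (1 + cnj \<beta> * v $ Inl 1) (v $ Inl 1)"])
      (auto simp: eta_V vec2_eq_iff intro!: hol_on_vec2 hol_on_mult hol_on_uminus hol_on_add)
  show "\<exists>U. openin (ctop (subspace_of Z L)) U \<and> p \<in> U \<and> holomorphic_map (subspace_of (subspace_of Z L) U) projective_space \<eta>"
    using p cover hU hV op by blast
qed

lemma gamma_biholomorphic: "biholomorphic_map projective_space (subspace_of Z L) \<gamma>"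
proof (rule biholomorphic_mapI[OF gamma_holomorphic eta_holomorphic])
  fix P assume "P \<in> pts (projective_space :: (complex^2) set cspace)"
  then show "\<eta> (\<gamma> P) = P" using eta_gamma by auto
next
  fix q assume "q \<in> pts (subspace_of Z L)"
  then show "\<gamma> (\<eta> q) = q" using cover gamma_eta_U(2) gamma_eta_V(2) by auto
qed

section \<open>Frames of the pulled-back normal bundle\<close>

abbreviation NL :: "(('a, 1 + 2) chart, (complex^2) set, 2) cocycle" where
  "NL \<equiv> pullback_bundle projective_space \<gamma> (normal_bundle Z L)"

lemma NL_bundle: "holomorphic_bundle projective_space NL"
proof (rule holomorphic_bundle_pullback[OF csheaf_subspace[OF Z] csheaf_projective_space gamma_holomorphic])
  show "holomorphic_bundle (subspace_of Z L) (normal_bundle Z L :: (('a, 1 + 2) chart, 'a, 2) cocycle)"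
    by (rule holomorphic_bundle_normal_bundle[OF Z LZ]) (use cover cU cV in blast)
qed

lemma patch_NL: "y \<noteq> 0 \<Longrightarrow> line_through y \<in> patch NL (U, \<phi>) \<longleftrightarrow> y \<in> WU"
  "y \<noteq> 0 \<Longrightarrow> line_through y \<in> patch NL (V, \<psi>) \<longleftrightarrow> y \<in> WV"
  using WU_iff WV_iff gamma_in_L by (auto simp: chol_pullback_patch normal_bundle_simps)

text \<open>Substituting x = - y0 / L3 turns cnj \<beta> + s x into - A L2 / L3 and 1 + \<beta> x
  into A y1 / L3; the matrix of \<open>jac\<close> then becomes the one in the last assumption, from
  which A has dropped out.\<close>

lemma bundle_iso_NL:
  assumes hol: "\<And>a r. hol_on WU (\<lambda>y. H y $ a $ r)" "\<And>a r. hol_on WV (\<lambda>y. K y $ a $ r)"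
    and inv: "\<And>y. y \<in> WU \<Longrightarrow> invertible (H y)" "\<And>y. y \<in> WV \<Longrightarrow> invertible (K y)"
    and hom: "\<And>y c a r. y \<in> WU \<Longrightarrow> c \<noteq> 0 \<Longrightarrow> H (c *s y) $ a $ r = c powi (- k r) * H y $ a $ r"
      "\<And>y c a r. y \<in> WV \<Longrightarrow> c \<noteq> 0 \<Longrightarrow> K (c *s y) $ a $ r = c powi (- k r) * K y $ a $ r"
    and tr: "\<And>y. y \<in> WU \<Longrightarrow> y \<in> WV \<Longrightarrow>
      mat22 (- (y $ 1 * L3 y) / (y $ 0 * L2 y)) 0 (\<kappa> * \<beta> * y $ 1 / L2 y) (\<beta> / cnj \<beta>) ** H y = K y"
  shows "bundle_iso projective_space NL (O_sum k)"
proof (rule bundle_iso_O_sumI[OF NL_bundle])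
  let ?F = "\<lambda>c. if c = (U, \<phi>) then H else K"
  have idx: "(U, \<phi>) \<in> idx NL" "(V, \<psi>) \<in> idx NL"
    using cU cV by (auto simp: chol_pullback_patch normal_bundle_simps)
  show "{(U, \<phi>), (V, \<psi>)} \<subseteq> idx NL" using idx by simp
  show "\<exists>j\<in>{(U, \<phi>), (V, \<psi>)}. line_through y \<in> patch NL j" if "y \<noteq> 0" for y
    using WUV_cover[OF that] patch_NL[OF that] by auto
  have pW: "{y. y \<noteq> 0 \<and> line_through y \<in> patch NL (U, \<phi>)} = WU" "{y. y \<noteq> 0 \<and> line_through y \<in> patch NL (V, \<psi>)} = WV"
    using patch_NL WUV_nonzero by auto
  have id: "trans NL c c P = mat 1" if "c \<in> idx NL" "P \<in> patch NL c" for c P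
    using NL_bundle that unfolding holomorphic_bundle_def by blast
  have coc: "trans NL c d P ** trans NL d e P = trans NL c e P"
    if "c \<in> idx NL" "d \<in> idx NL" "e \<in> idx NL" "P \<in> patch NL c \<inter> patch NL d \<inter> patch NL e" for c d e P
    using NL_bundle that unfolding holomorphic_bundle_def by blast
  have VU: "trans NL (V, \<psi>) (U, \<phi>) (line_through y) ** H y = K y" if y: "y \<in> WU" "y \<in> WV" for y
  proof -
    let ?p = "\<gamma> (line_through y)"
    have y0: "y \<noteq> 0" using y by (auto simp: WU_def)
    have p: "?p \<in> U \<inter> V \<inter> L" using y WU_iff WV_iff gamma_in_L y0 by blast
    have x: "\<phi> ?p $ Inl 1 = - y $ 0 / L3 y" using gU[OF y(1)] by (simp add: gamma_U[OF y(1)] vU_def)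
    have e: "cnj \<beta> + s * (- y $ 0 / L3 y) = - A * L2 y / L3 y"
      using y by (simp add: WU_def field_simps) (simp add: L3_def L2_def s algebra_simps)
    have e2: "1 + \<beta> * (- y $ 0 / L3 y) = A * y $ 1 / L3 y"
      using y by (simp add: WU_def field_simps) (simp add: L3_def algebra_simps)
    have "trans NL (V, \<psi>) (U, \<phi>) (line_through y) = trans (normal_bundle Z L) (V, \<psi>) (U, \<phi>) ?p"
      by (simp add: chol_pullback_patch)
    also have "\<dots> = mat22 (- (y $ 1 * L3 y) / (y $ 0 * L2 y)) 0 (\<kappa> * \<beta> * y $ 1 / L2 y) (\<beta> / cnj \<beta>)"
      unfolding jac[OF p] x e e2 using y nz by (simp add: mat22_eq_iff WU_def WV_def field_simps)
    finally show ?thesis using tr[OF y] by simp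
  qed
  have UV: "trans NL (U, \<phi>) (V, \<psi>) (line_through y) ** K y = H y" if y: "y \<in> WU" "y \<in> WV" for y
  proof -
    have "y \<noteq> 0" using y by (auto simp: WU_def)
    then have "trans NL (U, \<phi>) (V, \<psi>) (line_through y) ** trans NL (V, \<psi>) (U, \<phi>) (line_through y) = mat 1"
      using coc[OF idx idx(1), of "line_through y"] id[OF idx(1)] patch_NL y by simp
    then show ?thesis unfolding VU[OF y, symmetric] by (simp add: matrix_mul_assoc)
  qed
  have "trans NL c d (line_through y) ** ?F d y = ?F c y"
    if "c \<in> {(U, \<phi>), (V, \<psi>)}" "d \<in> {(U, \<phi>), (V, \<psi>)}" "y \<noteq> 0" "line_through y \<in> patch NL c \<inter> patch NL d" for c d y
  \<comment> \<open>If both charts are the same, \<open>?F\<close> selects \<open>H\<close> on all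
    of the curve and only the identity transition occurs.\<close>
  proof (cases "(V, \<psi>) = (U, \<phi>)")
    case True
    then have "c = (U, \<phi>)" "d = (U, \<phi>)" using that by auto
    then show ?thesis using id[OF idx(1), of "line_through y"] that by simp
  next
    case False
    then have n: "(V, \<psi>) \<noteq> (U, \<phi>)" .
    show ?thesis
      using that id[OF idx(1), of "line_through y"] id[OF idx(2), of "line_through y"] VU[of y] UV[of y] n
        patch_NL[OF that(3)]
      by (auto simp del: Pair_inject prod.inject)
  qed
  then show "homogeneous_frame NL {(U, \<phi>), (V, \<psi>)} k ?F"
    unfolding homogeneous_frame_def using hol inv hom pW patch_NL by auto
qed

lemma hol_on_frame_entries:
  assumes "hol_on W f" "hol_on W g" "hol_on W h" "hol_on W l"
  shows "hol_on W (\<lambda>y. mat22 (f y) (g y) (h y) (l y) $ a $ r)"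
  using assms by (cases "a = 0"; cases "r = 0") (auto simp: mat22_def vec2_def)

text \<open>For \<kappa> = 0 the transition matrix is diagonal. Its nonconstant entry is a quotient
  of y1 L3, which has no zero on \<open>WU\<close>, and y0 L2, which has none on \<open>WV\<close>;
  the inverses of these quadratic forms give the column of weight -2.\<close>

lemma splits_0_2: assumes "\<kappa> = 0" shows "normal_bundle_splits_as Z L 0 2"
proof -
  define H where "H y = mat22 0 (- 1 / (y $ 1 * L3 y)) 1 0" for y
  define K where "K y = mat22 0 (1 / (y $ 0 * L2 y)) (\<beta> / cnj \<beta>) 0" for y
  have "bundle_iso projective_space NL (O_sum (\<lambda>r. if r = 0 then 0 else 2))"
  proof (rule bundle_iso_NL[of H K])
    show "hol_on WU (\<lambda>y. H y $ a $ r)" for a r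
      unfolding H_def by (intro hol_on_frame_entries hol_on_divide hol_on_mult hol_on_const hol_on_coord hol_on_L23) (auto simp: WU_def)
    show "hol_on WV (\<lambda>y. K y $ a $ r)" for a r
      unfolding K_def by (intro hol_on_frame_entries hol_on_divide hol_on_mult hol_on_const hol_on_coord hol_on_L23) (auto simp: WV_def nz)
    show "invertible (H y)" if "y \<in> WU" for y unfolding H_def by (rule invertible_mat22) (use that in \<open>auto simp: WU_def\<close>)
    show "invertible (K y)" if "y \<in> WV" for y unfolding K_def by (rule invertible_mat22) (use that nz in \<open>auto simp: WV_def\<close>)
    show "H (c *s y) $ a $ r = c powi - (if r = 0 then 0 else 2) * H y $ a $ r" if "c \<noteq> 0" for y c a r
      using that exhaust_2[of a] exhaust_2[of r] by (auto simp: H_def power_int_minus power2_eq_square field_simps)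
    show "K (c *s y) $ a $ r = c powi - (if r = 0 then 0 else 2) * K y $ a $ r" if "c \<noteq> 0" for y c a r
      using that exhaust_2[of a] exhaust_2[of r] by (auto simp: K_def power_int_minus power2_eq_square field_simps)
    show "mat22 (- (y $ 1 * L3 y) / (y $ 0 * L2 y)) 0 (\<kappa> * \<beta> * y $ 1 / L2 y) (\<beta> / cnj \<beta>) ** H y = K y" if "y \<in> WU" "y \<in> WV" for y
      using that by (auto simp: H_def K_def assms mat22_eq_iff matrix_matrix_mult_def sum_2' WU_def)
  qed
  then show ?thesis unfolding normal_bundle_splits_as_def using gamma_biholomorphic by blast
qed

text \<open>After a twist by O(-1) the quotient O(2) becomes O(1), with sections \<open>L2\<close>
  and \<open>L3\<close>, and both lift because H^1(O(-1)) = 0: up to sign they are y1 L3 times the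
  first row of \<open>H\<close> and y0 L2 times that of \<open>K\<close>. The determinant of
  \<open>H\<close> is \<kappa> cnj \<beta> / (y1 L3), so the lifts form a frame when \<kappa>
  \<noteq> 0.\<close>

lemma splits_1_1: assumes "\<kappa> \<noteq> 0" shows "bundle_iso projective_space NL (O_sum (\<lambda>r. 1))"
proof -
  define H where "H y = mat22 (- L2 y / (y $ 1 * L3 y)) (- 1 / y $ 1) (\<kappa> * cnj \<beta> / L3 y) 0" for y
  define K where "K y = mat22 (1 / y $ 0) (L3 y / (y $ 0 * L2 y)) 0 (- \<kappa> * \<beta> / L2 y)" for y
  show "bundle_iso projective_space NL (O_sum (\<lambda>r. 1))"
  proof (rule bundle_iso_NL[of H K])
    show "hol_on WU (\<lambda>y. H y $ a $ r)" for a r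
      unfolding H_def by (intro hol_on_frame_entries hol_on_divide hol_on_mult hol_on_uminus hol_on_const hol_on_coord hol_on_L23) (auto simp: WU_def)
    show "hol_on WV (\<lambda>y. K y $ a $ r)" for a r
      unfolding K_def by (intro hol_on_frame_entries hol_on_divide hol_on_mult hol_on_uminus hol_on_const hol_on_coord hol_on_L23) (auto simp: WV_def nz)
    show "invertible (H y)" if "y \<in> WU" for y unfolding H_def by (rule invertible_mat22) (use that assms nz in \<open>auto simp: WU_def\<close>)
    show "invertible (K y)" if "y \<in> WV" for y unfolding K_def by (rule invertible_mat22) (use that assms nz in \<open>auto simp: WV_def\<close>)
    show "H (c *s y) $ a $ r = c powi - 1 * H y $ a $ r" if "c \<noteq> 0" for y c a r
      using that exhaust_2[of a] exhaust_2[of r] by (auto simp: H_def power_int_minus field_simps)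
    show "K (c *s y) $ a $ r = c powi - 1 * K y $ a $ r" if "c \<noteq> 0" for y c a r
      using that exhaust_2[of a] exhaust_2[of r] by (auto simp: K_def power_int_minus field_simps)
    show "mat22 (- (y $ 1 * L3 y) / (y $ 0 * L2 y)) 0 (\<kappa> * \<beta> * y $ 1 / L2 y) (\<beta> / cnj \<beta>) ** H y = K y" if "y \<in> WU" "y \<in> WV" for y
      using that nz by (auto simp: H_def K_def mat22_eq_iff matrix_matrix_mult_def sum_2' WU_def WV_def field_simps)
  qed
qed

theorem normal_bundle_splitting:
  "(normal_bundle_splits_as Z L 1 1 \<or> normal_bundle_splits_as Z L 0 2) \<and>
   (normal_bundle_splits_as Z L 0 2 \<longleftrightarrow> \<kappa> = 0)"
proof (cases "\<kappa> = 0")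
  case True
  then show ?thesis using splits_0_2 by blast
next
  case False
  have "normal_bundle_splits_as Z L 1 1"
    unfolding normal_bundle_splits_as_def using gamma_biholomorphic splits_1_1[OF False] by auto
  \<comment> \<open>The parametrisation hidden in \<open>normal_bundle_splits_as\<close> may differ
    from \<open>\<gamma>\<close>, which is why the types are compared for two
    parametrisations.\<close>
  moreover have "\<not> normal_bundle_splits_as Z L 0 2"
    using splitting_types_distinct[OF csheaf_subspace[OF Z] gamma_biholomorphic _ splits_1_1[OF False]]
    unfolding normal_bundle_splits_as_def by blast
  ultimately show ?thesis using False by blast
qed

end

section \<open>Charts of the local resolution\<close>

text \<open>Makes \<open>holomorphic_map_quotient_iff\<close> applicable to an open piece of a
  quotient.\<close>

lemma subspace_quotient:
  assumes "openin (ctop (quotient_space C \<pi>)) D"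
  shows "subspace_of (quotient_space C \<pi>) D = quotient_space (C \<inter> \<pi> -` D) \<pi>"
proof -
  let ?C = "C \<inter> \<pi> -` D"
  have D: "D \<subseteq> \<pi> ` C" "openin (top_of_set C) ?C" using assms by (auto simp: openin_quotient_space)
  have im: "\<pi> ` ?C = D" using D by auto
  have m: "model ?C = subspace_of (model C) ?C" by (simp add: subspace_model)
  have pre: "?C \<inter> \<pi> -` U = C \<inter> \<pi> -` U" if "U \<subseteq> D" for U using that by auto
  have "f \<in> chol (subspace_of (quotient_space C \<pi>) D) U \<longleftrightarrow> f \<in> chol (quotient_space ?C \<pi>) U" for f U
  proof (cases "U \<subseteq> D")
    case True
    have "f \<circ> \<pi> \<in> chol (model ?C) (C \<inter> \<pi> -` U) \<longleftrightarrow> f \<circ> \<pi> \<in> chol (model C) (C \<inter> \<pi> -` U)"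
      unfolding m using chol_subspace_open[OF csheaf_model, of C ?C] D(2) True by auto
    then show ?thesis using True D
      by (auto simp: chol_subspace_open[OF csheaf_quotient_space assms] chol_quotient_space im pre)
  qed (auto simp: chol_subspace_open[OF csheaf_quotient_space assms] chol_quotient_space im)
  then have 1: "chol (subspace_of (quotient_space C \<pi>) D) = chol (quotient_space ?C \<pi>)"
    by (auto simp: fun_eq_iff set_eq_iff)
  have "openin (subtopology (ctop (quotient_space C \<pi>)) D) U \<longleftrightarrow> openin (ctop (quotient_space ?C \<pi>)) U" for U
  proof (cases "U \<subseteq> D")
    case True
    have "openin (top_of_set C) (C \<inter> \<pi> -` U) \<longleftrightarrow> openin (top_of_set ?C) (C \<inter> \<pi> -` U)"
      using D(2) True by (metis (no_types, lifting) Int_mono inf_le1 openin_subset_trans openin_trans order_refl pre topspace_euclidean_subtopology vimage_mono Int_lower1)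
    then show ?thesis using True D
      by (auto simp: openin_open_subtopology[OF assms] openin_quotient_space im pre)
  qed (auto simp: openin_open_subtopology[OF assms] openin_quotient_space im)
  then have "ctop (subspace_of (quotient_space C \<pi>) D) = ctop (quotient_space ?C \<pi>)"
    by (simp add: topology_eq)
  with 1 show ?thesis by (intro cspace.equality) auto
qed

text \<open>A chart of a quotient arises from a map \<open>q\<close> that is constant on the fibres
  of \<open>\<pi>\<close> and a holomorphic slice \<open>\<Lambda>\<close> that inverts it modulo
  \<open>\<pi>\<close>. The predicate \<open>P\<close> describes the saturated open set on which
  this works.\<close>

lemma quotient_chart:
  assumes DC: "D = {w \<in> C. P w}" and oD: "openin (top_of_set C) D"
    and sat: "\<And>w w'. w \<in> C \<Longrightarrow> w' \<in> C \<Longrightarrow> \<pi> w = \<pi> w' \<Longrightarrow> P w \<Longrightarrow> P w' \<and> q w' = q w"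
    and q: "\<And>w. w \<in> D \<Longrightarrow> q w \<in> T" and qh: "\<And>i. hol_on W (\<lambda>w. q w $ i)" and W: "open W" "D \<subseteq> W"
    and T: "open T" and Lm: "\<And>v. v \<in> T \<Longrightarrow> \<Lambda> v \<in> D \<and> q (\<Lambda> v) = v" and Lh: "\<And>i. hol_on T (\<lambda>v. \<Lambda> v $ i)"
    and key: "\<And>w. w \<in> D \<Longrightarrow> \<pi> (\<Lambda> (q w)) = \<pi> w"
  shows "openin (ctop (quotient_space C \<pi>)) (\<pi> ` D)"
    and "\<exists>\<psi>. biholomorphic_map (subspace_of (quotient_space C \<pi>) (\<pi> ` D)) (model T) \<psi> \<and>
           (\<forall>w\<in>D. \<psi> (\<pi> w) = q w) \<and> (\<forall>v\<in>T. \<psi> (\<pi> (\<Lambda> v)) = v)"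
proof -
  have pre: "C \<inter> \<pi> -` (\<pi> ` D) = D"
  proof
    show "C \<inter> \<pi> -` (\<pi> ` D) \<subseteq> D"
    proof
      fix w assume "w \<in> C \<inter> \<pi> -` (\<pi> ` D)"
      then obtain w' where w': "w' \<in> D" "w \<in> C" "\<pi> w = \<pi> w'" by auto
      then show "w \<in> D" using sat[of w' w] unfolding DC by simp
    qed
  qed (auto simp: DC)
  show o: "openin (ctop (quotient_space C \<pi>)) (\<pi> ` D)"
    unfolding openin_quotient_space pre using oD DC by auto
  define \<psi> where "\<psi> r = q (SOME w. w \<in> C \<and> \<pi> w = r)" for r
  have \<psi>: "\<psi> (\<pi> w) = q w" if "w \<in> D" for w
  proof -
    have w: "w \<in> C" "P w" using that by (auto simp: DC)
    have "(SOME w'. w' \<in> C \<and> \<pi> w' = \<pi> w) \<in> C \<and> \<pi> (SOME w'. w' \<in> C \<and> \<pi> w' = \<pi> w) = \<pi> w"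
      by (rule someI[of _ w]) (use w in simp)
    then show ?thesis unfolding \<psi>_def using sat[OF w(1) _ _ w(2)] by metis
  qed
  have h1: "holomorphic_map (subspace_of (quotient_space C \<pi>) (\<pi> ` D)) (model T) \<psi>"
    unfolding subspace_quotient[OF o] pre holomorphic_map_quotient_iff[OF csheaf_model]
  proof (rule holomorphic_map_model)
    fix w assume "w \<in> D"
    then show "\<exists>W G. open W \<and> w \<in> W \<and> (\<forall>i. hol_on W (\<lambda>v. G v $ i)) \<and> (\<forall>w\<in>W \<inter> D. (\<psi> \<circ> \<pi>) w = G w)"
      using \<psi> qh W by (intro exI[of _ W] exI[of _ q]) auto
  qed (use \<psi> q in auto)
  have h2: "holomorphic_map (model T) (subspace_of (quotient_space C \<pi>) (\<pi> ` D)) (\<pi> \<circ> \<Lambda>)"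
    unfolding holomorphic_map_into_subspace[OF csheaf_model csheaf_quotient_space]
  proof
    have "holomorphic_map (model T) (model C) \<Lambda>"
      by (rule holomorphic_map_model_open[OF T]) (use Lm Lh DC in auto)
    then show "holomorphic_map (model T) (quotient_space C \<pi>) (\<pi> \<circ> \<Lambda>)"
      by (rule holomorphic_map_compose[OF _ holomorphic_map_quotient_proj])
  qed (use Lm in auto)
  have "biholomorphic_map (subspace_of (quotient_space C \<pi>) (\<pi> ` D)) (model T) \<psi>"
    by (rule biholomorphic_mapI[OF h1 h2]) (use \<psi> key Lm in auto)
  then show "\<exists>\<psi>. biholomorphic_map (subspace_of (quotient_space C \<pi>) (\<pi> ` D)) (model T) \<psi> \<and>
           (\<forall>w\<in>D. \<psi> (\<pi> w) = q w) \<and> (\<forall>v\<in>T. \<psi> (\<pi> (\<Lambda> v)) = v)"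
    using \<psi> Lm by (intro exI[of _ \<psi>]) auto
qed

text \<open>
  Both curves are treated at once: \<open>S/T\<close> is \<open>u\<close> for the curves meeting the first exceptional
  component and \<open>1/w\<close> for those meeting the third one, the roles of \<open>\<xi>\<close> and \<open>\<eta>\<close> being exchanged.
\<close>

locale resolution_chart =
  fixes C :: "(complex^'n) set" and \<pi> :: "complex^'n \<Rightarrow> 'a" and bd :: "complex^'n \<Rightarrow> complex^4"
    and S T :: "complex^'n \<Rightarrow> complex" and \<Lambda> :: "complex \<Rightarrow> complex \<Rightarrow> complex \<Rightarrow> complex^'n"
    and l R :: form and i\<xi> i\<eta> :: 4 and lam \<kappa> \<beta> g c2 :: complex
  assumes bd_hol: "\<And>i. hol_on UNIV (\<lambda>w. bd w $ i)" and S_hol: "hol_on UNIV S" and T_hol: "hol_on UNIV T"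
    and sat: "\<And>w w'. w \<in> C \<Longrightarrow> w' \<in> C \<Longrightarrow> \<pi> w = \<pi> w' \<Longrightarrow> bd w' = bd w \<and> (\<exists>c. c \<noteq> 0 \<and> S w' = c * S w \<and> T w' = c * T w)"
    and rel: "\<And>w. w \<in> C \<Longrightarrow> bd w $ i\<xi> * T w = S w * l (bd w $ 0) (bd w $ 1)"
    and ST: "\<And>w. w \<in> C \<Longrightarrow> S w \<noteq> 0 \<or> T w \<noteq> 0"
    and germ: "\<And>w. w \<in> C \<Longrightarrow> bd w $ i\<xi> * bd w $ i\<eta> = l (bd w $ 0) (bd w $ 1) * R (bd w $ 0) (bd w $ 1)"
    and Lm: "\<And>x0 x1 \<omega>. \<omega> \<noteq> 0 \<Longrightarrow> \<Lambda> x0 x1 \<omega> \<in> C \<and> bd (\<Lambda> x0 x1 \<omega>) $ 0 = x0 \<and> bd (\<Lambda> x0 x1 \<omega>) $ 1 = x1 \<and>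
        S (\<Lambda> x0 x1 \<omega>) = \<omega> \<and> T (\<Lambda> x0 x1 \<omega>) = 1"
    and Lm_hol: "\<And>(W :: (complex^(1 + 2)) set) X0 X1 \<Omega> i. hol_on W X0 \<Longrightarrow> hol_on W X1 \<Longrightarrow> hol_on W \<Omega> \<Longrightarrow>
        (\<And>v. v \<in> W \<Longrightarrow> \<Omega> v \<noteq> 0) \<Longrightarrow> hol_on W (\<lambda>v. \<Lambda> (X0 v) (X1 v) (\<Omega> v) $ i)"
    and key: "\<And>w. w \<in> C \<Longrightarrow> S w \<noteq> 0 \<Longrightarrow> T w \<noteq> 0 \<Longrightarrow> \<pi> (\<Lambda> (bd w $ 0) (bd w $ 1) (S w / T w)) = \<pi> w"
    and l: "\<And>x. l (lam * x) x = \<kappa> * x" and R: "\<And>x. R (lam * x) x = R lam 1 * x ^ 3"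
    and nz: "\<kappa> \<noteq> 0" "R lam 1 \<noteq> 0" "g \<noteq> 0"
begin

text \<open>This is \<omega> = S/T expressed in the chart \<open>qq\<close>, whose third coordinate
  is n = \<kappa> \<omega> + g (1 + \<beta> x) + c2 m. The constant \<open>g\<close> makes n vanish
  on the curve; the multiple of m does not affect the curve and is left free, to be used for
  normalising the Jacobian.\<close>

definition om :: "complex^(1 + 2) \<Rightarrow> complex" where
  "om v = (v $ Inr 1 - g * (1 + \<beta> * v $ Inl 1) - c2 * v $ Inr 0) / \<kappa>"

definition T0 :: "(complex^(1 + 2)) set" where "T0 = {v. om v \<noteq> 0}"

definition qq :: "complex^'n \<Rightarrow> complex^(1 + 2)" where
  "qq w = vec12 (bd w $ 1) (bd w $ 0 - lam * bd w $ 1)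
     (\<kappa> * (S w / T w) + g * (1 + \<beta> * bd w $ 1) + c2 * (bd w $ 0 - lam * bd w $ 1))"

definition lift :: "complex^(1 + 2) \<Rightarrow> complex^'n" where
  "lift v = \<Lambda> (v $ Inr 0 + lam * v $ Inl 1) (v $ Inl 1) (om v)"

definition DD :: "(complex^'n) set" where "DD = {w \<in> C. S w \<noteq> 0 \<and> T w \<noteq> 0}"

lemma om_hol: "hol_on W om"
  unfolding om_def by (intro hol_on_divide hol_on_diff hol_on_mult hol_on_add hol_on_const hol_on_coord) (simp add: nz)

lemma open_T0: "open T0"
  unfolding T0_def using open_Collect_neq[OF hol_on_continuous[OF om_hol] continuous_on_const] by blast

lemma om_qq: "om (qq w) = S w / T w"
  using nz by (simp add: om_def qq_def)

lemma chart_facts: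
  "openin (top_of_set C) DD"
  "\<And>w w'. w \<in> C \<Longrightarrow> w' \<in> C \<Longrightarrow> \<pi> w = \<pi> w' \<Longrightarrow> S w \<noteq> 0 \<and> T w \<noteq> 0 \<Longrightarrow> (S w' \<noteq> 0 \<and> T w' \<noteq> 0) \<and> qq w' = qq w"
  "\<And>w. w \<in> DD \<Longrightarrow> qq w \<in> T0"
  "open {w. T w \<noteq> 0}" "\<And>i. hol_on {w. T w \<noteq> 0} (\<lambda>w. qq w $ i)"
  "\<And>v. v \<in> T0 \<Longrightarrow> lift v \<in> DD \<and> qq (lift v) = v" "\<And>i. hol_on T0 (\<lambda>v. lift v $ i)"
  "\<And>w. w \<in> DD \<Longrightarrow> \<pi> (lift (qq w)) = \<pi> w"
proof -
  have "open {w. S w \<noteq> 0}" and oT: "open {w. T w \<noteq> 0}"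
    using open_Collect_neq[OF hol_on_continuous[OF S_hol] continuous_on_const]
      open_Collect_neq[OF hol_on_continuous[OF T_hol] continuous_on_const] by blast+
  moreover have "DD = C \<inter> ({w. S w \<noteq> 0} \<inter> {w. T w \<noteq> 0})" by (auto simp: DD_def)
  ultimately show "openin (top_of_set C) DD" by (metis open_Int openin_open_Int)
  show "open {w. T w \<noteq> 0}" by fact
  show "(S w' \<noteq> 0 \<and> T w' \<noteq> 0) \<and> qq w' = qq w" if "w \<in> C" "w' \<in> C" "\<pi> w = \<pi> w'" "S w \<noteq> 0 \<and> T w \<noteq> 0" for w w'
    using sat[OF that(1-3)] that(4) by (auto simp: qq_def)
  show "qq w \<in> T0" if "w \<in> DD" for w using that by (simp add: T0_def om_qq DD_def)
  show "hol_on {w. T w \<noteq> 0} (\<lambda>w. qq w $ i)" for i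
    unfolding qq_def
    by (intro hol_on_vec12 hol_on_diff hol_on_add hol_on_mult hol_on_const hol_on_divide
        hol_on_subset[OF bd_hol] hol_on_subset[OF S_hol] hol_on_subset[OF T_hol]) auto
  show "lift v \<in> DD \<and> qq (lift v) = v" if "v \<in> T0" for v
    using Lm[of "om v"] that nz unfolding T0_def DD_def
    by (simp add: lift_def qq_def vec12_eq_iff) (simp add: om_def)
  show "hol_on T0 (\<lambda>v. lift v $ i)" for i
    unfolding lift_def
    by (rule Lm_hol) (auto simp: T0_def intro!: hol_on_add hol_on_mult om_hol)
  show "\<pi> (lift (qq w)) = \<pi> w" if "w \<in> DD" for w
    using key[of w] that unfolding lift_def om_qq DD_def by (simp add: qq_def)
qed

definition D :: "'a set" where "D = \<pi> ` DD"

lemma DD_sub: "DD \<subseteq> {w. T w \<noteq> 0}"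
  by (auto simp: DD_def)

abbreviation QS :: "'a cspace" where "QS \<equiv> quotient_space C \<pi>"

lemma open_D: "openin (ctop QS) D"
  unfolding D_def
  by (rule quotient_chart(1)[where P = "\<lambda>w. S w \<noteq> 0 \<and> T w \<noteq> 0" and W = "{w. T w \<noteq> 0}" and q = qq and \<Lambda> = lift and T = T0 and \<pi> = \<pi> and D = DD and C = C,
        OF DD_def chart_facts(1,2,3) chart_facts(5,4) DD_sub open_T0 chart_facts(6,7,8)])

lemma chart_exists:
  "\<exists>\<psi>. biholomorphic_map (subspace_of QS D) (model T0) \<psi> \<and> (\<forall>w\<in>DD. \<psi> (\<pi> w) = qq w) \<and> (\<forall>v\<in>T0. \<psi> (\<pi> (lift v)) = v)"
  unfolding D_def
  by (rule quotient_chart(2)[where P = "\<lambda>w. S w \<noteq> 0 \<and> T w \<noteq> 0" and W = "{w. T w \<noteq> 0}" and q = qq and \<Lambda> = lift and T = T0 and \<pi> = \<pi> and D = DD and C = C,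
        OF DD_def chart_facts(1,2,3) chart_facts(5,4) DD_sub open_T0 chart_facts(6,7,8)])

text \<open>The part of the curve with x1 \<noteq> 0, hence off the exceptional curves, described by
  equations in the coordinates downstairs. Its closure is the proper transform over y3 \<noteq>
  0.\<close>

definition Gam :: "'a set" where
  "Gam = {r. \<exists>w\<in>C. r = \<pi> w \<and> bd w $ 1 \<noteq> 0 \<and> bd w $ 0 = lam * bd w $ 1 \<and> bd w $ i\<xi> = - g * bd w $ 1 * (1 + \<beta> * bd w $ 1)}"

lemma closed_coordinates:
  assumes "hol_on UNIV F" "\<And>w w'. w \<in> C \<Longrightarrow> w' \<in> C \<Longrightarrow> \<pi> w = \<pi> w' \<Longrightarrow> F w = 0 \<Longrightarrow> F w' = 0"
  shows "closedin (ctop QS) {r. \<exists>w\<in>C. r = \<pi> w \<and> F w = 0}"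
  unfolding closedin_def
proof
  let ?E = "{r. \<exists>w\<in>C. r = \<pi> w \<and> F w = 0}"
  show "?E \<subseteq> topspace (ctop QS)" by auto
  have "C \<inter> \<pi> -` (topspace (ctop QS) - ?E) = C \<inter> {w. F w \<noteq> 0}"
  proof (intro equalityI subsetI)
    fix w assume "w \<in> C \<inter> {w. F w \<noteq> 0}"
    then show "w \<in> C \<inter> \<pi> -` (topspace (ctop QS) - ?E)" using assms(2)[of _ w] by fastforce
  qed auto
  moreover have "open {w. F w \<noteq> 0}"
    using open_Collect_neq[OF hol_on_continuous[OF assms(1)] continuous_on_const] by blast
  ultimately show "openin (ctop QS) (topspace (ctop QS) - ?E)"
    unfolding openin_quotient_space by (auto simp: openin_open_Int)
qed

lemma line_mem:
  assumes "vec12 x 0 0 \<in> T0" "x \<noteq> 0" shows "\<pi> (lift (vec12 x 0 0)) \<in> Gam"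
proof -
  let ?w = "lift (vec12 x 0 0)"
  have w: "?w \<in> C" using chart_facts(6)[OF assms(1)] by (simp add: DD_def)
  have L: "bd ?w $ 0 = lam * x" "bd ?w $ 1 = x" "S ?w = om (vec12 x 0 0)" "T ?w = 1"
    using Lm[of "om (vec12 x 0 0)"] assms by (auto simp: lift_def T0_def)
  have "bd ?w $ i\<xi> = om (vec12 x 0 0) * (\<kappa> * x)" using rel[OF w] by (simp add: L l)
  also have "\<dots> = - g * x * (1 + \<beta> * x)" using nz by (simp add: om_def field_simps)
  finally show ?thesis unfolding Gam_def using w assms by (auto simp: L)
qed

text \<open>In one direction three equations that hold on \<open>Gam\<close> and define closed sets
  are used; two of them come from \<open>rel\<close> and \<open>germ\<close> by cancelling a factor
  x1, which keeps them informative over the singular point. In the other direction points with x1 =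
  0 are approximated by points of \<open>Gam\<close>.\<close>

lemma closure_Gam:
  assumes \<psi>: "\<And>w. w \<in> DD \<Longrightarrow> \<psi> (\<pi> w) = qq w"
  shows "r \<in> ctop QS closure_of Gam \<longleftrightarrow> r \<in> D \<and> \<psi> r $ Inr 0 = 0 \<and> \<psi> r $ Inr 1 = 0"
proof
  assume r: "r \<in> ctop QS closure_of Gam"
  let ?F1 = "\<lambda>w. bd w $ 0 - lam * bd w $ 1"
  let ?F2 = "\<lambda>w. S w * \<kappa> + g * (1 + \<beta> * bd w $ 1) * T w"
  let ?F3 = "\<lambda>w. g * (1 + \<beta> * bd w $ 1) * bd w $ i\<eta> + \<kappa> * R lam 1 * (bd w $ 1) ^ 3"
  have in_closed: "r \<in> {r. \<exists>w\<in>C. r = \<pi> w \<and> F w = 0}"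
    if "hol_on UNIV F" "\<And>w w'. w \<in> C \<Longrightarrow> w' \<in> C \<Longrightarrow> \<pi> w = \<pi> w' \<Longrightarrow> F w = 0 \<Longrightarrow> F w' = 0"
      "\<And>w. w \<in> C \<Longrightarrow> bd w $ 1 \<noteq> 0 \<Longrightarrow> bd w $ 0 = lam * bd w $ 1 \<Longrightarrow> bd w $ i\<xi> = - g * bd w $ 1 * (1 + \<beta> * bd w $ 1) \<Longrightarrow> F w = 0" for F
  proof -
    have "Gam \<subseteq> {r. \<exists>w\<in>C. r = \<pi> w \<and> F w = 0}" using that(3) unfolding Gam_def by blast
    moreover have "closedin (ctop QS) {r. \<exists>w\<in>C. r = \<pi> w \<and> F w = 0}"
      by (rule closed_coordinates[OF that(1)]) (fact that(2))
    ultimately show ?thesis using closure_of_minimal r by blast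
  qed
  have 1: "r \<in> {r. \<exists>w\<in>C. r = \<pi> w \<and> ?F1 w = 0}"
  proof (rule in_closed)
    show "hol_on UNIV ?F1" by (intro hol_on_diff hol_on_mult bd_hol hol_on_const)
    show "?F1 w' = 0" if "w \<in> C" "w' \<in> C" "\<pi> w = \<pi> w'" "?F1 w = 0" for w w'
      using sat[OF that(1-3)] that(4) by simp
  qed simp
  have 2: "r \<in> {r. \<exists>w\<in>C. r = \<pi> w \<and> ?F2 w = 0}"
  proof (rule in_closed)
    show "hol_on UNIV ?F2" by (intro hol_on_add hol_on_mult bd_hol S_hol T_hol hol_on_const)
    show "?F2 w' = 0" if w: "w \<in> C" "w' \<in> C" "\<pi> w = \<pi> w'" "?F2 w = 0" for w w'
    proof -
      obtain c where c: "bd w' = bd w" "S w' = c * S w" "T w' = c * T w" using sat[OF w(1-3)] by auto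
      have "?F2 w' = c * ?F2 w" by (simp add: c algebra_simps)
      then show ?thesis using w by simp
    qed
    fix w assume w: "w \<in> C" "bd w $ 1 \<noteq> 0" "bd w $ 0 = lam * bd w $ 1" "bd w $ i\<xi> = - g * bd w $ 1 * (1 + \<beta> * bd w $ 1)"
    have "- g * bd w $ 1 * (1 + \<beta> * bd w $ 1) * T w = S w * (\<kappa> * bd w $ 1)" using rel[OF w(1)] w by (simp add: l)
    then have "bd w $ 1 * ?F2 w = 0" by algebra
    then show "?F2 w = 0" using w by simp
  qed
  have 3: "r \<in> {r. \<exists>w\<in>C. r = \<pi> w \<and> ?F3 w = 0}"
  proof (rule in_closed)
    show "hol_on UNIV ?F3" by (intro hol_on_add hol_on_mult hol_on_power bd_hol hol_on_const)
    show "?F3 w' = 0" if w: "w \<in> C" "w' \<in> C" "\<pi> w = \<pi> w'" "?F3 w = 0" for w w'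
      using sat[OF w(1-3)] w(4) by auto
    fix w assume w: "w \<in> C" "bd w $ 1 \<noteq> 0" "bd w $ 0 = lam * bd w $ 1" "bd w $ i\<xi> = - g * bd w $ 1 * (1 + \<beta> * bd w $ 1)"
    have "- g * bd w $ 1 * (1 + \<beta> * bd w $ 1) * bd w $ i\<eta> = \<kappa> * bd w $ 1 * (R lam 1 * (bd w $ 1) ^ 3)"
      using germ[OF w(1)] w by (simp add: l R)
    then have "bd w $ 1 * ?F3 w = 0" by algebra
    then show "?F3 w = 0" using w by simp
  qed
  obtain w where w: "w \<in> C" "r = \<pi> w" "?F1 w = 0" using 1 by blast
  obtain w2 where w2: "w2 \<in> C" "r = \<pi> w2" "?F2 w2 = 0" using 2 by blast
  obtain c where c: "c \<noteq> 0" "bd w = bd w2" "S w = c * S w2" "T w = c * T w2" using sat[OF w2(1) w(1)] w w2 by auto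
  have F2: "?F2 w = 0"
  proof -
    have "?F2 w = c * ?F2 w2" by (simp add: c algebra_simps)
    then show ?thesis using w2 by simp
  qed
  obtain w3 where w3: "w3 \<in> C" "r = \<pi> w3" "?F3 w3 = 0" using 3 by blast
  have F3: "?F3 w = 0" using sat[OF w3(1) w(1)] w w3 by auto
  \<comment> \<open>A zero of 1 + \<beta> x1 would by the third equation force x1 = 0, where 1 +
    \<beta> x1 equals 1.\<close>
  have n: "1 + \<beta> * bd w $ 1 \<noteq> 0"
  proof
    assume z: "1 + \<beta> * bd w $ 1 = 0"
    then have "bd w $ 1 = 0" using F3 nz by simp
    then show False using z by simp
  qed
  have T: "T w \<noteq> 0"
  proof
    assume z: "T w = 0"
    then have "S w = 0" using F2 nz by simp
    then show False using z ST[OF w(1)] by simp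
  qed
  have Sw: "S w / T w * \<kappa> = - (g * (1 + \<beta> * bd w $ 1))"
  proof -
    have "S w * \<kappa> = - (g * (1 + \<beta> * bd w $ 1)) * T w" using F2 by algebra
    then have "S w * \<kappa> / T w = - (g * (1 + \<beta> * bd w $ 1))" using T by simp
    then show ?thesis by simp
  qed
  have "S w \<noteq> 0" using Sw n nz by auto
  then have DD: "w \<in> DD" using T w by (simp add: DD_def)
  moreover have "qq w = vec12 (bd w $ 1) 0 0" using w Sw by (simp add: qq_def vec12_eq_iff mult.commute)
  ultimately show "r \<in> D \<and> \<psi> r $ Inr 0 = 0 \<and> \<psi> r $ Inr 1 = 0" using \<psi>[OF DD] w by (auto simp: D_def)
next
  assume A: "r \<in> D \<and> \<psi> r $ Inr 0 = 0 \<and> \<psi> r $ Inr 1 = 0"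
  then obtain w where w: "w \<in> DD" "r = \<pi> w" by (auto simp: D_def)
  define x where "x = bd w $ 1"
  have q: "qq w = vec12 x 0 0" using A \<psi>[OF w(1)] w by (simp add: vec12_eq_iff) (simp add: qq_def x_def)
  have rx: "r = \<pi> (lift (vec12 x 0 0))" using chart_facts(8)[OF w(1)] w q by simp
  have xT: "vec12 x 0 0 \<in> T0" using chart_facts(3)[OF w(1)] q by simp
  show "r \<in> ctop QS closure_of Gam"
    unfolding in_closure_of
  proof (intro conjI allI impI)
    show "r \<in> pts QS" using w by (auto simp: DD_def)
    fix U assume U: "r \<in> U \<and> openin (ctop QS) U"
    have "holomorphic_map (model T0) (model C) lift"
      by (rule holomorphic_map_model_open[OF open_T0]) (use chart_facts(6,7) in \<open>auto simp: DD_def\<close>)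
    from holomorphic_map_compose[OF this holomorphic_map_quotient_proj]
    have "continuous_map (top_of_set T0) (ctop QS) (\<pi> \<circ> lift)" using holomorphic_map_continuous by fastforce
    then have "openin (top_of_set T0) {v \<in> T0. \<pi> (lift v) \<in> U}"
      using openin_continuous_map_preimage[of "top_of_set T0" "ctop QS" "\<pi> \<circ> lift" U] U by simp
    then have o: "open {v \<in> T0. \<pi> (lift v) \<in> U}" using open_T0 openin_open_eq by blast
    have "(\<lambda>t. vec12 t 0 0) = (\<lambda>t. t *s vec12 1 0 0)" by (simp add: fun_eq_iff vec12_eq_iff)
    then have "continuous_on UNIV (\<lambda>t. vec12 t 0 0)"
      unfolding vector_scalar_mult_def by (simp only:) (intro continuous_intros)
    with o have "open ((\<lambda>t. vec12 t 0 0) -` {v \<in> T0. \<pi> (lift v) \<in> U})" (is "open ?V") by (intro open_vimage)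
    moreover have "x \<in> ?V" using U rx xT by simp
    ultimately obtain e where e: "e > 0" "ball x e \<subseteq> ?V" by (meson open_contains_ball)
    \<comment> \<open>On the exceptional fibre, x = 0, a small nonzero parameter is taken instead;
      elsewhere the point itself lies in \<open>Gam\<close>.\<close>
    define t where "t = (if x = 0 then of_real (e / 2) else x)"
    have "t \<noteq> 0" "t \<in> ball x e" using e by (auto simp: t_def dist_norm)
    then have "t \<in> ?V" using e by blast
    then show "\<exists>y. y \<in> Gam \<and> y \<in> U" using line_mem[of t] \<open>t \<noteq> 0\<close> by auto
  qed
qed

end

subsection \<open>The iterated blow-up\<close>

definition comb :: "complex^'n \<Rightarrow> complex^'m \<Rightarrow> complex^('n::finite + 'm::finite)" where
  "comb v w = (\<chi> i. case i of Inl k \<Rightarrow> v $ k | Inr k \<Rightarrow> w $ k)"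

lemma comb_nth [simp]: "comb v w $ Inl k = v $ k" "comb v w $ Inr j = w $ j"
  by (simp_all add: comb_def)

lemma hol_on_comb:
  "(\<And>k. hol_on W (\<lambda>v. f v $ k)) \<Longrightarrow> (\<And>k. hol_on W (\<lambda>v. g v $ k)) \<Longrightarrow> hol_on W (\<lambda>v. comb (f v) (g v) $ i)"
  by (cases i) auto

lemma continuous_on_comb:
  assumes "continuous_on A f" "continuous_on A g" shows "continuous_on A (\<lambda>v. comb (f v) (g v))"
  unfolding comb_def
proof (rule continuous_on_vec_lambda)
  fix i show "continuous_on A (\<lambda>x. case i of Inl k \<Rightarrow> f x $ k | Inr k \<Rightarrow> g x $ k)"
    by (cases i) (auto intro!: continuous_intros assms)
qed

lemma continuous_on_vec2:
  assumes "continuous_on A f" "continuous_on A g" shows "continuous_on A (\<lambda>v. vec2 (f v) (g v))"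
  unfolding vec2_def
proof (rule continuous_on_vec_lambda)
  fix i :: 2 show "continuous_on A (\<lambda>x. if i = 0 then f x else g x)" by (cases "i = 0") (auto simp: assms)
qed

definition v4 :: "complex \<Rightarrow> complex \<Rightarrow> complex \<Rightarrow> complex \<Rightarrow> complex^4" where
  "v4 a b c d = (\<chi> i. if i = 0 then a else if i = 1 then b else if i = 2 then c else d)"

lemma v4_nth [simp]: "v4 a b c d $ 0 = a" "v4 a b c d $ 1 = b" "v4 a b c d $ 2 = c" "v4 a b c d $ 3 = d"
  by (simp_all add: v4_def)

lemma exhaust_4': "(i::4) = 0 \<or> i = 1 \<or> i = 2 \<or> i = 3"
  using exhaust_4[of i] by auto

lemma vec4_eq_iff: "(v :: complex^4) = w \<longleftrightarrow> v $ 0 = w $ 0 \<and> v $ 1 = w $ 1 \<and> v $ 2 = w $ 2 \<and> v $ 3 = w $ 3"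
proof
  assume A: "v $ 0 = w $ 0 \<and> v $ 1 = w $ 1 \<and> v $ 2 = w $ 2 \<and> v $ 3 = w $ 3"
  have "v $ i = w $ i" for i using exhaust_4'[of i] A by (elim disjE) simp_all
  then show "v = w" by (simp add: vec_eq_iff)
qed simp

lemma hol_on_v4:
  "hol_on W f \<Longrightarrow> hol_on W g \<Longrightarrow> hol_on W h \<Longrightarrow> hol_on W k \<Longrightarrow> hol_on W (\<lambda>v. v4 (f v) (g v) (h v) (k v) $ i)"
  using exhaust_4'[of i] by auto

lemma continuous_on_v4:
  assumes "continuous_on A f" "continuous_on A g" "continuous_on A h" "continuous_on A k"
  shows "continuous_on A (\<lambda>v. v4 (f v) (g v) (h v) (k v))"
proof -
  have "continuous_on A (\<lambda>v. \<chi> i. v4 (f v) (g v) (h v) (k v) $ i)"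
  proof (rule continuous_on_vec_lambda)
    fix i :: 4 show "continuous_on A (\<lambda>v. v4 (f v) (g v) (h v) (k v) $ i)"
      using exhaust_4'[of i] assms by auto
  qed
  then show ?thesis by simp
qed

lemma blowup_coords_direct:
  "lft w \<in> C \<Longrightarrow> rgt w \<noteq> 0 \<Longrightarrow> g (lft w) \<noteq> 0 \<or> h (lft w) \<noteq> 0 \<Longrightarrow> rgt w $ 0 * h (lft w) = rgt w $ 1 * g (lft w) \<Longrightarrow>
    w \<in> blowup_coords C g h"
  unfolding blowup_coords_def by (auto intro!: subsetD[OF closure_subset])

text \<open>A point of the blow-up over the centre is reached along a path whose other nearby points
  lie on the graph.\<close>

lemma blowup_coords_limit:
  fixes c :: "complex \<Rightarrow> complex^('n::finite + 2)"
  assumes "continuous_on UNIV c" "lft (c 0) \<in> C" "rgt (c 0) \<noteq> 0"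
    and "\<forall>\<^sub>F e in at 0. lft (c e) \<in> C \<and> rgt (c e) \<noteq> 0 \<and> (g (lft (c e)) \<noteq> 0 \<or> h (lft (c e)) \<noteq> 0) \<and>
            rgt (c e) $ 0 * h (lft (c e)) = rgt (c e) $ 1 * g (lft (c e))"
  shows "c 0 \<in> blowup_coords C g h"
proof -
  let ?S = "{w. lft w \<in> C \<and> rgt w \<noteq> 0 \<and> (g (lft w) \<noteq> 0 \<or> h (lft w) \<noteq> 0) \<and> rgt w $ 0 * h (lft w) = rgt w $ 1 * g (lft w)}"
  have "(c \<longlongrightarrow> c 0) (at 0)"
    using assms(1) by (simp add: continuous_on_def)
  moreover have "\<forall>\<^sub>F e in at 0. c e \<in> closure ?S"
    using assms(4) by eventually_elim (auto intro!: subsetD[OF closure_subset])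
  ultimately have "c 0 \<in> closure ?S"
    by (intro Lim_in_closed_set[OF closed_closure]) auto
  then show ?thesis using assms(2,3) by (simp add: blowup_coords_def)
qed

lemma continuous_on_lft: "continuous_on A lft" and continuous_on_rgt: "continuous_on A rgt"
  by (intro continuous_on_vec_lambda continuous_intros)+

text \<open>On the graph (s:t) is (g:h), and g k = h m shows that it is (m:k) as well. Both
  equations are closed, so they persist over the centre, where (g:h) is undefined.\<close>

lemma blowup_coords_relation:
  fixes C :: "(complex^'n::finite) set"
  assumes "w \<in> blowup_coords C g h"
    and cont: "continuous_on UNIV g" "continuous_on UNIV h" "continuous_on UNIV k" "continuous_on UNIV m"
    and gk: "\<And>v. v \<in> C \<Longrightarrow> g v * k v = h v * m v"
  shows "lft w \<in> C" "rgt w \<noteq> 0" "rgt w $ 0 * h (lft w) = rgt w $ 1 * g (lft w)" "rgt w $ 0 * k (lft w) = rgt w $ 1 * m (lft w)"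
proof -
  let ?S = "{w. lft w \<in> C \<and> rgt w \<noteq> 0 \<and> (g (lft w) \<noteq> 0 \<or> h (lft w) \<noteq> 0) \<and> rgt w $ 0 * h (lft w) = rgt w $ 1 * g (lft w)}"
  let ?E = "{w :: complex^('n + 2). rgt w $ 0 * h (lft w) = rgt w $ 1 * g (lft w) \<and> rgt w $ 0 * k (lft w) = rgt w $ 1 * m (lft w)}"
  show "lft w \<in> C" "rgt w \<noteq> 0" using assms(1) by (auto simp: blowup_coords_def)
  have sub: "?S \<subseteq> ?E"
  proof (intro subsetI CollectI)
    fix w assume "w \<in> ?S"
    then have w: "lft w \<in> C" "rgt w \<noteq> 0" "g (lft w) \<noteq> 0 \<or> h (lft w) \<noteq> 0" "rgt w $ 0 * h (lft w) = rgt w $ 1 * g (lft w)" by auto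
    have gk': "g (lft w) * k (lft w) = h (lft w) * m (lft w)" by (rule gk[OF w(1)])
    have "rgt w $ 0 * k (lft w) = rgt w $ 1 * m (lft w)"
    proof (cases "h (lft w) = 0")
      case True
      then have "g (lft w) \<noteq> 0" using w(3) by blast
      then have "rgt w $ 1 = 0" "k (lft w) = 0" using True w(4) gk' by auto
      then show ?thesis by simp
    next
      case False
      have "h (lft w) * (rgt w $ 0 * k (lft w)) = h (lft w) * (rgt w $ 1 * m (lft w))"
        using w(4) gk' by algebra
      then show ?thesis using False by simp
    qed
    with w(4) show "rgt w $ 0 * h (lft w) = rgt w $ 1 * g (lft w) \<and> rgt w $ 0 * k (lft w) = rgt w $ 1 * m (lft w)" by blast
  qed
  have c: "continuous_on UNIV (\<lambda>w. f (lft w))" if "continuous_on UNIV f" for f :: "complex^'n \<Rightarrow> complex"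
    by (rule continuous_on_compose2[OF that continuous_on_lft]) auto
  have r: "continuous_on UNIV (\<lambda>w :: complex^('n + 2). w $ Inr i)" for i
    by (intro continuous_intros)
  have "closed ?E"
    unfolding vec_lambda_beta by (intro closed_Collect_conj closed_Collect_eq continuous_on_mult continuous_intros c cont)
  then have "closure ?S \<subseteq> ?E" using sub by (rule closure_minimal[rotated])
  moreover have "w \<in> closure ?S" using assms(1) by (simp add: blowup_coords_def)
  ultimately show "rgt w $ 0 * h (lft w) = rgt w $ 1 * g (lft w)" "rgt w $ 0 * k (lft w) = rgt w $ 1 * m (lft w)" by auto
qed

text \<open>The point \<open>(1, -2)\<close> only serves as a direction in which no linear form vanishes.\<close>

definition lin_form :: "form \<Rightarrow> bool" where
  "lin_form l \<longleftrightarrow> (\<exists>c d :: real. (\<forall>x0 x1. l x0 x1 = of_real c * x0 + of_real d * x1) \<and> c - 2 * d \<noteq> 0)"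

lemma lin_form_hol: "lin_form l \<Longrightarrow> hol_on W X0 \<Longrightarrow> hol_on W X1 \<Longrightarrow> hol_on W (\<lambda>v. l (X0 v) (X1 v))"
  by (auto simp: lin_form_def intro!: hol_on_add hol_on_mult)

lemma lin_form_continuous:
  "lin_form l \<Longrightarrow> continuous_on W X0 \<Longrightarrow> continuous_on W X1 \<Longrightarrow> continuous_on W (\<lambda>v. l (X0 v) (X1 v))"
  by (auto simp: lin_form_def intro!: continuous_intros)

lemma lin_form_nonzero_nearby:
  assumes "lin_form l" shows "\<forall>\<^sub>F e in at 0. l (x0 + e) (x1 - 2 * e) \<noteq> 0"
proof -
  obtain c d :: real where l: "\<And>x0 x1. l x0 x1 = of_real c * x0 + of_real d * x1" "c - 2 * d \<noteq> 0"
    using assms by (auto simp: lin_form_def)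
  let ?k = "complex_of_real (c - 2 * d)"
  have k: "?k \<noteq> 0" using l(2) by (simp only: of_real_eq_0_iff not_False_eq_True)
  have e: "l (x0 + e) (x1 - 2 * e) = l x0 x1 + e * ?k" for e by (simp add: l(1) algebra_simps)
  have "\<forall>\<^sub>F e in at 0. e \<noteq> - l x0 x1 / ?k" by (rule eventually_neq_at_within)
  then show ?thesis
  proof eventually_elim
    case (elim e)
    show ?case
    proof
      assume "l (x0 + e) (x1 - 2 * e) = 0"
      then have "e * ?k = - l x0 x1" unfolding e by (simp add: add_eq_0_iff)
      then have "e = - l x0 x1 / ?k" by (rule eq_divide_imp[OF k])
      then show False using elim by blast
    qed
  qed
qed

abbreviation \<pi>3 :: "complex^(((4 + 2) + 2) + 2) \<Rightarrow> res_point" where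
  "\<pi>3 \<equiv> blowup_proj (blowup_proj (blowup_proj (\<lambda>v. v)))"

lemma pi3: "\<pi>3 w = (((lft (lft (lft w)), line_through (rgt (lft (lft w)))), line_through (rgt (lft w))), line_through (rgt w))"
  by (simp add: blowup_proj_def)

context
  fixes a b :: real and l1 l2 l3 l4 :: form
  assumes lin: "lin_form l1" "lin_form l2" "lin_form l3" "lin_form l4"
    and prod: "\<And>x0 x1. l1 x0 x1 * l2 x0 x1 * l3 x0 x1 * l4 x0 x1 = x0 * x1 * (x0 + x1) * (of_real a * x0 - of_real b * x1)"
begin

lemma germ_coords_iff: "v \<in> germ_coords a b \<longleftrightarrow>
    v $ 2 * v $ 3 = l1 (v $ 0) (v $ 1) * l2 (v $ 0) (v $ 1) * l3 (v $ 0) (v $ 1) * l4 (v $ 0) (v $ 1)"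
  by (simp add: germ_coords_def prod)

text \<open>The last equation says u \<eta> = l2 l3 l4; it comes from \<xi> \<eta> = l1 l2 l3 l4
  through \<open>blowup_coords_relation\<close>. Each further blow-up removes one more factor: v
  \<eta> = l3 l4 in \<open>res2_facts\<close> and w \<eta> = l4 in
  \<open>res3_facts\<close>.\<close>

lemma res1_facts:
  assumes "w \<in> res_coords1 a b l1"
  shows "lft w \<in> germ_coords a b" "rgt w \<noteq> 0"
    "rgt w $ 0 * l1 (lft w $ 0) (lft w $ 1) = rgt w $ 1 * lft w $ 2"
    "rgt w $ 0 * lft w $ 3 = rgt w $ 1 * (l2 (lft w $ 0) (lft w $ 1) * l3 (lft w $ 0) (lft w $ 1) * l4 (lft w $ 0) (lft w $ 1))"
proof -
  have c: "continuous_on UNIV (\<lambda>v :: complex^4. l (v $ 0) (v $ 1))" if "lin_form l" for l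
    by (intro lin_form_continuous[OF that] continuous_intros)
  note r = blowup_coords_relation[OF assms[unfolded res_coords1_def], where k = "\<lambda>v. v $ 3"
      and m = "\<lambda>v. l2 (v $ 0) (v $ 1) * l3 (v $ 0) (v $ 1) * l4 (v $ 0) (v $ 1)",
      OF _ c[OF lin(1)] _ continuous_on_mult[OF continuous_on_mult[OF c[OF lin(2)] c[OF lin(3)]] c[OF lin(4)]]]
  show "lft w \<in> germ_coords a b" "rgt w \<noteq> 0"
    "rgt w $ 0 * l1 (lft w $ 0) (lft w $ 1) = rgt w $ 1 * lft w $ 2"
    "rgt w $ 0 * lft w $ 3 = rgt w $ 1 * (l2 (lft w $ 0) (lft w $ 1) * l3 (lft w $ 0) (lft w $ 1) * l4 (lft w $ 0) (lft w $ 1))"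
    by (rule r, intro continuous_intros, intro continuous_intros, simp add: germ_coords_iff mult.assoc)+
qed

lemma res2_facts:
  assumes "w \<in> res_coords2 a b l1 l2"
  shows "lft w \<in> res_coords1 a b l1" "rgt w \<noteq> 0"
    "rgt w $ 0 * (rgt (lft w) $ 1 * l2 (lft (lft w) $ 0) (lft (lft w) $ 1)) = rgt w $ 1 * rgt (lft w) $ 0"
    "rgt w $ 0 * lft (lft w) $ 3 = rgt w $ 1 * (l3 (lft (lft w) $ 0) (lft (lft w) $ 1) * l4 (lft (lft w) $ 0) (lft (lft w) $ 1))"
proof -
  have c: "continuous_on UNIV (\<lambda>v :: complex^(4 + 2). l (v $ Inl 0) (v $ Inl 1))" if "lin_form l" for l
    by (intro lin_form_continuous[OF that] continuous_intros)
  have d: "continuous_on UNIV (\<lambda>v :: complex^(4 + 2). v $ i)" for i by (intro continuous_intros)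
  note r = blowup_coords_relation[OF assms[unfolded res_coords2_def vec_lambda_beta], where k = "\<lambda>v. v $ Inl 3"
      and m = "\<lambda>v. l3 (v $ Inl 0) (v $ Inl 1) * l4 (v $ Inl 0) (v $ Inl 1)",
      OF d continuous_on_mult[OF d c[OF lin(2)]] d continuous_on_mult[OF c[OF lin(3)] c[OF lin(4)]]]
  have *: "v $ Inr 0 * v $ Inl 3 = v $ Inr 1 * l2 (v $ Inl 0) (v $ Inl 1) * (l3 (v $ Inl 0) (v $ Inl 1) * l4 (v $ Inl 0) (v $ Inl 1))"
    if "v \<in> res_coords1 a b l1" for v
    using res1_facts(4)[OF that] by (simp add: mult.assoc)
  show "lft w \<in> res_coords1 a b l1" "rgt w \<noteq> 0" by (rule r; fact *)+
  show "rgt w $ 0 * (rgt (lft w) $ 1 * l2 (lft (lft w) $ 0) (lft (lft w) $ 1)) = rgt w $ 1 * rgt (lft w) $ 0"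
    using r(3)[OF *] by simp
  show "rgt w $ 0 * lft (lft w) $ 3 = rgt w $ 1 * (l3 (lft (lft w) $ 0) (lft (lft w) $ 1) * l4 (lft (lft w) $ 0) (lft (lft w) $ 1))"
    using r(4)[OF *] by simp
qed

lemma res3_facts:
  assumes "w \<in> res_coords3 a b l1 l2 l3"
  shows "lft w \<in> res_coords2 a b l1 l2" "rgt w \<noteq> 0"
    "rgt w $ 0 * (rgt (lft w) $ 1 * l3 (lft (lft (lft w)) $ 0) (lft (lft (lft w)) $ 1)) = rgt w $ 1 * rgt (lft w) $ 0"
    "rgt w $ 0 * lft (lft (lft w)) $ 3 = rgt w $ 1 * l4 (lft (lft (lft w)) $ 0) (lft (lft (lft w)) $ 1)"
proof -
  have c: "continuous_on UNIV (\<lambda>v :: complex^((4 + 2) + 2). l (v $ Inl (Inl 0)) (v $ Inl (Inl 1)))" if "lin_form l" for l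
    by (intro lin_form_continuous[OF that] continuous_intros)
  have d: "continuous_on UNIV (\<lambda>v :: complex^((4 + 2) + 2). v $ i)" for i by (intro continuous_intros)
  note r = blowup_coords_relation[OF assms[unfolded res_coords3_def vec_lambda_beta], where k = "\<lambda>v. v $ Inl (Inl 3)"
      and m = "\<lambda>v. l4 (v $ Inl (Inl 0)) (v $ Inl (Inl 1))",
      OF d continuous_on_mult[OF d c[OF lin(3)]] d c[OF lin(4)]]
  have *: "v $ Inr 0 * v $ Inl (Inl 3) = v $ Inr 1 * l3 (v $ Inl (Inl 0)) (v $ Inl (Inl 1)) * l4 (v $ Inl (Inl 0)) (v $ Inl (Inl 1))"
    if "v \<in> res_coords2 a b l1 l2" for v
    using res2_facts(4)[OF that] by (simp add: mult.assoc)
  show "lft w \<in> res_coords2 a b l1 l2" "rgt w \<noteq> 0" by (rule r; fact *)+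
  show "rgt w $ 0 * (rgt (lft w) $ 1 * l3 (lft (lft (lft w)) $ 0) (lft (lft (lft w)) $ 1)) = rgt w $ 1 * rgt (lft w) $ 0"
    using r(3)[OF *] by simp
  show "rgt w $ 0 * lft (lft (lft w)) $ 3 = rgt w $ 1 * l4 (lft (lft (lft w)) $ 0) (lft (lft (lft w)) $ 1)"
    using r(4)[OF *] by simp
qed

text \<open>Coordinates of the point with u = \<omega>: then \<xi> = \<omega> l1, \<eta> = l2 l3 l4
  / \<omega>, v = \<omega> / l2 and w = \<omega> / (l2 l3), written homogeneously. As \<omega>
  \<noteq> 0 the second and third centres are avoided, and only the first blow-up needs a
  limit.\<close>

definition liftp1 where "liftp1 x0 x1 \<omega> = comb (v4 x0 x1 (\<omega> * l1 x0 x1) (l2 x0 x1 * l3 x0 x1 * l4 x0 x1 / \<omega>)) (vec2 \<omega> 1)"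
definition liftp where "liftp x0 x1 \<omega> = comb (comb (liftp1 x0 x1 \<omega>) (vec2 \<omega> (l2 x0 x1))) (vec2 \<omega> (l2 x0 x1 * l3 x0 x1))"

lemma liftp_mem: assumes "\<omega> \<noteq> 0" shows "liftp x0 x1 \<omega> \<in> res_coords3 a b l1 l2 l3"
proof -
  have nz: "vec2 \<omega> t \<noteq> 0" for t using assms by (simp add: vec2_eq_iff)
  \<comment> \<open>Along this path l1 has at most one zero, so the points for small nonzero
    \<open>e\<close> lie on the graph and the point at 0 in its closure.\<close>
  define c where "c e = liftp1 (x0 + e) (x1 - 2 * e) \<omega>" for e
  have "c 0 \<in> res_coords1 a b l1"
    unfolding res_coords1_def
  proof (rule blowup_coords_limit)
    show "continuous_on UNIV c"
      unfolding c_def liftp1_def using assms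
      by (intro continuous_on_comb continuous_on_v4 continuous_on_vec2 lin[THEN lin_form_continuous] continuous_intros) auto
    show "\<forall>\<^sub>F e in at 0. lft (c e) \<in> germ_coords a b \<and> rgt (c e) \<noteq> 0 \<and>
        (lft (c e) $ 2 \<noteq> 0 \<or> l1 (lft (c e) $ 0) (lft (c e) $ 1) \<noteq> 0) \<and>
        rgt (c e) $ 0 * l1 (lft (c e) $ 0) (lft (c e) $ 1) = rgt (c e) $ 1 * lft (c e) $ 2"
      using lin_form_nonzero_nearby[OF lin(1), of x0 x1]
      by eventually_elim (use assms in \<open>simp add: c_def liftp1_def germ_coords_iff nz\<close>)
  qed (use assms in \<open>simp_all add: c_def liftp1_def germ_coords_iff nz\<close>)
  then have 1: "liftp1 x0 x1 \<omega> \<in> res_coords1 a b l1" by (simp add: c_def)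
  have 2: "comb (liftp1 x0 x1 \<omega>) (vec2 \<omega> (l2 x0 x1)) \<in> res_coords2 a b l1 l2"
    unfolding res_coords2_def by (rule blowup_coords_direct) (use assms 1 in \<open>auto simp: nz liftp1_def\<close>)
  show ?thesis
    unfolding res_coords3_def liftp_def by (rule blowup_coords_direct) (use assms 2 in \<open>auto simp: nz liftp1_def\<close>)
qed

text \<open>Coordinates of the point with w = 1 / \<omega>, worked out from the last blow-up
  backwards: v = l3 / \<omega>, u = l2 l3 / \<omega>, \<xi> = l1 l2 l3 / \<omega> and \<eta> =
  \<omega> l4. Such a point may lie over all three centres, so every blow-up needs a limit.\<close>

definition liftm1 where "liftm1 x0 x1 \<omega> = comb (v4 x0 x1 (l1 x0 x1 * l2 x0 x1 * l3 x0 x1 / \<omega>) (\<omega> * l4 x0 x1)) (vec2 (l2 x0 x1 * l3 x0 x1) \<omega>)"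
definition liftm2 where "liftm2 x0 x1 \<omega> = comb (liftm1 x0 x1 \<omega>) (vec2 (l3 x0 x1) \<omega>)"
definition liftm where "liftm x0 x1 \<omega> = comb (liftm2 x0 x1 \<omega>) (vec2 1 \<omega>)"

lemma liftm_mem: assumes "\<omega> \<noteq> 0" shows "liftm x0 x1 \<omega> \<in> res_coords3 a b l1 l2 l3"
proof -
  have nz: "vec2 t \<omega> \<noteq> 0" for t using assms by (simp add: vec2_eq_iff)
  have 1: "liftm1 x0 x1 \<omega> \<in> res_coords1 a b l1" for x0 x1
  proof -
    define c where "c e = liftm1 (x0 + e) (x1 - 2 * e) \<omega>" for e
    have "c 0 \<in> res_coords1 a b l1"
      unfolding res_coords1_def
    proof (rule blowup_coords_limit)
      show "continuous_on UNIV c"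
        unfolding c_def liftm1_def using assms
        by (intro continuous_on_comb continuous_on_v4 continuous_on_vec2 lin[THEN lin_form_continuous] continuous_intros) auto
      show "\<forall>\<^sub>F e in at 0. lft (c e) \<in> germ_coords a b \<and> rgt (c e) \<noteq> 0 \<and>
          (lft (c e) $ 2 \<noteq> 0 \<or> l1 (lft (c e) $ 0) (lft (c e) $ 1) \<noteq> 0) \<and>
          rgt (c e) $ 0 * l1 (lft (c e) $ 0) (lft (c e) $ 1) = rgt (c e) $ 1 * lft (c e) $ 2"
        using lin_form_nonzero_nearby[OF lin(1), of x0 x1]
        by eventually_elim (use assms in \<open>simp add: c_def liftm1_def germ_coords_iff nz\<close>)
    qed (use assms in \<open>simp_all add: c_def liftm1_def germ_coords_iff nz\<close>)
    then show ?thesis by (simp add: c_def)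
  qed
  have 2: "liftm2 x0 x1 \<omega> \<in> res_coords2 a b l1 l2" for x0 x1
  proof -
    define c where "c e = liftm2 (x0 + e) (x1 - 2 * e) \<omega>" for e
    have "c 0 \<in> res_coords2 a b l1 l2"
      unfolding res_coords2_def
    proof (rule blowup_coords_limit)
      show "continuous_on UNIV c"
        unfolding c_def liftm2_def liftm1_def using assms
        by (intro continuous_on_comb continuous_on_v4 continuous_on_vec2 lin[THEN lin_form_continuous] continuous_intros) auto
      show "\<forall>\<^sub>F e in at 0. lft (c e) \<in> res_coords1 a b l1 \<and> rgt (c e) \<noteq> 0 \<and>
          (rgt (lft (c e)) $ 0 \<noteq> 0 \<or> rgt (lft (c e)) $ 1 * l2 (lft (lft (c e)) $ 0) (lft (lft (c e)) $ 1) \<noteq> 0) \<and>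
          rgt (c e) $ 0 * (rgt (lft (c e)) $ 1 * l2 (lft (lft (c e)) $ 0) (lft (lft (c e)) $ 1)) = rgt (c e) $ 1 * rgt (lft (c e)) $ 0"
        using lin_form_nonzero_nearby[OF lin(2), of x0 x1]
        by eventually_elim (use assms 1 in \<open>simp add: c_def liftm2_def nz, simp add: liftm1_def\<close>)
    qed (use assms 1 in \<open>simp_all add: c_def liftm2_def nz\<close>)
    then show ?thesis by (simp add: c_def)
  qed
  define c where "c e = liftm (x0 + e) (x1 - 2 * e) \<omega>" for e
  have "c 0 \<in> res_coords3 a b l1 l2 l3"
    unfolding res_coords3_def
  proof (rule blowup_coords_limit)
    show "continuous_on UNIV c"
      unfolding c_def liftm_def liftm2_def liftm1_def using assms
      by (intro continuous_on_comb continuous_on_v4 continuous_on_vec2 lin[THEN lin_form_continuous] continuous_intros) auto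
    show "\<forall>\<^sub>F e in at 0. lft (c e) \<in> res_coords2 a b l1 l2 \<and> rgt (c e) \<noteq> 0 \<and>
        (rgt (lft (c e)) $ 0 \<noteq> 0 \<or> rgt (lft (c e)) $ 1 * l3 (lft (lft (lft (c e))) $ 0) (lft (lft (lft (c e))) $ 1) \<noteq> 0) \<and>
        rgt (c e) $ 0 * (rgt (lft (c e)) $ 1 * l3 (lft (lft (lft (c e))) $ 0) (lft (lft (lft (c e))) $ 1)) = rgt (c e) $ 1 * rgt (lft (c e)) $ 0"
      using lin_form_nonzero_nearby[OF lin(3), of x0 x1]
      by eventually_elim (use assms 2 in \<open>simp add: c_def liftm_def nz, simp add: liftm2_def liftm1_def\<close>)
  qed (use assms 2 in \<open>simp_all add: c_def liftm_def nz\<close>)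
  then show ?thesis by (simp add: c_def)
qed

lemma line_through_vec2_eqI:
  assumes "c \<noteq> 0" "s = c * w $ 0" "t = c * w $ 1" shows "line_through (vec2 s t) = line_through w"
proof -
  have "vec2 s t = c *s w" using assms by (simp add: vec2_eq_iff)
  then show ?thesis using assms(1) by simp
qed

lemma res3_all:
  assumes "w \<in> res_coords3 a b l1 l2 l3"
  obtains x0 x1 \<xi> \<eta> s1 t1 s2 t2 s3 t3 where
    "lft (lft (lft w)) = v4 x0 x1 \<xi> \<eta>" "rgt (lft (lft w)) = vec2 s1 t1" "rgt (lft w) = vec2 s2 t2" "rgt w = vec2 s3 t3"
    "s1 \<noteq> 0 \<or> t1 \<noteq> 0" "s2 \<noteq> 0 \<or> t2 \<noteq> 0" "s3 \<noteq> 0 \<or> t3 \<noteq> 0"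
    "\<xi> * \<eta> = l1 x0 x1 * l2 x0 x1 * l3 x0 x1 * l4 x0 x1"
    "s1 * l1 x0 x1 = t1 * \<xi>" "s1 * \<eta> = t1 * (l2 x0 x1 * l3 x0 x1 * l4 x0 x1)"
    "s2 * (t1 * l2 x0 x1) = t2 * s1" "s3 * (t2 * l3 x0 x1) = t3 * s2" "s3 * \<eta> = t3 * l4 x0 x1"
proof -
  note f3 = res3_facts[OF assms] note f2 = res2_facts[OF f3(1)] note f1 = res1_facts[OF f2(1)]
  show ?thesis
    using f1(1)[unfolded germ_coords_iff] f1(2-4) f2(2,3) f3(2-4)
    by (intro that[of "lft (lft (lft w)) $ 0" "lft (lft (lft w)) $ 1" "lft (lft (lft w)) $ 2" "lft (lft (lft w)) $ 3"
          "rgt (lft (lft w)) $ 0" "rgt (lft (lft w)) $ 1" "rgt (lft w) $ 0" "rgt (lft w) $ 1" "rgt w $ 0" "rgt w $ 1"])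
       (auto simp: vec4_eq_iff vec2_eq_iff)
qed

lemma pi3_eq_imp:
  assumes "\<pi>3 w = \<pi>3 w'"
  shows "lft (lft (lft w')) = lft (lft (lft w))" "\<exists>c. c \<noteq> 0 \<and> rgt (lft (lft w')) = c *s rgt (lft (lft w))"
    "\<exists>c. c \<noteq> 0 \<and> rgt w' = c *s rgt w"
  using assms unfolding pi3 by (simp_all add: line_through_eq_iff)

lemma resolution_chart_plus:
  fixes lam \<kappa> \<beta> g c2 :: complex
  assumes \<kappa>: "\<And>x. l1 (lam * x) x = \<kappa> * x"
    and R: "\<And>x. l2 (lam * x) x * l3 (lam * x) x * l4 (lam * x) x = l2 lam 1 * l3 lam 1 * l4 lam 1 * x ^ 3"
    and nz: "\<kappa> \<noteq> 0" "l2 lam 1 * l3 lam 1 * l4 lam 1 \<noteq> 0" "g \<noteq> 0"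
  shows "resolution_chart (res_coords3 a b l1 l2 l3) \<pi>3 (\<lambda>w. lft (lft (lft w)))
     (\<lambda>w. rgt (lft (lft w)) $ 0) (\<lambda>w. rgt (lft (lft w)) $ 1) liftp l1 (\<lambda>x0 x1. l2 x0 x1 * l3 x0 x1 * l4 x0 x1) 2 3 lam \<kappa> g"
proof
  fix w assume w: "w \<in> res_coords3 a b l1 l2 l3"
  obtain x0 x1 \<xi> \<eta> s1 t1 s2 t2 s3 t3 where *:
    "lft (lft (lft w)) = v4 x0 x1 \<xi> \<eta>" "rgt (lft (lft w)) = vec2 s1 t1" "rgt (lft w) = vec2 s2 t2" "rgt w = vec2 s3 t3"
    "s1 \<noteq> 0 \<or> t1 \<noteq> 0" "s2 \<noteq> 0 \<or> t2 \<noteq> 0" "s3 \<noteq> 0 \<or> t3 \<noteq> 0"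
    "\<xi> * \<eta> = l1 x0 x1 * l2 x0 x1 * l3 x0 x1 * l4 x0 x1"
    "s1 * l1 x0 x1 = t1 * \<xi>" "s1 * \<eta> = t1 * (l2 x0 x1 * l3 x0 x1 * l4 x0 x1)"
    "s2 * (t1 * l2 x0 x1) = t2 * s1" "s3 * (t2 * l3 x0 x1) = t3 * s2" "s3 * \<eta> = t3 * l4 x0 x1"
    using res3_all[OF w] by blast
  show "lft (lft (lft w)) $ 2 * rgt (lft (lft w)) $ 1 = rgt (lft (lft w)) $ 0 * l1 (lft (lft (lft w)) $ 0) (lft (lft (lft w)) $ 1)"
    unfolding * by (simp add: * mult.commute)
  show "rgt (lft (lft w)) $ 0 \<noteq> 0 \<or> rgt (lft (lft w)) $ 1 \<noteq> 0" unfolding * using * by simp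
  show "lft (lft (lft w)) $ 2 * lft (lft (lft w)) $ 3 = l1 (lft (lft (lft w)) $ 0) (lft (lft (lft w)) $ 1) *
      (l2 (lft (lft (lft w)) $ 0) (lft (lft (lft w)) $ 1) * l3 (lft (lft (lft w)) $ 0) (lft (lft (lft w)) $ 1) * l4 (lft (lft (lft w)) $ 0) (lft (lft (lft w)) $ 1))"
    unfolding * by (simp add: * mult.assoc)
  assume "rgt (lft (lft w)) $ 0 \<noteq> 0" "rgt (lft (lft w)) $ 1 \<noteq> 0"
  then have n: "s1 \<noteq> 0" "t1 \<noteq> 0" unfolding * by auto
  define \<omega> where "\<omega> = s1 / t1"
  have om: "\<omega> \<noteq> 0" "s1 = \<omega> * t1" using n by (auto simp: \<omega>_def)
  have xi: "\<xi> = \<omega> * l1 x0 x1" using *(9) n by (simp add: om field_simps)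
  have eta: "\<eta> = l2 x0 x1 * l3 x0 x1 * l4 x0 x1 / \<omega>" using *(10) n om by (simp add: field_simps)
  \<comment> \<open>As \<omega> is nonzero, t2 and then t3 are determined by s2 and s3; so s2 and s3
    cannot vanish, and all three points of the projective line are functions of x0, x1 and
    \<omega>.\<close>
  have t2: "t2 * \<omega> = s2 * l2 x0 x1" using *(11) n by (simp add: om)
  then have s2: "s2 \<noteq> 0" using *(6) om by auto
  have "s2 * (t3 * \<omega>) = s2 * (s3 * l2 x0 x1 * l3 x0 x1)" using *(12) t2 by algebra
  then have t3: "t3 * \<omega> = s3 * (l2 x0 x1 * l3 x0 x1)" using s2 by (simp add: mult.assoc)
  then have s3: "s3 \<noteq> 0" using *(7) om by auto
  have "line_through (vec2 \<omega> 1) = line_through (vec2 s1 t1)"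
    by (rule line_through_vec2_eqI[where c = "1 / t1"]) (use n om in auto)
  moreover have "line_through (vec2 \<omega> (l2 x0 x1)) = line_through (vec2 s2 t2)"
    by (rule line_through_vec2_eqI[where c = "\<omega> / s2"]) (use om s2 t2 in \<open>auto simp: field_simps\<close>)
  moreover have "line_through (vec2 \<omega> (l2 x0 x1 * l3 x0 x1)) = line_through (vec2 s3 t3)"
    by (rule line_through_vec2_eqI[where c = "\<omega> / s3"]) (use om s3 t3 in \<open>auto simp: field_simps\<close>)
  ultimately have "\<pi>3 (liftp x0 x1 \<omega>) = \<pi>3 w"
    unfolding pi3 * by (simp add: liftp_def liftp1_def xi eta)
  then show "\<pi>3 (liftp (lft (lft (lft w)) $ 0) (lft (lft (lft w)) $ 1) (rgt (lft (lft w)) $ 0 / rgt (lft (lft w)) $ 1)) = \<pi>3 w"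
    unfolding * by (simp add: \<omega>_def)
next
  fix w w' assume "\<pi>3 w = \<pi>3 w'"
  from pi3_eq_imp[OF this]
  show "lft (lft (lft w')) = lft (lft (lft w)) \<and> (\<exists>c. c \<noteq> 0 \<and> rgt (lft (lft w')) $ 0 = c * rgt (lft (lft w)) $ 0 \<and> rgt (lft (lft w')) $ 1 = c * rgt (lft (lft w)) $ 1)"
    unfolding vec2_eq_iff vector_smult_component by blast
next
  fix x0 x1 \<omega> :: complex assume "\<omega> \<noteq> 0"
  then show "liftp x0 x1 \<omega> \<in> res_coords3 a b l1 l2 l3 \<and> lft (lft (lft (liftp x0 x1 \<omega>))) $ 0 = x0 \<and> lft (lft (lft (liftp x0 x1 \<omega>))) $ 1 = x1 \<and>
      rgt (lft (lft (liftp x0 x1 \<omega>))) $ 0 = \<omega> \<and> rgt (lft (lft (liftp x0 x1 \<omega>))) $ 1 = 1"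
    using liftp_mem by (simp add: liftp_def liftp1_def)
next
  fix W :: "(complex^(1 + 2)) set" and X0 X1 \<Omega> i
  assume "hol_on W X0" "hol_on W X1" "hol_on W \<Omega>" "\<And>v. v \<in> W \<Longrightarrow> \<Omega> v \<noteq> 0"
  then show "hol_on W (\<lambda>v. liftp (X0 v) (X1 v) (\<Omega> v) $ i)"
    unfolding liftp_def liftp1_def
    by (intro hol_on_comb hol_on_v4 hol_on_vec2 hol_on_mult hol_on_divide lin[THEN lin_form_hol] hol_on_const)
qed (use \<kappa> R nz in auto)

lemma resolution_chart_minus:
  fixes lam \<kappa> \<beta> g c2 :: complex
  assumes \<kappa>: "\<And>x. l4 (lam * x) x = \<kappa> * x"
    and R: "\<And>x. l1 (lam * x) x * l2 (lam * x) x * l3 (lam * x) x = l1 lam 1 * l2 lam 1 * l3 lam 1 * x ^ 3"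
    and nz: "\<kappa> \<noteq> 0" "l1 lam 1 * l2 lam 1 * l3 lam 1 \<noteq> 0" "g \<noteq> 0"
  shows "resolution_chart (res_coords3 a b l1 l2 l3) \<pi>3 (\<lambda>w. lft (lft (lft w)))
     (\<lambda>w. rgt w $ 1) (\<lambda>w. rgt w $ 0) liftm l4 (\<lambda>x0 x1. l1 x0 x1 * l2 x0 x1 * l3 x0 x1) 3 2 lam \<kappa> g"
proof
  fix w assume w: "w \<in> res_coords3 a b l1 l2 l3"
  obtain x0 x1 \<xi> \<eta> s1 t1 s2 t2 s3 t3 where *:
    "lft (lft (lft w)) = v4 x0 x1 \<xi> \<eta>" "rgt (lft (lft w)) = vec2 s1 t1" "rgt (lft w) = vec2 s2 t2" "rgt w = vec2 s3 t3"
    "s1 \<noteq> 0 \<or> t1 \<noteq> 0" "s2 \<noteq> 0 \<or> t2 \<noteq> 0" "s3 \<noteq> 0 \<or> t3 \<noteq> 0"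
    "\<xi> * \<eta> = l1 x0 x1 * l2 x0 x1 * l3 x0 x1 * l4 x0 x1"
    "s1 * l1 x0 x1 = t1 * \<xi>" "s1 * \<eta> = t1 * (l2 x0 x1 * l3 x0 x1 * l4 x0 x1)"
    "s2 * (t1 * l2 x0 x1) = t2 * s1" "s3 * (t2 * l3 x0 x1) = t3 * s2" "s3 * \<eta> = t3 * l4 x0 x1"
    using res3_all[OF w] by blast
  show "lft (lft (lft w)) $ 3 * rgt w $ 0 = rgt w $ 1 * l4 (lft (lft (lft w)) $ 0) (lft (lft (lft w)) $ 1)"
    unfolding * using *(13) by (simp add: mult.commute)
  show "rgt w $ 1 \<noteq> 0 \<or> rgt w $ 0 \<noteq> 0" unfolding * using * by auto
  show "lft (lft (lft w)) $ 3 * lft (lft (lft w)) $ 2 = l4 (lft (lft (lft w)) $ 0) (lft (lft (lft w)) $ 1) *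
      (l1 (lft (lft (lft w)) $ 0) (lft (lft (lft w)) $ 1) * l2 (lft (lft (lft w)) $ 0) (lft (lft (lft w)) $ 1) * l3 (lft (lft (lft w)) $ 0) (lft (lft (lft w)) $ 1))"
    unfolding * using *(8) by (simp add: ac_simps)
  assume "rgt w $ 1 \<noteq> 0" "rgt w $ 0 \<noteq> 0"
  then have n: "s3 \<noteq> 0" "t3 \<noteq> 0" unfolding * by auto
  define \<omega> where "\<omega> = t3 / s3"
  have om: "\<omega> \<noteq> 0" "t3 = \<omega> * s3" using n by (auto simp: \<omega>_def)
  have eta: "\<eta> = \<omega> * l4 x0 x1" using *(13) n by (simp add: om field_simps)
  \<comment> \<open>The same elimination from the last blow-up to the first: now s2, s1 and \<xi>
    are determined, while t2 and t1 cannot vanish.\<close>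
  have s2: "s2 * \<omega> = t2 * l3 x0 x1" using *(12) n by (simp add: om field_simps)
  then have t2: "t2 \<noteq> 0" using *(6) om by auto
  have "t2 * (s1 * \<omega>) = t2 * (t1 * l2 x0 x1 * l3 x0 x1)" using *(11) s2 by algebra
  then have s1: "s1 * \<omega> = t1 * (l2 x0 x1 * l3 x0 x1)" using t2 by (simp add: mult.assoc)
  then have t1: "t1 \<noteq> 0" using *(5) om by auto
  have "t1 * (\<xi> * \<omega>) = t1 * (l1 x0 x1 * l2 x0 x1 * l3 x0 x1)" using *(9) s1 by algebra
  then have xi: "\<xi> = l1 x0 x1 * l2 x0 x1 * l3 x0 x1 / \<omega>" using t1 om by (simp add: field_simps)
  have "line_through (vec2 1 \<omega>) = line_through (vec2 s3 t3)"
    by (rule line_through_vec2_eqI[where c = "1 / s3"]) (use n om in auto)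
  moreover have "line_through (vec2 (l3 x0 x1) \<omega>) = line_through (vec2 s2 t2)"
    by (rule line_through_vec2_eqI[where c = "\<omega> / t2"]) (use om s2 t2 in \<open>auto simp: field_simps\<close>)
  moreover have "line_through (vec2 (l2 x0 x1 * l3 x0 x1) \<omega>) = line_through (vec2 s1 t1)"
    by (rule line_through_vec2_eqI[where c = "\<omega> / t1"]) (use om s1 t1 in \<open>auto simp: field_simps\<close>)
  ultimately have "\<pi>3 (liftm x0 x1 \<omega>) = \<pi>3 w"
    unfolding pi3 * by (simp add: liftm_def liftm2_def liftm1_def xi eta)
  then show "\<pi>3 (liftm (lft (lft (lft w)) $ 0) (lft (lft (lft w)) $ 1) (rgt w $ 1 / rgt w $ 0)) = \<pi>3 w"
    unfolding * by (simp add: \<omega>_def)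
next
  fix w w' assume "\<pi>3 w = \<pi>3 w'"
  from pi3_eq_imp[OF this]
  show "lft (lft (lft w')) = lft (lft (lft w)) \<and> (\<exists>c. c \<noteq> 0 \<and> rgt w' $ 1 = c * rgt w $ 1 \<and> rgt w' $ 0 = c * rgt w $ 0)"
    unfolding vec2_eq_iff vector_smult_component by blast
next
  fix x0 x1 \<omega> :: complex assume "\<omega> \<noteq> 0"
  then show "liftm x0 x1 \<omega> \<in> res_coords3 a b l1 l2 l3 \<and> lft (lft (lft (liftm x0 x1 \<omega>))) $ 0 = x0 \<and> lft (lft (lft (liftm x0 x1 \<omega>))) $ 1 = x1 \<and>
      rgt (liftm x0 x1 \<omega>) $ 1 = \<omega> \<and> rgt (liftm x0 x1 \<omega>) $ 0 = 1"
    using liftm_mem by (simp add: liftm_def liftm2_def liftm1_def)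
next
  fix W :: "(complex^(1 + 2)) set" and X0 X1 \<Omega> i
  assume "hol_on W X0" "hol_on W X1" "hol_on W \<Omega>" "\<And>v. v \<in> W \<Longrightarrow> \<Omega> v \<noteq> 0"
  then show "hol_on W (\<lambda>v. liftm (X0 v) (X1 v) (\<Omega> v) $ i)"
    unfolding liftm_def liftm2_def liftm1_def
    by (intro hol_on_comb hol_on_v4 hol_on_vec2 hol_on_mult hol_on_divide lin[THEN lin_form_hol] hol_on_const)
qed (use \<kappa> R nz in auto)

end

section \<open>The components of the preimage of the conic\<close>

subsection \<open>Analytic subsets and curves\<close>

text \<open>Near each coordinate vector of the curve \<open>f \<circ> \<pi>\<close> extends to a
  holomorphic function on an open set, which is then composed with the curve.\<close>

lemma chol_quotient_curve:
  assumes f: "f \<in> chol (quotient_space C \<pi>) U" and c: "\<And>i. (\<lambda>t. c t $ i) holomorphic_on UNIV" "\<And>t. c t \<in> C"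
  shows "open {t. \<pi> (c t) \<in> U}" "(\<lambda>t. f (\<pi> (c t))) holomorphic_on {t. \<pi> (c t) \<in> U}"
proof -
  let ?T = "{t. \<pi> (c t) \<in> U}"
  have F: "f \<circ> \<pi> \<in> chol (model C) (C \<inter> \<pi> -` U)" using f by (simp add: chol_quotient_space)
  have cont: "continuous_on UNIV c"
  proof -
    have "continuous_on UNIV (\<lambda>t. \<chi> i. c t $ i)"
      by (intro continuous_on_vec_lambda holomorphic_on_imp_continuous_on c)
    then show ?thesis by simp
  qed
  have "openin (top_of_set C) (C \<inter> \<pi> -` U)" using F by (simp add: chol_model)
  then obtain V where V: "open V" "C \<inter> \<pi> -` U = C \<inter> V" by (auto simp: openin_open)
  have "?T = c -` V" using V(2) c(2) by auto
  then show o: "open ?T" using open_vimage[OF V(1) cont] by simp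
  have "(\<lambda>t. f (\<pi> (c t))) field_differentiable (at t)" if t: "t \<in> ?T" for t
  proof -
    have "c t \<in> C \<inter> \<pi> -` U" using t c(2) by auto
    then obtain W G where W: "open W" "c t \<in> W" "hol_on W G" "\<forall>w\<in>W \<inter> (C \<inter> \<pi> -` U). (f \<circ> \<pi>) w = G w"
      using F unfolding chol_model by meson
    let ?S = "?T \<inter> c -` W"
    have oS: "open ?S" using o open_vimage[OF W(1) cont] by blast
    have "(\<lambda>t. G (c t)) holomorphic_on ?S"
      by (rule hol_on_compose_curve[OF W(3) _ oS]) (use c in \<open>auto intro: holomorphic_on_subset\<close>)
    then have "(\<lambda>t. f (\<pi> (c t))) holomorphic_on ?S"
      by (rule holomorphic_transform) (use W(4) c(2) in auto)
    then show ?thesis using oS t W(2) by (auto intro: holomorphic_on_imp_differentiable_at)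
  qed
  then show "(\<lambda>t. f (\<pi> (c t))) holomorphic_on ?T"
    using o by (simp add: holomorphic_on_def field_differentiable_at_within)
qed

text \<open>The identity theorem. The interior of the parameter set is also closed: near a limit
  point every defining function vanishes on an open part of a disc, hence on the disc; so a nonempty
  interior is everything.\<close>

lemma analytic_subset_curve:
  assumes A: "analytic_subset (quotient_space C \<pi>) A" and c: "\<And>i. (\<lambda>t. c t $ i) holomorphic_on UNIV" "\<And>t. c t \<in> C"
  shows "closed {t. \<pi> (c t) \<in> A}" "interior {t. \<pi> (c t) \<in> A} \<noteq> {} \<Longrightarrow> {t. \<pi> (c t) \<in> A} = UNIV"
proof -
  let ?T = "{t. \<pi> (c t) \<in> A}"
  have loc: "\<exists>U F. \<pi> (c t) \<in> U \<and> F \<subseteq> chol (quotient_space C \<pi>) U \<and> A \<inter> U = {q \<in> U. \<forall>f\<in>F. f q = 0} \<and> open {t. \<pi> (c t) \<in> U}" for t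
  proof -
    have "\<pi> (c t) \<in> pts (quotient_space C \<pi>)" using c(2) by simp
    then obtain U F where U: "openin (ctop (quotient_space C \<pi>)) U" "\<pi> (c t) \<in> U"
        "F \<subseteq> chol (quotient_space C \<pi>) U" "A \<inter> U = {q \<in> U. \<forall>f\<in>F. f q = 0}"
      using A unfolding analytic_subset_def by meson
    have "(\<lambda>_. 0) \<in> chol (quotient_space C \<pi>) U"
      using U(1) unfolding chol_quotient_space openin_quotient_space chol_model comp_def
      by (auto intro!: exI[of _ UNIV] exI[of _ "\<lambda>_. 0"])
    then have "open {t. \<pi> (c t) \<in> U}" using chol_quotient_curve(1)[OF _ c] by blast
    then show ?thesis using U by blast
  qed
  have "open (- ?T)"
    unfolding open_subopen[of "- ?T"]
  proof (intro ballI)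
    fix t assume "t \<in> - ?T"
    obtain U F where U: "\<pi> (c t) \<in> U" "F \<subseteq> chol (quotient_space C \<pi>) U" "A \<inter> U = {q \<in> U. \<forall>f\<in>F. f q = 0}"
      "open {t. \<pi> (c t) \<in> U}" using loc by meson
    then obtain f where f: "f \<in> F" "f (\<pi> (c t)) \<noteq> 0" using \<open>t \<in> - ?T\<close> by blast
    let ?U = "{t. \<pi> (c t) \<in> U}"
    have "continuous_on ?U (\<lambda>t. f (\<pi> (c t)))"
      using chol_quotient_curve(2)[OF _ c] f U(2) by (intro holomorphic_on_imp_continuous_on) auto
    then have "open (?U \<inter> (\<lambda>t. f (\<pi> (c t))) -` (- {0}))"
      using U(4) continuous_on_open_vimage[OF U(4)] by (metis Int_commute open_Compl closed_singleton)
    moreover have "?U \<inter> (\<lambda>t. f (\<pi> (c t))) -` (- {0}) \<subseteq> - ?T" using U(3) f(1) by auto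
    ultimately show "\<exists>V. open V \<and> t \<in> V \<and> V \<subseteq> - ?T"
      using f(2) U(1) by (intro exI[of _ "?U \<inter> (\<lambda>t. f (\<pi> (c t))) -` (- {0})"]) auto
  qed
  then show cl: "closed ?T" by (simp add: closed_def)
  assume ne: "interior ?T \<noteq> {}"
  have "closure (interior ?T) \<subseteq> interior ?T"
  proof
    fix t assume t: "t \<in> closure (interior ?T)"
    obtain U F where U: "\<pi> (c t) \<in> U" "F \<subseteq> chol (quotient_space C \<pi>) U" "A \<inter> U = {q \<in> U. \<forall>f\<in>F. f q = 0}"
      "open {t. \<pi> (c t) \<in> U}" using loc by meson
    then obtain e where e: "e > 0" "ball t e \<subseteq> {t. \<pi> (c t) \<in> U}" by (metis (mono_tags) mem_Collect_eq open_contains_ball)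
    obtain t' where t': "t' \<in> interior ?T" "t' \<in> ball t e"
      using t e(1) by (metis closure_approachable dist_commute mem_ball)
    have "f (\<pi> (c x)) = 0" if f: "f \<in> F" and x: "x \<in> ball t e" for f x
    proof (rule analytic_continuation_open[where s = "interior ?T \<inter> ball t e" and s' = "ball t e" and f = "\<lambda>t. f (\<pi> (c t))" and g = "\<lambda>_. 0"])
      show "(\<lambda>t. f (\<pi> (c t))) holomorphic_on ball t e"
        by (rule holomorphic_on_subset[OF chol_quotient_curve(2)[OF subsetD[OF U(2) f] c] e(2)])
      show "f (\<pi> (c z)) = 0" if "z \<in> interior ?T \<inter> ball t e" for z
        using that U(3) f e(2) interior_subset[of ?T] by blast
    qed (use t' x in auto)
    then have "ball t e \<subseteq> ?T" using U(3) e(2) by blast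
    then show "t \<in> interior ?T" using e(1) by (meson centre_in_ball interior_maximal open_ball subsetD)
  qed
  then have "closed (interior ?T)" by (metis closure_subset closed_closure subset_antisym)
  then have "interior ?T = UNIV"
    using clopen[of "interior ?T"] ne open_interior by blast
  then show "?T = UNIV" using interior_subset[of ?T] by blast
qed

lemma analytic_subset_Int:
  assumes X: "csheaf X" and "analytic_subset X A" "analytic_subset X B" shows "analytic_subset X (A \<inter> B)"
  unfolding analytic_subset_def
proof (intro conjI ballI)
  show "A \<inter> B \<subseteq> pts X" using assms(2) by (auto simp: analytic_subset_def)
  fix p assume p: "p \<in> pts X"
  obtain U F where U: "openin (ctop X) U" "p \<in> U" "F \<subseteq> chol X U" "A \<inter> U = {q \<in> U. \<forall>f\<in>F. f q = 0}"
    using assms(2) p unfolding analytic_subset_def by meson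
  obtain V G where V: "openin (ctop X) V" "p \<in> V" "G \<subseteq> chol X V" "B \<inter> V = {q \<in> V. \<forall>f\<in>G. f q = 0}"
    using assms(3) p unfolding analytic_subset_def by meson
  have o: "openin (ctop X) (U \<inter> V)" using U V by blast
  have "F \<union> G \<subseteq> chol X (U \<inter> V)"
    using csheaf_restrict[OF X _ o] U(3) V(3) by auto
  moreover have "A \<inter> B \<inter> (U \<inter> V) = {q \<in> U \<inter> V. \<forall>f\<in>F \<union> G. f q = 0}" using U(4) V(4) by blast
  ultimately show "\<exists>U F. openin (ctop X) U \<and> p \<in> U \<and> F \<subseteq> chol X U \<and> A \<inter> B \<inter> U = {q \<in> U. \<forall>f\<in>F. f q = 0}"
    using o U V by (intro exI[of _ "U \<inter> V"] exI[of _ "F \<union> G"]) auto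
qed

text \<open>An irreducible set inside the union is the union of its intersections with
  \<open>A\<close> and \<open>B\<close>, so it lies in one of them; the maximal ones are therefore
  \<open>A\<close> and \<open>B\<close>.\<close>

lemma irreducible_components_Un:
  assumes X: "csheaf X" and A: "irreducible_analytic X A" and B: "irreducible_analytic X B" and n: "\<not> A \<subseteq> B" "\<not> B \<subseteq> A"
  shows "irreducible_components X (A \<union> B) = {A, B}"
proof -
  have sub: "K \<subseteq> A \<or> K \<subseteq> B" if "irreducible_analytic X K" "K \<subseteq> A \<union> B" for K
  proof -
    have "analytic_subset X (K \<inter> A)" "analytic_subset X (K \<inter> B)"
      using that A B analytic_subset_Int[OF X] by (auto simp: irreducible_analytic_def)
    moreover have "K = (K \<inter> A) \<union> (K \<inter> B)" using that by blast
    ultimately have "K = K \<inter> A \<or> K = K \<inter> B" using that(1) unfolding irreducible_analytic_def by blast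
    then show ?thesis by blast
  qed
  show ?thesis
  proof (intro equalityI subsetI)
    fix K assume "K \<in> irreducible_components X (A \<union> B)"
    then have K: "irreducible_analytic X K" "K \<subseteq> A \<union> B"
        "\<And>K'. irreducible_analytic X K' \<Longrightarrow> K \<subseteq> K' \<Longrightarrow> K' \<subseteq> A \<union> B \<Longrightarrow> K' = K"
      by (auto simp: irreducible_components_def)
    show "K \<in> {A, B}" using sub[OF K(1,2)] K(3)[OF A] K(3)[OF B] by auto
  next
    have comp: "A' \<in> irreducible_components X (A \<union> B)"
      if A': "irreducible_analytic X A'" "A' \<subseteq> A \<union> B" and m: "\<And>K. A' \<subseteq> K \<Longrightarrow> K \<subseteq> A \<or> K \<subseteq> B \<Longrightarrow> K = A'" for A'
      unfolding irreducible_components_def using that sub by simp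
    fix K assume "K \<in> {A, B}"
    then show "K \<in> irreducible_components X (A \<union> B)"
    proof (elim insertE emptyE)
      assume "K = A"
      moreover have "A \<in> irreducible_components X (A \<union> B)" by (rule comp[OF A]) (use n in auto)
      ultimately show ?thesis by simp
    next
      assume "K = B"
      moreover have "B \<in> irreducible_components X (A \<union> B)" by (rule comp[OF B]) (use n in auto)
      ultimately show ?thesis by simp
    qed
  qed
qed

subsection \<open>The double solid\<close>

text \<open>The weighted scaling whose orbits are the classes \<open>O2_class\<close>.\<close>

definition act :: "complex \<Rightarrow> complex^(4 + 1) \<Rightarrow> complex^(4 + 1)" where
  "act c v = (\<chi> i. case i of Inl k \<Rightarrow> c * v $ Inl k | Inr k \<Rightarrow> c^2 * v $ Inr k)"

lemma act_nth [simp]: "act c v $ Inl k = c * v $ Inl k" "act c v $ Inr j = c^2 * v $ Inr j"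
  by (simp_all add: act_def)

lemma vec41_eq_iff: "(v :: complex^(4 + 1)) = w \<longleftrightarrow> (\<forall>k. v $ Inl k = w $ Inl k) \<and> v $ Inr 1 = w $ Inr 1"
proof
  assume A: "(\<forall>k. v $ Inl k = w $ Inl k) \<and> v $ Inr 1 = w $ Inr 1"
  have "v $ i = w $ i" for i
  proof (cases i)
    case (Inr k)
    have "k = 1" by (rule num1_eqI)
    then show ?thesis using A Inr \<open>k = 1\<close> by simp
  qed (use A in auto)
  then show "v = w" by (simp add: vec_eq_iff)
qed simp

lemma act_act: "act c (act d v) = act (c * d) v"
  by (simp add: vec41_eq_iff power_mult_distrib)

lemma act_1 [simp]: "act 1 v = v"
  by (simp add: vec41_eq_iff)

lemma O2_class_act: "O2_class v = {act c v | c. c \<noteq> 0}"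
  by (simp add: O2_class_def act_def)

lemma in_O2_class: "w \<in> O2_class v \<longleftrightarrow> (\<exists>c. c \<noteq> 0 \<and> w = act c v)"
  by (auto simp: O2_class_act)

lemma self_in_O2_class [simp]: "v \<in> O2_class v"
  unfolding in_O2_class by (rule exI[of _ 1]) simp

lemma O2_class_scale [simp]:
  assumes "c \<noteq> 0" shows "O2_class (act c v) = O2_class v"
proof -
  have "\<exists>d. d \<noteq> 0 \<and> act e (act c v) = act d v" if "e \<noteq> 0" for e
    using that assms by (intro exI[of _ "e * c"]) (simp add: act_act)
  moreover have "\<exists>d. d \<noteq> 0 \<and> act e v = act d (act c v)" if "e \<noteq> 0" for e
    using that assms by (intro exI[of _ "e / c"]) (simp add: act_act)
  ultimately show ?thesis unfolding set_eq_iff in_O2_class by metis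
qed

lemma O2_class_eq_iff: "O2_class v = O2_class w \<longleftrightarrow> (\<exists>c. c \<noteq> 0 \<and> w = act c v)"
  by (metis O2_class_scale in_O2_class self_in_O2_class)

lemma Z0_quotient: "Z0 a b Q = quotient_space (Z0_coords a b Q) O2_class"
  by (simp add: Z0_def)

lemma csheaf_Z0 [simp]: "csheaf (Z0 a b Q)"
  by (simp add: Z0_def)

lemma lft_nonzero: "lft (v :: complex^(4 + 1)) \<noteq> 0 \<longleftrightarrow> (\<exists>k. v $ Inl k \<noteq> 0)"
  by (auto simp: vec_eq_iff)

lemma Z0_coords_iff: "v \<in> Z0_coords a b Q \<longleftrightarrow> (\<exists>k. v $ Inl k \<noteq> 0) \<and>
    (v $ Inr 1)^2 + (v $ Inl 2 * v $ Inl 3 + quad_form Q (v $ Inl 0) (v $ Inl 1))^2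
         - v $ Inl 0 * v $ Inl 1 * (v $ Inl 0 + v $ Inl 1) * (of_real a * v $ Inl 0 - of_real b * v $ Inl 1) = 0"
  unfolding Z0_coords_def Let_def mem_Collect_eq lft_nonzero by simp

lemma open_Z0_coordinate: "openin (ctop (Z0 a b Q)) {q \<in> pts (Z0 a b Q). \<forall>v\<in>q. v $ Inl k \<noteq> 0}"
proof -
  have "Z0_coords a b Q \<inter> O2_class -` {q \<in> pts (Z0 a b Q). \<forall>v\<in>q. v $ Inl k \<noteq> 0} = Z0_coords a b Q \<inter> {v. v $ Inl k \<noteq> 0}"
    unfolding Z0_quotient pts_quotient_space by (auto simp: in_O2_class intro: self_in_O2_class)
  moreover have "open {v :: complex^(4 + 1). v $ Inl k \<noteq> 0}"
    using open_Collect_neq[OF hol_on_continuous[OF hol_on_coord] continuous_on_const] by blast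
  ultimately show ?thesis
    unfolding Z0_quotient openin_quotient_space by (auto simp: openin_open_Int)
qed

text \<open>A homogeneous equation of degree \<open>d\<close> is represented by \<open>P / y\<^sub>k\<^sup>d\<close> where \<open>y\<^sub>k \<noteq> 0\<close>.\<close>

lemma analytic_subset_Z0:
  assumes K: "K = {q \<in> pts (Z0 a b Q). \<forall>v\<in>q. \<forall>(P, d)\<in>F. P v = 0}"
    and hol: "\<And>P d. (P, d) \<in> F \<Longrightarrow> hol_on UNIV P" and hom: "\<And>P d c v. (P, d) \<in> F \<Longrightarrow> P (act c v) = c ^ d * P v"
  shows "analytic_subset (Z0 a b Q) K"
  unfolding analytic_subset_def
proof (intro conjI ballI)
  show "K \<subseteq> pts (Z0 a b Q)" using K by auto
  fix p assume "p \<in> pts (Z0 a b Q)"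
  then obtain w where w: "w \<in> Z0_coords a b Q" "p = O2_class w" by (auto simp: Z0_quotient)
  then obtain k where k: "w $ Inl k \<noteq> 0" by (auto simp: Z0_coords_iff)
  let ?U = "{q \<in> pts (Z0 a b Q). \<forall>v\<in>q. v $ Inl k \<noteq> 0}"
  define fn where "fn = (\<lambda>(P, d) q. let v = (SOME v :: complex^(4 + 1). v \<in> q) in P v / (v $ Inl k) ^ d :: complex)"
  have fn: "fn (P, d) (O2_class v) = P v / (v $ Inl k) ^ d" if "(P, d) \<in> F" for P d v
  proof -
    have "(SOME v'. v' \<in> O2_class v) \<in> O2_class v" by (rule someI) (rule self_in_O2_class)
    then obtain c where c: "c \<noteq> 0" "(SOME v'. v' \<in> O2_class v) = act c v" by (auto simp: in_O2_class)
    then show ?thesis unfolding fn_def by (simp add: hom[OF that] power_mult_distrib)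
  qed
  have oU: "openin (ctop (Z0 a b Q)) ?U" by (rule open_Z0_coordinate)
  have "fn (P, d) \<in> chol (Z0 a b Q) ?U" if PF: "(P, d) \<in> F" for P d
    unfolding Z0_quotient chol_quotient_space
  proof
    have "C \<inter> O2_class -` ?U \<subseteq> {v. v $ Inl k \<noteq> 0}" for C by (auto intro: self_in_O2_class)
    moreover have "open {v :: complex^(4 + 1). v $ Inl k \<noteq> 0}"
      using open_Collect_neq[OF hol_on_continuous[OF hol_on_coord] continuous_on_const] by blast
    moreover have "hol_on {v :: complex^(4 + 1). v $ Inl k \<noteq> 0} (\<lambda>v. P v / (v $ Inl k) ^ d)"
      by (intro hol_on_divide hol_on_power hol_on_coord hol_on_subset[OF hol[OF PF]]) auto
    ultimately show "fn (P, d) \<circ> O2_class \<in> chol (model (Z0_coords a b Q)) (Z0_coords a b Q \<inter> O2_class -`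
        {q \<in> pts (quotient_space (Z0_coords a b Q) O2_class). \<forall>v\<in>q. v $ Inl k \<noteq> 0})"
      using oU unfolding Z0_quotient openin_quotient_space chol_model
      by (auto simp: fn[OF PF] intro!: exI[of _ "{v. v $ Inl k \<noteq> 0}"] exI[of _ "\<lambda>v. P v / (v $ Inl k) ^ d"])
  qed auto
  then have "fn ` F \<subseteq> chol (Z0 a b Q) ?U" by auto
  moreover have "K \<inter> ?U = {q \<in> ?U. \<forall>f\<in>fn ` F. f q = 0}"
  proof -
    have "(\<forall>v\<in>q. \<forall>(P, d)\<in>F. P v = 0) \<longleftrightarrow> (\<forall>f\<in>fn ` F. f q = 0)" if q: "q \<in> ?U" for q
    proof -
      obtain v where v: "q = O2_class v" using q by (auto simp: Z0_quotient)
      have vk: "v $ Inl k \<noteq> 0" using q v by auto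
      have "(\<forall>v'\<in>q. \<forall>(P, d)\<in>F. P v' = 0) \<longleftrightarrow> (\<forall>(P, d)\<in>F. P v = 0)"
        using v hom by (fastforce simp: in_O2_class)
      also have "\<dots> \<longleftrightarrow> (\<forall>f\<in>fn ` F. f q = 0)" using fn vk v by fastforce
      finally show ?thesis .
    qed
    then show ?thesis using K by blast
  qed
  moreover have "p \<in> ?U" using w k by (auto simp: Z0_quotient in_O2_class)
  ultimately show "\<exists>U F. openin (ctop (Z0 a b Q)) U \<and> p \<in> U \<and> F \<subseteq> chol (Z0 a b Q) U \<and> K \<inter> U = {q \<in> U. \<forall>f\<in>F. f q = 0}"
    using oU by blast
qed

lemma affine_coords_nth [simp]:
  "affine_coords Q v $ 0 = v $ Inl 0 / v $ Inl 3" "affine_coords Q v $ 1 = v $ Inl 1 / v $ Inl 3"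
  "affine_coords Q v $ 2 = v $ Inr 1 / (v $ Inl 3)^2 + \<i> * (v $ Inl 2 / v $ Inl 3 + quad_form Q (v $ Inl 0 / v $ Inl 3) (v $ Inl 1 / v $ Inl 3))"
  "affine_coords Q v $ 3 = v $ Inr 1 / (v $ Inl 3)^2 - \<i> * (v $ Inl 2 / v $ Inl 3 + quad_form Q (v $ Inl 0 / v $ Inl 3) (v $ Inl 1 / v $ Inl 3))"
  by (simp_all add: affine_coords_def Let_def)

lemma line_through_lft: "lft ` O2_class v = line_through (lft v)"
proof
  show "lft ` O2_class v \<subseteq> line_through (lft v)"
  proof
    fix y assume "y \<in> lft ` O2_class v"
    then obtain c where "c \<noteq> 0" "y = lft (act c v)" by (auto simp: in_O2_class)
    then show "y \<in> line_through (lft v)" unfolding in_line_through by (auto simp: vec_eq_iff intro!: exI[of _ c])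
  qed
  show "line_through (lft v) \<subseteq> lft ` O2_class v"
  proof
    fix y assume "y \<in> line_through (lft v)"
    then obtain c where c: "c \<noteq> 0" "y = c *s lft v" by (auto simp: in_line_through)
    then have "y = lft (act c v)" by (simp add: vec_eq_iff)
    moreover have "act c v \<in> O2_class v" using c(1) by (auto simp: in_O2_class)
    ultimately show "y \<in> lft ` O2_class v" by (rule image_eqI)
  qed
qed

text \<open>The coordinate that vanishes to first order along the curve, and the other one.\<close>

definition iX :: "complex \<Rightarrow> 4" where "iX j = (if j = \<i> then 2 else 3)"
definition iE :: "complex \<Rightarrow> 4" where "iE j = (if j = \<i> then 3 else 2)"

lemma affine_coords_iX_iE:
  assumes "j = \<i> \<or> j = - \<i>"
  shows "affine_coords Q v $ iX j = v $ Inr 1 / (v $ Inl 3)^2 + j * (v $ Inl 2 / v $ Inl 3 + quad_form Q (v $ Inl 0 / v $ Inl 3) (v $ Inl 1 / v $ Inl 3))"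
    "affine_coords Q v $ iE j = v $ Inr 1 / (v $ Inl 3)^2 - j * (v $ Inl 2 / v $ Inl 3 + quad_form Q (v $ Inl 0 / v $ Inl 3) (v $ Inl 1 / v $ Inl 3))"
proof -
  have "- \<i> \<noteq> \<i>" by (simp add: complex_eq_iff)
  then show "affine_coords Q v $ iX j = v $ Inr 1 / (v $ Inl 3)^2 + j * (v $ Inl 2 / v $ Inl 3 + quad_form Q (v $ Inl 0 / v $ Inl 3) (v $ Inl 1 / v $ Inl 3))"
    "affine_coords Q v $ iE j = v $ Inr 1 / (v $ Inl 3)^2 - j * (v $ Inl 2 / v $ Inl 3 + quad_form Q (v $ Inl 0 / v $ Inl 3) (v $ Inl 1 / v $ Inl 3))"
    using assms by (auto simp: iX_def iE_def)
qed

text \<open>Negativity of f makes s, A and B positive, so that \<beta> and A can be divided by;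
  \<open>lam \<noteq> lam0\<close> keeps the curves away from the double point over P_0.\<close>

locale conic_pencil =
  fixes a b lam lam0 \<theta> :: real and Q :: "real \<times> real \<times> real"
  assumes f_neg: "f_cubic a b lam < 0" and lam0: "lam \<noteq> lam0"
begin

definition qv :: real where "qv = quad_form Q lam 1"
definition fv :: real where "fv = f_cubic a b lam"
definition sv :: real where "sv = sqrt (qv^2 - fv)"
definition Bv :: real where "Bv = B_fun a b Q lam"
text \<open>The counterpart of B^2 = (s - q)/2. Then s = A + B^2, q = A - B^2 and f = - 4 A B^2,
  which is the source of all algebraic identities below.\<close>

definition Av :: real where "Av = (sv + qv) / 2"
definition \<beta> :: complex where "\<beta> = of_real Bv * cis \<theta>"

lemma sv: "\<bar>qv\<bar> < sv" "sv^2 = qv^2 - fv"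
proof -
  have "qv^2 < qv^2 - fv" using f_neg by (simp add: fv_def)
  then have "sqrt (qv^2) < sv" unfolding sv_def by (rule real_sqrt_less_mono)
  then show "\<bar>qv\<bar> < sv" by simp
  have "0 \<le> qv^2 - fv" using \<open>qv^2 < qv^2 - fv\<close> zero_le_power2[of qv] by linarith
  then show "sv^2 = qv^2 - fv" unfolding sv_def by (rule real_sqrt_pow2)
qed

lemma Bv: "Bv > 0" "Bv^2 = (sv - qv) / 2"
proof -
  have e: "Bv = sqrt ((sv - qv) / 2)" by (simp add: Bv_def B_fun_def sv_def qv_def fv_def)
  then show "Bv > 0" "Bv^2 = (sv - qv) / 2" using sv(1) by auto
qed

lemma Av: "Av > 0" using sv(1) by (simp add: Av_def)

lemma beta_cnj: "cnj \<beta> = of_real Bv * cis (- \<theta>)"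
  by (simp add: \<beta>_def cis_cnj)

lemma rels: "\<beta> * cnj \<beta> = of_real sv - of_real Av" "of_real qv = 2 * of_real Av - (of_real sv :: complex)"
  "of_real fv = - 4 * of_real Av * (\<beta> * cnj \<beta>)" "\<beta> \<noteq> 0" "of_real Av \<noteq> (0 :: complex)" "of_real sv \<noteq> (0 :: complex)"
proof -
  have "\<beta> * cnj \<beta> = of_real (Bv^2)" by (simp add: \<beta>_def cis_cnj[symmetric] complex_mult_cnj norm_mult complex_norm_square[symmetric] power2_eq_square cis_mult ac_simps)
  also have "Bv^2 = sv - Av" by (simp add: Bv Av_def field_simps)
  finally show 1: "\<beta> * cnj \<beta> = of_real sv - of_real Av" by simp
  have "qv = 2 * Av - sv" by (simp add: Av_def field_simps)
  then show "of_real qv = 2 * of_real Av - (of_real sv :: complex)" by simp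
  have "fv = - 4 * Av * (sv - Av)" using sv(2) by (simp add: Av_def power2_eq_square field_simps)
  then show "of_real fv = - 4 * of_real Av * (\<beta> * cnj \<beta>)" unfolding 1 by simp
  show "\<beta> \<noteq> 0" using Bv by (simp add: \<beta>_def)
  show "of_real Av \<noteq> (0 :: complex)" "of_real sv \<noteq> (0 :: complex)" using Av sv by auto
qed

lemma quad_form_lam: "quad_form Q (of_real lam * y) y = of_real qv * (y :: complex)^2"
proof -
  obtain p q r where Q: "Q = (p, q, r)" by (metis surj_pair)
  have e: "of_real qv = (of_real p * of_real lam ^ 2 + of_real q * of_real lam + of_real r :: complex)"
    unfolding qv_def unfolding Q by simp
  show ?thesis unfolding e unfolding Q by (simp add: power2_eq_square algebra_simps)
qed

lemma quartic_lam: "of_real lam * y * y * (of_real lam * y + y) * (of_real a * (of_real lam * y) - of_real b * y) = of_real fv * (y :: complex)^4"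
  by (simp add: fv_def f_cubic_def power4_eq_xxxx algebra_simps)

definition cpoly :: "complex^(4 + 1) \<Rightarrow> complex" where
  "cpoly v = of_real sv * (v $ Inl 1)^2 + \<beta> * v $ Inl 1 * v $ Inl 2 + cnj \<beta> * v $ Inl 1 * v $ Inl 3 + v $ Inl 2 * v $ Inl 3"

definition Kc :: "complex \<Rightarrow> (complex^(4 + 1)) set" where
  "Kc j = {v. (\<exists>k. v $ Inl k \<noteq> 0) \<and> v $ Inl 0 = of_real lam * v $ Inl 1 \<and> cpoly v = 0 \<and>
     v $ Inr 1 = j * v $ Inl 1 * (\<beta> * v $ Inl 2 - cnj \<beta> * v $ Inl 3)}"

definition K :: "complex \<Rightarrow> (complex^(4 + 1)) set set" where "K j = O2_class ` Kc j"

definition is_i :: "complex \<Rightarrow> bool" where "is_i j \<longleftrightarrow> j = \<i> \<or> j = - \<i>"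

lemma is_i: "is_i j \<Longrightarrow> j * j = - 1" "is_i j \<Longrightarrow> cnj j = - j" "is_i j \<Longrightarrow> j \<noteq> 0" "is_i j \<Longrightarrow> is_i (- j)" "is_i j \<Longrightarrow> - j \<noteq> j"
  by (auto simp: is_i_def complex_eq_iff)

text \<open>On the conic y2 y3 = - s y1^2 - y1 (\<beta> y2 + cnj \<beta> y3); by q = s - 2 \<beta>
  cnj \<beta> and f = - 4 A \<beta> cnj \<beta> the expression (y2 y3 + Q)^2 - f y1^4 becomes the
  square of y1 (\<beta> y2 - cnj \<beta> y3). So the double cover splits over the conic, z being
  this square root times \<i> or - \<i>.\<close>

lemma equation_on_plane:
  assumes "v $ Inl 0 = of_real lam * v $ Inl 1"
  shows "(v $ Inr 1)^2 + (v $ Inl 2 * v $ Inl 3 + quad_form Q (v $ Inl 0) (v $ Inl 1))^2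
         - v $ Inl 0 * v $ Inl 1 * (v $ Inl 0 + v $ Inl 1) * (of_real a * v $ Inl 0 - of_real b * v $ Inl 1)
      = (v $ Inr 1)^2 + (v $ Inl 1 * (\<beta> * v $ Inl 2 - cnj \<beta> * v $ Inl 3))^2
        + cpoly v * (4 * (\<beta> * cnj \<beta>) * (v $ Inl 1)^2 + cpoly v + 2 * (of_real qv - of_real sv) * (v $ Inl 1)^2 - 2 * v $ Inl 1 * (\<beta> * v $ Inl 2 + cnj \<beta> * v $ Inl 3))"
  unfolding assms quad_form_lam quartic_lam cpoly_def rels(2,3) using rels(1) by algebra

lemma Kc_sub: assumes "is_i j" shows "Kc j \<subseteq> Z0_coords a b Q"
proof
  fix v assume v: "v \<in> Kc j"
  then have "v $ Inl 0 = of_real lam * v $ Inl 1" by (simp add: Kc_def)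
  from equation_on_plane[OF this] show "v \<in> Z0_coords a b Q"
    using v is_i(1)[OF assms] unfolding Z0_coords_iff Kc_def by (simp add: power2_eq_square) algebra
qed

lemma Kc_act: assumes "c \<noteq> 0" shows "act c v \<in> Kc j \<longleftrightarrow> v \<in> Kc j"
proof -
  have "cpoly (act c v) = c^2 * cpoly v" by (simp add: cpoly_def power2_eq_square algebra_simps)
  moreover have "c^2 * v $ Inr 1 = j * (c * v $ Inl 1) * (\<beta> * (c * v $ Inl 2) - cnj \<beta> * (c * v $ Inl 3)) \<longleftrightarrow>
      v $ Inr 1 = j * v $ Inl 1 * (\<beta> * v $ Inl 2 - cnj \<beta> * v $ Inl 3)"
  proof -
    have *: "j * (c * v $ Inl 1) * (\<beta> * (c * v $ Inl 2) - cnj \<beta> * (c * v $ Inl 3)) = c^2 * (j * v $ Inl 1 * (\<beta> * v $ Inl 2 - cnj \<beta> * v $ Inl 3))"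
      by (simp add: power2_eq_square algebra_simps)
    show ?thesis unfolding * using assms by simp
  qed
  ultimately show ?thesis using assms by (simp add: Kc_def)
qed

lemma in_K: "O2_class v \<in> K j \<longleftrightarrow> v \<in> Kc j"
  unfolding K_def image_iff O2_class_eq_iff by (metis Kc_act O2_class_eq_iff)

lemma K_pts: "is_i j \<Longrightarrow> K j \<subseteq> pts (Z0 a b Q)"
  using Kc_sub by (auto simp: K_def Z0_quotient)

lemma conic_preimage: "{q \<in> pts (Z0 a b Q). Phi0 q \<in> conic a b Q lam \<theta>} = K \<i> \<union> K (- \<i>)"
proof -
  have cc: "Phi0 (O2_class v) \<in> conic a b Q lam \<theta> \<longleftrightarrow> (v $ Inl 0 = of_real lam * v $ Inl 1 \<and> cpoly v = 0)" if "v \<in> Z0_coords a b Q" for v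
  proof -
    have "lft v \<noteq> 0" using that by (simp add: Z0_coords_iff lft_nonzero)
    then have pt: "line_through (lft v) \<in> pts projective_space" by simp
    have "(\<forall>y\<in>line_through (lft v). y $ 0 = of_real lam * y $ 1 \<and> of_real sv * (y $ 1)^2 + of_real Bv * cis \<theta> * y $ 1 * y $ 2 + of_real Bv * cis (- \<theta>) * y $ 1 * y $ 3 + y $ 2 * y $ 3 = 0)
       \<longleftrightarrow> (v $ Inl 0 = of_real lam * v $ Inl 1 \<and> cpoly v = 0)" (is "(\<forall>y\<in>_. ?P y) \<longleftrightarrow> _")
    proof
      assume "\<forall>y\<in>line_through (lft v). ?P y"
      then have "?P (lft v)" using self_in_line_through by blast
      then show "v $ Inl 0 = of_real lam * v $ Inl 1 \<and> cpoly v = 0" by (simp add: cpoly_def \<beta>_def cis_cnj)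
    next
      assume A: "v $ Inl 0 = of_real lam * v $ Inl 1 \<and> cpoly v = 0"
      show "\<forall>y\<in>line_through (lft v). ?P y"
      proof
        fix y assume "y \<in> line_through (lft v)"
        then obtain c where c: "c \<noteq> 0" "y = c *s lft v" by (auto simp: in_line_through)
        have "of_real sv * (y $ 1)^2 + of_real Bv * cis \<theta> * y $ 1 * y $ 2 + of_real Bv * cis (- \<theta>) * y $ 1 * y $ 3 + y $ 2 * y $ 3 = c^2 * cpoly v"
          by (simp add: c cpoly_def \<beta>_def cis_cnj power2_eq_square algebra_simps)
        then show "?P y" using A c by simp
      qed
    qed
    then show ?thesis using pt unfolding Phi0_def line_through_lft conic_def
      by (simp add: sv_def qv_def fv_def Bv_def del: pts_projective_space)
  qed
  have "(v \<in> Z0_coords a b Q \<and> v $ Inl 0 = of_real lam * v $ Inl 1 \<and> cpoly v = 0) \<longleftrightarrow> v \<in> Kc \<i> \<union> Kc (- \<i>)" for v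
  proof
    assume A: "v \<in> Z0_coords a b Q \<and> v $ Inl 0 = of_real lam * v $ Inl 1 \<and> cpoly v = 0"
    then have "(v $ Inr 1)^2 + (v $ Inl 1 * (\<beta> * v $ Inl 2 - cnj \<beta> * v $ Inl 3))^2 = 0" (is "?z^2 + ?w^2 = 0")
    proof -
      have v0: "v $ Inl 0 = of_real lam * v $ Inl 1" and c0: "cpoly v = 0" using A by auto
      have "(v $ Inr 1)^2 + (v $ Inl 2 * v $ Inl 3 + quad_form Q (v $ Inl 0) (v $ Inl 1))^2
         - v $ Inl 0 * v $ Inl 1 * (v $ Inl 0 + v $ Inl 1) * (of_real a * v $ Inl 0 - of_real b * v $ Inl 1) = 0"
        using A unfolding Z0_coords_iff by blast
      from trans[OF equation_on_plane[OF v0, symmetric] this] show ?thesis by (simp only: c0 mult_zero_left add_0_right)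
    qed
    moreover have "?z^2 + ?w^2 = (?z - \<i> * ?w) * (?z + \<i> * ?w)" by (simp add: power2_eq_square algebra_simps)
    ultimately have "?z = \<i> * ?w \<or> ?z = - \<i> * ?w" by (simp add: eq_neg_iff_add_eq_0)
    then have "?z = \<i> * v $ Inl 1 * (\<beta> * v $ Inl 2 - cnj \<beta> * v $ Inl 3) \<or>
        ?z = - \<i> * v $ Inl 1 * (\<beta> * v $ Inl 2 - cnj \<beta> * v $ Inl 3)" by (simp only: mult.assoc)
    then show "v \<in> Kc \<i> \<union> Kc (- \<i>)" using A unfolding Kc_def Z0_coords_iff by blast
  next
    assume "v \<in> Kc \<i> \<union> Kc (- \<i>)"
    then show "v \<in> Z0_coords a b Q \<and> v $ Inl 0 = of_real lam * v $ Inl 1 \<and> cpoly v = 0"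
      using Kc_sub[of \<i>] Kc_sub[of "- \<i>"] by (auto simp: Kc_def is_i_def)
  qed
  then have *: "(v \<in> Z0_coords a b Q \<and> Phi0 (O2_class v) \<in> conic a b Q lam \<theta>) \<longleftrightarrow> v \<in> Kc \<i> \<union> Kc (- \<i>)" for v
    using cc[of v] by blast
  have "{q \<in> pts (Z0 a b Q). Phi0 q \<in> conic a b Q lam \<theta>} = O2_class ` {v. v \<in> Z0_coords a b Q \<and> Phi0 (O2_class v) \<in> conic a b Q lam \<theta>}"
    by (auto simp: Z0_quotient)
  also have "\<dots> = O2_class ` (Kc \<i> \<union> Kc (- \<i>))" unfolding * by (rule arg_cong[where f = "image O2_class"]) auto
  finally show ?thesis by (simp add: K_def image_Un)
qed

lemma analytic_K: assumes "is_i j" shows "analytic_subset (Z0 a b Q) (K j)"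
proof -
  let ?P1 = "\<lambda>v :: complex^(4 + 1). v $ Inl 0 - of_real lam * v $ Inl 1"
  let ?P2 = "\<lambda>v :: complex^(4 + 1). v $ Inr 1 - j * v $ Inl 1 * (\<beta> * v $ Inl 2 - cnj \<beta> * v $ Inl 3)"
  let ?F = "{(?P1, 1), (cpoly, 2), (?P2, 2 :: nat)}"
  show ?thesis
  proof (rule analytic_subset_Z0[where F = ?F])
    show "K j = {q \<in> pts (Z0 a b Q). \<forall>v\<in>q. \<forall>(P, d)\<in>?F. P v = 0}"
    proof (intro equalityI subsetI)
      fix q assume q: "q \<in> K j"
      then obtain v where v: "q = O2_class v" "v \<in> Kc j" by (auto simp: K_def)
      have "v' \<in> Kc j" if "v' \<in> q" for v' using that v Kc_act by (auto simp: in_O2_class)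
      then show "q \<in> {q \<in> pts (Z0 a b Q). \<forall>v\<in>q. \<forall>(P, d)\<in>?F. P v = 0}"
        using K_pts[OF assms] q by (auto simp: Kc_def)
    next
      fix q assume q: "q \<in> {q \<in> pts (Z0 a b Q). \<forall>v\<in>q. \<forall>(P, d)\<in>?F. P v = 0}"
      note q' = q[unfolded mem_Collect_eq]
      have "q \<in> pts (Z0 a b Q)" by (rule conjunct1[OF q'])
      then obtain v where v: "q = O2_class v" "v \<in> Z0_coords a b Q" by (auto simp: Z0_quotient)
      have "\<forall>v\<in>q. \<forall>(P, d)\<in>?F. P v = 0" by (rule conjunct2[OF q'])
      then have "\<forall>(P, d)\<in>?F. P v = 0" by (rule bspec) (simp add: v(1))
      then have "v $ Inl 0 - of_real lam * v $ Inl 1 = 0" "cpoly v = 0"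
        "v $ Inr 1 - j * v $ Inl 1 * (\<beta> * v $ Inl 2 - cnj \<beta> * v $ Inl 3) = 0"
        by (simp_all only: ball_simps prod.case)
      moreover have "\<exists>k. v $ Inl k \<noteq> 0" using v(2) unfolding Z0_coords_iff by blast
      ultimately have "v \<in> Kc j" unfolding Kc_def by simp
      then show "q \<in> K j" using v by (simp add: in_K)
    qed
    have h: "hol_on UNIV ?P1" "hol_on UNIV cpoly" "hol_on UNIV ?P2"
      unfolding cpoly_def[abs_def]
      by (intro hol_on_diff hol_on_add hol_on_mult hol_on_power hol_on_coord hol_on_const)+
    have hm: "?P1 (act c v) = c ^ 1 * ?P1 v" "cpoly (act c v) = c ^ 2 * cpoly v" "?P2 (act c v) = c ^ 2 * ?P2 v" for c v
      unfolding act_nth cpoly_def by algebra+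
    fix P d assume P: "(P, d) \<in> ?F"
    then have cs: "P = ?P1 \<and> d = 1 \<or> P = cpoly \<and> d = 2 \<or> P = ?P2 \<and> d = 2" by blast
    then show "hol_on UNIV P" using h by blast
    show "P (act c v) = c ^ d * P v" for c v
      using cs hm[of c v] by (elim disjE conjE) (simp_all only:)
  qed
qed

subsection \<open>Parametrisation and irreducibility\<close>

text \<open>In the plane the conic is (y2 + cnj \<beta> y1) (y3 + \<beta> y1) = - A y1^2. With
  parameters p0, p1 this is solved by y1 = p0 p1, y2 + cnj \<beta> y1 = p0^2 and y3 + \<beta> y1 = -
  A p1^2.\<close>

definition par :: "complex \<Rightarrow> complex^2 \<Rightarrow> complex^(4 + 1)" where
  "par j y = (let Y1 = y $ 0 * y $ 1; Y2 = y $ 0 * (y $ 0 - cnj \<beta> * y $ 1); Y3 = - y $ 1 * (of_real Av * y $ 1 + \<beta> * y $ 0)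
     in comb (v4 (of_real lam * Y1) Y1 Y2 Y3) (\<chi> i. j * Y1 * (\<beta> * Y2 - cnj \<beta> * Y3)))"

lemma par_nth [simp]: "par j y $ Inl 0 = of_real lam * (y $ 0 * y $ 1)" "par j y $ Inl 1 = y $ 0 * y $ 1"
  "par j y $ Inl 2 = y $ 0 * (y $ 0 - cnj \<beta> * y $ 1)" "par j y $ Inl 3 = - y $ 1 * (of_real Av * y $ 1 + \<beta> * y $ 0)"
  "par j y $ Inr 1 = j * (y $ 0 * y $ 1) * (\<beta> * (y $ 0 * (y $ 0 - cnj \<beta> * y $ 1)) - cnj \<beta> * (- y $ 1 * (of_real Av * y $ 1 + \<beta> * y $ 0)))"
  by (simp_all add: par_def Let_def)

lemma par_mem: assumes "y \<noteq> 0" shows "par j y \<in> Kc j"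
proof -
  have "\<exists>k. par j y $ Inl k \<noteq> 0"
  proof (cases "y $ 1 = 0")
    case True
    then have "y $ 0 \<noteq> 0" using assms by (auto simp: vec2_eq_iff)
    then show ?thesis using True by (intro exI[of _ 2]) simp
  next
    case False
    show ?thesis
    proof (cases "y $ 0 = 0")
      case True
      then show ?thesis using False rels(5) by (intro exI[of _ 3]) simp
    qed (use False in \<open>auto intro!: exI[of _ 1]\<close>)
  qed
  moreover have "cpoly (par j y) = 0" unfolding cpoly_def par_nth using rels(1) by algebra
  ultimately show ?thesis by (simp add: Kc_def)
qed

text \<open>Off the line y1 = 0 the affine parameter is recovered as y2 / y1 + cnj \<beta>, by the
  factorisation behind \<open>par\<close>. On that line the conic reduces to y2 y3 = 0, which leaves
  the parameters (0:1) and (1:0).\<close>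

lemma par_surj: assumes "v \<in> Kc j" shows "\<exists>y. y \<noteq> 0 \<and> O2_class (par j y) = O2_class v"
proof -
  have v: "v $ Inl 0 = of_real lam * v $ Inl 1" "cpoly v = 0" "v $ Inr 1 = j * v $ Inl 1 * (\<beta> * v $ Inl 2 - cnj \<beta> * v $ Inl 3)"
    using assms by (auto simp: Kc_def)
  have all: "v = w" if "\<And>k. k \<in> {0, 1, 2, 3} \<Longrightarrow> v $ Inl k = w $ Inl k" "v $ Inr 1 = w $ Inr 1" for w
    using that exhaust_4' unfolding vec41_eq_iff by blast
  show ?thesis
  proof (cases "v $ Inl 1 = 0")
    case True
    then have "v $ Inl 2 = 0 \<or> v $ Inl 3 = 0" using v(2) by (simp add: cpoly_def)
    then show ?thesis
    proof
      assume z: "v $ Inl 2 = 0"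
      have n: "v $ Inl 3 \<noteq> 0"
      proof
        assume "v $ Inl 3 = 0"
        then have "v $ Inl k = 0" for k using exhaust_4'[of k] z True v(1) by auto
        then show False using assms by (auto simp: Kc_def)
      qed
      have "v = act (- v $ Inl 3 / of_real Av) (par j (vec2 0 1))"
        by (rule all) (use z True v rels(5) in auto)
      then show ?thesis using n rels(5) by (intro exI[of _ "vec2 0 1"]) (simp add: vec2_eq_iff O2_class_eq_iff, metis divide_eq_0_iff neg_equal_0_iff_equal of_real_eq_0_iff)
    next
      assume z: "v $ Inl 3 = 0"
      have n: "v $ Inl 2 \<noteq> 0"
      proof
        assume "v $ Inl 2 = 0"
        then have "v $ Inl k = 0" for k using exhaust_4'[of k] z True v(1) by auto
        then show False using assms by (auto simp: Kc_def)
      qed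
      have "v = act (v $ Inl 2) (par j (vec2 1 0))"
        by (rule all) (use z True v in auto)
      then show ?thesis using n by (intro exI[of _ "vec2 1 0"]) (simp add: vec2_eq_iff O2_class_eq_iff, metis)
    qed
  next
    case False
    define t where "t = v $ Inl 2 / v $ Inl 1 + cnj \<beta>"
    have v2: "v $ Inl 2 = v $ Inl 1 * (t - cnj \<beta>)" using False by (simp add: t_def)
    have "v $ Inl 1 * (t * (v $ Inl 3 + \<beta> * v $ Inl 1) + of_real Av * v $ Inl 1) = 0"
      using v(2) rels(1) unfolding cpoly_def v2 by algebra
    then have "t * (v $ Inl 3 + \<beta> * v $ Inl 1) + of_real Av * v $ Inl 1 = 0" using False by (metis mult_eq_0_iff)
    then have 3: "t * v $ Inl 3 = - v $ Inl 1 * (of_real Av + \<beta> * t)" by algebra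
    have t: "t \<noteq> 0" using 3 False rels(5) by auto
    have "v = act (v $ Inl 1 / t) (par j (vec2 t 1))"
    proof (rule all)
      show "v $ Inr 1 = act (v $ Inl 1 / t) (par j (vec2 t 1)) $ Inr 1"
      proof -
        have "t * v $ Inr 1 = j * v $ Inl 1 * (\<beta> * (v $ Inl 1 * (t - cnj \<beta>)) * t + cnj \<beta> * (v $ Inl 1 * (of_real Av + \<beta> * t)))"
          using v(3) 3 unfolding v2 by algebra
        then show ?thesis using t by (simp add: field_simps power2_eq_square)
      qed
    qed (use t v(1) 3 in \<open>auto simp: v2 field_simps\<close>)
    moreover have "v $ Inl 1 / t \<noteq> 0" using t False by simp
    ultimately show ?thesis by (intro exI[of _ "vec2 t 1"]) (metis O2_class_scale vec2_nth(2) zero_index zero_neq_one)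
  qed
qed

lemma K_param: "K j = (\<lambda>y. O2_class (par j y)) ` (- {0})"
  using par_mem par_surj by (fastforce simp: K_def)

lemma par_scale: "par j (c *s y) = act (c^2) (par j y)"
proof -
  have "par j (c *s y) $ Inl k = act (c^2) (par j y) $ Inl k" for k
    using exhaust_4'[of k] by (auto simp: power2_eq_square algebra_simps)
  then show ?thesis unfolding vec41_eq_iff by (simp add: power2_eq_square power4_eq_xxxx algebra_simps)
qed

lemma hol_on_par: "hol_on W f \<Longrightarrow> hol_on W g \<Longrightarrow> hol_on W (\<lambda>v. par j (vec2 (f v) (g v)) $ i)"
  unfolding par_def Let_def vec2_nth
  by (intro hol_on_comb hol_on_v4) (auto intro!: hol_on_mult hol_on_diff hol_on_add hol_on_uminus)

lemma par_curve_holomorphic: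
  "(\<lambda>t. par j (vec2 t 1) $ i) holomorphic_on UNIV" "(\<lambda>t. par j (vec2 1 t) $ i) holomorphic_on UNIV"
proof -
  have "(\<lambda>t. (\<lambda>v. par j (vec2 (v $ 0) (v $ 1)) $ i) (vec2 t 1)) holomorphic_on UNIV"
    by (rule hol_on_compose_curve[OF hol_on_par[of UNIV]]) (auto intro!: vec2_holomorphic holomorphic_intros)
  then show "(\<lambda>t. par j (vec2 t 1) $ i) holomorphic_on UNIV" by simp
  have "(\<lambda>t. (\<lambda>v. par j (vec2 (v $ 0) (v $ 1)) $ i) (vec2 1 t)) holomorphic_on UNIV"
    by (rule hol_on_compose_curve[OF hol_on_par[of UNIV]]) (auto intro!: vec2_holomorphic holomorphic_intros)
  then show "(\<lambda>t. par j (vec2 1 t) $ i) holomorphic_on UNIV" by simp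
qed

text \<open>If \<open>K j\<close> is the union of two analytic subsets and the parameters of the
  first are not everything, their complement is a nonempty open set contained in the parameters of
  the second, which by \<open>analytic_subset_curve\<close> are then everything.\<close>

lemma irreducible_K: assumes j: "is_i j" shows "irreducible_analytic (Z0 a b Q) (K j)"
  unfolding irreducible_analytic_def
proof (intro conjI allI impI)
  show "analytic_subset (Z0 a b Q) (K j)" by (rule analytic_K[OF j])
  show "K j \<noteq> {}" unfolding K_param by (auto intro: exI[of _ "vec2 1 1"] simp: vec2_eq_iff)
  have c: "par j (vec2 t 1) \<in> Z0_coords a b Q" "par j (vec2 1 t) \<in> Z0_coords a b Q" for t
    using par_mem[of _ j] Kc_sub[OF j] by (auto simp: vec2_eq_iff)
  \<comment> \<open>The point (1:0) that the parametrisation by (t:1) misses is a limit in the other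
    affine parameter, whose parameter set is closed.\<close>
  have whole: "K j \<subseteq> A" if A: "analytic_subset (Z0 a b Q) A" and all: "{t. O2_class (par j (vec2 t 1)) \<in> A} = UNIV" for A
  proof -
    let ?S = "{t. O2_class (par j (vec2 1 t)) \<in> A}"
    have cl: "closed ?S" using analytic_subset_curve(1)[OF A[unfolded Z0_quotient] par_curve_holomorphic(2) c(2)] .
    have "t \<in> ?S" if "t \<noteq> 0" for t
    proof -
      have "vec2 1 t = t *s vec2 (1 / t) 1" using that by (simp add: vec2_eq_iff)
      then have "O2_class (par j (vec2 1 t)) = O2_class (par j (vec2 (1 / t) 1))" using that by (simp add: par_scale)
      then show ?thesis using all by auto
    qed
    then have "- {0} \<subseteq> ?S" by blast
    then have "closure (- {0 :: complex}) \<subseteq> ?S" using cl by (rule closure_minimal)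
    moreover have "closure (- {0 :: complex}) = UNIV" by (simp add: closure_complement)
    ultimately have S: "?S = UNIV" by blast
    show ?thesis
    proof
      fix q assume "q \<in> K j"
      then obtain y where y: "y \<noteq> 0" "q = O2_class (par j y)" by (auto simp: K_param)
      show "q \<in> A"
      proof (cases "y $ 1 = 0")
        case True
        then have "y $ 0 \<noteq> 0" "y = y $ 0 *s vec2 1 0" using y(1) by (auto simp: vec2_eq_iff)
        then have "q = O2_class (par j (vec2 1 0))" using y(2) par_scale[of j "y $ 0" "vec2 1 0"] by simp
        then show ?thesis using S by auto
      next
        case False
        then have "y = y $ 1 *s vec2 (y $ 0 / y $ 1) 1" by (auto simp: vec2_eq_iff)
        then have "q = O2_class (par j (vec2 (y $ 0 / y $ 1) 1))" using y(2) par_scale[of j "y $ 1" "vec2 (y $ 0 / y $ 1) 1"] False by simp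
        then show ?thesis using all by auto
      qed
    qed
  qed
  fix A1 A2 assume A: "analytic_subset (Z0 a b Q) A1 \<and> analytic_subset (Z0 a b Q) A2 \<and> K j = A1 \<union> A2"
  let ?T = "\<lambda>A. {t. O2_class (par j (vec2 t 1)) \<in> A}"
  note cv = analytic_subset_curve[where \<pi> = O2_class and C = "Z0_coords a b Q", OF _ par_curve_holomorphic(1) c(1), folded Z0_quotient]
  have un: "?T A1 \<union> ?T A2 = UNIV"
  proof -
    have "O2_class (par j (vec2 t 1)) \<in> K j" for t using par_mem by (auto simp: in_K vec2_eq_iff)
    then show ?thesis using A by blast
  qed
  show "K j = A1 \<or> K j = A2"
  proof (cases "?T A1 = UNIV")
    case True
    then show ?thesis using whole[of A1] A by blast
  next
    case False
    have "- ?T A1 \<subseteq> interior (?T A2)"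
      by (rule interior_maximal) (use un cv(1)[where A = A1] A in \<open>auto simp: open_Compl\<close>)
    then have "interior (?T A2) \<noteq> {}" using False by blast
    then have "?T A2 = UNIV" using cv(2)[where A = A2] A by blast
    then show ?thesis using whole[of A2] A by blast
  qed
qed

lemma K_distinct: assumes j: "is_i j" shows "\<not> K j \<subseteq> K (- j)"
proof
  assume A: "K j \<subseteq> K (- j)"
  \<comment> \<open>At this parameter y2 = 0 and z = j s (cnj \<beta>)^2 is nonzero, whereas a
    common point of the two components has z equal to its negative.\<close>
  let ?v = "par j (vec2 (cnj \<beta>) 1)"
  have "?v \<in> Kc j" by (rule par_mem) (simp add: vec2_eq_iff)
  then have "?v \<in> Kc (- j)" using A by (metis in_K subsetD)
  then have "?v $ Inr 1 = 0" using \<open>?v \<in> Kc j\<close> by (simp add: Kc_def)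
  then have "(of_real Av + \<beta> * cnj \<beta>) * (j * cnj \<beta> * cnj \<beta>) = 0" unfolding par_nth vec2_nth by algebra
  then show False using rels is_i(3)[OF j] by simp
qed

lemma components: "irreducible_components (Z0 a b Q) {q \<in> pts (Z0 a b Q). Phi0 q \<in> conic a b Q lam \<theta>} = {K \<i>, K (- \<i>)}"
  unfolding conic_preimage
  by (rule irreducible_components_Un) (use irreducible_K K_distinct[of \<i>] K_distinct[of "- \<i>"] in \<open>auto simp: is_i_def\<close>)

end

context conic_pencil
begin

subsection \<open>Germs at the singular point\<close>

text \<open>Elimination of y2 / y3 by means of the conic. These closed formulas give the germ at
  \<open>p_inf\<close>, with orders 1 and 3, and also the values on the curve that enter the
  Jacobian.\<close>

lemma Kc_affine:
  assumes j: "is_i j" and v: "v \<in> Kc j" and v3: "v $ Inl 3 \<noteq> 0"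
  defines "x \<equiv> affine_coords Q v"
  shows "x $ 0 = of_real lam * x $ 1" "x $ iX j = - 2 * j * cnj \<beta> * x $ 1 * (1 + \<beta> * x $ 1)"
    "x $ iE j * (1 + \<beta> * x $ 1) = - 2 * j * of_real Av * \<beta> * (x $ 1) ^ 3"
    "v $ Inl 2 / v $ Inl 3 * (1 + \<beta> * x $ 1) = - x $ 1 * (cnj \<beta> + of_real sv * x $ 1)"
proof -
  define x1 where "x1 = v $ Inl 1 / v $ Inl 3"
  define x2 where "x2 = v $ Inl 2 / v $ Inl 3"
  define z where "z = v $ Inr 1 / (v $ Inl 3)^2"
  have v1: "v $ Inl 1 = x1 * v $ Inl 3" "v $ Inl 2 = x2 * v $ Inl 3" "v $ Inr 1 = z * (v $ Inl 3)^2"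
    using v3 by (simp_all add: x1_def x2_def z_def)
  have "(v $ Inl 3)^2 * (of_real sv * x1^2 + \<beta> * x1 * x2 + cnj \<beta> * x1 + x2) = 0"
    using v unfolding Kc_def cpoly_def v1 mem_Collect_eq by algebra
  then have con: "of_real sv * x1^2 + \<beta> * x1 * x2 + cnj \<beta> * x1 + x2 = 0" using v3 by simp
  have "(v $ Inl 3)^2 * (z - j * x1 * (\<beta> * x2 - cnj \<beta>)) = 0"
    using v unfolding Kc_def v1 mem_Collect_eq by algebra
  then have z: "z = j * x1 * (\<beta> * x2 - cnj \<beta>)" using v3 by simp
  have v0: "v $ Inl 0 / v $ Inl 3 = of_real lam * x1" using v by (simp add: Kc_def x1_def)
  have x1': "x $ 1 = x1" by (simp add: x_def x1_def)
  show "x $ 0 = of_real lam * x $ 1" using v0 by (simp add: x_def x1_def)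
  have X: "x $ iX j = z + j * (x2 + of_real qv * x1^2)" "x $ iE j = z - j * (x2 + of_real qv * x1^2)"
    using affine_coords_iX_iE[OF j[unfolded is_i_def], of Q v] unfolding v0 x_def
    by (simp_all add: x1_def[symmetric] x2_def[symmetric] z_def[symmetric] quad_form_lam)
  show "x $ iX j = - 2 * j * cnj \<beta> * x $ 1 * (1 + \<beta> * x $ 1)"
    unfolding X x1' z rels(2) using con rels(1) by algebra
  show "x $ iE j * (1 + \<beta> * x $ 1) = - 2 * j * of_real Av * \<beta> * (x $ 1) ^ 3"
    unfolding X x1' z rels(2) using con rels(1) by algebra
  show "v $ Inl 2 / v $ Inl 3 * (1 + \<beta> * x $ 1) = - x $ 1 * (cnj \<beta> + of_real sv * x $ 1)"
    unfolding x2_def[symmetric] x1' using con by algebra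
qed

text \<open>On \<open>Z0\<close> the product of the coordinates \<open>iX j\<close> and
  \<open>iE j\<close> is f x1^4, so for x1 \<noteq> 0 the given one fixes the other. Together they
  determine z and y2 / y3, hence the conic equation and the sign of z.\<close>

lemma Kc_affine_converse:
  assumes j: "is_i j" and v: "v \<in> Z0_coords a b Q" and v3: "v $ Inl 3 \<noteq> 0"
  defines "x \<equiv> affine_coords Q v"
  assumes x0: "x $ 0 = of_real lam * x $ 1" and x1: "x $ 1 \<noteq> 0" and xi: "x $ iX j = - 2 * j * cnj \<beta> * x $ 1 * (1 + \<beta> * x $ 1)"
  shows "v \<in> Kc j"
proof -
  define X1 where "X1 = v $ Inl 1 / v $ Inl 3"
  define x2 where "x2 = v $ Inl 2 / v $ Inl 3"
  define z where "z = v $ Inr 1 / (v $ Inl 3)^2"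
  have v1: "v $ Inl 1 = X1 * v $ Inl 3" "v $ Inl 2 = x2 * v $ Inl 3" "v $ Inr 1 = z * (v $ Inl 3)^2"
    using v3 by (simp_all add: X1_def x2_def z_def)
  have x1': "x $ 1 = X1" by (simp add: x_def X1_def)
  have v0: "v $ Inl 0 / v $ Inl 3 = of_real lam * X1" using x0 by (simp add: x_def X1_def)
  then have v0': "v $ Inl 0 = of_real lam * (X1 * v $ Inl 3)" using v3 by (simp add: field_simps)
  have X: "x $ iX j = z + j * (x2 + of_real qv * X1^2)"
    using affine_coords_iX_iE(1)[OF j[unfolded is_i_def], of Q v] unfolding v0 x_def
    by (simp add: X1_def[symmetric] x2_def[symmetric] z_def[symmetric] quad_form_lam)
  have xi': "z + j * (x2 + of_real qv * X1^2) = - 2 * j * cnj \<beta> * X1 * (1 + \<beta> * X1)" using xi unfolding X x1' .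
  have jj: "j * j = - 1" by (rule is_i(1)[OF j])
  have "(v $ Inl 3)^4 * (z^2 + (x2 + of_real qv * X1^2)^2 - of_real fv * X1^4) = 0"
  proof -
    have "(v $ Inr 1)^2 + (v $ Inl 2 * v $ Inl 3 + quad_form Q (of_real lam * (X1 * v $ Inl 3)) (X1 * v $ Inl 3))^2
         - of_real fv * (X1 * v $ Inl 3)^4 = 0"
      using v unfolding Z0_coords_iff v0' v1(1) quartic_lam by blast
    then show ?thesis unfolding v1 quad_form_lam by algebra
  qed
  then have Z: "z^2 + (x2 + of_real qv * X1^2)^2 = of_real fv * X1^4" using v3 by simp
  define E where "E = 1 + \<beta> * X1"
  \<comment> \<open>This is the coordinate \<open>iE j\<close>. Its product with E is a nonzero
    multiple of x1^3, so E does not vanish and can be cancelled at the end.\<close>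
  define h where "h = z - j * (x2 + of_real qv * X1^2)"
  have "- 2 * j * cnj \<beta> * X1 * E * h = of_real fv * X1^4"
    using Z xi' jj unfolding h_def E_def by algebra
  then have "X1 * cnj \<beta> * (j * E * h - 2 * of_real Av * \<beta> * X1^3) = 0"
    unfolding rels(3) by algebra
  then have hE: "j * E * h = 2 * of_real Av * \<beta> * X1^3" using x1 x1' rels(4) by simp
  have cE: "E * (of_real sv * X1^2 + \<beta> * X1 * x2 + cnj \<beta> * X1 + x2) = 0"
  proof -
    have "2 * (x2 + of_real qv * X1^2) * E = - 2 * cnj \<beta> * X1 * E^2 + 2 * of_real Av * \<beta> * X1^3"
      using hE xi' jj unfolding h_def E_def by algebra
    then have "2 * (x2 * E + of_real sv * X1^2 + cnj \<beta> * X1) = 0"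
      using rels(1)
      unfolding rels(2) E_def by algebra
    then have "x2 * E + of_real sv * X1^2 + cnj \<beta> * X1 = 0" by (metis mult_eq_0_iff zero_neq_numeral)
    then have "of_real sv * X1^2 + \<beta> * X1 * x2 + cnj \<beta> * X1 + x2 = 0" unfolding E_def by algebra
    then show ?thesis by simp
  qed
  have En: "E \<noteq> 0"
  proof
    assume "E = 0"
    then have "2 * of_real Av * \<beta> * X1^3 = 0" using hE by simp
    then show False using rels x1 x1' by simp
  qed
  then have con: "of_real sv * X1^2 + \<beta> * X1 * x2 + cnj \<beta> * X1 + x2 = 0" using cE by simp
  have z: "z = j * X1 * (\<beta> * x2 - cnj \<beta>)"
    using xi' con rels(1) unfolding rels(2) by algebra
  have "cpoly v = 0" unfolding cpoly_def v1 using con by algebra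
  moreover have "v $ Inr 1 = j * v $ Inl 1 * (\<beta> * v $ Inl 2 - cnj \<beta> * v $ Inl 3)" unfolding v1 z by algebra
  ultimately show ?thesis using v3 v0' v1(1) by (auto simp: Kc_def)
qed

lemma p_inf_in_K: "p_inf \<in> K j" "p_inf_bar \<in> K j"
proof -
  have e: "axis (Inl 3) 1 = act (- 1 / of_real Av) (par j (vec2 0 1)) \<and> axis (Inl 2) 1 = par j (vec2 1 0)"
  proof -
    have "(axis (Inl 3) 1 :: complex^(4 + 1)) $ Inl k = act (- 1 / of_real Av) (par j (vec2 0 1)) $ Inl k"
      "(axis (Inl 2) 1 :: complex^(4 + 1)) $ Inl k = par j (vec2 1 0) $ Inl k" for k
      using exhaust_4'[of k] rels(5) by (auto simp: axis_def)
    then show ?thesis unfolding vec41_eq_iff by (simp add: axis_def)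
  qed
  have "par j (vec2 0 1) \<in> Kc j" "par j (vec2 1 0) \<in> Kc j" by (auto intro!: par_mem simp: vec2_eq_iff)
  then show "p_inf \<in> K j" "p_inf_bar \<in> K j"
    unfolding p_inf_def p_inf_bar_def in_K using e rels(5) by (simp_all add: Kc_act)
qed

text \<open>Here the norm of \<beta> x1 is below 1/2, so that of 1 + \<beta> x1 is above 1/2.
  Written without dividing by y3 the condition is homogeneous, and its strictness forces y3 \<noteq>
  0.\<close>

definition germ_nbhd :: "(complex^(4 + 1)) set set" where
  "germ_nbhd = {q \<in> pts (Z0 a b Q). \<forall>v\<in>q. 2 * norm \<beta> * norm (v $ Inl 1) < norm (v $ Inl 3)}"

lemma germ_nbhd_open: "openin (ctop (Z0 a b Q)) germ_nbhd"
proof -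
  have "Z0_coords a b Q \<inter> O2_class -` germ_nbhd = Z0_coords a b Q \<inter> {v. 2 * norm \<beta> * norm (v $ Inl 1) < norm (v $ Inl 3)}"
  proof (intro equalityI subsetI)
    fix v assume v: "v \<in> Z0_coords a b Q \<inter> {v. 2 * norm \<beta> * norm (v $ Inl 1) < norm (v $ Inl 3)}"
    have "2 * norm \<beta> * norm (act c v $ Inl 1) < norm (act c v $ Inl 3)" if "c \<noteq> 0" for c
    proof -
      have "norm c * (2 * norm \<beta> * norm (v $ Inl 1)) < norm c * norm (v $ Inl 3)"
        using v that by (intro mult_strict_left_mono) auto
      then show ?thesis by (simp add: norm_mult ac_simps)
    qed
    then show "v \<in> Z0_coords a b Q \<inter> O2_class -` germ_nbhd"
      using v by (auto simp: germ_nbhd_def Z0_quotient in_O2_class)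
  qed (use self_in_O2_class in \<open>auto simp: germ_nbhd_def\<close>)
  moreover have "open {v :: complex^(4 + 1). 2 * norm \<beta> * norm (v $ Inl 1) < norm (v $ Inl 3)}"
    by (intro open_Collect_less continuous_intros)
  ultimately show ?thesis
    unfolding Z0_quotient openin_quotient_space by (auto simp: openin_open_Int germ_nbhd_def Z0_quotient)
qed

text \<open>The formulas of \<open>Kc_affine\<close> leave the errors - 2 j \<beta> cnj \<beta> x1^2
  and 2 j A \<beta>^2 x1^4 / (1 + \<beta> x1); the denominator costs at most a factor 2. Their
  constants are added up to the single \<open>M\<close>.\<close>

lemma germ_bounds:
  assumes j: "is_i j" and q: "q \<in> K j" "q \<in> germ_nbhd" and v: "v \<in> q"
  defines "x \<equiv> affine_coords Q v" and "M \<equiv> 2 * norm (cnj \<beta> * \<beta>) + 4 * norm (of_real Av * \<beta> * \<beta>)"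
  shows "v $ Inl 3 \<noteq> 0" "x $ 0 = of_real lam * x $ 1"
    "norm (x $ iX j - (- 2 * j * cnj \<beta>) * (x $ 1) ^ 1) \<le> M * norm (x $ 1) ^ (1 + 1)"
    "norm (x $ iE j - (- 2 * j * of_real Av * \<beta>) * (x $ 1) ^ 3) \<le> M * norm (x $ 1) ^ (3 + 1)"
proof -
  have small: "2 * norm \<beta> * norm (v $ Inl 1) < norm (v $ Inl 3)" using q(2) v by (simp add: germ_nbhd_def)
  moreover have "0 \<le> 2 * norm \<beta> * norm (v $ Inl 1)" by simp
  ultimately have "0 < norm (v $ Inl 3)" by linarith
  then show v3: "v $ Inl 3 \<noteq> 0" by simp
  have vK: "v \<in> Kc j" using q(1) v Kc_act unfolding K_def by (auto simp: in_O2_class)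
  note ka = Kc_affine[OF j vK v3, folded x_def]
  show "x $ 0 = of_real lam * x $ 1" by (rule ka(1))
  have nj: "norm j = 1" using j by (auto simp: is_i_def)
  have "norm (\<beta> * x $ 1) < 1 / 2" using small v3 by (simp add: x_def norm_mult norm_divide field_simps)
  moreover have "1 \<le> norm (1 + \<beta> * x $ 1) + norm (\<beta> * x $ 1)"
    using norm_triangle_ineq4[of "1 + \<beta> * x $ 1" "\<beta> * x $ 1"] by simp
  ultimately have E: "norm (1 + \<beta> * x $ 1) > 1 / 2" by linarith
  then have En: "1 + \<beta> * x $ 1 \<noteq> 0" by auto
  have "x $ iX j - (- 2 * j * cnj \<beta>) * (x $ 1) ^ 1 = - 2 * j * (cnj \<beta> * \<beta>) * (x $ 1)^2"
    unfolding ka(2) by algebra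
  then have "norm (x $ iX j - (- 2 * j * cnj \<beta>) * (x $ 1) ^ 1) = 2 * norm (cnj \<beta> * \<beta>) * norm (x $ 1) ^ (1 + 1)"
    by (simp add: norm_mult norm_power nj power2_eq_square)
  also have "\<dots> \<le> M * norm (x $ 1) ^ (1 + 1)" unfolding M_def by (intro mult_right_mono) auto
  finally show "norm (x $ iX j - (- 2 * j * cnj \<beta>) * (x $ 1) ^ 1) \<le> M * norm (x $ 1) ^ (1 + 1)" .
  have "(x $ iE j - (- 2 * j * of_real Av * \<beta>) * (x $ 1) ^ 3) * (1 + \<beta> * x $ 1) = 2 * j * (of_real Av * \<beta> * \<beta>) * (x $ 1)^4"
    using ka(3) by algebra
  then have "norm (x $ iE j - (- 2 * j * of_real Av * \<beta>) * (x $ 1) ^ 3) * norm (1 + \<beta> * x $ 1) = 2 * norm (of_real Av * \<beta> * \<beta>) * norm (x $ 1)^4"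
    by (metis (no_types, lifting) norm_mult norm_power nj norm_numeral mult.right_neutral)
  moreover have "norm (x $ iE j - (- 2 * j * of_real Av * \<beta>) * (x $ 1) ^ 3) * (1 / 2) \<le>
      norm (x $ iE j - (- 2 * j * of_real Av * \<beta>) * (x $ 1) ^ 3) * norm (1 + \<beta> * x $ 1)"
    using E by (intro mult_left_mono) auto
  ultimately have "norm (x $ iE j - (- 2 * j * of_real Av * \<beta>) * (x $ 1) ^ 3) \<le> 4 * norm (of_real Av * \<beta> * \<beta>) * norm (x $ 1)^(3 + 1)"
    by (simp add: numeral_eq_Suc)
  also have "\<dots> \<le> M * norm (x $ 1)^(3 + 1)" unfolding M_def by (intro mult_right_mono) auto
  finally show "norm (x $ iE j - (- 2 * j * of_real Av * \<beta>) * (x $ 1) ^ 3) \<le> M * norm (x $ 1) ^ (3 + 1)" .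
qed

text \<open>On \<open>K j\<close> the coordinate \<open>iE j\<close> vanishes to third order at
  \<open>p_inf\<close>, so it has no expansion that begins with a nonzero multiple of x1. This tells
  the two components apart.\<close>

lemma not_germ:
  assumes j: "is_i j" and c: "c \<noteq> 0" and W: "openin (ctop (Z0 a b Q)) W" "p_inf \<in> W"
    and bound: "\<And>q v. q \<in> K j \<Longrightarrow> q \<in> W \<Longrightarrow> v \<in> q \<Longrightarrow>
       norm (affine_coords Q v $ iE j - c * (affine_coords Q v $ 1) ^ 1) \<le> M * norm (affine_coords Q v $ 1) ^ (1 + 1)"
  shows False
proof -
  let ?v = "\<lambda>t. par j (vec2 t 1)"
  \<comment> \<open>The coordinate x1 along the parameters (t:1), which reach \<open>p_inf\<close>
    at t = 0. Dividing the assumed estimate by the norm of x1 bounds the norm of \<open>c\<close> by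
    \<open>?g\<close>, which tends to 0.\<close>
  let ?x1 = "\<lambda>t. - t / (of_real Av + \<beta> * t)"
  let ?g = "\<lambda>t. norm (2 * j * of_real Av * \<beta> * (?x1 t)^2 / (1 + \<beta> * ?x1 t)) + M * norm (?x1 t)"
  have vK: "?v t \<in> Kc j" for t by (rule par_mem) (simp add: vec2_eq_iff)
  then have vZ: "?v t \<in> Z0_coords a b Q" for t using Kc_sub[OF j] by blast
  have "openin (top_of_set (Z0_coords a b Q)) (Z0_coords a b Q \<inter> O2_class -` W)"
    using W(1) by (simp add: Z0_quotient openin_quotient_space)
  then obtain V where V: "open V" "Z0_coords a b Q \<inter> O2_class -` W = Z0_coords a b Q \<inter> V" by (auto simp: openin_open)
  have "continuous_on UNIV (\<lambda>t. \<chi> i. ?v t $ i)"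
    by (intro continuous_on_vec_lambda holomorphic_on_imp_continuous_on par_curve_holomorphic)
  then have "open (?v -` V)" using open_vimage[OF V(1)] by simp
  moreover have "axis (Inl 3) 1 = act (- 1 / of_real Av) (?v 0)"
  proof -
    have "(axis (Inl 3) 1 :: complex^(4 + 1)) $ Inl k = act (- 1 / of_real Av) (?v 0) $ Inl k" for k
      using exhaust_4'[of k] rels(5) by (auto simp: axis_def)
    then show ?thesis unfolding vec41_eq_iff by (simp add: axis_def)
  qed
  then have "O2_class (?v 0) \<in> W" using W(2) rels(5) unfolding p_inf_def by simp
  then have "0 \<in> ?v -` V" using V(2) vZ by auto
  ultimately have e1: "\<forall>\<^sub>F t in at 0. t \<in> ?v -` V" by (rule eventually_at_in_open')
  have "((\<lambda>t. of_real Av + \<beta> * t) \<longlongrightarrow> of_real Av) (at 0)" by (auto intro!: tendsto_eq_intros)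
  from tendsto_imp_eventually_ne[OF this rels(5)] have e2: "\<forall>\<^sub>F t in at 0. of_real Av + \<beta> * t \<noteq> 0" .
  have e3: "\<forall>\<^sub>F t in at (0 :: complex). t \<noteq> 0" by (rule eventually_neq_at_within)
  have "\<forall>\<^sub>F t in at 0. norm c \<le> ?g t"
    using e1 e2 e3
  proof eventually_elim
    case (elim t)
    have inW: "O2_class (?v t) \<in> W" using V(2) vZ[of t] elim(1) by auto
    have "?v t $ Inl 3 = - (of_real Av + \<beta> * t)" by simp
    note par3 = this
    then have v3: "?v t $ Inl 3 \<noteq> 0" using elim(2) by (simp only: neg_equal_0_iff_equal not_False_eq_True)
    have "?v t $ Inl 1 = t" by simp
    then have x1: "affine_coords Q (?v t) $ 1 = ?x1 t"
      unfolding affine_coords_nth par3 by (simp only: divide_minus_right minus_divide_left)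
    have n: "?x1 t \<noteq> 0" using elim by simp
    have E: "1 + \<beta> * ?x1 t \<noteq> 0"
    proof
      assume "1 + \<beta> * ?x1 t = 0"
      then have "of_real Av + \<beta> * t - \<beta> * t = 0" using elim(2) by (simp add: field_simps)
      then show False using rels(5) by simp
    qed
    have "affine_coords Q (?v t) $ iE j * (1 + \<beta> * ?x1 t) = - 2 * j * of_real Av * \<beta> * (?x1 t) ^ 3"
      using Kc_affine(3)[OF j vK v3] unfolding x1 .
    then have xE: "affine_coords Q (?v t) $ iE j = - 2 * j * of_real Av * \<beta> * (?x1 t) ^ 3 / (1 + \<beta> * ?x1 t)"
      by (rule eq_divide_imp[OF E])
    have "O2_class (?v t) \<in> K j" using vK by (simp add: in_K)
    from bound[OF this inW self_in_O2_class]
    have b: "norm (affine_coords Q (?v t) $ iE j - c * ?x1 t) \<le> M * norm (?x1 t) ^ 2"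
      unfolding x1 by (simp add: numeral_2_eq_2)
    have "c * ?x1 t = affine_coords Q (?v t) $ iE j - (affine_coords Q (?v t) $ iE j - c * ?x1 t)" by simp
    then have "norm (c * ?x1 t) \<le> norm (affine_coords Q (?v t) $ iE j) + M * norm (?x1 t) ^ 2"
      using norm_triangle_ineq4[of "affine_coords Q (?v t) $ iE j" "affine_coords Q (?v t) $ iE j - c * ?x1 t"] b by simp
    also have "norm (affine_coords Q (?v t) $ iE j) = norm (?x1 t) * norm (2 * j * of_real Av * \<beta> * (?x1 t)^2 / (1 + \<beta> * ?x1 t))"
      unfolding xE by (simp only: norm_mult norm_divide norm_minus_cancel norm_power norm_numeral power3_eq_cube power2_eq_square mult_minus_left) (simp only: times_divide_eq_right ac_simps)
    finally have f: "norm (c * ?x1 t) \<le> norm (?x1 t) * norm (2 * j * of_real Av * \<beta> * (?x1 t)^2 / (1 + \<beta> * ?x1 t)) + M * norm (?x1 t) ^ 2" .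
    have arith: "y * n \<le> y * (u + M * y)" if "m \<le> y * u + M * y ^ 2" "m = n * y" for m n y u :: real
      using that by (simp add: power2_eq_square algebra_simps)
    show ?case by (rule mult_left_le_imp_le[OF arith[OF f norm_mult]]) (use n in \<open>simp only: zero_less_norm_iff not_False_eq_True\<close>)
  qed
  moreover have "(?g \<longlongrightarrow> norm (2 * j * of_real Av * \<beta> * (- 0 / (of_real Av + \<beta> * 0))^2 / (1 + \<beta> * (- 0 / (of_real Av + \<beta> * 0)))) + M * norm (- 0 / (of_real Av + \<beta> * 0))) (at 0)"
    by (intro tendsto_intros) (use rels(5) in auto)
  then have "(?g \<longlongrightarrow> 0) (at 0)" by simp
  ultimately have "norm c \<le> 0" by (intro tendsto_lowerbound) auto
  then show False using c by simp
qed

lemma is_i_cases: "is_i \<i>" "is_i (- \<i>)" "iX \<i> = 2" "iE \<i> = 3" "iX (- \<i>) = 3" "iE (- \<i>) = 2"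
  by (auto simp: is_i_def iX_def iE_def complex_eq_iff)

text \<open>By f = - 4 A B^2 the coefficient f / (2 B) equals - 2 A B, which matches the expansions
  of \<open>Kc_affine\<close>.\<close>

lemma germ_constants:
  "- 2 * \<i> * of_real (B_fun a b Q lam) * cis (- \<theta>) = - 2 * \<i> * cnj \<beta>"
  "2 * \<i> * of_real (B_fun a b Q lam) * cis (- \<theta>) = - 2 * (- \<i>) * cnj \<beta>"
  "\<i> * cis \<theta> * of_real (f_cubic a b lam) / (2 * of_real (B_fun a b Q lam)) = - 2 * \<i> * of_real Av * \<beta>"
  "- \<i> * cis \<theta> * of_real (f_cubic a b lam) / (2 * of_real (B_fun a b Q lam)) = - 2 * (- \<i>) * of_real Av * \<beta>"
proof -
  show "- 2 * \<i> * of_real (B_fun a b Q lam) * cis (- \<theta>) = - 2 * \<i> * cnj \<beta>"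
    "2 * \<i> * of_real (B_fun a b Q lam) * cis (- \<theta>) = - 2 * (- \<i>) * cnj \<beta>"
    by (simp_all add: beta_cnj Bv_def)
  have "fv = - 4 * Av * Bv^2" using sv(2) unfolding Bv(2) by (simp add: Av_def power2_eq_square field_simps)
  then have "complex_of_real fv / (2 * of_real Bv) = - 2 * of_real Av * of_real Bv"
    using Bv(1) by (simp add: power2_eq_square)
  then have *: "complex_of_real (f_cubic a b lam) / (2 * of_real (B_fun a b Q lam)) = - 2 * of_real Av * of_real Bv"
    by (simp add: fv_def Bv_def)
  show "\<i> * cis \<theta> * of_real (f_cubic a b lam) / (2 * of_real (B_fun a b Q lam)) = - 2 * \<i> * of_real Av * \<beta>"
    unfolding times_divide_eq_right[symmetric] * by (simp add: \<beta>_def)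
  show "- \<i> * cis \<theta> * of_real (f_cubic a b lam) / (2 * of_real (B_fun a b Q lam)) = - 2 * (- \<i>) * of_real Av * \<beta>"
    unfolding times_divide_eq_right[symmetric] * by (simp add: \<beta>_def)
qed

lemma p_inf_nbhd: "p_inf \<in> germ_nbhd"
  unfolding germ_nbhd_def
  using K_pts[OF is_i_cases(1)] p_inf_in_K(1) by (auto simp: p_inf_def in_O2_class axis_def norm_mult)

lemma has_germ_plus: "has_germ a b Q lam (- 2 * \<i> * cnj \<beta>) 1 (- 2 * \<i> * of_real Av * \<beta>) 3 (K \<i>)"
proof -
  note gb = germ_bounds[OF is_i_cases(1), unfolded is_i_cases]
  show ?thesis
    unfolding has_germ_def Let_def
    by (intro conjI exI[of _ germ_nbhd] exI[of _ "2 * norm (cnj \<beta> * \<beta>) + 4 * norm (of_real Av * \<beta> * \<beta>)"] ballI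
        p_inf_in_K p_inf_nbhd germ_nbhd_open gb) blast+
qed

lemma has_germ_minus: "has_germ a b Q lam (- 2 * (- \<i>) * of_real Av * \<beta>) 3 (- 2 * (- \<i>) * cnj \<beta>) 1 (K (- \<i>))"
proof -
  note gb = germ_bounds[OF is_i_cases(2), unfolded is_i_cases]
  show ?thesis
    unfolding has_germ_def Let_def
    by (intro conjI exI[of _ germ_nbhd] exI[of _ "2 * norm (cnj \<beta> * \<beta>) + 4 * norm (of_real Av * \<beta> * \<beta>)"] ballI
        p_inf_in_K p_inf_nbhd germ_nbhd_open gb) blast+
qed

lemma cnj_beta_nz: "cnj \<beta> \<noteq> 0" using rels(4) by simp

lemma not_germ_plus: "\<not> has_germ a b Q lam (- 2 * \<i> * cnj \<beta>) 1 d n (K (- \<i>))"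
proof
  assume "has_germ a b Q lam (- 2 * \<i> * cnj \<beta>) 1 d n (K (- \<i>))"
  then obtain W M where W: "openin (ctop (Z0 a b Q)) W" "p_inf \<in> W"
    "\<And>q v. q \<in> K (- \<i>) \<Longrightarrow> q \<in> W \<Longrightarrow> v \<in> q \<Longrightarrow>
       norm (affine_coords Q v $ 2 - (- 2 * \<i> * cnj \<beta>) * (affine_coords Q v $ 1) ^ 1) \<le> M * norm (affine_coords Q v $ 1) ^ (1 + 1)"
    unfolding has_germ_def Let_def by blast
  show False by (rule not_germ[OF is_i_cases(2) _ W(1,2) W(3)[folded is_i_cases(6)]]) (use cnj_beta_nz in auto)
qed

lemma not_germ_minus: "\<not> has_germ a b Q lam d n (- 2 * (- \<i>) * cnj \<beta>) 1 (K \<i>)"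
proof
  assume "has_germ a b Q lam d n (- 2 * (- \<i>) * cnj \<beta>) 1 (K \<i>)"
  then obtain W M where W: "openin (ctop (Z0 a b Q)) W" "p_inf \<in> W"
    "\<And>q v. q \<in> K \<i> \<Longrightarrow> q \<in> W \<Longrightarrow> v \<in> q \<Longrightarrow>
       norm (affine_coords Q v $ 3 - (- 2 * (- \<i>) * cnj \<beta>) * (affine_coords Q v $ 1) ^ 1) \<le> M * norm (affine_coords Q v $ 1) ^ (1 + 1)"
    unfolding has_germ_def Let_def by blast
  show False by (rule not_germ[OF is_i_cases(1) _ W(1,2) W(3)[folded is_i_cases(4)]]) (use cnj_beta_nz in auto)
qed

lemma conic_component_plus:
  "conic_component a b Q lam \<theta> (- 2 * \<i> * of_real (B_fun a b Q lam) * cis (- \<theta>)) 1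
        (\<i> * cis \<theta> * of_real (f_cubic a b lam) / (2 * of_real (B_fun a b Q lam))) 3 = K \<i>"
  unfolding conic_component_def components germ_constants
  by (rule the_equality) (use has_germ_plus not_germ_plus in auto)

lemma conic_component_minus:
  "conic_component a b Q lam \<theta> (- \<i> * cis \<theta> * of_real (f_cubic a b lam) / (2 * of_real (B_fun a b Q lam))) 3
        (2 * \<i> * of_real (B_fun a b Q lam) * cis (- \<theta>)) 1 = K (- \<i>)"
  unfolding conic_component_def components germ_constants
  by (rule the_equality) (use has_germ_minus not_germ_minus in auto)

lemma L_plus_eq: "L_plus a b Q lam0 Z \<mu> lam \<theta> = ctop Z closure_of {p \<in> pts Z. \<mu> p \<in> K \<i> - {p_inf, p_inf_bar, p_zero lam0}}"
  unfolding L_plus_def conic_component_plus proper_transform_def ..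

lemma L_minus_eq: "L_minus a b Q lam0 Z \<mu> lam \<theta> = ctop Z closure_of {p \<in> pts Z. \<mu> p \<in> K (- \<i>) - {p_inf, p_inf_bar, p_zero lam0}}"
  unfolding L_minus_def conic_component_minus proper_transform_def ..

subsection \<open>The curves away from the singular points\<close>

lemma vec41_eqI:
  "v $ Inl 0 = w $ Inl 0 \<Longrightarrow> v $ Inl 1 = w $ Inl 1 \<Longrightarrow> v $ Inl 2 = w $ Inl 2 \<Longrightarrow> v $ Inl 3 = w $ Inl 3 \<Longrightarrow> v $ Inr 1 = w $ Inr 1 \<Longrightarrow>
    v = (w :: complex^(4 + 1))"
proof -
  assume A: "v $ Inl 0 = w $ Inl 0" "v $ Inl 1 = w $ Inl 1" "v $ Inl 2 = w $ Inl 2" "v $ Inl 3 = w $ Inl 3" "v $ Inr 1 = w $ Inr 1"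
  have "v $ Inl k = w $ Inl k" for k using exhaust_4'[of k] A by auto
  then show "v = w" using A unfolding vec41_eq_iff by blast
qed

text \<open>On the conic y1 = 0 leaves y2 y3 = 0, that is, the two points over P_\<infinity> and its
  conjugate. The remaining singular point lies outside the plane of the conic, since
  \<open>lam \<noteq> lam0\<close>.\<close>

lemma K_minus_S:
  assumes j: "is_i j"
  shows "O2_class v \<in> K j - {p_inf, p_inf_bar, p_zero lam0} \<longleftrightarrow> v \<in> Kc j \<and> v $ Inl 1 \<noteq> 0"
proof -
  have eqS: "O2_class v = p_inf \<or> O2_class v = p_inf_bar" if v: "v \<in> Kc j" and z: "v $ Inl 1 = 0"
  proof -
    have v0: "v $ Inl 0 = 0" "v $ Inr 1 = 0" "v $ Inl 2 * v $ Inl 3 = 0" using v z by (auto simp: Kc_def cpoly_def)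
    have ex: "\<exists>k. v $ Inl k \<noteq> 0" using v by (simp add: Kc_def)
    from v0(3) have "v $ Inl 2 = 0 \<or> v $ Inl 3 = 0" by simp
    then show ?thesis
    proof
      assume z2: "v $ Inl 2 = 0"
      have e: "v = act (v $ Inl 3) (axis (Inl 3) 1)"
        by (rule vec41_eqI) (use z z2 v0 in \<open>simp_all add: axis_def\<close>)
      have "v $ Inl 3 \<noteq> 0" 
      proof
        assume z3: "v $ Inl 3 = 0"
        have "v $ Inl k = 0" for k using exhaust_4'[of k] z z2 z3 v0(1) by auto
        then show False using ex by blast
      qed
      then have "O2_class v = p_inf" unfolding p_inf_def by (subst e) (rule O2_class_scale)
      then show ?thesis ..
    next
      assume z3: "v $ Inl 3 = 0"
      have e: "v = act (v $ Inl 2) (axis (Inl 2) 1)"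
        by (rule vec41_eqI) (use z z3 v0 in \<open>simp_all add: axis_def\<close>)
      have "v $ Inl 2 \<noteq> 0" 
      proof
        assume z2: "v $ Inl 2 = 0"
        have "v $ Inl k = 0" for k using exhaust_4'[of k] z z2 z3 v0(1) by auto
        then show False using ex by blast
      qed
      then have "O2_class v = p_inf_bar" unfolding p_inf_bar_def by (subst e) (rule O2_class_scale)
      then show ?thesis ..
    qed
  qed
  have "v $ Inl 1 = 0" if S: "O2_class v = p_inf \<or> O2_class v = p_inf_bar"
  proof -
    obtain k c where c: "k = 2 \<or> k = 3" "c \<noteq> 0" "axis (Inl k) 1 = act c v"
      using S unfolding p_inf_def p_inf_bar_def O2_class_eq_iff by blast
    then have "(axis (Inl k) 1 :: complex^(4 + 1)) $ Inl 1 = c * v $ Inl 1" by simp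
    then show ?thesis using c(1,2) by (auto simp: axis_def)
  qed
  moreover have "O2_class v \<noteq> p_zero lam0" if v: "v \<in> Kc j"
  proof
    assume "O2_class v = p_zero lam0"
    then obtain c where c: "c \<noteq> 0" "axis (Inl 0) (of_real lam0) + axis (Inl 1) 1 = act c v"
      unfolding p_zero_def O2_class_eq_iff by blast
    then have "(axis (Inl 0) (of_real lam0) + axis (Inl 1) 1 :: complex^(4 + 1)) $ Inl 0 = c * v $ Inl 0"
      "(axis (Inl 0) (of_real lam0) + axis (Inl 1) 1 :: complex^(4 + 1)) $ Inl 1 = c * v $ Inl 1" by simp_all
    then have "of_real lam0 = c * v $ Inl 0" "1 = c * v $ Inl 1" by (simp_all add: axis_def)
    moreover have "v $ Inl 0 = of_real lam * v $ Inl 1" using v by (simp add: Kc_def)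
    ultimately have "(of_real lam0 :: complex) = of_real lam" by (metis mult.left_commute mult.right_neutral)
    then show False using lam0 by simp
  qed
  ultimately show ?thesis using eqS unfolding Diff_iff insert_iff empty_iff in_K by blast
qed

text \<open>The real structure on coordinate vectors, of which \<open>Z0_conj\<close> is the effect
  on classes.\<close>

definition conjv :: "complex^(4 + 1) \<Rightarrow> complex^(4 + 1)" where
  "conjv v = (\<chi> i. case i of Inl k \<Rightarrow> cnj (v $ Inl (if k = 2 then 3 else if k = 3 then 2 else k)) | Inr k \<Rightarrow> cnj (v $ Inr k))"

lemma conjv_nth [simp]: "conjv v $ Inl 0 = cnj (v $ Inl 0)" "conjv v $ Inl 1 = cnj (v $ Inl 1)"
  "conjv v $ Inl 2 = cnj (v $ Inl 3)" "conjv v $ Inl 3 = cnj (v $ Inl 2)" "conjv v $ Inr k = cnj (v $ Inr k)"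
  by (simp_all add: conjv_def)

lemma conjv_act: "conjv (act c v) = act (cnj c) (conjv v)"
  by (rule vec41_eqI) simp_all

lemma Z0_conj_class: "Z0_conj (O2_class v) = O2_class (conjv v)"
proof -
  have "Z0_conj q = conjv ` q" for q unfolding Z0_conj_def conjv_def ..
  moreover have "conjv ` O2_class v = O2_class (conjv v)"
  proof (intro equalityI subsetI)
    fix w assume "w \<in> O2_class (conjv v)"
    then obtain c where c: "c \<noteq> 0" "w = act c (conjv v)" by (auto simp: in_O2_class)
    then have "w = conjv (act (cnj c) v)" by (simp add: conjv_act)
    moreover have "act (cnj c) v \<in> O2_class v" using c by (auto simp: in_O2_class)
    ultimately show "w \<in> conjv ` O2_class v" by blast
  next
    fix w assume "w \<in> conjv ` O2_class v"
    then obtain c where "c \<noteq> 0" "w = act (cnj c) (conjv v)" by (auto simp: in_O2_class conjv_act)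
    then show "w \<in> O2_class (conjv v)" unfolding in_O2_class by (intro exI[of _ "cnj c"]) simp
  qed
  ultimately show ?thesis by simp
qed

text \<open>Each component is real: the real structure sends \<beta> y2 - cnj \<beta> y3 to its
  negative conjugate, and this sign is compensated by cnj j = - j.\<close>

lemma conjv_Kc:
  assumes j: "is_i j" and v: "v \<in> Kc j" shows "conjv v \<in> Kc j"
proof -
  have e: "v $ Inl 0 = of_real lam * v $ Inl 1" "cpoly v = 0" "v $ Inr 1 = j * v $ Inl 1 * (\<beta> * v $ Inl 2 - cnj \<beta> * v $ Inl 3)" and ex: "\<exists>k. v $ Inl k \<noteq> 0"
    using v by (auto simp: Kc_def)
  have "cpoly (conjv v) = cnj (cpoly v)" by (simp add: cpoly_def algebra_simps)
  then have "cpoly (conjv v) = 0" using e by simp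
  moreover have "conjv v $ Inr 1 = j * conjv v $ Inl 1 * (\<beta> * conjv v $ Inl 2 - cnj \<beta> * conjv v $ Inl 3)"
    using is_i(2)[OF j] by (simp add: e(3) algebra_simps)
  moreover have "\<exists>k. conjv v $ Inl k \<noteq> 0"
  proof (rule ccontr)
    assume "\<not> (\<exists>k. conjv v $ Inl k \<noteq> 0)"
    then have "conjv v $ Inl 0 = 0" "conjv v $ Inl 1 = 0" "conjv v $ Inl 2 = 0" "conjv v $ Inl 3 = 0" by blast+
    then have "v $ Inl k = 0" for k using exhaust_4'[of k] by auto
    then show False using ex by blast
  qed
  ultimately show ?thesis using e(1) by (simp add: Kc_def)
qed

lemma conjv_conjv [simp]: "conjv (conjv v) = v"
  by (rule vec41_eqI) simp_all

lemma conjv_K_minus_S: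
  assumes j: "is_i j"
  shows "O2_class (conjv v) \<in> K j - {p_inf, p_inf_bar, p_zero lam0} \<longleftrightarrow> O2_class v \<in> K j - {p_inf, p_inf_bar, p_zero lam0}"
  unfolding K_minus_S[OF j] using conjv_Kc[OF j, of v] conjv_Kc[OF j, of "conjv v"] by auto

lemma conjv_Z0_coords: "v \<in> Z0_coords a b Q \<Longrightarrow> conjv v \<in> Z0_coords a b Q"
proof -
  assume v: "v \<in> Z0_coords a b Q"
  have qf: "quad_form Q (cnj x) (cnj y) = cnj (quad_form Q x y)" for x y :: complex by (cases Q) simp
  have ex: "\<exists>k. conjv v $ Inl k \<noteq> 0"
  proof (rule ccontr)
    assume "\<not> (\<exists>k. conjv v $ Inl k \<noteq> 0)"
    then have "conjv v $ Inl 0 = 0" "conjv v $ Inl 1 = 0" "conjv v $ Inl 2 = 0" "conjv v $ Inl 3 = 0" by blast+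
    then have "v $ Inl k = 0" for k using exhaust_4'[of k] by auto
    then show False using v by (auto simp: Z0_coords_iff)
  qed
  let ?P = "(v $ Inr 1)^2 + (v $ Inl 2 * v $ Inl 3 + quad_form Q (v $ Inl 0) (v $ Inl 1))^2
         - v $ Inl 0 * v $ Inl 1 * (v $ Inl 0 + v $ Inl 1) * (of_real a * v $ Inl 0 - of_real b * v $ Inl 1)"
  have "?P = 0" using v unfolding Z0_coords_iff by blast
  then have "cnj ?P = 0" by simp
  then show ?thesis unfolding Z0_coords_iff conjv_nth qf using ex by (simp add: mult.commute)
qed

lemma affine_line_iff:
  assumes j: "is_i j" and v: "v \<in> Z0_coords a b Q" and v3: "v $ Inl 3 \<noteq> 0"
  defines "x \<equiv> affine_coords Q v"
  shows "O2_class v \<in> K j - {p_inf, p_inf_bar, p_zero lam0} \<longleftrightarrow>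
    x $ 1 \<noteq> 0 \<and> x $ 0 = of_real lam * x $ 1 \<and> x $ iX j = - (2 * j * cnj \<beta>) * x $ 1 * (1 + \<beta> * x $ 1)"
  unfolding K_minus_S[OF j] x_def
  using Kc_affine(1,2)[OF j _ v3] Kc_affine_converse[OF j v v3] v3 by auto

text \<open>For y2 = y3 = 0 the conic leaves s y1^2 = 0. Hence the affine parts y3 \<noteq> 0 and y2
  \<noteq> 0 cover the curve.\<close>

lemma Kc_coordinate: "v \<in> Kc j \<Longrightarrow> v $ Inl 2 \<noteq> 0 \<or> v $ Inl 3 \<noteq> 0"
proof (rule ccontr)
  assume v: "v \<in> Kc j" and "\<not> (v $ Inl 2 \<noteq> 0 \<or> v $ Inl 3 \<noteq> 0)"
  then have z: "v $ Inl 2 = 0" "v $ Inl 3 = 0" by auto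
  then have "v $ Inl 1 = 0" using v rels(6) by (simp add: Kc_def cpoly_def)
  then have "v $ Inl k = 0" for k using exhaust_4'[of k] z v by (auto simp: Kc_def)
  then show False using v by (auto simp: Kc_def)
qed

text \<open>Keeps the closure that defines the proper transform inside the preimage of
  \<open>K j\<close>.\<close>

lemma closed_K: assumes "is_i j" shows "closedin (ctop (Z0 a b Q)) (K j)"
proof -
  have "Z0_coords a b Q \<inter> O2_class -` (pts (Z0 a b Q) - K j) = Z0_coords a b Q \<inter> - Kc j"
    by (auto simp: in_K Z0_quotient)
  also have "\<dots> = Z0_coords a b Q \<inter> - {v. v $ Inl 0 = of_real lam * v $ Inl 1 \<and> cpoly v = 0 \<and>
     v $ Inr 1 = j * v $ Inl 1 * (\<beta> * v $ Inl 2 - cnj \<beta> * v $ Inl 3)}"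
    by (auto simp: Kc_def Z0_coords_iff)
  finally have e: "Z0_coords a b Q \<inter> O2_class -` (pts (Z0 a b Q) - K j) = \<dots>" .
  have "closed {v. v $ Inl 0 = of_real lam * v $ Inl 1 \<and> cpoly v = 0 \<and>
     v $ Inr 1 = j * v $ Inl 1 * (\<beta> * v $ Inl 2 - cnj \<beta> * v $ Inl 3)}"
    unfolding cpoly_def by (intro closed_Collect_conj closed_Collect_eq continuous_intros)
  then have "openin (ctop (Z0 a b Q)) (pts (Z0 a b Q) - K j)"
    using e by (auto simp: Z0_quotient openin_quotient_space openin_open_Int open_Compl)
  then show ?thesis using K_pts[OF assms] by (simp add: closedin_def)
qed

end

lemma closure_meets:
  "p \<in> X closure_of A \<Longrightarrow> p \<in> W \<Longrightarrow> openin X W \<Longrightarrow> \<exists>y. y \<in> A \<and> y \<in> W"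
  by (auto simp: in_closure_of)

context resolution_chart
begin

text \<open>\<open>F\<close> is a homeomorphism of the open set \<open>U\<close> onto the quotient,
  so the closure of \<open>A\<close> inside \<open>U\<close> is computed there by
  \<open>closure_Gam\<close>; the chart is that of the quotient composed with
  \<open>F\<close>.\<close>

lemma chart_on_manifold:
  assumes Z: "csheaf Z" and U: "openin (ctop Z) U" and F: "biholomorphic_map (subspace_of Z U) QS F"
    and A: "A \<subseteq> pts Z" and AG: "\<And>p. p \<in> U \<Longrightarrow> p \<in> A \<longleftrightarrow> F p \<in> Gam"
  shows "\<exists>V \<phi>. openin (ctop Z) V \<and> V \<subseteq> U \<and> biholomorphic_map (subspace_of Z V) (model T0) \<phi> \<and>
     (\<forall>p\<in>V. \<exists>w\<in>C. F p = \<pi> w \<and> S w \<noteq> 0 \<and> T w \<noteq> 0 \<and> \<phi> p = qq w) \<and>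
     (\<forall>p\<in>U. p \<in> ctop Z closure_of A \<longleftrightarrow> p \<in> V \<and> \<phi> p $ Inr 0 = 0 \<and> \<phi> p $ Inr 1 = 0)"
proof -
  obtain \<psi> where \<psi>: "biholomorphic_map (subspace_of QS D) (model T0) \<psi>" "\<forall>w\<in>DD. \<psi> (\<pi> w) = qq w"
    using chart_exists by blast
  have ptU: "pts (subspace_of Z U) = U" by (rule pts_subspace[OF U])
  have hF: "holomorphic_map (subspace_of Z U) QS F" using F unfolding biholomorphic_map_def by blast
  have bij: "bij_betw F U (pts QS)" using biholomorphic_map_bij[OF F] by (simp only: ptU)
  define V where "V = {p \<in> U. F p \<in> D}"
  have "openin (ctop (subspace_of Z U)) {p \<in> pts (subspace_of Z U). F p \<in> D}"
    by (rule openin_continuous_map_preimage[OF holomorphic_map_continuous[OF hF] open_D])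
  then have oV: "openin (ctop Z) V" unfolding ptU V_def using openin_open_subtopology[OF U] by simp
  have "biholomorphic_map (subspace_of (subspace_of Z U) {p \<in> pts (subspace_of Z U). F p \<in> D}) (subspace_of QS D) F"
    by (rule biholomorphic_map_restrict[OF csheaf_subspace[OF Z] csheaf_quotient_space F openin_subset[OF open_D]])
  moreover have "subspace_of (subspace_of Z U) {p \<in> pts (subspace_of Z U). F p \<in> D} = subspace_of Z V"
    unfolding ptU subspace_subspace[OF Z] V_def by (rule arg_cong[where f = "subspace_of Z"]) auto
  ultimately have "biholomorphic_map (subspace_of Z V) (subspace_of QS D) F" by simp
  then have b: "biholomorphic_map (subspace_of Z V) (model T0) (\<psi> \<circ> F)"
    by (rule biholomorphic_map_compose[OF _ \<psi>(1)])
  have w: "\<exists>w\<in>C. F p = \<pi> w \<and> S w \<noteq> 0 \<and> T w \<noteq> 0 \<and> (\<psi> \<circ> F) p = qq w" if "p \<in> V" for p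
    using that \<psi>(2) by (auto simp: V_def D_def DD_def)
  have GamQ: "Gam \<subseteq> pts QS" by (auto simp: Gam_def)
  have cl: "p \<in> ctop Z closure_of A \<longleftrightarrow> F p \<in> ctop QS closure_of Gam" if p: "p \<in> U" for p
  proof
    assume L: "p \<in> ctop Z closure_of A"
    show "F p \<in> ctop QS closure_of Gam"
      unfolding in_closure_of
    proof (intro conjI allI impI)
      show "F p \<in> pts QS" using bij p by (auto simp: bij_betw_def)
      fix W assume W: "F p \<in> W \<and> openin (ctop QS) W"
      have "openin (ctop (subspace_of Z U)) {p \<in> pts (subspace_of Z U). F p \<in> W}"
        using openin_continuous_map_preimage[OF holomorphic_map_continuous[OF hF]] W by blast
      then have "openin (ctop Z) {p \<in> U. F p \<in> W}" unfolding ptU using openin_open_subtopology[OF U] by simp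
      moreover have "p \<in> {p \<in> U. F p \<in> W}" using p W by simp
      ultimately have "\<exists>y. y \<in> A \<and> y \<in> {p \<in> U. F p \<in> W}"
        by (rule closure_meets[OF L, rotated])
      then obtain y where "y \<in> A" "y \<in> U" "F y \<in> W" by auto
      then show "\<exists>y. y \<in> Gam \<and> y \<in> W" using AG by blast
    qed
  next
    assume R: "F p \<in> ctop QS closure_of Gam"
    obtain G where G: "holomorphic_map QS (subspace_of Z U) G" "\<forall>p\<in>pts (subspace_of Z U). G (F p) = p" "\<forall>q\<in>pts QS. F (G q) = q"
      using F unfolding biholomorphic_map_def by blast
    show "p \<in> ctop Z closure_of A"
      unfolding in_closure_of
    proof (intro conjI allI impI)
      show "p \<in> pts Z" using openin_subset[OF U] p by blast
      fix W assume W: "p \<in> W \<and> openin (ctop Z) W"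
      then have "openin (ctop (subspace_of Z U)) (W \<inter> U)" by (auto simp: openin_subtopology)
      then have "openin (ctop QS) {q \<in> pts QS. G q \<in> W \<inter> U}"
        by (rule openin_continuous_map_preimage[OF holomorphic_map_continuous[OF G(1)]])
      moreover have "F p \<in> {q \<in> pts QS. G q \<in> W \<inter> U}"
        using G(2) p W bij ptU by (auto simp: bij_betw_def)
      ultimately have "\<exists>r. r \<in> Gam \<and> r \<in> {q \<in> pts QS. G q \<in> W \<inter> U}"
        by (rule closure_meets[OF R, rotated])
      then obtain r where r: "r \<in> Gam" "r \<in> pts QS" "G r \<in> W" "G r \<in> U" by auto
      then have "G r \<in> A" using AG[OF r(4)] G(3) by simp
      then show "\<exists>y. y \<in> A \<and> y \<in> W" using r by blast
    qed
  qed
  have "p \<in> ctop Z closure_of A \<longleftrightarrow> p \<in> V \<and> (\<psi> \<circ> F) p $ Inr 0 = 0 \<and> (\<psi> \<circ> F) p $ Inr 1 = 0" if p: "p \<in> U" for p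
    using cl[OF p] closure_Gam[of \<psi> "F p"] \<psi>(2) p by (simp add: V_def)
  then show ?thesis using oV b w by (intro exI[of _ V] exI[of _ "\<psi> \<circ> F"]) (auto simp: V_def)
qed

end

section \<open>The Jacobian of the transition map\<close>

text \<open>
  Along the curve the second chart is a function of the first one: with \<open>\<xi> = \<omega> l\<close> and \<open>\<eta> = P/\<xi>\<close> one
  has \<open>y\<^sub>2/y\<^sub>3 = x\<^sub>2 = (\<xi> - \<eta>)/(2j) - q\<close>, and the second chart is given by \<open>x/x\<^sub>2\<close>, \<open>m/x\<^sub>2\<close> and \<open>\<eta>/(l x\<^sub>2)\<close>.
\<close>

locale transition_calculus =
  fixes \<beta> bb A s qv f f1 Q1 e \<kappa> j x :: complex
  assumes jj: "j * j = - 1" and B2: "\<beta> * bb = s - A" and qv: "qv = 2 * A - s" and f: "f = - 4 * A * (\<beta> * bb)"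
    and nz: "\<kappa> \<noteq> 0" "\<beta> \<noteq> 0" "bb \<noteq> 0" "A \<noteq> 0" "x \<noteq> 0" "1 + \<beta> * x \<noteq> 0" "bb + s * x \<noteq> 0"
begin

text \<open>The multiple of m that is added to n. It contributes the coboundary that leaves exactly
  a multiple of \<delta> in \<open>value_m\<close>.\<close>

definition c2 where "c2 = 2 * j * (e / \<kappa>) * (\<beta> * bb)"
definition E where "E = 1 + \<beta> * x"
definition X2 where "X2 = - x * (bb + s * x) / E"
definition \<delta> where "\<delta> = Q1 - A * f1 / f + 2 * s * e / \<kappa>"

lemma j0: "j \<noteq> 0" using jj by auto

lemma E0: "E \<noteq> 0" using nz by (simp add: E_def)

lemma X20: "X2 \<noteq> 0" using nz E0 by (simp add: X2_def)

lemma f0: "f \<noteq> 0" using nz by (simp add: f)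

text \<open>Values on the curve of the coordinates with indices \<open>iX j\<close> and
  \<open>iE j\<close>, taken from \<open>Kc_affine\<close>; \<open>X2\<close> is the value of y2 /
  y3.\<close>

definition \<xi>0 where "\<xi>0 = - 2 * j * bb * x * E"
definition \<eta>0 where "\<eta>0 = - 2 * j * A * \<beta> * x ^ 3 / E"

lemma xi_eta: "\<xi>0 * \<eta>0 = f * x ^ 4"
proof -
  have "\<xi>0 * \<eta>0 = 4 * (j * j) * A * (\<beta> * bb) * x ^ 4"
    using E0 by (simp add: \<xi>0_def \<eta>0_def field_simps numeral_eq_Suc)
  then show ?thesis by (simp add: jj f)
qed

lemma xi0: "\<xi>0 \<noteq> 0" using nz j0 E0 by (simp add: \<xi>0_def)

lemma eta0_eq: "f * x ^ 4 / \<xi>0 = \<eta>0"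
  using xi_eta xi0 by (simp add: field_simps)

lemma x2_at: "(\<xi>0 - \<eta>0) / (2 * j) - qv * x\<^sup>2 = X2"
proof -
  have "(\<xi>0 - \<eta>0) / (2 * j) = - bb * x * E + A * \<beta> * x ^ 3 / E"
    using j0 by (simp add: \<xi>0_def \<eta>0_def field_simps)
  moreover have "(- bb * x * E + A * \<beta> * x ^ 3 / E - qv * x\<^sup>2) * E = - x * (bb + s * x)"
  proof -
    have "(- bb * x * E + A * \<beta> * x ^ 3 / E - qv * x\<^sup>2) * E = - bb * x * E\<^sup>2 + A * \<beta> * x ^ 3 - qv * x\<^sup>2 * E"
      using E0 by (simp add: field_simps power2_eq_square)
    also have "\<dots> = - x * (bb + s * x)" unfolding E_def qv using B2 by algebra
    finally show ?thesis .
  qed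
  ultimately show ?thesis unfolding X2_def by (metis eq_divide_imp E0)
qed

text \<open>In the derivative of the second chart the derivative \<open>d\<close> of x2 occurs with
  this coefficient over X2^2; the identity turns it into a single term over X2.\<close>

lemma key: "\<eta>0 / x - 2 * j * \<beta> * bb * x = 2 * j * \<beta> * X2"
proof -
  have "(\<eta>0 / x - 2 * j * \<beta> * bb * x) * E = - 2 * j * \<beta> * x * (A * x + bb * E)"
    using E0 nz by (simp add: \<eta>0_def field_simps power3_eq_cube)
  also have "\<dots> = - 2 * j * \<beta> * x * (bb + s * x)" unfolding E_def using B2 by algebra
  also have "\<dots> = 2 * j * \<beta> * X2 * E" using E0 by (simp add: X2_def)
  finally show ?thesis using E0 by simp
qed

text \<open>The primed quantities are the derivatives along either of the two transverse directions, \<open>m\<close> and \<open>n\<close>.\<close>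

lemma transition_derivative:
  fixes l P q w mm :: "complex \<Rightarrow> complex"
  assumes l: "(l has_field_derivative l') (at 0)" "l 0 = \<kappa> * x"
    and P: "(P has_field_derivative P') (at 0)" "P 0 = f * x ^ 4"
    and q: "(q has_field_derivative q') (at 0)" "q 0 = qv * x\<^sup>2"
    and w: "(w has_field_derivative w') (at 0)" "w 0 = - 2 * j * bb * E / \<kappa>"
    and mm: "(mm has_field_derivative m') (at 0)" "mm 0 = 0"
  defines "x2 \<equiv> \<lambda>z. (w z * l z - P z / (w z * l z)) / (2 * j) - q z"
    and "\<xi>' \<equiv> w' * \<kappa> * x - 2 * j * bb * E / \<kappa> * l'"
  defines "\<eta>' \<equiv> (P' - \<xi>' * \<eta>0) / \<xi>0"
  defines "d \<equiv> (\<xi>' - \<eta>') / (2 * j) - q'"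
  shows "((\<lambda>z. mm z / x2 z) has_field_derivative m' / X2) (at 0)"
    and "((\<lambda>z. \<kappa> * (P z / (w z * (l z)\<^sup>2 * x2 z)) - 2 * j * \<beta> * (1 + bb * (x / x2 z)) - c2 * (mm z / x2 z)) has_field_derivative
       (\<eta>' / x - \<eta>0 * l' / (\<kappa> * x\<^sup>2) - 2 * j * \<beta> * d - c2 * m') / X2) (at 0)"
proof -
  define xi where "xi z = w z * l z" for z
  define et where "et z = P z / xi z" for z
  have xi_at: "xi 0 = \<xi>0" using nz by (simp add: xi_def w l \<xi>0_def)
  have dxi: "(xi has_field_derivative \<xi>') (at 0)"
    unfolding xi_def \<xi>'_def by (rule derivative_eq_intros w l refl)+ (use nz in \<open>simp add: w l\<close>)
  have et_at: "et 0 = \<eta>0" by (simp add: et_def xi_at P eta0_eq)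
  have det: "(et has_field_derivative \<eta>') (at 0)"
  proof -
    have "(et has_field_derivative (P' * xi 0 - P 0 * \<xi>') / (xi 0 * xi 0)) (at 0)"
      unfolding et_def using DERIV_divide[OF P(1) dxi] xi_at xi0 by simp
    moreover have "(P' * xi 0 - P 0 * \<xi>') / (xi 0 * xi 0) = \<eta>'"
      unfolding xi_at P(2) xi_eta[symmetric] \<eta>'_def using xi0 by (simp add: field_simps)
    ultimately show ?thesis by simp
  qed
  have x2: "x2 = (\<lambda>z. (xi z - et z) / (2 * j) - q z)" by (simp add: x2_def xi_def et_def)
  have x2_0: "x2 0 = X2" unfolding x2 xi_at et_at q(2) by (rule x2_at)
  have dx2: "(x2 has_field_derivative d) (at 0)"
    unfolding x2 d_def by (intro DERIV_diff DERIV_cdivide dxi det q)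
  show dM: "((\<lambda>z. mm z / x2 z) has_field_derivative m' / X2) (at 0)"
  proof -
    have "((\<lambda>z. mm z / x2 z) has_field_derivative (m' * x2 0 - mm 0 * d) / (x2 0 * x2 0)) (at 0)"
      using DERIV_divide[OF mm(1) dx2] x2_0 X20 by simp
    then show ?thesis using X20 by (simp add: x2_0 mm)
  qed
  have dx: "((\<lambda>z. x / x2 z) has_field_derivative (- x * d / X2\<^sup>2)) (at 0)"
  proof -
    have "((\<lambda>z. x / x2 z) has_field_derivative (0 * x2 0 - x * d) / (x2 0 * x2 0)) (at 0)"
      using DERIV_divide[OF DERIV_const dx2] x2_0 X20 by simp
    then show ?thesis by (simp add: x2_0 power2_eq_square)
  qed
  have dlx: "((\<lambda>z. l z * x2 z) has_field_derivative (l' * X2 + d * (\<kappa> * x))) (at 0)"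
    using DERIV_mult[OF l(1) dx2] by (simp add: x2_0 l)
  have dU: "((\<lambda>z. et z / (l z * x2 z)) has_field_derivative
      (\<eta>' * (\<kappa> * x * X2) - \<eta>0 * (l' * X2 + d * (\<kappa> * x))) / (\<kappa> * x * X2 * (\<kappa> * x * X2))) (at 0)"
    using DERIV_divide[OF det dlx] nz X20 by (simp add: x2_0 et_at l)
  have U: "P z / (w z * (l z)\<^sup>2 * x2 z) = et z / (l z * x2 z)" for z
    by (simp add: et_def xi_def power2_eq_square ac_simps)
  have "((\<lambda>z. \<kappa> * (et z / (l z * x2 z)) - 2 * j * \<beta> * (1 + bb * (x / x2 z)) - c2 * (mm z / x2 z)) has_field_derivative
     \<kappa> * ((\<eta>' * (\<kappa> * x * X2) - \<eta>0 * (l' * X2 + d * (\<kappa> * x))) / (\<kappa> * x * X2 * (\<kappa> * x * X2)))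
       - 2 * j * \<beta> * (0 + bb * (- x * d / X2\<^sup>2)) - c2 * (m' / X2)) (at 0)"
    by (intro DERIV_diff DERIV_cmult DERIV_add DERIV_const dU dx dM)
  moreover have "\<kappa> * ((\<eta>' * (\<kappa> * x * X2) - \<eta>0 * (l' * X2 + d * (\<kappa> * x))) / (\<kappa> * x * X2 * (\<kappa> * x * X2)))
       - 2 * j * \<beta> * (0 + bb * (- x * d / X2\<^sup>2)) - c2 * (m' / X2)
     = (\<eta>' / x - \<eta>0 * l' / (\<kappa> * x\<^sup>2) - 2 * j * \<beta> * d - c2 * m') / X2"
  proof -
    have "\<kappa> * ((\<eta>' * (\<kappa> * x * X2) - \<eta>0 * (l' * X2 + d * (\<kappa> * x))) / (\<kappa> * x * X2 * (\<kappa> * x * X2)))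
        = \<eta>' / (x * X2) - \<eta>0 * l' / (\<kappa> * x\<^sup>2 * X2) - \<eta>0 * d / (x * X2\<^sup>2)"
      using nz X20 by (simp add: field_simps power2_eq_square)
    then have "\<kappa> * ((\<eta>' * (\<kappa> * x * X2) - \<eta>0 * (l' * X2 + d * (\<kappa> * x))) / (\<kappa> * x * X2 * (\<kappa> * x * X2)))
       - 2 * j * \<beta> * (0 + bb * (- x * d / X2\<^sup>2)) - c2 * (m' / X2)
      = \<eta>' / (x * X2) - \<eta>0 * l' / (\<kappa> * x\<^sup>2 * X2) - (\<eta>0 / x - 2 * j * \<beta> * bb * x) * d / X2\<^sup>2 - c2 * m' / X2"
      using nz X20 by (simp add: field_simps power2_eq_square)
    also have "\<dots> = (\<eta>' / x - \<eta>0 * l' / (\<kappa> * x\<^sup>2) - 2 * j * \<beta> * d - c2 * m') / X2"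
      unfolding key using nz X20 by (simp add: field_simps power2_eq_square)
    finally show ?thesis .
  qed
  ultimately show "((\<lambda>z. \<kappa> * (P z / (w z * (l z)\<^sup>2 * x2 z)) - 2 * j * \<beta> * (1 + bb * (x / x2 z)) - c2 * (mm z / x2 z)) has_field_derivative
       (\<eta>' / x - \<eta>0 * l' / (\<kappa> * x\<^sup>2) - 2 * j * \<beta> * d - c2 * m') / X2) (at 0)"
    unfolding U by simp
qed

text \<open>Direction m: l, P and q have the derivatives e, f1 x^3 and Q1 x, and \<omega> has - c2 /
  \<kappa>, because n is held fixed. This is the off-diagonal entry of the transition
  matrix.\<close>

lemma value_m:
  defines "\<xi>' \<equiv> (- c2 / \<kappa>) * \<kappa> * x - 2 * j * bb * E / \<kappa> * e"
  defines "\<eta>' \<equiv> (f1 * x ^ 3 - \<xi>' * \<eta>0) / \<xi>0"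
  defines "d \<equiv> (\<xi>' - \<eta>') / (2 * j) - Q1 * x"
  shows "(\<eta>' / x - \<eta>0 * e / (\<kappa> * x\<^sup>2) - 2 * j * \<beta> * d - c2 * 1) / X2 = - (2 * j * \<delta>) * \<beta> * E / (bb + s * x)"
proof -
  define \<epsilon> where "\<epsilon> = e / \<kappa>"
  define F where "F = f1 / f"
  have xi': "\<xi>' = - 2 * j * bb * \<epsilon> * (E + \<beta> * x)"
    using nz by (simp add: \<xi>'_def c2_def \<epsilon>_def field_simps)
  have eta': "\<eta>' = \<eta>0 / x * (F - \<epsilon> * (E + \<beta> * x) / E)"
  proof -
    have "f1 * x ^ 3 = F * (\<xi>0 * \<eta>0) / x" unfolding xi_eta using f0 nz by (simp add: F_def numeral_eq_Suc)
    then have "\<eta>' = F * \<eta>0 / x - \<xi>' * \<eta>0 / \<xi>0" using xi0 nz by (simp add: \<eta>'_def field_simps)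
    also have "\<xi>' * \<eta>0 / \<xi>0 = \<eta>0 / x * (\<epsilon> * (E + \<beta> * x) / E)"
      using nz j0 E0 unfolding xi' \<xi>0_def by (simp add: field_simps)
    finally show ?thesis by (simp add: right_diff_distrib mult.commute)
  qed
  have d: "d = - bb * \<epsilon> * (E + \<beta> * x) + A * \<beta> * x\<^sup>2 / E * (F - \<epsilon> * (E + \<beta> * x) / E) - Q1 * x"
  proof -
    have "\<xi>' / (2 * j) = - bb * \<epsilon> * (E + \<beta> * x)" using j0 by (simp add: xi')
    moreover have "\<eta>' / (2 * j) = - (A * \<beta> * x\<^sup>2 / E * (F - \<epsilon> * (E + \<beta> * x) / E))"
      using j0 nz unfolding eta' \<eta>0_def by (simp add: power3_eq_cube power2_eq_square)
    ultimately show ?thesis by (simp add: d_def diff_divide_distrib)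
  qed
  have eta0: "\<eta>0 / x = - 2 * j * A * \<beta> * x\<^sup>2 / E" "\<eta>0 / x\<^sup>2 = - 2 * j * A * \<beta> * x / E"
    using nz by (simp_all add: \<eta>0_def power3_eq_cube power2_eq_square)
  define G where "G = F - \<epsilon> * (E + \<beta> * x) / E"
  have G: "G * E = F * E - \<epsilon> * (E + \<beta> * x)" using E0 by (simp add: G_def field_simps)
  have c2: "c2 = 2 * j * \<epsilon> * (\<beta> * bb)" by (simp add: c2_def \<epsilon>_def)
  have e1: "\<eta>' / x = - 2 * j * A * \<beta> * x / E * G"
    unfolding eta' eta0(1) G_def[symmetric] using nz by (simp add: power2_eq_square)
  have e2: "\<eta>0 * e / (\<kappa> * x\<^sup>2) = - 2 * j * A * \<beta> * x / E * \<epsilon>"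
    using arg_cong[OF eta0(2), of "\<lambda>t. t * \<epsilon>"] by (simp add: \<epsilon>_def field_simps)
  \<comment> \<open>After multiplication by E^2 the claim is a polynomial identity modulo the
    relation for G E and \<beta> bb = s - A.\<close>
  have "E * E * (\<eta>' / x - \<eta>0 * e / (\<kappa> * x\<^sup>2) - 2 * j * \<beta> * d - c2 * 1)
      = - 2 * j * \<beta> * (A * x * E * G - A * x * E * \<epsilon> - bb * \<epsilon> * (E + \<beta> * x) * E\<^sup>2 + A * \<beta> * x\<^sup>2 * E * G - Q1 * x * E\<^sup>2 + \<epsilon> * bb * E\<^sup>2)"
    unfolding e1 e2 d G_def[symmetric] c2 using E0 by (simp add: field_simps power2_eq_square)
  also have "\<dots> = E * E * (2 * j * \<beta> * x * (Q1 - A * F + 2 * s * \<epsilon>))"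
    using G B2 unfolding E_def by algebra
  finally have N: "\<eta>' / x - \<eta>0 * e / (\<kappa> * x\<^sup>2) - 2 * j * \<beta> * d - c2 * 1 = 2 * j * \<beta> * x * (Q1 - A * F + 2 * s * \<epsilon>)"
    using E0 by simp
  have "Q1 - A * F + 2 * s * \<epsilon> = \<delta>" by (simp add: \<delta>_def F_def \<epsilon>_def)
  moreover have "2 * j * \<beta> * x * D / (- x * H / E) = - (2 * j * D) * \<beta> * E / H" if "H \<noteq> 0" for D H
    using that nz E0 by (simp add: field_simps)
  ultimately show ?thesis unfolding N X2_def using nz by simp
qed

text \<open>Direction n: only \<omega> moves, with derivative 1 / \<kappa>. The value is constant in
  x, so this direction spans a trivial line subbundle, the O of the extension.\<close>

lemma value_n:
  defines "\<xi>' \<equiv> (1 / \<kappa>) * \<kappa> * x - 2 * j * bb * E / \<kappa> * 0"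
  defines "\<eta>' \<equiv> (0 - \<xi>' * \<eta>0) / \<xi>0"
  defines "d \<equiv> (\<xi>' - \<eta>') / (2 * j) - 0"
  shows "(\<eta>' / x - \<eta>0 * 0 / (\<kappa> * x\<^sup>2) - 2 * j * \<beta> * d - c2 * 0) / X2 = \<beta> / bb"
proof -
  have xi': "\<xi>' = x" using nz by (simp add: \<xi>'_def)
  define r where "r = \<eta>0 / \<xi>0"
  have r: "r * (bb * E\<^sup>2) = A * \<beta> * x\<^sup>2"
    using nz j0 E0 by (simp add: r_def \<eta>0_def \<xi>0_def field_simps numeral_eq_Suc)
  have eta': "\<eta>' = - x * r" by (simp add: \<eta>'_def xi' r_def)
  have d: "2 * j * d = x + x * r" using j0 by (simp add: d_def xi' eta')
  have "bb * E * (\<eta>' / x - 2 * j * \<beta> * d) = bb * E * (- r - \<beta> * (x + x * r))"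
    using nz d by (simp add: eta' algebra_simps)
  also have "\<dots> * E = - \<beta> * x * (bb + s * x) * E" using r B2 unfolding E_def by algebra
  finally have "(bb * (\<eta>' / x - 2 * j * \<beta> * d) * E) * E = (- \<beta> * x * (bb + s * x)) * E" by (simp only: ac_simps)
  then have "bb * (\<eta>' / x - 2 * j * \<beta> * d) * E = - \<beta> * x * (bb + s * x)" by (simp only: mult_right_cancel[OF E0])
  also have "\<dots> = \<beta> * X2 * E" using E0 by (simp add: X2_def)
  finally have "bb * (\<eta>' / x - 2 * j * \<beta> * d) = \<beta> * X2" using E0 by simp
  then show ?thesis using nz X20 by (simp add: field_simps)
qed

end

section \<open>Critical points\<close>

context conic_pencil
begin

definition fv' :: real where "fv' = (2 * lam + 1) * (a * lam - b) + lam * (lam + 1) * a"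
definition qv' :: real where "qv' = 2 * fst Q * lam + fst (snd Q)"

lemma quad_form_deriv: "((\<lambda>t. quad_form Q t 1) has_real_derivative qv') (at lam)"
proof -
  obtain p q r where Q: "Q = (p, q, r)" by (metis surj_pair)
  have "((\<lambda>t. quad_form (p, q, r) t 1) has_real_derivative 2 * p * lam + q) (at lam)"
    by (auto intro!: derivative_eq_intros)
  moreover have "qv' = 2 * p * lam + q" unfolding qv'_def by (simp add: Q)
  ultimately show ?thesis by (simp add: Q)
qed

lemma f_cubic_deriv: "(f_cubic a b has_real_derivative fv') (at lam)"
proof -
  have "((\<lambda>t. t * (t + 1) * (a * t - b)) has_real_derivative fv') (at lam)"
    unfolding fv'_def by (auto intro!: derivative_eq_intros simp: algebra_simps)
  then show ?thesis unfolding f_cubic_def[abs_def] .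
qed

lemma B_fun_pos:
  assumes "f_cubic a b t < 0" shows "B_fun a b Q t > 0"
proof -
  interpret t: conic_pencil a b t "t + 1" \<theta> Q by standard (use assms in auto)
  show ?thesis using t.Bv(1) by (simp add: t.Bv_def)
qed

text \<open>In logarithmic form B'/B = - (Q' - A f'/f) / (2 s). It follows by differentiating B^2 =
  (s - Q)/2 and s^2 = Q^2 - f and eliminating Q and f by means of A, B and s.\<close>

lemma B_fun_deriv: "(B_fun a b Q has_real_derivative - Bv / (2 * sv) * (qv' - Av * fv' / fv)) (at lam)"
proof -
  have pos: "qv\<^sup>2 - fv > 0" using sv(1) unfolding sv(2)[symmetric] by auto
  have d: "((\<lambda>t. (sqrt ((quad_form Q t 1)\<^sup>2 - f_cubic a b t) - quad_form Q t 1) / 2) has_real_derivative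
      ((inverse sv / 2) * (2 * qv * qv' - fv') - qv') / 2) (at lam)"
    unfolding sv_def using pos
    by (auto intro!: derivative_eq_intros quad_form_deriv f_cubic_deriv DERIV_real_sqrt simp: qv_def fv_def)
  have Beq: "sqrt ((sqrt ((quad_form Q lam 1)\<^sup>2 - f_cubic a b lam) - quad_form Q lam 1) / 2) = Bv"
    by (simp add: Bv_def B_fun_def)
  have arg: "(sqrt ((quad_form Q lam 1)\<^sup>2 - f_cubic a b lam) - quad_form Q lam 1) / 2 > 0"
    using sv(1) by (simp add: sv_def qv_def fv_def)
  have "((\<lambda>t. sqrt ((sqrt ((quad_form Q t 1)\<^sup>2 - f_cubic a b t) - quad_form Q t 1) / 2)) has_real_derivative
      (inverse Bv / 2) * (((inverse sv / 2) * (2 * qv * qv' - fv') - qv') / 2)) (at lam)"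
    using DERIV_chain2[OF DERIV_real_sqrt[OF arg] d] unfolding Beq .
  moreover have "(inverse Bv / 2) * (((inverse sv / 2) * (2 * qv * qv' - fv') - qv') / 2) = - Bv / (2 * sv) * (qv' - Av * fv' / fv)"
  proof -
    have f: "fv = - 4 * Av * Bv\<^sup>2" unfolding Bv(2) using sv(2) by (simp add: Av_def power2_eq_square field_simps)
    have q: "qv = sv - 2 * Bv\<^sup>2" unfolding Bv(2) by (simp add: field_simps)
    show ?thesis unfolding f q using Bv(1) Av sv(1) by (simp add: field_simps power2_eq_square)
  qed
  ultimately show ?thesis unfolding B_fun_def[abs_def] by simp
qed

text \<open>The logarithmic derivative of B / |l| is that of B minus e / (e lam + h); the common
  factor - 1 / (2 s) brings it to the form of \<delta>.\<close>

lemma h1_deriv: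
  assumes l: "\<And>t. l (of_real t) 1 = of_real (e * t + h)" and nz: "e * lam + h \<noteq> 0"
  shows "(h1 a b Q l has_real_derivative - h1 a b Q l lam / (2 * sv) * (qv' - Av * fv' / fv + 2 * sv * e / (e * lam + h))) (at lam)"
proof -
  \<comment> \<open>Near \<open>lam\<close> the linear form keeps its sign, so the absolute value
    can be replaced by the constant factor \<sigma>.\<close>
  define \<sigma> where "\<sigma> = sgn (e * lam + h)"
  have \<sigma>: "\<sigma> * \<sigma> = 1" "\<sigma> \<noteq> 0" "\<bar>e * lam + h\<bar> = \<sigma> * (e * lam + h)" using nz by (auto simp: \<sigma>_def sgn_if)
  have "\<forall>\<^sub>F t in nhds lam. \<sigma> * (e * t + h) > 0"
    using nz by (intro order_tendstoD(1)[where y = "\<sigma> * (e * lam + h)"] tendsto_intros filterlim_ident) (auto simp: \<sigma>_def sgn_if)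
  then have ev: "\<forall>\<^sub>F t in nhds lam. 2 * B_fun a b Q t * (\<sigma> / (e * t + h)) = h1 a b Q l t"
  proof eventually_elim
    case (elim t)
    then have "norm (1 / complex_of_real (e * t + h)) = \<sigma> / (e * t + h)"
      unfolding norm_divide norm_of_real norm_one \<sigma>_def by (auto simp: sgn_if abs_if divide_simps split: if_splits)
    then show ?case by (simp add: h1_def l del: of_real_add of_real_mult)
  qed
  have "((\<lambda>t. \<sigma> / (e * t + h)) has_real_derivative (- \<sigma> * e / (e * lam + h)\<^sup>2)) (at lam)"
    using nz by (auto intro!: derivative_eq_intros simp: power2_eq_square)
  from DERIV_mult[OF DERIV_cmult[OF B_fun_deriv, of 2] this]
  have "((\<lambda>t. 2 * B_fun a b Q t * (\<sigma> / (e * t + h))) has_real_derivative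
      2 * (- Bv / (2 * sv) * (qv' - Av * fv' / fv)) * (\<sigma> / (e * lam + h)) + (- \<sigma> * e / (e * lam + h)\<^sup>2) * (2 * Bv)) (at lam)"
    unfolding Bv_def .
  then have d: "(h1 a b Q l has_real_derivative
      2 * (- Bv / (2 * sv) * (qv' - Av * fv' / fv)) * (\<sigma> / (e * lam + h)) + (- \<sigma> * e / (e * lam + h)\<^sup>2) * (2 * Bv)) (at lam)"
    by (rule DERIV_cong_ev[THEN iffD1, OF refl ev refl])
  have h: "h1 a b Q l lam = 2 * Bv * (\<sigma> / (e * lam + h))" using eventually_nhds_x_imp_x[OF ev] by (simp add: Bv_def)
  have "2 * (- Bv / (2 * sv) * D) * (\<sigma> / k) + (- \<sigma> * e / k\<^sup>2) * (2 * Bv) = - (2 * Bv * (\<sigma> / k)) / (2 * sv) * (D + 2 * sv * e / k)"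
    if "k \<noteq> 0" for D k using that sv(1) by (simp add: field_simps power2_eq_square)
  from this[OF nz] d show ?thesis unfolding h by simp
qed

lemma h1_pos: "l (of_real t) 1 \<noteq> 0 \<Longrightarrow> f_cubic a b t < 0 \<Longrightarrow> h1 a b Q l t > 0"
  using B_fun_pos[of t] by (simp add: h1_def)

lemma h1_critical:
  assumes l: "\<And>t. l (of_real t) 1 = of_real (e * t + h)" and nz: "e * lam + h \<noteq> 0"
  shows "critical_point (h1 a b Q l) lam \<longleftrightarrow> qv' - Av * fv' / fv + 2 * sv * e / (e * lam + h) = 0"
proof -
  have "h1 a b Q l lam > 0" using nz f_neg by (intro h1_pos) (simp_all add: l del: of_real_add of_real_mult)
  then have "- h1 a b Q l lam / (2 * sv) \<noteq> 0" using sv(1) by auto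
  then show ?thesis
    unfolding critical_point_def using h1_deriv[of l e h, OF l nz] DERIV_unique[OF h1_deriv[of l e h, OF l nz]]
    by (metis mult_eq_0_iff)
qed

text \<open>Where \<open>f < 0\<close>, the functions \<open>h\<^sub>1\<close> formed with \<open>l\<^sub>4\<close> and \<open>h\<^sub>3\<close> are reciprocal to each other.\<close>

lemma h3_critical:
  assumes l: "\<And>t. l1 (of_real t) 1 * l2 (of_real t) 1 * l3 (of_real t) 1 * l4 (of_real t) 1 = complex_of_real (f_cubic a b t)"
  shows "critical_point (h3 a b Q l1 l2 l3) lam \<longleftrightarrow> critical_point (h1 a b Q l4) lam"
proof -
  have ct: "isCont (f_cubic a b) lam" using f_cubic_deriv by (rule DERIV_isCont)
  have "\<forall>\<^sub>F t in nhds lam. f_cubic a b t < 0"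
    using order_tendstoD(2)[OF ct[unfolded isCont_def tendsto_at_iff_tendsto_nhds] f_neg] .
  then have ev: "\<forall>\<^sub>F t in nhds lam. h1 a b Q l4 t > 0 \<and> h3 a b Q l1 l2 l3 t = inverse (h1 a b Q l4 t)"
  proof eventually_elim
    case (elim t)
    define P where "P = l1 (of_real t) 1 * l2 (of_real t) 1 * l3 (of_real t) 1"
    have P4: "P * l4 (of_real t) 1 = of_real (f_cubic a b t)" unfolding P_def by (rule l)
    then have nz: "P \<noteq> 0" "l4 (of_real t) 1 \<noteq> 0" using elim by auto
    have "norm P * norm (l4 (of_real t) 1) = - f_cubic a b t"
      using arg_cong[OF P4, of norm] elim by (simp add: norm_mult)
    then have "h3 a b Q l1 l2 l3 t = norm P * norm (l4 (of_real t) 1) / (2 * B_fun a b Q t) * norm (1 / P)"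
      by (simp add: h3_def P_def)
    then show ?case using nz B_fun_pos[OF elim] h1_pos[of l4 t, OF nz(2) elim]
      by (simp add: h1_def norm_divide field_simps)
  qed
  have inv: "((\<lambda>t. inverse (g t)) has_real_derivative 0) (at lam)"
    if "(g has_real_derivative 0) (at lam)" "g lam \<noteq> 0" for g
    using DERIV_inverse_fun[OF that] by simp
  show ?thesis
    unfolding critical_point_def
  proof
    assume "(h1 a b Q l4 has_real_derivative 0) (at lam)"
    from inv[OF this] have "((\<lambda>t. inverse (h1 a b Q l4 t)) has_real_derivative 0) (at lam)"
      using eventually_nhds_x_imp_x[OF ev] by auto
    then show "(h3 a b Q l1 l2 l3 has_real_derivative 0) (at lam)"
      by (rule DERIV_cong_ev[THEN iffD1, OF refl _ refl, rotated]) (use ev in \<open>auto elim: eventually_mono\<close>)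
  next
    assume "(h3 a b Q l1 l2 l3 has_real_derivative 0) (at lam)"
    from inv[OF this] have "((\<lambda>t. inverse (h3 a b Q l1 l2 l3 t)) has_real_derivative 0) (at lam)"
      using eventually_nhds_x_imp_x[OF ev] by auto
    then show "(h1 a b Q l4 has_real_derivative 0) (at lam)"
      by (rule DERIV_cong_ev[THEN iffD1, OF refl _ refl, rotated]) (use ev in \<open>auto elim: eventually_mono\<close>)
  qed
qed

end

section \<open>The curves and their charts\<close>

text \<open>\<open>g\<close> is chosen so that n vanishes on the curve, where \<omega> = - g (1 +
  \<beta> x1) / \<kappa>, and \<open>c2\<close> is the constant of
  \<open>transition_calculus\<close>. In both interpretations \<open>R\<close> is the product of the
  three linear forms other than \<open>l\<close>.\<close>

locale twistor_line =
  conic_pencil a b lam lam0 \<theta> Q +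
  rc: resolution_chart C \<pi>3 "\<lambda>w. lft (lft (lft w))" S T \<Lambda> l R "iX j" "iE j" "of_real lam" "of_real \<kappa>"
    \<beta>' g c2
  for a b lam lam0 \<theta> :: real and Q j l R S T \<Lambda> and e h \<kappa> :: real and \<beta>' g c2 and C +
  assumes j: "j = \<i> \<or> j = - \<i>"
    and leq: "\<And>x0 x1. l x0 x1 = of_real e * x0 + of_real h * x1"
    and params: "\<beta>' = conic_pencil.\<beta> a b lam \<theta> Q" "g = 2 * j * cnj \<beta>'" "c2 = 2 * j * (of_real e / of_real \<kappa>) * (\<beta>' * cnj \<beta>')"
begin

abbreviation "Sing \<equiv> {p_inf, p_inf_bar, p_zero lam0}"

lemma is_j: "is_i j" using j by (simp add: is_i_def)

lemma \<kappa>: "\<kappa> = e * lam + h" "\<kappa> \<noteq> 0"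
proof -
  have "of_real \<kappa> = (of_real (e * lam + h) :: complex)" using rc.l[of 1] by (simp add: leq)
  then show "\<kappa> = e * lam + h" by (simp only: of_real_eq_iff)
  show "\<kappa> \<noteq> 0" using rc.nz(1) by simp
qed

lemma Z0_points: "q \<in> pts (Z0 a b Q) \<Longrightarrow> \<exists>v\<in>Z0_coords a b Q. q = O2_class v"
  by (auto simp: Z0_quotient)

text \<open>The space and the map to \<open>Z0\<close> are left open because the lemma is used
  twice: for \<open>Z\<close> with \<open>\<mu>\<close>, and for \<open>conj_space Z\<close> with
  \<open>\<mu>\<close> followed by the real structure.\<close>

lemma chart_near_infinity:
  fixes Z' :: "'z cspace" and \<nu> :: "'z \<Rightarrow> (complex^(4 + 1)) set"
  defines "U \<equiv> {p \<in> pts Z'. \<forall>v\<in>\<nu> p. v $ Inl 3 \<noteq> 0}"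
  assumes Z': "csheaf Z'" and oU: "openin (ctop Z') U" and \<nu>: "\<And>p. p \<in> pts Z' \<Longrightarrow> \<nu> p \<in> pts (Z0 a b Q)"
    and F: "biholomorphic_map (subspace_of Z' U) (quotient_space C \<pi>3) F"
      "\<And>p v. p \<in> U \<Longrightarrow> v \<in> \<nu> p \<Longrightarrow> blow_down (F p) = affine_coords Q v"
    and A: "A \<subseteq> pts Z'" "\<And>p. p \<in> pts Z' \<Longrightarrow> p \<in> A \<longleftrightarrow> \<nu> p \<in> K j - Sing"
  obtains V \<phi> where "openin (ctop Z') V" "V \<subseteq> U" "biholomorphic_map (subspace_of Z' V) (model rc.T0) \<phi>"
    "\<And>p v. p \<in> V \<Longrightarrow> v \<in> \<nu> p \<Longrightarrow> rc.om (\<phi> p) \<noteq> 0 \<and> affine_coords Q v $ 1 = \<phi> p $ Inl 1 \<and>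
       affine_coords Q v $ 0 = \<phi> p $ Inr 0 + of_real lam * \<phi> p $ Inl 1 \<and>
       affine_coords Q v $ iX j = rc.om (\<phi> p) * l (affine_coords Q v $ 0) (affine_coords Q v $ 1)"
    "\<And>p. p \<in> U \<Longrightarrow> p \<in> ctop Z' closure_of A \<longleftrightarrow> p \<in> V \<and> \<phi> p $ Inr 0 = 0 \<and> \<phi> p $ Inr 1 = 0"
proof -
  have AG: "p \<in> A \<longleftrightarrow> F p \<in> rc.Gam" if p: "p \<in> U" for p
  proof -
    have pZ: "p \<in> pts Z'" using p by (simp add: U_def)
    obtain v where v: "v \<in> Z0_coords a b Q" "\<nu> p = O2_class v" using Z0_points[OF \<nu>[OF pZ]] by blast
    have v3: "v $ Inl 3 \<noteq> 0" using p v(2) by (simp add: U_def)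
    have bd: "blow_down (F p) = affine_coords Q v" using F(2)[OF p] v(2) by simp
    have "bij_betw F U (pts (quotient_space C \<pi>3))"
      using biholomorphic_map_bij[OF F(1)] pts_subspace[OF oU] by simp
    then obtain w where w: "w \<in> C" "F p = \<pi>3 w" using p by (auto simp: bij_betw_def)
    have bdw: "lft (lft (lft w)) = affine_coords Q v" using bd unfolding w by (simp add: blow_down_def pi3)
    have bdw': "lft (lft (lft w')) = affine_coords Q v" if "\<pi>3 w' = \<pi>3 w" for w'
      using that bdw by (simp add: pi3)
    have "p \<in> A \<longleftrightarrow> O2_class v \<in> K j - Sing" using A(2)[OF pZ] v(2) by simp
    also have "\<dots> \<longleftrightarrow> affine_coords Q v $ 1 \<noteq> 0 \<and> affine_coords Q v $ 0 = of_real lam * affine_coords Q v $ 1 \<and>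
        affine_coords Q v $ iX j = - (2 * j * cnj \<beta>) * affine_coords Q v $ 1 * (1 + \<beta> * affine_coords Q v $ 1)"
      by (rule affine_line_iff[OF is_j v(1) v3])
    also have "\<dots> \<longleftrightarrow> F p \<in> rc.Gam"
    proof
      assume L: "affine_coords Q v $ 1 \<noteq> 0 \<and> affine_coords Q v $ 0 = of_real lam * affine_coords Q v $ 1 \<and>
        affine_coords Q v $ iX j = - (2 * j * cnj \<beta>) * affine_coords Q v $ 1 * (1 + \<beta> * affine_coords Q v $ 1)"
      show "F p \<in> rc.Gam" unfolding rc.Gam_def unfolding w(2) params(1,2) mem_Collect_eq
        by (rule bexI[OF _ w(1)]) (use L in \<open>simp only: bdw refl simp_thms\<close>)
    next
      assume "F p \<in> rc.Gam"
      then obtain w' where w': "\<pi>3 w' = \<pi>3 w" "lft (lft (lft w')) $ 1 \<noteq> 0" "lft (lft (lft w')) $ 0 = of_real lam * lft (lft (lft w')) $ 1"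
        "lft (lft (lft w')) $ iX j = - (2 * j * cnj \<beta>) * lft (lft (lft w')) $ 1 * (1 + \<beta> * lft (lft (lft w')) $ 1)"
        unfolding rc.Gam_def unfolding w(2) params(1,2) by auto
      show "affine_coords Q v $ 1 \<noteq> 0 \<and> affine_coords Q v $ 0 = of_real lam * affine_coords Q v $ 1 \<and>
        affine_coords Q v $ iX j = - (2 * j * cnj \<beta>) * affine_coords Q v $ 1 * (1 + \<beta> * affine_coords Q v $ 1)"
        using w'(2-4) unfolding bdw'[OF w'(1)] by blast
    qed
    finally show ?thesis .
  qed
  obtain V \<phi> where V: "openin (ctop Z') V" "V \<subseteq> U" "biholomorphic_map (subspace_of Z' V) (model rc.T0) \<phi>"
    and w: "\<forall>p\<in>V. \<exists>w\<in>C. F p = \<pi>3 w \<and> S w \<noteq> 0 \<and> T w \<noteq> 0 \<and> \<phi> p = rc.qq w"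
    and cl: "\<forall>p\<in>U. p \<in> ctop Z' closure_of A \<longleftrightarrow> p \<in> V \<and> \<phi> p $ Inr 0 = 0 \<and> \<phi> p $ Inr 1 = 0"
    using rc.chart_on_manifold[OF Z' oU F(1) A(1) AG] by blast
  have "rc.om (\<phi> p) \<noteq> 0 \<and> affine_coords Q v $ 1 = \<phi> p $ Inl 1 \<and>
       affine_coords Q v $ 0 = \<phi> p $ Inr 0 + of_real lam * \<phi> p $ Inl 1 \<and>
       affine_coords Q v $ iX j = rc.om (\<phi> p) * l (affine_coords Q v $ 0) (affine_coords Q v $ 1)"
    if p: "p \<in> V" and v: "v \<in> \<nu> p" for p v
  proof -
    obtain w where w: "w \<in> C" "F p = \<pi>3 w" "S w \<noteq> 0" "T w \<noteq> 0" "\<phi> p = rc.qq w" using w p by blast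
    have bd: "lft (lft (lft w)) = affine_coords Q v"
      using F(2)[of p v] p V(2) v unfolding w by (simp add: blow_down_def pi3 subset_iff)
    have rel: "affine_coords Q v $ iX j * T w = S w * l (affine_coords Q v $ 0) (affine_coords Q v $ 1)"
      using rc.rel[OF w(1)] unfolding bd .
    have q: "rc.qq w $ Inl 1 = affine_coords Q v $ 1"
      "rc.qq w $ Inr 0 = affine_coords Q v $ 0 - of_real lam * affine_coords Q v $ 1"
      unfolding rc.qq_def bd by simp_all
    have "affine_coords Q v $ iX j = S w / T w * l (affine_coords Q v $ 0) (affine_coords Q v $ 1)"
      using rel w(4) by (metis nonzero_eq_divide_eq times_divide_eq_left)
    then show ?thesis
      unfolding w(5) rc.om_qq q using w(3,4) by simp
  qed
  then show ?thesis using that[OF V] cl by blast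
qed

end

text \<open>Computes a Jacobian entry from a one-variable formula \<open>G\<close> that is known
  only where the auxiliary function \<open>l\<close> is nonzero; by continuity this holds near 0,
  which is enough for a derivative.\<close>

lemma directional_derivative_eq:
  fixes T :: "complex^'n \<Rightarrow> complex^'m"
  assumes T: "\<And>i. hol_on W (\<lambda>v. T v $ i)" and W: "open W" "x \<in> W" and l: "isCont l (0 :: complex)" "l 0 \<noteq> (0 :: complex)"
    and eq: "\<And>z. x + z *s b \<in> W \<Longrightarrow> l z \<noteq> 0 \<Longrightarrow> T (x + z *s b) $ i = G z"
    and G: "(G has_field_derivative d) (at 0)"
  shows "frechet_derivative T (at x) b $ i = d"
proof -
  have "isCont (\<lambda>z. x + z *s b) 0"
    unfolding isCont_def vector_scalar_mult_def by (intro tendsto_intros tendsto_vec_lambda)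
  then have "((\<lambda>z. x + z *s b) \<longlongrightarrow> x + 0 *s b) (nhds 0)"
    by (simp only: isCont_def tendsto_at_iff_tendsto_nhds[of "\<lambda>z. x + z *s b" 0])
  then have "((\<lambda>z. x + z *s b) \<longlongrightarrow> x) (nhds 0)" by simp
  then have "\<forall>\<^sub>F z in nhds 0. x + z *s b \<in> W" by (rule topological_tendstoD[OF _ W])
  moreover have "\<forall>\<^sub>F z in nhds 0. l z \<in> - {0}"
    using l by (intro topological_tendstoD[where l = "l 0"]) (auto simp: isCont_def tendsto_at_iff_tendsto_nhds)
  ultimately have "\<forall>\<^sub>F z in nhds 0. T (x + z *s b) $ i = G z"
    by eventually_elim (simp add: eq)
  from DERIV_cong_ev[OF refl this refl, THEN iffD2, OF G] show ?thesis
    by (rule DERIV_unique[OF frechet_derivative_direction[OF T W(2)]])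
qed

lemma O2_class_nonzero_iff: "(\<forall>w\<in>O2_class v. w $ Inl k \<noteq> 0) \<longleftrightarrow> v $ Inl k \<noteq> 0"
  using self_in_O2_class[of v] by (auto simp: in_O2_class)

section \<open>The transition between the two charts and its Jacobian\<close>

context twistor_line
begin

definition quartic :: "complex \<Rightarrow> complex \<Rightarrow> complex" where
  "quartic x0 x1 = x0 * x1 * (x0 + x1) * (of_real a * x0 - of_real b * x1)"

definition x2_of :: "complex \<Rightarrow> complex \<Rightarrow> complex \<Rightarrow> complex" where
  "x2_of \<omega> x0 x1 = (\<omega> * l x0 x1 - quartic x0 x1 / (\<omega> * l x0 x1)) / (2 * j) - quad_form Q x0 x1"

lemma affine_coords_rel:
  assumes v: "v \<in> Z0_coords a b Q" and v3: "v $ Inl 3 \<noteq> 0"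
  shows "affine_coords Q v $ iX j * affine_coords Q v $ iE j = quartic (affine_coords Q v $ 0) (affine_coords Q v $ 1)"
    "v $ Inl 2 / v $ Inl 3 = (affine_coords Q v $ iX j - affine_coords Q v $ iE j) / (2 * j)
        - quad_form Q (affine_coords Q v $ 0) (affine_coords Q v $ 1)"
proof -
  have jj: "j * j = - 1" and j0: "j \<noteq> 0" using is_i[OF is_j] by auto
  define y where "y = v $ Inl 3"
  have y: "y \<noteq> 0" using v3 by (simp add: y_def)
  define X where "X = v $ Inl 0 / y" define Y where "Y = v $ Inl 1 / y"
  define W where "W = v $ Inl 2 / y" define z where "z = v $ Inr 1 / y\<^sup>2"
  have vs: "v $ Inl 0 = X * y" "v $ Inl 1 = Y * y" "v $ Inl 2 = W * y" "v $ Inr 1 = z * y\<^sup>2" "v $ Inl 3 = y"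
    using y by (simp_all add: X_def Y_def W_def z_def y_def)
  have qf: "quad_form Q (X * y) (Y * y) = quad_form Q X Y * y\<^sup>2"
    by (cases Q) (simp add: power2_eq_square algebra_simps)
  have "(z * y\<^sup>2)\<^sup>2 + (W * y * y + quad_form Q X Y * y\<^sup>2)\<^sup>2 = X * y * (Y * y) * (X * y + Y * y) * (of_real a * (X * y) - of_real b * (Y * y))"
    using v unfolding Z0_coords_def by (simp add: Let_def vs qf)
  then have "y ^ 4 * (z\<^sup>2 + (W + quad_form Q X Y)\<^sup>2 - quartic X Y) = 0" unfolding quartic_def by algebra
  then have main: "z\<^sup>2 + (W + quad_form Q X Y)\<^sup>2 = quartic X Y" using y by simp
  note co = affine_coords_iX_iE[OF j, of Q v] affine_coords_nth(1,2)[of Q v]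
  note co' = co[folded y_def X_def Y_def W_def, folded z_def]
  have "(z + j * u) * (z - j * u) = z\<^sup>2 + u\<^sup>2" for u using jj by algebra
  then show "affine_coords Q v $ iX j * affine_coords Q v $ iE j = quartic (affine_coords Q v $ 0) (affine_coords Q v $ 1)"
    unfolding co' main[symmetric] W_def by simp
  show "v $ Inl 2 / v $ Inl 3 = (affine_coords Q v $ iX j - affine_coords Q v $ iE j) / (2 * j)
        - quad_form Q (affine_coords Q v $ 0) (affine_coords Q v $ 1)"
    unfolding co' unfolding y_def[symmetric] W_def[symmetric] using j0 by (simp add: field_simps)
qed

text \<open>The real structure exchanges y2 and y3, so up to conjugation these are the coordinates
  normalised by y2 instead of y3. By cnj j = - j the coordinate \<open>iX j\<close> turns into
  \<open>iE j\<close>; it has weight 2, hence the square.\<close>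

lemma affine_coords_conjv:
  assumes v3: "v $ Inl 3 \<noteq> 0" and v2: "v $ Inl 2 \<noteq> 0"
  defines "x2 \<equiv> v $ Inl 2 / v $ Inl 3"
  shows "cnj (affine_coords Q (conjv v) $ 0) = affine_coords Q v $ 0 / x2"
    "cnj (affine_coords Q (conjv v) $ 1) = affine_coords Q v $ 1 / x2"
    "cnj (affine_coords Q (conjv v) $ iX j) = affine_coords Q v $ iE j / x2\<^sup>2"
proof -
  have qc: "cnj (quad_form Q x y) = quad_form Q (cnj x) (cnj y)" for x y :: complex by (cases Q) simp
  have qs: "quad_form Q (x / y) (x' / y) = quad_form Q x x' / y\<^sup>2" for x x' y :: complex
    by (cases Q) (simp add: power_divide add_divide_distrib power2_eq_square)
  show "cnj (affine_coords Q (conjv v) $ 0) = affine_coords Q v $ 0 / x2"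
    "cnj (affine_coords Q (conjv v) $ 1) = affine_coords Q v $ 1 / x2"
    using v2 v3 by (simp_all add: x2_def)
  show "cnj (affine_coords Q (conjv v) $ iX j) = affine_coords Q v $ iE j / x2\<^sup>2"
    unfolding affine_coords_iX_iE[OF j] using v2 v3 is_i(2)[OF is_j]
    by (simp add: x2_def qc qs field_simps power2_eq_square)
qed

text \<open>By \<open>affine_coords_conjv\<close> the conjugate of the second \<omega> is \<eta> /
  (l x2), where \<eta> is the quartic divided by \<xi> = \<omega> l; the constants \<open>g\<close>
  and \<open>c2\<close> are conjugated by means of cnj j = - j.\<close>

lemma transition_formula:
  assumes v: "v \<in> Z0_coords a b Q" and v3: "v $ Inl 3 \<noteq> 0" and v2: "v $ Inl 2 \<noteq> 0"
    and u: "rc.om u \<noteq> 0" "affine_coords Q v $ 1 = x1" "affine_coords Q v $ 0 = x0"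
       "affine_coords Q v $ iX j = rc.om u * l (affine_coords Q v $ 0) (affine_coords Q v $ 1)"
    and u': "affine_coords Q (conjv v) $ 1 = u' $ Inl 1" "affine_coords Q (conjv v) $ 0 = u' $ Inr 0 + of_real lam * u' $ Inl 1"
       "affine_coords Q (conjv v) $ iX j = rc.om u' * l (affine_coords Q (conjv v) $ 0) (affine_coords Q (conjv v) $ 1)"
    and l0: "l x0 x1 \<noteq> 0"
  defines "x2 \<equiv> x2_of (rc.om u) x0 x1"
  shows "v $ Inl 2 / v $ Inl 3 = x2" "cnj (u' $ Inl 1) = x1 / x2" "cnj (u' $ Inr 0) = (x0 - of_real lam * x1) / x2"
    "cnj (u' $ Inr 1) = of_real \<kappa> * (quartic x0 x1 / (rc.om u * (l x0 x1)\<^sup>2 * x2)) - 2 * j * \<beta> * (1 + cnj \<beta> * (x1 / x2))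
       - 2 * j * (of_real e / of_real \<kappa>) * (\<beta> * cnj \<beta>) * ((x0 - of_real lam * x1) / x2)"
proof -
  define x2' where "x2' = v $ Inl 2 / v $ Inl 3"
  have x2'0: "x2' \<noteq> 0" using v2 v3 by (simp add: x2'_def)
  note ar = affine_coords_rel[OF v v3, unfolded u(2,3) u(4)]
  note ac = affine_coords_conjv[OF v3 v2, folded x2'_def, unfolded u(2,3)]
  have xi0: "rc.om u * l x0 x1 \<noteq> 0" using u(1) l0 by simp
  have eta: "affine_coords Q v $ iE j = quartic x0 x1 / (rc.om u * l x0 x1)"
    using ar(1) xi0 by (metis nonzero_mult_div_cancel_left)
  show x2: "v $ Inl 2 / v $ Inl 3 = x2"
    using ar(2) unfolding eta x2_def x2_of_def .
  have x22: "x2' = x2" using x2 by (simp add: x2'_def)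
  have x20: "x2 \<noteq> 0" using x2'0 x22 by simp
  note ac = ac[unfolded x22]
  show 1: "cnj (u' $ Inl 1) = x1 / x2" using ac(2) unfolding u'(1) .
  have "cnj (u' $ Inr 0) + of_real lam * (x1 / x2) = x0 / x2"
    using ac(1) unfolding u'(2) by (simp add: 1)
  then show 0: "cnj (u' $ Inr 0) = (x0 - of_real lam * x1) / x2"
    by (simp add: diff_divide_distrib eq_diff_eq)
  have "cnj (l y0 y1) = l (cnj y0) (cnj y1)" for y0 y1 by (simp add: leq)
  then have "cnj (rc.om u') * l (x0 / x2) (x1 / x2) = affine_coords Q v $ iE j / x2\<^sup>2"
    using ac(3) unfolding u'(3) by (simp only: complex_cnj_mult ac(1,2))
  moreover have "l (x0 / x2) (x1 / x2) = l x0 x1 / x2" by (simp add: leq add_divide_distrib)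
  ultimately have "cnj (rc.om u') * (l x0 x1 / x2) = quartic x0 x1 / (rc.om u * l x0 x1) / x2\<^sup>2"
    unfolding eta by simp
  then have om: "cnj (rc.om u') = quartic x0 x1 / (rc.om u * (l x0 x1)\<^sup>2 * x2)"
    using x20 l0 u(1) by (simp add: field_simps power2_eq_square)
  have "u' $ Inr 1 = of_real \<kappa> * rc.om u' + g * (1 + \<beta>' * u' $ Inl 1) + c2 * u' $ Inr 0"
    using \<kappa>(2) by (simp add: rc.om_def field_simps)
  then have "cnj (u' $ Inr 1) = of_real \<kappa> * cnj (rc.om u') + cnj g * (1 + cnj \<beta> * cnj (u' $ Inl 1)) + cnj c2 * cnj (u' $ Inr 0)"
    unfolding params(1) by simp
  moreover have "cnj g = - 2 * j * \<beta>" "cnj c2 = - (2 * j * (of_real e / of_real \<kappa>) * (\<beta> * cnj \<beta>))"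
    unfolding params(3) params(2) params(1) using is_i(2)[OF is_j] by simp_all
  ultimately show "cnj (u' $ Inr 1) = of_real \<kappa> * (quartic x0 x1 / (rc.om u * (l x0 x1)\<^sup>2 * x2)) - 2 * j * \<beta> * (1 + cnj \<beta> * (x1 / x2))
       - 2 * j * (of_real e / of_real \<kappa>) * (\<beta> * cnj \<beta>) * ((x0 - of_real lam * x1) / x2)"
    unfolding om 1 0 by simp
qed

definition \<delta> :: real where "\<delta> = qv' - Av * fv' / fv + 2 * sv * e / \<kappa>"

text \<open>The formula for the second chart is assumed only where l is nonzero. At a point of the
  curve l = \<kappa> x with x \<noteq> 0, so the formula holds nearby and can be
  differentiated.\<close>

lemma transition_jacobian:
  fixes Tr :: "complex^(1 + 2) \<Rightarrow> complex^(1 + 2)"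
  assumes Tr: "\<And>i. hol_on W (\<lambda>v. Tr v $ i)" and W: "open W" "u0 \<in> W"
    and u0: "u0 $ Inr 0 = 0" "u0 $ Inr 1 = 0" "u0 $ Inl 1 = x"
    and nz: "x \<noteq> 0" "1 + \<beta> * x \<noteq> 0" "cnj \<beta> + of_real sv * x \<noteq> 0"
    and Treq: "\<And>u x0 x1 x2. u \<in> W \<Longrightarrow> x1 = u $ Inl 1 \<Longrightarrow> x0 = u $ Inr 0 + of_real lam * x1 \<Longrightarrow> l x0 x1 \<noteq> 0 \<Longrightarrow> x2 = x2_of (rc.om u) x0 x1 \<Longrightarrow>
      Tr u $ Inr 0 = (x0 - of_real lam * x1) / x2 \<and>
      Tr u $ Inr 1 = of_real \<kappa> * (quartic x0 x1 / (rc.om u * (l x0 x1)\<^sup>2 * x2)) - 2 * j * \<beta> * (1 + cnj \<beta> * (x1 / x2))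
       - 2 * j * (of_real e / of_real \<kappa>) * (\<beta> * cnj \<beta>) * ((x0 - of_real lam * x1) / x2)"
  defines "D \<equiv> \<lambda>k. frechet_derivative Tr (at u0) (axis (Inr k) 1)"
  shows "D 0 $ Inr 0 = - (1 + \<beta> * x) / (x * (cnj \<beta> + of_real sv * x))" "D 1 $ Inr 0 = 0"
    "D 0 $ Inr 1 = - (2 * j * of_real \<delta>) * \<beta> * (1 + \<beta> * x) / (cnj \<beta> + of_real sv * x)" "D 1 $ Inr 1 = \<beta> / cnj \<beta>"
proof -
  interpret tc: transition_calculus \<beta> "cnj \<beta>" "of_real Av" "of_real sv" "of_real qv" "of_real fv" "of_real fv'" "of_real qv'"
    "of_real e" "of_real \<kappa>" j x
    by unfold_locales (use rels nz \<kappa>(2) is_i[OF is_j] in auto)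
  have tcd: "tc.\<delta> = of_real \<delta>" by (simp add: tc.\<delta>_def \<delta>_def)
  have kl: "of_real \<kappa> = of_real e * of_real lam + (of_real h :: complex)" by (simp add: \<kappa>(1))
  have w0: "rc.om u0 = - 2 * j * cnj \<beta> * tc.E / of_real \<kappa>"
    unfolding rc.om_def by (simp add: u0 params(2) params(1) tc.E_def)
  have l_at: "l (of_real lam * x) x = of_real \<kappa> * x" by (simp add: leq kl algebra_simps)
  have P_at: "quartic (of_real lam * x) x = of_real fv * x ^ 4" unfolding quartic_def by (rule quartic_lam)
  have q_at: "quad_form Q (of_real lam * x) x = of_real qv * x\<^sup>2" by (rule quad_form_lam)
  have P': "((\<lambda>z. quartic (z + of_real lam * x) x) has_field_derivative of_real fv' * x ^ 3) (at 0)"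
    unfolding quartic_def fv'_def
    by (auto intro!: derivative_eq_intros simp: algebra_simps power3_eq_cube)
  have Q': "((\<lambda>z. quad_form Q (z + of_real lam * x) x) has_field_derivative of_real qv' * x) (at 0)"
  proof -
    obtain p q r where Q: "Q = (p, q, r)" by (metis surj_pair)
    have q': "of_real qv' = (2 * of_real p * of_real lam + of_real q :: complex)" unfolding qv'_def by (simp add: Q)
    show ?thesis unfolding q' unfolding Q by (auto intro!: derivative_eq_intros simp: algebra_simps)
  qed
  have c2_eq: "c2 = tc.c2" unfolding tc.c2_def params(3) params(1) ..
  have lx: "((\<lambda>z. l (z + of_real lam * x) x) has_field_derivative of_real e) (at 0)"
    unfolding leq by (auto intro!: derivative_eq_intros)
  \<comment> \<open>Lines through the point in the two transverse directions: index 0 is m and index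
    1 is n.\<close>
  let ?u = "\<lambda>k z. u0 + z *s axis (Inr k) 1"
  have um: "?u 0 z $ Inl 1 = x" "?u 0 z $ Inr 0 = z" "?u 0 z $ Inr 1 = 0" for z
    by (simp_all add: u0 axis_def)
  have un: "?u 1 z $ Inl 1 = x" "?u 1 z $ Inr 0 = 0" "?u 1 z $ Inr 1 = z" for z
    by (simp_all add: u0 axis_def)
  have wm: "((\<lambda>z. rc.om (?u 0 z)) has_field_derivative - tc.c2 / of_real \<kappa>) (at 0)"
    unfolding rc.om_def unfolding um c2_eq using \<kappa>(2) by (auto intro!: derivative_eq_intros)
  have wn: "((\<lambda>z. rc.om (?u 1 z)) has_field_derivative 1 / of_real \<kappa>) (at 0)"
    unfolding rc.om_def unfolding un using \<kappa>(2) by (auto intro!: derivative_eq_intros)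
  have um0: "?u k 0 = u0" for k by (simp add: vec_eq_iff)
  have lnz: "l (0 + of_real lam * x) x \<noteq> 0" using nz \<kappa>(2) by (simp add: l_at)
  note dm = tc.transition_derivative[where l = "\<lambda>z. l (z + of_real lam * x) x" and P = "\<lambda>z. quartic (z + of_real lam * x) x"
      and q = "\<lambda>z. quad_form Q (z + of_real lam * x) x" and w = "\<lambda>z. rc.om (?u 0 z)" and mm = "\<lambda>z. z",
      OF lx _ P' _ Q' _ wm _ DERIV_ident refl, unfolded um0 w0 add_0_left, OF l_at P_at q_at refl, unfolded tc.value_m]
  note dn = tc.transition_derivative[where l = "\<lambda>z. l (of_real lam * x) x" and P = "\<lambda>z. quartic (of_real lam * x) x"
      and q = "\<lambda>z. quad_form Q (of_real lam * x) x" and w = "\<lambda>z. rc.om (?u 1 z)" and mm = "\<lambda>z. 0",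
      OF DERIV_const l_at DERIV_const P_at DERIV_const q_at wn _ DERIV_const refl, unfolded um0 w0, OF refl, unfolded tc.value_n]
  have Trm: "Tr (?u 0 z) $ Inr 0 = z / x2_of (rc.om (?u 0 z)) (z + of_real lam * x) x"
    "Tr (?u 0 z) $ Inr 1 = of_real \<kappa> * (quartic (z + of_real lam * x) x / (rc.om (?u 0 z) * (l (z + of_real lam * x) x)\<^sup>2 * x2_of (rc.om (?u 0 z)) (z + of_real lam * x) x))
       - 2 * j * \<beta> * (1 + cnj \<beta> * (x / x2_of (rc.om (?u 0 z)) (z + of_real lam * x) x))
       - tc.c2 * (z / x2_of (rc.om (?u 0 z)) (z + of_real lam * x) x)"
    if "?u 0 z \<in> W" "l (z + of_real lam * x) x \<noteq> 0" for z
    using Treq[OF that(1) refl refl _ refl, unfolded um] that(2) by (simp_all add: tc.c2_def)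
  have Trn: "Tr (?u 1 z) $ Inr 0 = 0 / x2_of (rc.om (?u 1 z)) (of_real lam * x) x"
    "Tr (?u 1 z) $ Inr 1 = of_real \<kappa> * (quartic (of_real lam * x) x / (rc.om (?u 1 z) * (l (of_real lam * x) x)\<^sup>2 * x2_of (rc.om (?u 1 z)) (of_real lam * x) x))
       - 2 * j * \<beta> * (1 + cnj \<beta> * (x / x2_of (rc.om (?u 1 z)) (of_real lam * x) x))
       - tc.c2 * (0 / x2_of (rc.om (?u 1 z)) (of_real lam * x) x)"
    if "?u 1 z \<in> W" "l (of_real lam * x) x \<noteq> 0" for z
    using Treq[OF that(1) refl refl _ refl, unfolded un] that(2) by (simp_all add: tc.c2_def)
  note de = directional_derivative_eq[OF Tr W]
  have ct: "isCont (\<lambda>z. l (z + of_real lam * x) x) 0" "isCont (\<lambda>z. l (of_real lam * x) x) (0 :: complex)"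
    using lx DERIV_isCont by auto
  have X2: "1 / tc.X2 = - (1 + \<beta> * x) / (x * (cnj \<beta> + of_real sv * x))"
  proof -
    have "1 / (- x * H / E) = - E / (x * H)" for H E by simp
    from this[of "cnj \<beta> + of_real sv * x" "1 + \<beta> * x"]
    show "1 / tc.X2 = - (1 + \<beta> * x) / (x * (cnj \<beta> + of_real sv * x))" unfolding tc.X2_def tc.E_def .
  qed
  show "D 0 $ Inr 0 = - (1 + \<beta> * x) / (x * (cnj \<beta> + of_real sv * x))"
    unfolding D_def X2[symmetric]
    by (rule de[OF ct(1) lnz Trm(1)]) (use dm(1) in \<open>auto simp: x2_of_def\<close>)
  have "D 1 $ Inr 0 = 0 / tc.X2"
    unfolding D_def by (rule de[OF ct(2) _ Trn(1)]) (use dn(1) lnz in \<open>auto simp: x2_of_def\<close>)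
  then show "D 1 $ Inr 0 = 0" by simp
  show "D 0 $ Inr 1 = - (2 * j * of_real \<delta>) * \<beta> * (1 + \<beta> * x) / (cnj \<beta> + of_real sv * x)"
    unfolding D_def tcd[symmetric] tc.E_def[symmetric]
    by (rule de[OF ct(1) lnz Trm(2)]) (use dm(2) in \<open>auto simp: x2_of_def\<close>)
  show "D 1 $ Inr 1 = \<beta> / cnj \<beta>"
    unfolding D_def
    by (rule de[OF ct(2) _ Trn(2)]) (use dn(2) lnz in \<open>auto simp: x2_of_def\<close>)
qed

end

section \<open>The splitting of the normal bundle of a single curve\<close>

context twistor_line
begin

text \<open>For m = n = 0 one has \<omega> = - g (1 + \<beta> x1) / \<kappa>, and \<open>T0\<close>
  is the set where \<omega> is nonzero.\<close>

lemma T0_line: "u $ Inr 0 = 0 \<Longrightarrow> u $ Inr 1 = 0 \<Longrightarrow> u \<in> rc.T0 \<longleftrightarrow> 1 + \<beta> * u $ Inl 1 \<noteq> 0"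
  using rc.nz(3) \<kappa>(2) unfolding rc.T0_def rc.om_def mem_Collect_eq by (simp add: params(1))

lemma image_line:
  assumes V: "\<phi> ` V = rc.T0" and L: "\<And>p. p \<in> V \<Longrightarrow> p \<in> L \<longleftrightarrow> \<phi> p $ Inr 0 = 0 \<and> \<phi> p $ Inr 1 = 0"
  shows "\<phi> ` (V \<inter> L) = {v. v $ Inr 0 = 0 \<and> v $ Inr 1 = 0 \<and> 1 + \<beta> * v $ Inl 1 \<noteq> 0}"
proof -
  have "\<phi> ` (V \<inter> L) = {v \<in> \<phi> ` V. v $ Inr 0 = 0 \<and> v $ Inr 1 = 0}" using L by auto
  then show ?thesis unfolding V using T0_line by auto
qed

text \<open>The chart of \<open>chart_near_infinity\<close> is taken for \<open>Z\<close> and for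
  \<open>conj_space Z\<close>. By \<open>conjv_K_minus_S\<close> the curve is real, so both charts
  are adapted to the same set \<open>L\<close>, and they satisfy the assumptions of
  \<open>glued_line\<close>.\<close>

theorem splitting_of_line:
  fixes Z :: "'z cspace" and \<mu> :: "'z \<Rightarrow> (complex^(4 + 1)) set"
  defines "U1 \<equiv> {p \<in> pts Z. \<forall>v\<in>\<mu> p. v $ Inl 3 \<noteq> 0}" and "U2 \<equiv> {p \<in> pts (conj_space Z). \<forall>v\<in>Z0_conj (\<mu> p). v $ Inl 3 \<noteq> 0}"
  assumes Z: "csheaf Z" and \<mu>: "continuous_map (ctop Z) (ctop (Z0 a b Q)) \<mu>"
    and F1: "biholomorphic_map (subspace_of Z U1) (quotient_space C \<pi>3) F1"
      "\<And>p v. p \<in> U1 \<Longrightarrow> v \<in> \<mu> p \<Longrightarrow> blow_down (F1 p) = affine_coords Q v"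
    and F2: "biholomorphic_map (subspace_of (conj_space Z) U2) (quotient_space C \<pi>3) F2"
      "\<And>p v. p \<in> U2 \<Longrightarrow> v \<in> Z0_conj (\<mu> p) \<Longrightarrow> blow_down (F2 p) = affine_coords Q v"
  defines "L \<equiv> ctop Z closure_of {p \<in> pts Z. \<mu> p \<in> K j - Sing}"
  shows "(normal_bundle_splits_as Z L 1 1 \<or> normal_bundle_splits_as Z L 0 2) \<and>
    (normal_bundle_splits_as Z L 0 2 \<longleftrightarrow> \<delta> = 0)"
proof -
  define A where "A = {p \<in> pts Z. \<mu> p \<in> K j - Sing}"
  have LA: "L = ctop Z closure_of A" by (simp add: L_def A_def)
  have \<mu>Z: "\<mu> p \<in> pts (Z0 a b Q)" if "p \<in> pts Z" for p using \<mu> that by (auto simp: continuous_map_def)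
  have U2: "p \<in> U2 \<longleftrightarrow> p \<in> pts Z \<and> (\<forall>v\<in>\<mu> p. v $ Inl 2 \<noteq> 0)" for p
  proof -
    have "(\<forall>w\<in>Z0_conj (\<mu> p). w $ Inl 3 \<noteq> 0) \<longleftrightarrow> (\<forall>v\<in>\<mu> p. v $ Inl 2 \<noteq> 0)" if p: "p \<in> pts Z"
    proof -
      obtain v where v: "\<mu> p = O2_class v" using Z0_points[OF \<mu>Z[OF p]] by blast
      show ?thesis unfolding v Z0_conj_class by (simp add: O2_class_nonzero_iff)
    qed
    then show ?thesis by (auto simp: U2_def)
  qed
  have open_pre: "openin (ctop Z) {p \<in> pts Z. \<forall>v\<in>\<mu> p. v $ Inl k \<noteq> 0}" for k
  proof -
    have "{p \<in> pts Z. \<forall>v\<in>\<mu> p. v $ Inl k \<noteq> 0} = {p \<in> pts Z. \<mu> p \<in> {q \<in> pts (Z0 a b Q). \<forall>v\<in>q. v $ Inl k \<noteq> 0}}"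
      using \<mu>Z by auto
    then show ?thesis using openin_continuous_map_preimage[OF \<mu> open_Z0_coordinate] by simp
  qed
  have oU1: "openin (ctop Z) U1" unfolding U1_def by (rule open_pre)
  have "U2 = {p \<in> pts Z. \<forall>v\<in>\<mu> p. v $ Inl 2 \<noteq> 0}" using U2 by blast
  then have oU2: "openin (ctop (conj_space Z)) U2" using open_pre[of 2] by simp
  have cmu: "Z0_conj (\<mu> p) \<in> pts (Z0 a b Q)" "p \<in> A \<longleftrightarrow> Z0_conj (\<mu> p) \<in> K j - Sing" if p: "p \<in> pts Z" for p
  proof -
    obtain v where v: "v \<in> Z0_coords a b Q" "\<mu> p = O2_class v" using Z0_points[OF \<mu>Z[OF p]] by blast
    show "Z0_conj (\<mu> p) \<in> pts (Z0 a b Q)"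
      unfolding v Z0_conj_class Z0_quotient using conjv_Z0_coords[OF v(1)] by simp
    show "p \<in> A \<longleftrightarrow> Z0_conj (\<mu> p) \<in> K j - Sing"
      using p conjv_K_minus_S[OF is_j, of v] by (simp add: A_def v Z0_conj_class)
  qed
  obtain V \<phi> where V: "openin (ctop Z) V" "V \<subseteq> U1" "biholomorphic_map (subspace_of Z V) (model rc.T0) \<phi>"
    and \<phi>: "\<And>p v. p \<in> V \<Longrightarrow> v \<in> \<mu> p \<Longrightarrow> rc.om (\<phi> p) \<noteq> 0 \<and> affine_coords Q v $ 1 = \<phi> p $ Inl 1 \<and>
       affine_coords Q v $ 0 = \<phi> p $ Inr 0 + of_real lam * \<phi> p $ Inl 1 \<and>
       affine_coords Q v $ iX j = rc.om (\<phi> p) * l (affine_coords Q v $ 0) (affine_coords Q v $ 1)"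
    and LV: "\<And>p. p \<in> U1 \<Longrightarrow> p \<in> L \<longleftrightarrow> p \<in> V \<and> \<phi> p $ Inr 0 = 0 \<and> \<phi> p $ Inr 1 = 0"
    by (rule chart_near_infinity[where Z' = Z and \<nu> = \<mu> and F = F1 and A = A])
      (use Z oU1 \<mu>Z F1 in \<open>auto simp: U1_def A_def L_def\<close>)
  obtain V2 \<phi>2 where V2: "openin (ctop (conj_space Z)) V2" "V2 \<subseteq> U2" "biholomorphic_map (subspace_of (conj_space Z) V2) (model rc.T0) \<phi>2"
    and \<phi>2: "\<And>p v. p \<in> V2 \<Longrightarrow> v \<in> Z0_conj (\<mu> p) \<Longrightarrow> rc.om (\<phi>2 p) \<noteq> 0 \<and> affine_coords Q v $ 1 = \<phi>2 p $ Inl 1 \<and>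
       affine_coords Q v $ 0 = \<phi>2 p $ Inr 0 + of_real lam * \<phi>2 p $ Inl 1 \<and>
       affine_coords Q v $ iX j = rc.om (\<phi>2 p) * l (affine_coords Q v $ 0) (affine_coords Q v $ 1)"
    and LV2: "\<And>p. p \<in> U2 \<Longrightarrow> p \<in> L \<longleftrightarrow> p \<in> V2 \<and> \<phi>2 p $ Inr 0 = 0 \<and> \<phi>2 p $ Inr 1 = 0"
    by (rule chart_near_infinity[where Z' = "conj_space Z" and \<nu> = "\<lambda>p. Z0_conj (\<mu> p)" and F = F2 and A = A])
      (use csheaf_conj_space[OF Z] oU2 cmu F2 in \<open>auto simp: U2_def A_def L_def\<close>)
  define \<psi> where "\<psi> = vcnj \<circ> \<phi>2"
  have oV2: "openin (ctop Z) V2" using V2(1) by simp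
  have b2: "biholomorphic_map (subspace_of Z V2) (model (vcnj ` rc.T0)) \<psi>"
  proof -
    have "biholomorphic_map (conj_space (conj_space (subspace_of Z V2))) (conj_space (model rc.T0)) \<phi>2"
      using biholomorphic_map_conj_space[OF V2(3)] by (simp only: conj_space_subspace)
    then show ?thesis unfolding \<psi>_def conj_conj_space
      by (rule biholomorphic_map_compose[OF _ biholomorphic_map_conj_model[OF rc.open_T0]])
  qed
  have im1: "\<phi> ` V = rc.T0"
    using biholomorphic_map_bij[OF V(3)] unfolding pts_subspace[OF V(1)] by (simp add: bij_betw_def)
  have im2: "\<phi>2 ` V2 = rc.T0"
    using biholomorphic_map_bij[OF V2(3)] unfolding pts_subspace[OF V2(1)] by (simp add: bij_betw_def)
  have im2': "\<psi> ` V2 = vcnj ` rc.T0" unfolding \<psi>_def image_comp[symmetric] im2 ..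
  have c1: "(V, \<phi>) \<in> charts Z" unfolding charts_iff im1 using V rc.open_T0 by blast
  have c2: "(V2, \<psi>) \<in> charts Z" unfolding charts_iff im2' using oV2 b2 open_vcnj[OF rc.open_T0] by blast
  have L1: "p \<in> L \<longleftrightarrow> \<phi> p $ Inr 0 = 0 \<and> \<phi> p $ Inr 1 = 0" if "p \<in> V" for p using that V(2) LV by blast
  have L2: "p \<in> L \<longleftrightarrow> \<phi>2 p $ Inr 0 = 0 \<and> \<phi>2 p $ Inr 1 = 0" if "p \<in> V2" for p using that V2(2) LV2 by blast
  have imL1: "\<phi> ` (V \<inter> L) = {v. v $ Inr 0 = 0 \<and> v $ Inr 1 = 0 \<and> 1 + \<beta> * v $ Inl 1 \<noteq> 0}"
    by (rule image_line[OF im1 L1])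
  have "\<phi>2 ` (V2 \<inter> L) = {v. v $ Inr 0 = 0 \<and> v $ Inr 1 = 0 \<and> 1 + \<beta> * v $ Inl 1 \<noteq> 0}"
    by (rule image_line[OF im2 L2])
  then have imL2: "\<psi> ` (V2 \<inter> L) = vcnj ` {v. v $ Inr 0 = 0 \<and> v $ Inr 1 = 0 \<and> 1 + \<beta> * v $ Inl 1 \<noteq> 0}"
    unfolding \<psi>_def image_comp[symmetric] by simp
  have cn: "1 + cnj \<beta> * y = 0 \<longleftrightarrow> 1 + \<beta> * cnj y = 0" for y
    by (metis complex_cnj_add complex_cnj_cnj complex_cnj_mult complex_cnj_one complex_cnj_zero)
  have imL2': "\<psi> ` (V2 \<inter> L) = {v. v $ Inr 0 = 0 \<and> v $ Inr 1 = 0 \<and> 1 + cnj \<beta> * v $ Inl 1 \<noteq> 0}"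
    unfolding imL2 by (auto simp: vcnj_image_iff cn)
  have LZ: "L \<subseteq> pts Z" unfolding L_def by (rule closure_of_subset_topspace)
  \<comment> \<open>Taking the closure does not lead out of the closed set over \<open>K j\<close>,
    so the points of \<open>L\<close> over the singular points have coordinates in
    \<open>Kc j\<close> as well.\<close>
  have onK: "\<mu> p \<in> K j" if "p \<in> L" for p
  proof -
    have "closedin (ctop Z) {p \<in> pts Z. \<mu> p \<in> K j}" by (rule closedin_continuous_map_preimage[OF \<mu> closed_K[OF is_j]])
    then have "L \<subseteq> {p \<in> pts Z. \<mu> p \<in> K j}" unfolding LA by (intro closure_of_minimal) (auto simp: A_def)
    then show ?thesis using that by blast
  qed
  have onK': "\<exists>v. v \<in> Kc j \<and> \<mu> p = O2_class v" if "p \<in> L" for p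
    using onK[OF that] by (auto simp: K_def)
  have inU: "p \<in> U1 \<longleftrightarrow> v $ Inl 3 \<noteq> 0" "p \<in> U2 \<longleftrightarrow> v $ Inl 2 \<noteq> 0" if "p \<in> pts Z" "\<mu> p = O2_class v" for p v
    using that unfolding U2 unfolding U1_def by (auto simp: O2_class_nonzero_iff)
  have cover: "L \<subseteq> V \<union> V2"
  proof
    fix p assume p: "p \<in> L"
    then obtain v where v: "v \<in> Kc j" "\<mu> p = O2_class v" using onK' by blast
    have "p \<in> U1 \<or> p \<in> U2" using inU[OF _ v(2)] Kc_coordinate[OF v(1)] LZ p by blast
    then show "p \<in> V \<union> V2" using LV LV2 p by blast
  qed
  \<comment> \<open>The domain of the second chart is y2 \<noteq> 0, and y2 / y3 = - x H / E on the
    curve; so the overlap is where x and H are nonzero, and there the second coordinate x / x2 is -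
    E / H.\<close>
  have on1: "1 + \<beta> * \<phi> p $ Inl 1 \<noteq> 0 \<and> (p \<in> V2 \<longleftrightarrow> \<phi> p $ Inl 1 \<noteq> 0 \<and> cnj \<beta> + of_real sv * \<phi> p $ Inl 1 \<noteq> 0) \<and>
      (p \<in> V2 \<longrightarrow> \<psi> p $ Inl 1 = - (1 + \<beta> * \<phi> p $ Inl 1) / (cnj \<beta> + of_real sv * \<phi> p $ Inl 1))" if p: "p \<in> V \<inter> L" for p
  proof -
    obtain v where v: "v \<in> Kc j" "\<mu> p = O2_class v" using onK' p by blast
    have pZ: "p \<in> pts Z" using p LZ by blast
    have v3: "v $ Inl 3 \<noteq> 0" using inU(1)[OF pZ v(2)] p V(2) by blast
    have x1: "affine_coords Q v $ 1 = \<phi> p $ Inl 1" using \<phi>[of p v, unfolded v(2), OF _ self_in_O2_class] p by simp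
    define x where "x = \<phi> p $ Inl 1"
    define E where "E = 1 + \<beta> * x"
    define H where "H = cnj \<beta> + of_real sv * x"
    have E: "E \<noteq> 0" using imL1 p by (auto simp: E_def x_def)
    have x2: "v $ Inl 2 / v $ Inl 3 * E = - x * H"
      using Kc_affine(4)[OF is_j v(1) v3] unfolding x1 E_def H_def x_def .
    have pV2: "p \<in> V2 \<longleftrightarrow> v $ Inl 2 \<noteq> 0" using LV2[of p] p inU(2)[OF pZ v(2)] V2(2) by blast
    have "v $ Inl 2 \<noteq> 0 \<longleftrightarrow> v $ Inl 2 / v $ Inl 3 * E \<noteq> 0" using v3 E by simp
    also have "\<dots> \<longleftrightarrow> x \<noteq> 0 \<and> H \<noteq> 0" unfolding x2 by simp
    finally have iff: "v $ Inl 2 \<noteq> 0 \<longleftrightarrow> x \<noteq> 0 \<and> H \<noteq> 0" .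
    have "\<psi> p $ Inl 1 = - E / H" if p2: "p \<in> V2"
    proof -
      have v2: "v $ Inl 2 \<noteq> 0" using p2 pV2 by blast
      have "affine_coords Q (conjv v) $ 1 = \<phi>2 p $ Inl 1" using \<phi>2[OF p2, of "conjv v"] by (simp add: v(2) Z0_conj_class)
      then have "\<psi> p $ Inl 1 = x / (v $ Inl 2 / v $ Inl 3)"
        using affine_coords_conjv(2)[OF v3 v2] unfolding \<psi>_def x1 x_def by simp
      also have "v $ Inl 2 / v $ Inl 3 = - x * H / E" using x2 E by (metis nonzero_eq_divide_eq)
      finally show ?thesis using iff v2 E by (simp add: field_simps)
    qed
    then show ?thesis using E iff pV2 unfolding E_def H_def x_def by blast
  qed
  have jac: "trans (normal_bundle Z L) (V2, \<psi>) (V, \<phi>) p =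
        mat22 (- (1 + \<beta> * \<phi> p $ Inl 1) / (\<phi> p $ Inl 1 * (cnj \<beta> + of_real sv * \<phi> p $ Inl 1))) 0
              (- (2 * j * of_real \<delta>) * \<beta> * (1 + \<beta> * \<phi> p $ Inl 1) / (cnj \<beta> + of_real sv * \<phi> p $ Inl 1)) (\<beta> / cnj \<beta>)"
    if p: "p \<in> V \<inter> V2 \<inter> L" for p
  proof -
    define W where "W = \<phi> ` (V2 \<inter> V)"
    have T: "hol_on W (\<lambda>v. (\<psi> \<circ> inv_into V \<phi>) v $ i)" for i unfolding W_def by (rule chart_transition(2)[OF Z c2 c1])
    have oW: "open W" unfolding W_def by (rule chart_transition(1)[OF Z c2 c1])
    have pW: "\<phi> p \<in> W" using p by (auto simp: W_def)
    have pz: "\<phi> p $ Inr 0 = 0" "\<phi> p $ Inr 1 = 0" using L1[of p] p by auto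
    have nz: "\<phi> p $ Inl 1 \<noteq> 0" "1 + \<beta> * \<phi> p $ Inl 1 \<noteq> 0" "cnj \<beta> + of_real sv * \<phi> p $ Inl 1 \<noteq> 0"
      using on1[of p] p by auto
    have Teq: "(\<psi> \<circ> inv_into V \<phi>) u $ Inr 0 = (x0 - of_real lam * x1) / x2 \<and>
      (\<psi> \<circ> inv_into V \<phi>) u $ Inr 1 = of_real \<kappa> * (quartic x0 x1 / (rc.om u * (l x0 x1)\<^sup>2 * x2)) - 2 * j * \<beta> * (1 + cnj \<beta> * (x1 / x2))
       - 2 * j * (of_real e / of_real \<kappa>) * (\<beta> * cnj \<beta>) * ((x0 - of_real lam * x1) / x2)"
      if u: "u \<in> W" and x1: "x1 = u $ Inl 1" and x0: "x0 = u $ Inr 0 + of_real lam * x1" and l0: "l x0 x1 \<noteq> 0"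
        and x2: "x2 = x2_of (rc.om u) x0 x1" for u x0 x1 x2
    proof -
      obtain r where r: "r \<in> V" "r \<in> V2" "u = \<phi> r" using u by (auto simp: W_def)
      have rZ: "r \<in> pts Z" using r(1) V(2) by (auto simp: U1_def)
      obtain v where v: "v \<in> Z0_coords a b Q" "\<mu> r = O2_class v" using Z0_points[OF \<mu>Z[OF rZ]] by blast
      have v3: "v $ Inl 3 \<noteq> 0" and v2: "v $ Inl 2 \<noteq> 0" using inU[OF rZ v(2)] r V(2) V2(2) by auto
      note f1 = \<phi>[OF r(1), of v, folded r(3), folded x1, folded x0, unfolded v(2), OF self_in_O2_class]
      note f2 = \<phi>2[OF r(2), of "conjv v", unfolded v(2) Z0_conj_class, OF self_in_O2_class]
      have inv: "(\<psi> \<circ> inv_into V \<phi>) u = vcnj (\<phi>2 r)" using chart_inv_into[OF c1 r(1)] by (simp add: r(3) \<psi>_def)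
      show ?thesis unfolding inv vcnj_nth x2
        using transition_formula(3,4)[OF v(1) v3 v2, of u x1 x0 "\<phi>2 r"] f1 f2 l0 by blast
    qed
    note J = transition_jacobian[OF T oW pW pz refl nz Teq]
    show ?thesis unfolding mat22_eq_iff normal_bundle_simps mat22_nth using J by blast
  qed
  have ad: "(V, \<phi>) \<in> adapted_charts Z L" "(V2, \<psi>) \<in> adapted_charts Z L"
  proof -
    show "(V, \<phi>) \<in> adapted_charts Z L"
      unfolding adapted_charts_def using c1 L1 by (auto simp: forall_2')
    show "(V2, \<psi>) \<in> adapted_charts Z L"
      unfolding adapted_charts_def using c2 L2 by (auto simp: forall_2' \<psi>_def)
  qed
  \<comment> \<open>The extension class is 2 j \<delta>, which vanishes exactly when \<delta>
    does.\<close>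
  interpret gl: glued_line Z L V V2 \<phi> \<psi> \<beta> "of_real Av" "of_real sv" "2 * j * of_real \<delta>"
  proof
    show "of_real sv = of_real Av + \<beta> * cnj \<beta>" using rels(1) by simp
  qed (use Z LZ ad cover rels(4-6) imL1 imL2' on1 jac in auto)
  show ?thesis using gl.normal_bundle_splitting is_i(3)[OF is_j] by auto
qed

end

section \<open>Critical points, the choice of the linear forms, and the conclusion\<close>

context twistor_line
begin

lemma splitting_iff_critical:
  fixes Z :: "'z cspace"
  assumes tr: "twistor_resolution a b Q lam0 l1 l2 l3 Z \<mu>" and C: "C = res_coords3 a b l1 l2 l3"
  defines "L \<equiv> ctop Z closure_of {p \<in> pts Z. \<mu> p \<in> K j - Sing}"
  shows "(normal_bundle_splits_as Z L 1 1 \<or> normal_bundle_splits_as Z L 0 2) \<and>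
    (normal_bundle_splits_as Z L 0 2 \<longleftrightarrow> critical_point (h1 a b Q l) lam)"
proof -
  have Z: "csheaf Z" using tr by (simp add: twistor_resolution_def small_resolution_def complex_manifold_def csheaf_def)
  have \<mu>: "continuous_map (ctop Z) (ctop (Z0 a b Q)) \<mu>"
    using tr by (simp add: twistor_resolution_def small_resolution_def holomorphic_map_def)
  obtain F1 where F1: "biholomorphic_map (subspace_of Z {p \<in> pts Z. \<forall>v\<in>\<mu> p. v $ Inl 3 \<noteq> 0}) (quotient_space C \<pi>3) F1"
    "\<And>p v. p \<in> {p \<in> pts Z. \<forall>v\<in>\<mu> p. v $ Inl 3 \<noteq> 0} \<Longrightarrow> v \<in> \<mu> p \<Longrightarrow> blow_down (F1 p) = affine_coords Q v"
    using tr unfolding twistor_resolution_def resolves_p_inf_by_def Let_def local_resolution_def C by blast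
  obtain F2 where F2: "biholomorphic_map (subspace_of (conj_space Z) {p \<in> pts (conj_space Z). \<forall>v\<in>Z0_conj (\<mu> p). v $ Inl 3 \<noteq> 0}) (quotient_space C \<pi>3) F2"
    "\<And>p v. p \<in> {p \<in> pts (conj_space Z). \<forall>v\<in>Z0_conj (\<mu> p). v $ Inl 3 \<noteq> 0} \<Longrightarrow> v \<in> Z0_conj (\<mu> p) \<Longrightarrow> blow_down (F2 p) = affine_coords Q v"
    using tr unfolding twistor_resolution_def resolves_p_inf_by_def Let_def local_resolution_def C by blast
  have "l (of_real t) 1 = of_real (e * t + h)" for t by (simp add: leq)
  then have "critical_point (h1 a b Q l) lam \<longleftrightarrow> \<delta> = 0"
    unfolding \<delta>_def using h1_critical[of l e h] \<kappa>(2) unfolding \<kappa>(1) by blast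
  then show ?thesis using splitting_of_line[OF Z \<mu> F1 F2] unfolding L_def by blast
qed

end

text \<open>\<open>l4\<close> is the linear form left over by the ordered triple; the curve meeting
  the third exceptional component sees it through \<eta> = \<omega> l4.\<close>

lemma linear_forms_complement:
  assumes "{l1, l2, l3} \<subseteq> linear_forms a b" "distinct [l1, l2, l3]"
  obtains l4 where "l4 \<in> linear_forms a b"
    "\<And>x0 x1. l1 x0 x1 * l2 x0 x1 * l3 x0 x1 * l4 x0 x1 = x0 * x1 * (x0 + x1) * (of_real a * x0 - of_real b * x1)"
proof -
  have "\<exists>l4\<in>{p0, p1, p2, p3}. \<forall>x0 x1. l1 x0 x1 * l2 x0 x1 * l3 x0 x1 * l4 x0 x1 = p0 x0 x1 * p1 x0 x1 * p2 x0 x1 * p3 x0 x1"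
    if "{l1, l2, l3} \<subseteq> {p0, p1, p2, p3}" for p0 p1 p2 p3 :: form
    using that assms(2) by (auto simp: ac_simps)
  from this[OF assms(1)[unfolded linear_forms_def]] show thesis
    using that unfolding linear_forms_def by blast
qed

text \<open>The values of the four forms at (1, -2) are 1, -2, -1 and a + 2 b, the last being
  nonzero because \<open>a\<close> and \<open>b\<close> are positive.\<close>

lemma linear_forms_lin_form:
  assumes "l \<in> linear_forms a b" "a > 0" "b > 0" shows "lin_form l"
proof -
  have "lin_form (\<lambda>x0 x1. of_real c * x0 + of_real d * x1)" if "c - 2 * d \<noteq> 0" for c d :: real
    using that unfolding lin_form_def by blast
  from this[of 1 0] this[of 0 1] this[of 1 1] this[of a "- b"] show ?thesis
    using assms unfolding linear_forms_def by auto
qed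

lemma lin_formE:
  assumes "lin_form l"
  obtains e h :: real where "\<And>x0 x1. l x0 x1 = of_real e * x0 + of_real h * x1" "\<And>t x. l (of_real t * x) x = of_real (e * t + h) * x"
proof -
  obtain e h :: real where l: "\<And>x0 x1. l x0 x1 = of_real e * x0 + of_real h * x1" using assms unfolding lin_form_def by blast
  show thesis by (rule that[OF l]) (simp add: l algebra_simps)
qed

context conic_pencil
begin

context
  fixes l1 l2 l3 l4 :: form and Z :: "'z cspace" and \<mu>
  assumes lin: "lin_form l1" "lin_form l2" "lin_form l3" "lin_form l4"
    and prod: "\<And>x0 x1. l1 x0 x1 * l2 x0 x1 * l3 x0 x1 * l4 x0 x1 = x0 * x1 * (x0 + x1) * (of_real a * x0 - of_real b * x1)"
    and tr: "twistor_resolution a b Q lam0 l1 l2 l3 Z \<mu>"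
begin

lemma prod_lam: "l1 (of_real t) 1 * l2 (of_real t) 1 * l3 (of_real t) 1 * l4 (of_real t) 1 = complex_of_real (f_cubic a b t)"
  unfolding prod by (simp add: f_cubic_def)

lemma nonzero_at_lam: "l1 (of_real lam) 1 \<noteq> 0" "l2 (of_real lam) 1 \<noteq> 0" "l3 (of_real lam) 1 \<noteq> 0" "l4 (of_real lam) 1 \<noteq> 0"
proof -
  have "l1 (of_real lam) 1 * l2 (of_real lam) 1 * l3 (of_real lam) 1 * l4 (of_real lam) 1 \<noteq> 0"
    unfolding prod_lam using f_neg by simp
  then show "l1 (of_real lam) 1 \<noteq> 0" "l2 (of_real lam) 1 \<noteq> 0" "l3 (of_real lam) 1 \<noteq> 0" "l4 (of_real lam) 1 \<noteq> 0" by auto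
qed

lemma lin_form_lam: "lin_form l \<Longrightarrow> l (of_real lam * x) x = l (of_real lam) 1 * x"
  by (auto simp: lin_form_def algebra_simps)

lemma splitting_plus:
  defines "L \<equiv> L_plus a b Q lam0 Z \<mu> lam \<theta>"
  shows "(normal_bundle_splits_as Z L 1 1 \<or> normal_bundle_splits_as Z L 0 2) \<and>
    (normal_bundle_splits_as Z L 0 2 \<longleftrightarrow> critical_point (h1 a b Q l1) lam)"
proof -
  obtain e h :: real where l: "\<And>x0 x1. l1 x0 x1 = of_real e * x0 + of_real h * x1" "\<And>t x. l1 (of_real t * x) x = of_real (e * t + h) * x"
    using lin_formE[OF lin(1)] by metis
  have "of_real (e * lam + h) \<noteq> (0 :: complex)" using nonzero_at_lam(1) l(2)[of lam 1] by simp
  then have rc: "resolution_chart (res_coords3 a b l1 l2 l3) \<pi>3 (\<lambda>w. lft (lft (lft w)))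
     (\<lambda>w. rgt (lft (lft w)) $ 0) (\<lambda>w. rgt (lft (lft w)) $ 1) (liftp l1 l2 l3 l4) l1 (\<lambda>x0 x1. l2 x0 x1 * l3 x0 x1 * l4 x0 x1) (iX \<i>) (iE \<i>)
     (of_real lam) (of_real (e * lam + h)) (2 * \<i> * cnj \<beta>)"
    unfolding is_i_cases
    by (intro resolution_chart_plus[OF lin prod] l(2))
      (use nonzero_at_lam rels(4) in \<open>auto simp: lin_form_lam lin power3_eq_cube\<close>)
  interpret tl: twistor_line a b lam lam0 \<theta> Q \<i> l1 "\<lambda>x0 x1. l2 x0 x1 * l3 x0 x1 * l4 x0 x1" "\<lambda>w. rgt (lft (lft w)) $ 0"
    "\<lambda>w. rgt (lft (lft w)) $ 1" "liftp l1 l2 l3 l4" e h "e * lam + h" \<beta> "2 * \<i> * cnj \<beta>"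
    "2 * \<i> * (of_real e / of_real (e * lam + h)) * (\<beta> * cnj \<beta>)" "res_coords3 a b l1 l2 l3"
    by (intro twistor_line.intro twistor_line_axioms.intro conic_pencil_axioms rc l(1))
      (use prod in \<open>simp_all add: ac_simps\<close>)
  show ?thesis unfolding L_def L_plus_eq by (rule tl.splitting_iff_critical[OF tr refl])
qed

text \<open>The chart in which \<eta> = \<omega> l4 leads to the criterion for \<open>h1\<close>
  formed with \<open>l4\<close>; \<open>h3_critical\<close> passes to its reciprocal
  \<open>h3\<close>, which involves the blown-up forms only.\<close>

lemma splitting_minus:
  defines "L \<equiv> L_minus a b Q lam0 Z \<mu> lam \<theta>"
  shows "(normal_bundle_splits_as Z L 1 1 \<or> normal_bundle_splits_as Z L 0 2) \<and>
    (normal_bundle_splits_as Z L 0 2 \<longleftrightarrow> critical_point (h3 a b Q l1 l2 l3) lam)"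
proof -
  obtain e h :: real where l: "\<And>x0 x1. l4 x0 x1 = of_real e * x0 + of_real h * x1" "\<And>t x. l4 (of_real t * x) x = of_real (e * t + h) * x"
    using lin_formE[OF lin(4)] by metis
  have "of_real (e * lam + h) \<noteq> (0 :: complex)" using nonzero_at_lam(4) l(2)[of lam 1] by simp
  then have rc: "resolution_chart (res_coords3 a b l1 l2 l3) \<pi>3 (\<lambda>w. lft (lft (lft w)))
     (\<lambda>w. rgt w $ 1) (\<lambda>w. rgt w $ 0) (liftm l1 l2 l3 l4) l4 (\<lambda>x0 x1. l1 x0 x1 * l2 x0 x1 * l3 x0 x1) (iX (- \<i>)) (iE (- \<i>))
     (of_real lam) (of_real (e * lam + h)) (2 * (- \<i>) * cnj \<beta>)"
    unfolding is_i_cases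
    by (intro resolution_chart_minus[OF lin prod] l(2))
      (use nonzero_at_lam rels(4) in \<open>auto simp: lin_form_lam lin power3_eq_cube\<close>)
  interpret tl: twistor_line a b lam lam0 \<theta> Q "- \<i>" l4 "\<lambda>x0 x1. l1 x0 x1 * l2 x0 x1 * l3 x0 x1" "\<lambda>w. rgt w $ 1"
    "\<lambda>w. rgt w $ 0" "liftm l1 l2 l3 l4" e h "e * lam + h" \<beta> "2 * (- \<i>) * cnj \<beta>"
    "2 * (- \<i>) * (of_real e / of_real (e * lam + h)) * (\<beta> * cnj \<beta>)" "res_coords3 a b l1 l2 l3"
    by (intro twistor_line.intro twistor_line_axioms.intro conic_pencil_axioms rc l(1))
      (use prod in \<open>simp_all add: ac_simps\<close>)
  show ?thesis unfolding L_def L_minus_eq h3_critical[of l1 l2 l3 l4, OF prod_lam]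
    by (rule tl.splitting_iff_critical[OF tr refl])
qed

end

end

theorem proposition5p12:
  fixes a b lam0 lam \<theta> :: real
    and Q :: "real \<times> real \<times> real"
    and l1 l2 l3 :: form
    and Z :: "'z cspace"
    and \<mu> :: "'z \<Rightarrow> (complex^(4 + 1)) set"
  assumes "a > 0" and "b > 0"
    and "\<And>t. (quad_form Q t 1)^2 - f_cubic a b t \<ge> 0"
    and "\<And>t. (quad_form Q t 1)^2 - f_cubic a b t = 0 \<longleftrightarrow> t = lam0"
    and "order lam0 (Q2f_poly a b Q) = 2"
    and "\<And>t. f_cubic a b t \<ge> 0 \<Longrightarrow> t \<noteq> lam0 \<Longrightarrow> quad_form Q t 1 > sqrt (f_cubic a b t)"
    and "lam0 > b / a"
    and "{l1, l2, l3} \<subseteq> linear_forms a b" and "distinct [l1, l2, l3]"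
    and "twistor_resolution a b Q lam0 l1 l2 l3 Z \<mu>"
    and "lam \<in> {..< -1} \<union> {0<..<b / a}"
  shows "((normal_bundle_splits_as Z (L_plus a b Q lam0 Z \<mu> lam \<theta>) 1 1 \<or>
          normal_bundle_splits_as Z (L_plus a b Q lam0 Z \<mu> lam \<theta>) 0 2) \<and>
         (normal_bundle_splits_as Z (L_plus a b Q lam0 Z \<mu> lam \<theta>) 0 2 \<longleftrightarrow>
          critical_point (h1 a b Q l1) lam)) \<and>
         ((normal_bundle_splits_as Z (L_minus a b Q lam0 Z \<mu> lam \<theta>) 1 1 \<or>
          normal_bundle_splits_as Z (L_minus a b Q lam0 Z \<mu> lam \<theta>) 0 2) \<and>
         (normal_bundle_splits_as Z (L_minus a b Q lam0 Z \<mu> lam \<theta>) 0 2 \<longleftrightarrow>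
          critical_point (h3 a b Q l1 l2 l3) lam))"
proof -
  have ba: "0 < b / a" using assms(1,2) by simp
  then have lam: "lam < -1 \<or> 0 < lam" "lam < b / a" using assms(11) by auto
  then have "a * lam - b < 0" using assms(1) by (simp add: pos_less_divide_eq mult.commute)
  moreover have "lam * (lam + 1) > 0" using lam(1) by (auto intro: mult_neg_neg mult_pos_pos)
  ultimately have f: "f_cubic a b lam < 0" unfolding f_cubic_def by (rule mult_pos_neg[rotated])
  interpret conic_pencil a b lam lam0 \<theta> Q by standard (use f lam assms(7) in auto)
  obtain l4 where l4: "l4 \<in> linear_forms a b"
    "\<And>x0 x1. l1 x0 x1 * l2 x0 x1 * l3 x0 x1 * l4 x0 x1 = x0 * x1 * (x0 + x1) * (of_real a * x0 - of_real b * x1)"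
    by (rule linear_forms_complement[OF assms(8,9)]) blast
  have lin: "lin_form l1" "lin_form l2" "lin_form l3" "lin_form l4"
    using assms(1,2,8) l4(1) linear_forms_lin_form by auto
  show ?thesis
    using splitting_plus[OF lin l4(2) assms(10)] splitting_minus[OF lin l4(2) assms(10)] by blast
qed

end
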